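(* Let $Q=(\mathbb{R}/2\pi\mathbb{Z})^3$, $T>0$, $Q_T=Q\times[0,T)$, $\overline{Q}_T=Q\times[0,T]$. For $F\in\mathrm{Mat}^{3\times3}$ let $\Phi(F)=(F,\mathrm{cof}\,F,\det F)\in\mathrm{Mat}^{3\times3}\times\mathrm{Mat}^{3\times3}\times\mathbb{R}\cong\mathbb{R}^{19}$, with components $\Phi^A$, $A=1,\dots,19$. Let $G:\mathrm{Mat}^{3\times3}\times\mathrm{Mat}^{3\times3}\times\mathbb{R}\to[0,\infty)$, $G=G(F,Z,w)$, satisfy: (H1) $G\in C^3$ is strictly convex with $D^2G\ge\gamma_0>0$; (H2) $G(F,Z,w)\ge c_1(|F|^p+|Z|^q+|w|^r+1)-c_2$ with $p\in(4,\infty)$, $q,r\in[2,\infty)$; (H3) $G(F,Z,w)\le c(|F|^p+|Z|^q+|w|^r+1)$; (H4)$'$ $|\partial_FG|+|\partial_ZG|^{p/(p-1)}+|\partial_wG|^{p/(p-2)}\le o(1)(|F|^p+|Z|^q+|w|^r+1)$, where $o(1)\to0$ as $|(F,Z,w)|\to\infty$. Let $\eta(v,\Xi)=\tfrac12|v|^2+G(\Xi)$ for $v\in\mathbb{R}^3$, $\Xi\in\mathbb{R}^{19}$. Let $(y,\nu,\gamma)$ be a dissipative measure-valued solution with concentration of $\partial_t^2y=\nabla\cdot S(\nabla y)$, $S=\partial_F[G(\Phi(F))]$, with initial data $(v^0,F^0)$, in the following sense: $y:Q\times[0,T)\to\mathbb{R}^3$ has distributional derivatives $v=\partial_ty\in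 L^\infty(L^2)$, $F=\nabla y\in L^\infty(L^p)$; $\nu=(\nu_{x,t})_{(x,t)\in\overline{Q}_T}$ is a Young measure on $\mathbb{R}^3\times\mathbb{R}^{19}$ (coordinates $(\lambda_v,\lambda_\Xi)$, $\lambda_\Xi=(\lambda_F,\lambda_Z,\lambda_w)$) generated by a sequence $(v^\epsilon,\Xi^\epsilon)$ with $\sup_{\epsilon,t}\int\eta(v^\epsilon,\Xi^\epsilon)dx<\infty$, in the sense that $g(v^\epsilon,\Xi^\epsilon)\rightharpoonup\int g\,d\nu_{x,t}$ weakly for every continuous $g$ with $g(\lambda_v,\lambda_\Xi)/(\tfrac12|\lambda_v|^2+G(\lambda_\Xi))\to0$ as $|\lambda_v|+|\lambda_\Xi|\to\infty$; $F=\langle\nu,\lambda_F\rangle$, $v=\langle\nu,\lambda_v\rangle$, $\Xi:=\langle\nu,\lambda_\Xi\rangle=\Phi(F)$ a.e.; the equations $$\partial_tv_i-\partial_\alpha\Big\langle\nu,\frac{\partial G}{\partial\Xi^A}(\lambda_\Xi)\frac{\partial\Phi^A}{\partial F_{i\alpha}}(\lambda_F)\Big\rangle=0\ (i=1,2,3),\qquad\partial_t\Phi^A(F)-\partial_\alpha\Big(\frac{\partial\Phi^A}{\partial F_{i\alpha}}(F)v_i\Big)=0\ (A=1,\dots,19)$$ hold in the weak sense on $Q\times[0,T)$ with initial values $v^0$ and $\Phi(F^0)$ respectively; $\gamma$ is a non-negative Radon measure on $Q_T$; and $$\iint\dot\theta(t)\big(\langle\nu,\eta\rangle\,dx\,dt+\gamma(dx\,dt)\big)+\int\theta(0)\eta_0(x)\,dx\ge0$$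 for all $\theta\in C^1_c([0,T))$ with $\theta\ge0$, where $\eta_0=\eta(v^0,\Phi(F^0))$. Suppose $(\hat v,\hat F)\in W^{1,\infty}(\overline{Q}_T)$ is a bounded Lipschitz classical solution of the system $\partial_t\hat v_i=\partial_\alpha\big(\frac{\partial G}{\partial\Xi^A}(\Phi(\hat F))\frac{\partial\Phi^A}{\partial F_{i\alpha}}(\hat F)\big)$, $\partial_t\Phi^A(\hat F)=\partial_\alpha\big(\frac{\partial\Phi^A}{\partial F_{i\alpha}}(\hat F)\hat v_i\big)$, and that the initial data agree: $(v(x,0),\Xi(x,0))=(\hat v(x,0),\Phi(\hat F(x,0)))$. Then $\gamma=0$, $(v,\Xi)=(\hat v,\Phi(\hat F))$ and $\nu=\delta_{(\hat v,\Phi(\hat F))}$.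
   Context: Summation convention over repeated indices. $\mathrm{cof}\,F$ is the cofactor matrix of $F$. $C^1_c([0,T))$ denotes $C^1$ functions on $[0,T)$ vanishing near $T$. *)

theory Defs
  imports "HOL-Probability.Probability"
begin

text \<open>Space points x :: real^3 (periodic representatives of the torus Q = (R/2piZ)^3),
  space-time points z = (x,t) :: real^3 \<times> real.  Matrices F :: real^3^3 with
  F $ i $ alpha = F_{i alpha}; the norm on real^3^3 is the Frobenius norm.
  Xi = (F,Z,w) lives in real^3^3 \<times> real^3^3 \<times> real (= R^19).\<close>

type_synonym mat3 = "real^3^3"
type_synonym xi = "mat3 \<times> mat3 \<times> real"
type_synonym pt = "(real^3) \<times> real"

definition Emat :: "3 \<Rightarrow> 3 \<Rightarrow> mat3" where
  "Emat i a = (\<chi> j b. if j = i \<and> b = a then 1 else 0)"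

text \<open>Cofactor matrix: (cof F)_{i alpha} is the determinant of F with row i replaced
  by the unit row e_alpha (Laplace expansion), i.e. the signed minor.\<close>
definition cof :: "mat3 \<Rightarrow> mat3" where
  "cof F = (\<chi> i a. det (\<chi> j b. if j = i then (if b = a then 1 else 0) else F $ j $ b))"

definition Phi :: "mat3 \<Rightarrow> xi" where
  "Phi F = (F, cof F, det F)"

definition dd :: "('a::real_normed_vector \<Rightarrow> 'b::real_normed_vector) \<Rightarrow> 'a \<Rightarrow> 'a \<Rightarrow> 'b" where
  "dd f h z = frechet_derivative f (at z) h"

definition C1_fun :: "('a::euclidean_space \<Rightarrow> 'b::real_normed_vector) \<Rightarrow> bool" where
  "C1_fun f \<longleftrightarrow> (\<forall>z. f differentiable (at z)) \<and> (\<forall>h. continuous_on UNIV (dd f h))"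

definition C3_fun :: "('a::euclidean_space \<Rightarrow> real) \<Rightarrow> bool" where
  "C3_fun f \<longleftrightarrow> (\<forall>z. f differentiable (at z))
     \<and> (\<forall>h1 z. dd f h1 differentiable (at z))
     \<and> (\<forall>h1 h2 z. dd (dd f h1) h2 differentiable (at z))
     \<and> (\<forall>h1 h2 h3. continuous_on UNIV (dd (dd (dd f h1) h2) h3))"

definition strictly_convex :: "('a::real_vector \<Rightarrow> real) \<Rightarrow> bool" where
  "strictly_convex f \<longleftrightarrow> (\<forall>x y u. x \<noteq> y \<and> 0 < u \<and> u < 1 \<longrightarrow>
      f (u *\<^sub>R x + (1 - u) *\<^sub>R y) < u * f x + (1 - u) * f y)"

definition weight :: "real \<Rightarrow> real \<Rightarrow> real \<Rightarrow> xi \<Rightarrow> real" where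
  "weight p q r X = (case X of (F, Z, w) \<Rightarrow>
      norm F powr p + norm Z powr q + \<bar>w\<bar> powr r + 1)"

definition dG_F :: "(xi \<Rightarrow> real) \<Rightarrow> xi \<Rightarrow> mat3" where
  "dG_F G X = (\<chi> i a. dd G (Emat i a, 0, 0) X)"
definition dG_Z :: "(xi \<Rightarrow> real) \<Rightarrow> xi \<Rightarrow> mat3" where
  "dG_Z G X = (\<chi> i a. dd G (0, Emat i a, 0) X)"
definition dG_w :: "(xi \<Rightarrow> real) \<Rightarrow> xi \<Rightarrow> real" where
  "dG_w G X = dd G (0, 0, 1) X"

definition hyp_G :: "(xi \<Rightarrow> real) \<Rightarrow> real \<Rightarrow> real \<Rightarrow> real \<Rightarrow> bool" where
  "hyp_G G p q r \<longleftrightarrow>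
     (\<forall>X. 0 \<le> G X)
   \<and> 4 < p \<and> 2 \<le> q \<and> 2 \<le> r
   \<comment> \<open>(H1)\<close>
   \<and> C3_fun G \<and> strictly_convex G
   \<and> (\<exists>\<gamma>0>0. \<forall>X h. dd (dd G h) h X \<ge> \<gamma>0 * (norm h)\<^sup>2)
   \<comment> \<open>(H2)\<close>
   \<and> (\<exists>c1 c2. c1 > 0 \<and> c2 \<ge> 0 \<and> (\<forall>X. G X \<ge> c1 * weight p q r X - c2))
   \<comment> \<open>(H3)\<close>
   \<and> (\<exists>c. \<forall>X. G X \<le> c * weight p q r X)
   \<comment> \<open>(H4')\<close>
   \<and> ((\<lambda>X. (norm (dG_F G X) + norm (dG_Z G X) powr (p / (p - 1))
             + \<bar>dG_w G X\<bar> powr (p / (p - 2))) / weight p q r X) \<longlongrightarrow> 0) at_infinity"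

definition eta :: "(xi \<Rightarrow> real) \<Rightarrow> (real^3) \<times> xi \<Rightarrow> real" where
  "eta G l = (norm (fst l))\<^sup>2 / 2 + G (snd l)"

text \<open>Flux density (dG/dXi^A)(lambda_Xi) (dPhi^A/dF_{i alpha})(lambda_F), summed over A.\<close>
definition flux :: "(xi \<Rightarrow> real) \<Rightarrow> 3 \<Rightarrow> 3 \<Rightarrow> (real^3) \<times> xi \<Rightarrow> real" where
  "flux G i a l = dd G (dd Phi (Emat i a) (fst (snd l))) (snd l)"

definition Qbox :: "(real^3) set" where
  "Qbox = {x. \<forall>i. 0 \<le> x $ i \<and> x $ i < 2 * pi}"

definition QT :: "real \<Rightarrow> pt set" where
  "QT T = Qbox \<times> {0..<T}"

definition periodic :: "(pt \<Rightarrow> 'b) \<Rightarrow> bool" where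
  "periodic f \<longleftrightarrow> (\<forall>x t i. f (x + (2 * pi) *\<^sub>R axis i 1, t) = f (x, t))"

definition periodic_x :: "(real^3 \<Rightarrow> 'b) \<Rightarrow> bool" where
  "periodic_x f \<longleftrightarrow> (\<forall>x i. f (x + (2 * pi) *\<^sub>R axis i 1) = f x)"

definition d_t :: "(pt \<Rightarrow> real) \<Rightarrow> pt \<Rightarrow> real" where
  "d_t f = dd f (0, 1)"
definition d_x :: "3 \<Rightarrow> (pt \<Rightarrow> real) \<Rightarrow> pt \<Rightarrow> real" where
  "d_x a f = dd f (axis a 1, 0)"

definition test_fn :: "real \<Rightarrow> (pt \<Rightarrow> real) \<Rightarrow> bool" where
  "test_fn T \<phi> \<longleftrightarrow> C1_fun \<phi> \<and> periodic \<phi> \<and> (\<exists>T'<T. \<forall>x t. T' \<le> t \<longrightarrow> \<phi> (x, t) = 0)"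

definition test_fn0 :: "real \<Rightarrow> (pt \<Rightarrow> real) \<Rightarrow> bool" where
  "test_fn0 T \<phi> \<longleftrightarrow> test_fn T \<phi> \<and> (\<exists>t0>0. \<forall>x t. t \<le> t0 \<longrightarrow> \<phi> (x, t) = 0)"

text \<open>Weak form on Q \<times> [0,T) of d_t U - sum_alpha d_alpha (Flx alpha) = 0 with U(.,0) = U0:
  int_{Q_T} (U d_t phi - sum_alpha Flx_alpha d_alpha phi) + int_Q U0 phi(.,0) = 0.\<close>
definition weak_cons_law ::
  "real \<Rightarrow> (pt \<Rightarrow> 'b::euclidean_space) \<Rightarrow> (3 \<Rightarrow> pt \<Rightarrow> 'b) \<Rightarrow> (real^3 \<Rightarrow> 'b) \<Rightarrow> bool" where
  "weak_cons_law T U Flx U0 \<longleftrightarrow> (\<forall>\<phi>. test_fn T \<phi> \<longrightarrow>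
     (LINT z:QT T|lborel. (d_t \<phi> z *\<^sub>R U z - (\<Sum>a\<in>UNIV. d_x a \<phi> z *\<^sub>R Flx a z)))
     + (LINT x:Qbox|lborel. \<phi> (x, 0) *\<^sub>R U0 x) = 0)"

definition Linf_Ls :: "real \<Rightarrow> real \<Rightarrow> (pt \<Rightarrow> 'b::real_normed_vector) \<Rightarrow> bool" where
  "Linf_Ls T s f \<longleftrightarrow> f \<in> borel_measurable borel \<and>
     (\<exists>C::real. AE t in lborel. t \<in> {0..<T} \<longrightarrow>
        (\<integral>\<^sup>+ x. ennreal (norm (f (x, t)) powr s) * indicator Qbox x \<partial>lborel) \<le> ennreal C)"

definition young_generated ::
  "(xi \<Rightarrow> real) \<Rightarrow> real \<Rightarrow> (pt \<Rightarrow> ((real^3) \<times> xi) measure) \<Rightarrow> bool" where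
  "young_generated G T \<nu> \<longleftrightarrow>
     (\<forall>z. prob_space (\<nu> z) \<and> sets (\<nu> z) = sets borel)
   \<and> periodic \<nu>
   \<and> (\<forall>B \<in> sets borel. (\<lambda>z. emeasure (\<nu> z) B) \<in> borel_measurable borel)
   \<and> (\<exists>ve :: nat \<Rightarrow> pt \<Rightarrow> real^3. \<exists>Xe :: nat \<Rightarrow> pt \<Rightarrow> xi.
        (\<forall>n. ve n \<in> borel_measurable borel \<and> Xe n \<in> borel_measurable borel)
      \<and> (\<exists>C::real. \<forall>n t. t \<in> {0..<T} \<longrightarrow>
           (\<integral>\<^sup>+ x. ennreal (eta G (ve n (x, t), Xe n (x, t))) * indicator Qbox x \<partial>lborel) \<le> ennreal C)
      \<and> (\<forall>g :: (real^3) \<times> xi \<Rightarrow> real. continuous_on UNIV g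
            \<and> ((\<lambda>l. g l / eta G l) \<longlongrightarrow> 0) at_infinity \<longrightarrow>
          (\<forall>\<psi> :: pt \<Rightarrow> real. continuous_on UNIV \<psi> \<and> periodic \<psi> \<longrightarrow>
             (\<lambda>n. LINT z:QT T|lborel. g (ve n z, Xe n z) * \<psi> z)
               \<longlonglongrightarrow> (LINT z:QT T|lborel. (\<integral>l. g l \<partial>\<nu> z) * \<psi> z))))"

definition dmv_solution ::
  "(xi \<Rightarrow> real) \<Rightarrow> real \<Rightarrow> real \<Rightarrow> (real^3 \<Rightarrow> real^3) \<Rightarrow> (real^3 \<Rightarrow> mat3)
   \<Rightarrow> (pt \<Rightarrow> real^3) \<Rightarrow> (pt \<Rightarrow> real^3) \<Rightarrow> (pt \<Rightarrow> mat3)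
   \<Rightarrow> (pt \<Rightarrow> ((real^3) \<times> xi) measure) \<Rightarrow> pt measure \<Rightarrow> bool" where
  "dmv_solution G p T v0 F0 y v F \<nu> \<gamma> \<longleftrightarrow>
     \<comment> \<open>initial data\<close>
     v0 \<in> borel_measurable borel \<and> F0 \<in> borel_measurable borel
   \<and> periodic_x v0 \<and> periodic_x F0
   \<and> set_integrable lborel Qbox (\<lambda>x. eta G (v0 x, Phi (F0 x)))
     \<comment> \<open>y, v = d_t y, F = grad y\<close>
   \<and> periodic y \<and> periodic v \<and> periodic F
   \<and> y \<in> borel_measurable borel
   \<and> (\<forall>T'<T. set_integrable lborel (Qbox \<times> {0..T'}) y)
   \<and> Linf_Ls T 2 v \<and> Linf_Ls T p F
   \<and> (\<forall>\<phi>. test_fn0 T \<phi> \<longrightarrow>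
        (LINT z:QT T|lborel. d_t \<phi> z *\<^sub>R y z) = - (LINT z:QT T|lborel. \<phi> z *\<^sub>R v z)
      \<and> (\<forall>a. (LINT z:QT T|lborel. d_x a \<phi> z *\<^sub>R y z)
              = - (LINT z:QT T|lborel. \<phi> z *\<^sub>R (\<chi> i. F z $ i $ a))))
     \<comment> \<open>Young measure\<close>
   \<and> young_generated G T \<nu>
   \<and> (AE z in lborel. z \<in> QT T \<longrightarrow> integrable (\<nu> z) (eta G))
   \<and> set_integrable lborel (QT T) (\<lambda>z. \<integral>l. eta G l \<partial>\<nu> z)
   \<and> (AE z in lborel. z \<in> QT T \<longrightarrow>
        F z = (\<integral>l. fst (snd l) \<partial>\<nu> z) \<and> v z = (\<integral>l. fst l \<partial>\<nu> z)
      \<and> (\<integral>l. snd l \<partial>\<nu> z) = Phi (F z))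
     \<comment> \<open>averaged equations\<close>
   \<and> weak_cons_law T (\<lambda>z. \<integral>l. fst l \<partial>\<nu> z)
        (\<lambda>a z. \<chi> i. \<integral>l. flux G i a l \<partial>\<nu> z) v0
   \<and> weak_cons_law T (\<lambda>z. Phi (F z))
        (\<lambda>a z. \<Sum>i\<in>UNIV. (v z $ i) *\<^sub>R dd Phi (Emat i a) (F z)) (\<lambda>x. Phi (F0 x))
     \<comment> \<open>concentration measure: non-negative Radon measure on Q_T\<close>
   \<and> sets \<gamma> = sets borel
   \<and> emeasure \<gamma> (UNIV - QT T) = 0
   \<and> (\<forall>T'<T. emeasure \<gamma> (Qbox \<times> {0..T'}) < \<infinity>)
     \<comment> \<open>energy inequality\<close>
   \<and> (\<forall>\<theta> :: real \<Rightarrow> real. C1_fun \<theta> \<and> (\<forall>t\<in>{0..<T}. 0 \<le> \<theta> t)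
        \<and> (\<exists>T'<T. \<forall>t. T' \<le> t \<longrightarrow> \<theta> t = 0) \<longrightarrow>
        (LINT z:QT T|lborel. deriv \<theta> (snd z) * (\<integral>l. eta G l \<partial>\<nu> z))
        + (\<integral>z. deriv \<theta> (snd z) \<partial>\<gamma>)
        + (LINT x:Qbox|lborel. \<theta> 0 * eta G (v0 x, Phi (F0 x))) \<ge> 0)"

definition lipschitz_solution ::
  "(xi \<Rightarrow> real) \<Rightarrow> real \<Rightarrow> (pt \<Rightarrow> real^3) \<Rightarrow> (pt \<Rightarrow> mat3) \<Rightarrow> bool" where
  "lipschitz_solution G T vh Fh \<longleftrightarrow>
     periodic vh \<and> periodic Fh
   \<and> (\<exists>L. L-lipschitz_on (UNIV \<times> {0..T}) vh) \<and> (\<exists>L. L-lipschitz_on (UNIV \<times> {0..T}) Fh)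
   \<and> bounded (vh ` (UNIV \<times> {0..T})) \<and> bounded (Fh ` (UNIV \<times> {0..T}))
   \<and> weak_cons_law T vh
        (\<lambda>a z. \<chi> i. dd G (dd Phi (Emat i a) (Fh z)) (Phi (Fh z))) (\<lambda>x. vh (x, 0))
   \<and> weak_cons_law T (\<lambda>z. Phi (Fh z))
        (\<lambda>a z. \<Sum>i\<in>UNIV. (vh z $ i) *\<^sub>R dd Phi (Emat i a) (Fh z)) (\<lambda>x. Phi (Fh (x, 0)))"

end

theory Submission imports Defs begin

text \<open>Let \<open>(v', F')\<close> be the Lipschitz solution and let \<open>h(z)\<close> be the average of \<open>\<eta>(\<lambda> | (v', \<Phi>(F')))\<close> under \<open>\<nu>\<^sub>z\<close>, where
  \<open>\<eta>(l | w)\<close> is \<open>\<eta>(l)\<close> minus its first order Taylor polynomial at \<open>w\<close>.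
  Testing the averaged equations with the multipliers \<open>D\<eta>(v', \<Phi>(F'))\<close> and subtracting from the energy inequality
  shows that \<open>h + \<gamma>\<close> decays up to an error bounded by \<open>C h\<close>: the averaged flux minus its linearisation is
  controlled by \<open>h\<close>, by Taylor's formula for bounded arguments and by (H4)' at infinity, and the
  remaining first order terms form null Lagrangians, which integrate to zero because \<open>F\<close> is a gradient. The cut-off \<open>(max 0 (T' - t))\<^sup>2 e\<^sup>-\<^sup>C\<^sup>t\<close> then forces \<open>h = 0\<close> and \<open>\<gamma> = 0\<close>,
  and strong convexity turns \<open>h = 0\<close> into \<open>\<nu>\<close> being a Dirac mass.

  The Lipschitz solution is only differentiable almost everywhere, so the multipliers are evaluated
  at mollifications of it. These are smooth and uniformly Lipschitz, and the residuals with which they solve the equations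
  are bounded and tend to zero weakly in \<open>L\<^sup>1\<close> duality, which suffices since they are only multiplied by
  pointwise convergent bounded factors and fixed integrable functions.\<close>

section \<open>Calculus of continuously differentiable functions\<close>

text \<open>Three obstacles shape the argument. (1) \<open>F\<close> is rough, so products of its
  entries are never integrated by parts. Each \<open>cof F\<close> against a derivative of the
  multipliers is expanded exactly as \<open>cof (F - H) + ccof H F - cof H\<close> about the smooth
  strain \<open>H\<close>: the first term is a quadratic error, the others are at most linear in
  \<open>F\<close>, and for these the weak identity curl F = 0 suffices. (2) The Lipschitz strain is
  not assumed to be a gradient. Both strains satisfy d_t F = grad v, which freezes the curl in time,
  and they agree at time 0; so the curl of \<open>Fh\<close> vanishes because that of
  \<open>F\<close> does. (3) The measure \<nu> need not live on the graph of \<open>Phi\<close>: the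
  flux evaluates dPhi at \<lambda>_F, while only the barycentre is known to be Phi(F). Hence the
  stress is linearised with dPhi left at \<lambda>_F, and the mean of the resulting minor is
  compared with the minor of \<open>F\<close> separately. The exponents p/(p-1) and p/(p-2) in (H4)'
  are Hoelder conjugate to p and p/2, the integrabilities of the linear and quadratic entries of
  dPhi(F); this makes the flux dominated by G + 1.\<close>

lemma dd_eqI: "(f has_derivative f') (at z) \<Longrightarrow> dd f h z = f' h"
  unfolding dd_def using frechet_derivative_at by metis

lemma has_derivative_dd: "f differentiable (at z) \<Longrightarrow> (f has_derivative (\<lambda>h. dd f h z)) (at z)"
  unfolding dd_def by (simp add: frechet_derivative_works)

lemma C1_funI:
  assumes "\<And>z. (f has_derivative f' z) (at z)" "\<And>h. continuous_on UNIV (\<lambda>z. f' z h)"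
  shows "C1_fun f"
  unfolding C1_fun_def
proof (intro conjI allI)
  show "f differentiable (at z)" for z using assms(1) by (auto simp: differentiable_def)
  have "dd f h = (\<lambda>z. f' z h)" for h using dd_eqI[OF assms(1)] by auto
  then show "continuous_on UNIV (dd f h)" for h using assms(2) by simp
qed

lemma C1_fun_has_derivative: "C1_fun f \<Longrightarrow> (f has_derivative (\<lambda>h. dd f h z)) (at z)"
  by (simp add: C1_fun_def has_derivative_dd)

lemma C1_fun_continuous_on: "C1_fun f \<Longrightarrow> continuous_on S f"
  by (meson C1_fun_has_derivative continuous_at_imp_continuous_on has_derivative_continuous)

lemma C1_fun_continuous_on_dd: "C1_fun f \<Longrightarrow> continuous_on S (dd f h)"
  by (meson C1_fun_def continuous_on_subset subset_UNIV)

text \<open>\<open>C1_fun\<close> provides continuity of \<open>dd f h\<close> for a fixed direction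
  only. The expansion over \<open>Basis\<close> reduces directions that vary with the point, and
  estimates uniform in the direction, to finitely many fixed ones.\<close>

lemma dd_Basis:
  fixes f :: "'a::euclidean_space \<Rightarrow> 'b::real_normed_vector"
  assumes "f differentiable (at z)"
  shows "dd f h z = (\<Sum>b\<in>Basis. (h \<bullet> b) *\<^sub>R dd f b z)"
proof -
  interpret bounded_linear "\<lambda>h. dd f h z"
    using has_derivative_dd[OF assms] by (rule has_derivative_bounded_linear)
  have "dd f h z = dd f (\<Sum>b\<in>Basis. (h \<bullet> b) *\<^sub>R b) z" by (simp add: euclidean_representation)
  then show ?thesis by (simp add: sum scaleR)
qed

lemma linear_dd: "f differentiable (at z) \<Longrightarrow> linear (\<lambda>h. dd f h z)"
  using has_derivative_bounded_linear[OF has_derivative_dd] bounded_linear.linear by blast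

lemma C1_fun_const [simp]: "C1_fun (\<lambda>z. c)"
  by (rule C1_funI[where f' = "\<lambda>z h. 0"]) auto

lemma dd_const [simp]: "dd (\<lambda>z. c) h z = 0"
  by (rule dd_eqI[THEN trans]) (auto intro: has_derivative_const)

lemma C1_fun_linear:
  assumes "bounded_linear f" shows "C1_fun f"
  by (rule C1_funI[where f' = "\<lambda>z. f"]) (auto intro: bounded_linear_imp_has_derivative assms)

lemma dd_linear: "bounded_linear f \<Longrightarrow> dd f h z = f h"
  by (rule dd_eqI) (auto intro: bounded_linear_imp_has_derivative)

lemma dd_add: "C1_fun f \<Longrightarrow> C1_fun g \<Longrightarrow> dd (\<lambda>z. f z + g z) h z = dd f h z + dd g h z"
  by (rule dd_eqI[where f' = "\<lambda>h. dd f h z + dd g h z"])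
     (intro has_derivative_add C1_fun_has_derivative)

lemma C1_fun_add: "C1_fun f \<Longrightarrow> C1_fun g \<Longrightarrow> C1_fun (\<lambda>z. f z + g z)"
  by (rule C1_funI[where f' = "\<lambda>z h. dd f h z + dd g h z"])
     (auto intro!: has_derivative_add C1_fun_has_derivative continuous_intros C1_fun_continuous_on_dd)

lemma dd_minus: "C1_fun f \<Longrightarrow> dd (\<lambda>z. - f z) h z = - dd f h z"
  by (rule dd_eqI[where f' = "\<lambda>h. - dd f h z"])
     (intro has_derivative_minus C1_fun_has_derivative)

lemma C1_fun_minus: "C1_fun f \<Longrightarrow> C1_fun (\<lambda>z. - f z)"
  by (rule C1_funI[where f' = "\<lambda>z h. - dd f h z"])
     (auto intro!: has_derivative_minus C1_fun_has_derivative continuous_intros C1_fun_continuous_on_dd)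

lemma dd_diff: "C1_fun f \<Longrightarrow> C1_fun g \<Longrightarrow> dd (\<lambda>z. f z - g z) h z = dd f h z - dd g h z"
  using dd_add[of f "\<lambda>z. - g z"] dd_minus[of g] C1_fun_minus[of g] by simp

lemma C1_fun_diff: "C1_fun f \<Longrightarrow> C1_fun g \<Longrightarrow> C1_fun (\<lambda>z. f z - g z)"
  using C1_fun_add[of f "\<lambda>z. - g z"] C1_fun_minus[of g] by simp

lemma C1_fun_sum: "(\<And>i. i \<in> I \<Longrightarrow> C1_fun (f i)) \<Longrightarrow> C1_fun (\<lambda>z. \<Sum>i\<in>I. f i z)"
  by (induction I rule: infinite_finite_induct) (auto intro: C1_fun_add)

lemma dd_sum: "(\<And>i. i \<in> I \<Longrightarrow> C1_fun (f i)) \<Longrightarrow> dd (\<lambda>z. \<Sum>i\<in>I. f i z) h z = (\<Sum>i\<in>I. dd (f i) h z)"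
  by (induction I rule: infinite_finite_induct) (auto simp: dd_add C1_fun_sum)

lemma dd_scaleR: "C1_fun f \<Longrightarrow> C1_fun g \<Longrightarrow>
    dd (\<lambda>z. f z *\<^sub>R g z) h z = f z *\<^sub>R dd g h z + dd f h z *\<^sub>R g z"
  by (rule dd_eqI[where f' = "\<lambda>h. f z *\<^sub>R dd g h z + dd f h z *\<^sub>R g z"])
     (intro has_derivative_scaleR C1_fun_has_derivative)

lemma C1_fun_scaleR: "C1_fun f \<Longrightarrow> C1_fun g \<Longrightarrow> C1_fun (\<lambda>z. f z *\<^sub>R g z)"
proof (rule C1_funI[where f' = "\<lambda>z h. f z *\<^sub>R dd g h z + dd f h z *\<^sub>R g z"])
  assume f: "C1_fun f" and g: "C1_fun g"
  show "((\<lambda>z. f z *\<^sub>R g z) has_derivative (\<lambda>h. f z *\<^sub>R dd g h z + dd f h z *\<^sub>R g z)) (at z)" for z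
    by (intro has_derivative_scaleR C1_fun_has_derivative f g)
  note [continuous_intros] = f[THEN C1_fun_continuous_on] g[THEN C1_fun_continuous_on]
    f[THEN C1_fun_continuous_on_dd] g[THEN C1_fun_continuous_on_dd]
  show "continuous_on UNIV (\<lambda>z. f z *\<^sub>R dd g h z + dd f h z *\<^sub>R g z)" for h
    by (intro continuous_intros)
qed

lemma dd_mult:
  fixes f g :: "'a::euclidean_space \<Rightarrow> real"
  shows "C1_fun f \<Longrightarrow> C1_fun g \<Longrightarrow> dd (\<lambda>z. f z * g z) h z = f z * dd g h z + dd f h z * g z"
  using dd_scaleR[of f g] by simp

lemma C1_fun_mult:
  fixes f g :: "'a::euclidean_space \<Rightarrow> real"
  shows "C1_fun f \<Longrightarrow> C1_fun g \<Longrightarrow> C1_fun (\<lambda>z. f z * g z)"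
  using C1_fun_scaleR[of f g] by simp

lemma dd_compose:
  fixes f :: "'a::euclidean_space \<Rightarrow> 'b::euclidean_space"
  assumes "C1_fun g" "C1_fun f"
  shows "dd (\<lambda>z. g (f z)) h z = dd g (dd f h z) (f z)"
  by (rule dd_eqI[where f' = "\<lambda>h. dd g (dd f h z) (f z)"])
     (intro has_derivative_compose[where g=g and f=f] C1_fun_has_derivative assms)

lemma C1_fun_compose:
  fixes f :: "'a::euclidean_space \<Rightarrow> 'b::euclidean_space"
  assumes "C1_fun g" "C1_fun f"
  shows "C1_fun (\<lambda>z. g (f z))"
proof (rule C1_funI[where f' = "\<lambda>z h. dd g (dd f h z) (f z)"])
  show "((\<lambda>z. g (f z)) has_derivative (\<lambda>h. dd g (dd f h z) (f z))) (at z)" for z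
    by (intro has_derivative_compose[where g=g and f=f] C1_fun_has_derivative assms)
  fix h
  have "continuous_on UNIV (\<lambda>z. \<Sum>b\<in>Basis. (dd f h z \<bullet> b) *\<^sub>R dd g b (f z))"
    by (intro continuous_intros C1_fun_continuous_on_dd assms
        continuous_on_compose2[OF C1_fun_continuous_on_dd[OF assms(1)] C1_fun_continuous_on[OF assms(2)]]) auto
  then show "continuous_on UNIV (\<lambda>z. dd g (dd f h z) (f z))"
    using assms(1) by (subst dd_Basis) (auto simp: C1_fun_def)
qed

lemma C1_fun_inner_left:
  fixes f :: "'a::euclidean_space \<Rightarrow> 'b::euclidean_space"
  assumes "C1_fun f" shows "C1_fun (\<lambda>z. f z \<bullet> c)"
  by (rule C1_fun_compose[OF C1_fun_linear[OF bounded_linear_inner_left] assms])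

lemma dd_inner_left:
  fixes f :: "'a::euclidean_space \<Rightarrow> 'b::euclidean_space"
  assumes "C1_fun f" shows "dd (\<lambda>z. f z \<bullet> c) h z = dd f h z \<bullet> c"
  using dd_compose[OF C1_fun_linear[OF bounded_linear_inner_left] assms, of c h z]
    dd_linear[OF bounded_linear_inner_left, of c] by simp

lemma C1_fun_componentwise:
  fixes f :: "'a::euclidean_space \<Rightarrow> 'b::euclidean_space"
  assumes "\<And>b. b \<in> Basis \<Longrightarrow> C1_fun (\<lambda>z. f z \<bullet> b)"
  shows "C1_fun f"
proof -
  have "C1_fun (\<lambda>z. \<Sum>b\<in>Basis. (f z \<bullet> b) *\<^sub>R b)"
    by (intro C1_fun_sum C1_fun_scaleR assms C1_fun_const)
  then show ?thesis by (simp add: euclidean_representation)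
qed

lemma C1_fun_real:
  assumes "\<And>x. (f has_real_derivative f' x) (at x)" "continuous_on UNIV f'"
  shows "C1_fun f"
proof (rule C1_funI[where f' = "\<lambda>z h. f' z * h"])
  show "(f has_derivative (\<lambda>h. f' z * h)) (at z)" for z
    using assms(1)[of z] by (simp add: has_field_derivative_def)
qed (intro continuous_intros assms(2))

lemma dd_real:
  fixes f :: "real \<Rightarrow> real"
  assumes "(f has_real_derivative f') (at x)" shows "dd f h x = f' * h"
  by (rule dd_eqI) (rule assms[unfolded has_field_derivative_def])

lemma C1_fun_has_real_derivative:
  fixes f :: "real \<Rightarrow> real"
  assumes "C1_fun f"
  shows "(f has_real_derivative dd f 1 x) (at x)"
proof -
  have "(\<lambda>h. dd f h x) = (*) (dd f 1 x)"
  proof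
    show "dd f h x = dd f 1 x * h" for h
      using dd_Basis[of f x h] assms by (simp add: C1_fun_def)
  qed
  then show ?thesis
    using C1_fun_has_derivative[OF assms, of x] unfolding has_field_derivative_def by metis
qed

lemma has_real_derivative_line:
  fixes f :: "'a::euclidean_space \<Rightarrow> real"
  assumes "f differentiable (at (x + s *\<^sub>R h))"
  shows "((\<lambda>s. f (x + s *\<^sub>R h)) has_real_derivative dd f h (x + s *\<^sub>R h)) (at s)"
proof -
  have 1: "((\<lambda>s. x + s *\<^sub>R h) has_derivative (\<lambda>t. t *\<^sub>R h)) (at s)"
    by (auto intro!: derivative_eq_intros)
  have "((\<lambda>s. f (x + s *\<^sub>R h)) has_derivative (\<lambda>t. dd f (t *\<^sub>R h) (x + s *\<^sub>R h))) (at s)"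
    by (rule has_derivative_compose[OF 1 has_derivative_dd[OF assms]])
  moreover have "dd f (t *\<^sub>R h) (x + s *\<^sub>R h) = dd f h (x + s *\<^sub>R h) * t" for t
    using linear_cmul[OF linear_dd[OF assms]] by simp
  ultimately show ?thesis unfolding has_field_derivative_def by simp
qed

lemma mean_value_line:
  fixes f :: "'a::euclidean_space \<Rightarrow> real"
  assumes "\<And>z. f differentiable (at z)"
  obtains s where "0 < s" "s < 1" "f (x + h) - f x = dd f h (x + s *\<^sub>R h)"
proof -
  have "\<exists>s>0. s < 1 \<and> f (x + 1 *\<^sub>R h) - f (x + 0 *\<^sub>R h) = (1 - 0) * dd f h (x + s *\<^sub>R h)"
    by (rule MVT2) (auto intro: has_real_derivative_line assms)
  then show ?thesis using that by auto
qed

definition C2_fun :: "('a::euclidean_space \<Rightarrow> real) \<Rightarrow> bool" where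
  "C2_fun f \<longleftrightarrow> C1_fun f \<and> (\<forall>h. C1_fun (dd f h))"

text \<open>Mean value theorem twice: in the direction \<open>h\<close> for the increment along
  \<open>k\<close>, then in the direction \<open>k\<close> for \<open>dd f h\<close>. The difference
  on the left is symmetric in \<open>h\<close> and \<open>k\<close>, the order of differentiation on
  the right is not.\<close>

lemma second_difference:
  fixes f :: "'a::euclidean_space \<Rightarrow> real"
  assumes f: "C2_fun f" and s: "s > 0"
  obtains w where "norm (w - z) \<le> s * (norm h + norm k)"
    "f (z + s *\<^sub>R h + s *\<^sub>R k) - f (z + s *\<^sub>R h) - (f (z + s *\<^sub>R k) - f z) = s^2 * dd (dd f h) k w"
proof -
  have d: "f differentiable (at z)" "dd f h differentiable (at z)" for z
    using f by (auto simp: C2_fun_def C1_fun_def)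
  have 1: "((\<lambda>a. f (z + s *\<^sub>R k + a *\<^sub>R h) - f (z + a *\<^sub>R h)) has_real_derivative
      dd f h (z + s *\<^sub>R k + a *\<^sub>R h) - dd f h (z + a *\<^sub>R h)) (at a)" for a
    by (intro DERIV_diff has_real_derivative_line d)
  obtain a where a: "0 < a" "a < s"
    "f (z + s *\<^sub>R k + s *\<^sub>R h) - f (z + s *\<^sub>R h) - (f (z + s *\<^sub>R k + 0 *\<^sub>R h) - f (z + 0 *\<^sub>R h))
      = (s - 0) * (dd f h (z + s *\<^sub>R k + a *\<^sub>R h) - dd f h (z + a *\<^sub>R h))"
    using MVT2[OF s 1] by blast
  have 2: "((\<lambda>b. dd f h (z + a *\<^sub>R h + b *\<^sub>R k)) has_real_derivative
      dd (dd f h) k (z + a *\<^sub>R h + b *\<^sub>R k)) (at b)" for b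
    by (intro has_real_derivative_line d)
  obtain b where b: "0 < b" "b < s"
    "dd f h (z + a *\<^sub>R h + s *\<^sub>R k) - dd f h (z + a *\<^sub>R h + 0 *\<^sub>R k)
      = (s - 0) * dd (dd f h) k (z + a *\<^sub>R h + b *\<^sub>R k)"
    using MVT2[OF s 2] by blast
  show ?thesis
  proof (rule that[of "z + a *\<^sub>R h + b *\<^sub>R k"])
    have "norm (a *\<^sub>R h + b *\<^sub>R k) \<le> a * norm h + b * norm k"
      using norm_triangle_ineq[of "a *\<^sub>R h" "b *\<^sub>R k"] a b by simp
    also have "\<dots> \<le> s * norm h + s * norm k"
      using a b by (intro add_mono mult_right_mono) auto
    finally show "norm (z + a *\<^sub>R h + b *\<^sub>R k - z) \<le> s * (norm h + norm k)"
      by (simp add: algebra_simps)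
    show "f (z + s *\<^sub>R h + s *\<^sub>R k) - f (z + s *\<^sub>R h) - (f (z + s *\<^sub>R k) - f z)
        = s^2 * dd (dd f h) k (z + a *\<^sub>R h + b *\<^sub>R k)"
      using a(3) b(3) by (simp add: algebra_simps power2_eq_square)
  qed
qed

text \<open>Evaluating the symmetric second difference in both orders gives equal mixed derivatives
  at two points whose distance to \<open>z\<close> is of order \<open>s n\<close>; continuity of
  both derivatives identifies them at \<open>z\<close>.\<close>

lemma dd_commute:
  fixes f :: "'a::euclidean_space \<Rightarrow> real"
  assumes f: "C2_fun f"
  shows "dd (dd f h) k z = dd (dd f k) h z"
proof -
  define s where "s n = inverse (real (Suc n))" for n
  have s: "s n > 0" for n by (simp add: s_def)
  have "\<exists>w. norm (w - z) \<le> s n * (norm h + norm k) \<and>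
    f (z + s n *\<^sub>R h + s n *\<^sub>R k) - f (z + s n *\<^sub>R h) - (f (z + s n *\<^sub>R k) - f z) = (s n)^2 * dd (dd f h) k w" for n
    using second_difference[OF f s] by metis
  then obtain u where u: "\<And>n. norm (u n - z) \<le> s n * (norm h + norm k)"
    "\<And>n. f (z + s n *\<^sub>R h + s n *\<^sub>R k) - f (z + s n *\<^sub>R h) - (f (z + s n *\<^sub>R k) - f z) = (s n)^2 * dd (dd f h) k (u n)"
    by metis
  have "\<exists>w. norm (w - z) \<le> s n * (norm k + norm h) \<and>
    f (z + s n *\<^sub>R k + s n *\<^sub>R h) - f (z + s n *\<^sub>R k) - (f (z + s n *\<^sub>R h) - f z) = (s n)^2 * dd (dd f k) h w" for n
    using second_difference[OF f s] by metis
  then obtain w where w: "\<And>n. norm (w n - z) \<le> s n * (norm k + norm h)"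
    "\<And>n. f (z + s n *\<^sub>R k + s n *\<^sub>R h) - f (z + s n *\<^sub>R k) - (f (z + s n *\<^sub>R h) - f z) = (s n)^2 * dd (dd f k) h (w n)"
    by metis
  have eq: "dd (dd f h) k (u n) = dd (dd f k) h (w n)" for n
  proof -
    have "(s n)^2 * dd (dd f h) k (u n) = (s n)^2 * dd (dd f k) h (w n)"
      unfolding u(2)[symmetric] w(2)[symmetric] by (simp add: algebra_simps)
    then show ?thesis using s[of n] by simp
  qed
  have s0: "(\<lambda>n. s n * c) \<longlonglongrightarrow> 0" for c
    unfolding s_def using tendsto_mult_right[OF LIMSEQ_inverse_real_of_nat, of c] by (simp add: mult.commute)
  have "(\<lambda>n. u n - z) \<longlonglongrightarrow> 0"
    by (rule Lim_null_comparison[OF always_eventually s0]) (use u in auto)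
  then have 1: "u \<longlonglongrightarrow> z" by (simp add: LIM_zero_iff)
  have "(\<lambda>n. w n - z) \<longlonglongrightarrow> 0"
    by (rule Lim_null_comparison[OF always_eventually s0]) (use w in auto)
  then have 2: "w \<longlonglongrightarrow> z" by (simp add: LIM_zero_iff)
  have c: "isCont (dd (dd f h) k) z" for h k
    using f by (meson C1_fun_def C2_fun_def UNIV_I continuous_on_eq_continuous_at open_UNIV)
  have "(\<lambda>n. dd (dd f h) k (u n)) \<longlonglongrightarrow> dd (dd f h) k z"
    by (rule isCont_tendsto_compose[OF c 1])
  moreover have "(\<lambda>n. dd (dd f h) k (u n)) \<longlonglongrightarrow> dd (dd f k) h z"
    unfolding eq by (rule isCont_tendsto_compose[OF c 2])
  ultimately show ?thesis by (rule LIMSEQ_unique)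
qed

section \<open>Uniform bounds and Taylor estimates on balls\<close>

lemma C1_fun_bounded_cball:
  fixes f :: "'a::euclidean_space \<Rightarrow> real"
  assumes "continuous_on UNIV f"
  obtains C where "C \<ge> 0" "\<And>z. norm z \<le> R \<Longrightarrow> \<bar>f z\<bar> \<le> C"
proof -
  have "compact (f ` cball 0 R)"
    by (rule compact_continuous_image[OF continuous_on_subset[OF assms]]) auto
  then obtain C where "\<And>y. y \<in> f ` cball 0 R \<Longrightarrow> norm y \<le> C"
    using compact_imp_bounded bounded_iff by metis
  then show ?thesis by (intro that[of "max 0 C"]) (force simp: max_def)+
qed

lemma dd_bounded_cball:
  fixes f :: "'a::euclidean_space \<Rightarrow> real"
  assumes f: "C1_fun f"
  obtains C where "C \<ge> 0" "\<And>z h. norm z \<le> R \<Longrightarrow> \<bar>dd f h z\<bar> \<le> C * norm h"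
proof -
  have "\<exists>C\<ge>0. \<forall>z. norm z \<le> R \<longrightarrow> \<bar>dd f b z\<bar> \<le> C" for b
    using C1_fun_bounded_cball[of "dd f b" R] f by (metis C1_fun_def)
  then obtain C where C: "\<And>b. C b \<ge> 0" "\<And>b z. norm z \<le> R \<Longrightarrow> \<bar>dd f b z\<bar> \<le> C b" by metis
  show ?thesis
  proof (rule that[of "\<Sum>b\<in>Basis. C b"])
    show "0 \<le> sum C Basis" by (intro sum_nonneg C)
    fix z h :: 'a assume z: "norm z \<le> R"
    have "\<bar>dd f h z\<bar> = \<bar>\<Sum>b\<in>Basis. (h \<bullet> b) * dd f b z\<bar>"
      using f by (subst dd_Basis) (auto simp: C1_fun_def)
    also have "\<dots> \<le> (\<Sum>b\<in>Basis. \<bar>h \<bullet> b\<bar> * \<bar>dd f b z\<bar>)"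
      by (rule order_trans[OF sum_abs]) (simp add: abs_mult)
    also have "\<dots> \<le> (\<Sum>b\<in>Basis. norm h * C b)"
      by (intro sum_mono mult_mono C z) (auto simp: Basis_le_norm)
    finally show "\<bar>dd f h z\<bar> \<le> sum C Basis * norm h" by (simp add: sum_distrib_left mult.commute)
  qed
qed

lemma C1_fun_lipschitz_cball:
  fixes f :: "'a::euclidean_space \<Rightarrow> real"
  assumes f: "C1_fun f"
  obtains C where "C \<ge> 0" "\<And>x y. norm x \<le> R \<Longrightarrow> norm y \<le> R \<Longrightarrow> \<bar>f y - f x\<bar> \<le> C * norm (y - x)"
proof -
  obtain C where C: "C \<ge> 0" "\<And>z h. norm z \<le> R \<Longrightarrow> \<bar>dd f h z\<bar> \<le> C * norm h"
    using dd_bounded_cball[OF f] by metis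
  show ?thesis
  proof (rule that[OF C(1)])
    fix x y :: 'a assume xy: "norm x \<le> R" "norm y \<le> R"
    obtain s where s: "0 < s" "s < 1" "f (x + (y - x)) - f x = dd f (y - x) (x + s *\<^sub>R (y - x))"
      using mean_value_line[of f x "y - x"] f by (metis C1_fun_def)
    have "x + s *\<^sub>R (y - x) = (1 - s) *\<^sub>R x + s *\<^sub>R y" by (simp add: algebra_simps)
    moreover have "(1 - s) *\<^sub>R x + s *\<^sub>R y \<in> cball 0 R"
      by (rule convexD[OF convex_cball]) (use xy s in auto)
    ultimately have "norm (x + s *\<^sub>R (y - x)) \<le> R" by simp
    then show "\<bar>f y - f x\<bar> \<le> C * norm (y - x)" using C(2) s(3) by simp
  qed
qed

text \<open>The mean value theorem turns the remainder into a difference of first derivatives at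
  \<open>x\<close> and at a point of the segment, which stays in the ball by convexity. The constant
  adds up the Lipschitz constants of the partial derivatives.\<close>

lemma C2_fun_taylor_cball:
  fixes f :: "'a::euclidean_space \<Rightarrow> real"
  assumes f: "C2_fun f"
  obtains C where "C \<ge> 0" "\<And>x y. norm x \<le> R \<Longrightarrow> norm y \<le> R \<Longrightarrow>
    \<bar>f y - f x - dd f (y - x) x\<bar> \<le> C * (norm (y - x))\<^sup>2"
proof -
  have f1: "C1_fun f" and fd: "\<And>z. f differentiable (at z)" and f2: "\<And>h. C1_fun (dd f h)"
    using f by (auto simp: C2_fun_def C1_fun_def)
  have "\<exists>C\<ge>0. \<forall>x y. norm x \<le> R \<longrightarrow> norm y \<le> R \<longrightarrow> \<bar>dd f b y - dd f b x\<bar> \<le> C * norm (y - x)" for b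
    using C1_fun_lipschitz_cball[OF f2] by metis
  then obtain C where C: "\<And>b. C b \<ge> 0"
    "\<And>b x y. norm x \<le> R \<Longrightarrow> norm y \<le> R \<Longrightarrow> \<bar>dd f b y - dd f b x\<bar> \<le> C b * norm (y - x)" by metis
  show ?thesis
  proof (rule that[of "\<Sum>b\<in>Basis. C b"])
    show "0 \<le> sum C Basis" by (intro sum_nonneg C)
    fix x y :: 'a assume xy: "norm x \<le> R" "norm y \<le> R"
    obtain s where s: "0 < s" "s < 1" "f (x + (y - x)) - f x = dd f (y - x) (x + s *\<^sub>R (y - x))"
      using mean_value_line[of f x "y - x"] fd by metis
    define u where "u = x + s *\<^sub>R (y - x)"
    have "x + s *\<^sub>R (y - x) = (1 - s) *\<^sub>R x + s *\<^sub>R y" by (simp add: algebra_simps)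
    moreover have "(1 - s) *\<^sub>R x + s *\<^sub>R y \<in> cball 0 R"
      by (rule convexD[OF convex_cball]) (use xy s in auto)
    ultimately have u: "norm u \<le> R" by (simp add: u_def)
    have ux: "norm (u - x) \<le> norm (y - x)" unfolding u_def using s by (simp add: mult_left_le_one_le)
    have "f y - f x - dd f (y - x) x = dd f (y - x) u - dd f (y - x) x"
      using s(3) by (simp add: u_def)
    also have "\<dots> = (\<Sum>b\<in>Basis. ((y - x) \<bullet> b) * (dd f b u - dd f b x))"
      using dd_Basis[OF fd, of "y - x"] by (simp add: sum_subtractf right_diff_distrib)
    finally have "\<bar>f y - f x - dd f (y - x) x\<bar> \<le> (\<Sum>b\<in>Basis. \<bar>(y - x) \<bullet> b\<bar> * \<bar>dd f b u - dd f b x\<bar>)"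
      by (simp only:) (rule order_trans[OF sum_abs], simp add: abs_mult)
    also have "\<dots> \<le> (\<Sum>b\<in>Basis. norm (y - x) * (C b * norm (y - x)))"
      using order_trans[OF C(2)[OF xy(1) u] mult_left_mono[OF ux C(1)]]
      by (intro sum_mono mult_mono) (auto simp: Basis_le_norm)
    finally show "\<bar>f y - f x - dd f (y - x) x\<bar> \<le> sum C Basis * (norm (y - x))\<^sup>2"
      by (simp add: sum_distrib_right power2_eq_square mult_ac)
  qed
qed

text \<open>Along the segment, subtract from \<open>f\<close> its tangent at \<open>x\<close> and
  the parabola with second derivative \<open>c * (norm h)\<^sup>2\<close>. The difference
  \<open>k\<close> has zero slope at 0 and nonnegative second derivative, so it does not decrease up
  to 1.\<close>

lemma strong_convexity_lower:
  fixes f :: "'a::euclidean_space \<Rightarrow> real"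
  assumes f: "C2_fun f" and c: "\<And>X h. dd (dd f h) h X \<ge> c * (norm h)\<^sup>2"
  shows "f y - f x - dd f (y - x) x \<ge> c / 2 * (norm (y - x))\<^sup>2"
proof -
  have f1: "\<And>z. f differentiable (at z)" and f2: "\<And>h z. dd f h differentiable (at z)"
    using f by (auto simp: C2_fun_def C1_fun_def)
  define h where "h = y - x"
  define k where "k s = f (x + s *\<^sub>R h) - s * dd f h x - c * (norm h)\<^sup>2 * s\<^sup>2 / 2" for s
  define k' where "k' s = dd f h (x + s *\<^sub>R h) - dd f h x - c * (norm h)\<^sup>2 * s" for s
  have k: "(k has_real_derivative k' s) (at s)" for s
    unfolding k_def k'_def by (auto intro!: derivative_eq_intros has_real_derivative_line f1)
  have k': "(k' has_real_derivative dd (dd f h) h (x + s *\<^sub>R h) - c * (norm h)\<^sup>2) (at s)" for s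
    unfolding k'_def by (auto intro!: derivative_eq_intros has_real_derivative_line f2)
  have k'_nonneg: "k' s \<ge> 0" if "s \<ge> 0" for s
  proof -
    have "k' 0 \<le> k' s"
      by (rule DERIV_nonneg_imp_nondecreasing[OF that]) (use k' c in \<open>auto intro!: exI\<close>)
    then show ?thesis by (simp add: k'_def)
  qed
  have "k 0 \<le> k 1"
    by (rule DERIV_nonneg_imp_nondecreasing) (use k k'_nonneg in auto)
  then show ?thesis by (simp add: k_def h_def)
qed

section \<open>Cofactor matrices\<close>

text \<open>The polarised cofactor, that is \<open>cof (M + N) - cof M - cof N\<close>, normalised
  so that the diagonal is twice \<open>cof\<close>. Arithmetic in the type \<open>3\<close> is
  modulo 3, and with cyclic indices the minors carry no alternating signs.\<close>

definition ccof :: "mat3 \<Rightarrow> mat3 \<Rightarrow> mat3" where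
  "ccof M N = (\<chi> i a. M $ (i+1) $ (a+1) * N $ (i+2) $ (a+2) + N $ (i+1) $ (a+1) * M $ (i+2) $ (a+2)
     - M $ (i+1) $ (a+2) * N $ (i+2) $ (a+1) - N $ (i+1) $ (a+2) * M $ (i+2) $ (a+1))"

lemma add_3_cyclic:
  "(1::3) + 1 = 2" "(2::3) + 1 = 3" "(3::3) + 1 = 1"
  "(1::3) + 2 = 3" "(2::3) + 2 = 1" "(3::3) + 2 = 2" "(4::3) = 1" "(5::3) = 2"
  by simp_all

lemma neq_3: "(1::3) \<noteq> 3" "(2::3) \<noteq> 1" "(2::3) \<noteq> 3" "(3::3) \<noteq> 1" "(3::3) \<noteq> 2"
  by simp_all

lemma cof_eq_ccof: "cof F = (1/2) *\<^sub>R ccof F F"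
  unfolding vec_eq_iff cof_def ccof_def forall_3
  by (simp add: det_3 add_3_cyclic neq_3 del: add_numeral_special)

text \<open>Euler's identity for the cubic form det: the cofactor matrix paired with
  \<open>F\<close> gives three times the determinant.\<close>

lemma det_eq_ccof: "det F = (1/6) * (ccof F F \<bullet> F)"
  by (simp add: det_3 ccof_def inner_vec_def sum_3 add_3_cyclic del: add_numeral_special) (simp add: algebra_simps)

lemma ccof_commute: "ccof M N = ccof N M"
  by (simp add: ccof_def vec_eq_iff algebra_simps)

text \<open>Both sides are the full polarisation of the determinant, a symmetric trilinear form.
  This symmetry is what later moves a cofactor from a test direction onto a coefficient
  matrix.\<close>

lemma ccof_inner_commute: "ccof M N \<bullet> A = ccof M A \<bullet> N"
  by (simp add: ccof_def inner_vec_def sum_3 add_3_cyclic del: add_numeral_special) (simp add: algebra_simps)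

lemma bounded_bilinear_ccof: "bounded_bilinear ccof"
proof -
  have "bilinear ccof"
    unfolding bilinear_def
    by (auto intro!: linearI simp: ccof_def vec_eq_iff algebra_simps)
  then show ?thesis by (simp add: bilinear_conv_bounded_bilinear)
qed

interpretation ccof: bounded_bilinear ccof
  by (rule bounded_bilinear_ccof)

lemma cof_add: "cof (M + N) = cof M + ccof M N + cof N"
  by (simp add: cof_eq_ccof ccof.add_left ccof.add_right ccof_commute[of N M] scaleR_right_distrib
      flip: scaleR_left_distrib)

text \<open>Exact because \<open>cof\<close> is quadratic. It later expands a rough cofactor about a
  smooth one, leaving a quadratic remainder and terms at most linear in the rough matrix.\<close>

lemma cof_diff: "cof (M - N) = cof M - ccof N M + cof N"
  using cof_add[of M "- N"]
  by (simp add: cof_eq_ccof ccof.minus_left ccof.minus_right ccof_commute[of M N])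

lemma Emat_eq: "Emat i a = axis i (axis a 1)"
  by (auto simp: Emat_def axis_def vec_eq_iff)

lemma inner_Emat: "M \<bullet> Emat i a = M $ i $ a" "Emat i a \<bullet> M = M $ i $ a"
  by (simp_all add: Emat_eq inner_axis inner_axis')

lemma norm_Emat [simp]: "norm (Emat i a) = 1"
  by (simp add: Emat_eq norm_axis_1 norm_eq_sqrt_inner inner_axis)

text \<open>The product rule for \<open>ccof F F \<bullet> F\<close> gives three terms, equal by the
  symmetry of the trilinear form; this is how the factor 1/6 turns into the single cofactor in the
  last slot.\<close>

lemma Phi_has_derivative: "(Phi has_derivative (\<lambda>N. (N, ccof M N, cof M \<bullet> N))) (at M)"
proof -
  have "((\<lambda>F. ccof F F) has_derivative (\<lambda>N. ccof M N + ccof N M)) (at M)"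
    by (rule ccof.FDERIV[where f="\<lambda>x. x" and g="\<lambda>x. x"]) (auto intro: has_derivative_ident)
  then have c: "((\<lambda>F. ccof F F) has_derivative (\<lambda>N. 2 *\<^sub>R ccof M N)) (at M)"
    by (simp add: ccof_commute[of _ M] scaleR_2)
  have 1: "(cof has_derivative (\<lambda>N. ccof M N)) (at M)"
    using has_derivative_scaleR_right[OF c, of "1/2"] by (simp add: cof_eq_ccof[abs_def])
  have "((\<lambda>F. (1/6) * (ccof F F \<bullet> F)) has_derivative (\<lambda>N. (1/6) * (ccof M M \<bullet> N + 2 *\<^sub>R ccof M N \<bullet> M))) (at M)"
    by (intro has_derivative_mult_right has_derivative_inner[OF c] has_derivative_ident)
  moreover have "(1/6) * (ccof M M \<bullet> N + 2 *\<^sub>R ccof M N \<bullet> M) = cof M \<bullet> N" for N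
    by (simp add: cof_eq_ccof ccof_inner_commute[of M N M])
  ultimately have 2: "(det has_derivative (\<lambda>N. cof M \<bullet> N)) (at M)"
    by (simp add: det_eq_ccof[abs_def])
  show ?thesis
    unfolding Phi_def[abs_def] by (intro has_derivative_Pair has_derivative_ident 1 2)
qed

lemma dd_Phi: "dd Phi N M = (N, ccof M N, cof M \<bullet> N)"
  by (rule dd_eqI[OF Phi_has_derivative])

lemma C1_fun_cof: "C1_fun cof"
proof -
  have "C1_fun (\<lambda>M. cof M)"
  proof (rule C1_funI[where f' = "\<lambda>M N. ccof M N"])
    fix M
    have "((\<lambda>F. fst (snd (Phi F))) has_derivative (\<lambda>N. fst (snd (N, ccof M N, cof M \<bullet> N)))) (at M)"
      by (intro has_derivative_fst has_derivative_snd Phi_has_derivative)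
    then show "(cof has_derivative ccof M) (at M)" by (simp add: Phi_def)
  qed (intro continuous_intros ccof.continuous_on)
  then show ?thesis by simp
qed

lemma dd_cof: "dd cof N M = ccof M N"
proof -
  have "((\<lambda>F. fst (snd (Phi F))) has_derivative (\<lambda>N. fst (snd (N, ccof M N, cof M \<bullet> N)))) (at M)"
    by (intro has_derivative_fst has_derivative_snd Phi_has_derivative)
  then show ?thesis by (intro dd_eqI[where f' = "ccof M"]) (simp add: Phi_def)
qed

lemma C1_fun_Phi: "C1_fun Phi"
  by (rule C1_funI[OF Phi_has_derivative])
     (intro continuous_intros ccof.continuous_on C1_fun_continuous_on C1_fun_cof)

lemma dd_Phi_Emat_inner:
  "dd Phi (Emat i a) M \<bullet> (A1, A2, A3) = A1 $ i $ a + ccof A2 M $ i $ a + A3 * cof M $ i $ a"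
  by (simp add: dd_Phi inner_Emat ccof_inner_commute[of M "Emat i a"] ccof_commute[of M A2])

lemma C1_fun_dd_Phi: "C1_fun (\<lambda>M. dd Phi N M)"
proof -
  have "C1_fun (\<lambda>M. (0, 0, 0))" by simp
  have p: "C1_fun (\<lambda>M. (f M, g M, h M))"
    if "C1_fun f" "C1_fun g" "C1_fun h" for f g :: "mat3 \<Rightarrow> mat3" and h :: "mat3 \<Rightarrow> real"
    by (rule C1_funI[where f' = "\<lambda>z k. (dd f k z, dd g k z, dd h k z)"])
       (intro has_derivative_Pair C1_fun_has_derivative that continuous_intros C1_fun_continuous_on_dd)+
  show ?thesis
    unfolding dd_Phi
    by (intro p C1_fun_const C1_fun_inner_left C1_fun_cof C1_fun_linear ccof.bounded_linear_left)
qed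

text \<open>The algebra of the Piola identity. When \<open>D a\<close> is the derivative in
  direction \<open>a\<close> of a matrix field, the brackets are the components of the curls of its
  rows, so the divergence of a mixed cofactor contains only curls of the differentiated
  argument.\<close>

lemma sum_ccof_curl:
  "(\<Sum>a\<in>UNIV. ccof (D a) M $ i $ a) =
     (\<Sum>c\<in>UNIV. M $ (i+2) $ c * (D (c+1) $ (i+1) $ (c+2) - D (c+2) $ (i+1) $ (c+1))
             - M $ (i+1) $ c * (D (c+1) $ (i+2) $ (c+2) - D (c+2) $ (i+2) $ (c+1)))"
  by (simp add: ccof_def sum_3 add_3_cyclic del: add_numeral_special) (simp add: algebra_simps)

text \<open>The same sum grouped by entries of \<open>D\<close>: each derivative of a fixed entry
  meets the two entries of a row of \<open>M\<close> that form a curl component. This grouping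
  serves a rough \<open>M\<close> whose curl is known only in the weak sense.\<close>

lemma sum_ccof_curl':
  "(\<Sum>a\<in>UNIV. ccof (D a) M $ i $ a) =
     (\<Sum>c\<in>UNIV. (D (c+2) $ (i+1) $ c * M $ (i+2) $ (c+1) - D (c+1) $ (i+1) $ c * M $ (i+2) $ (c+2))
             - (D (c+2) $ (i+2) $ c * M $ (i+1) $ (c+1) - D (c+1) $ (i+2) $ c * M $ (i+1) $ (c+2)))"
  by (simp add: ccof_def sum_3 add_3_cyclic del: add_numeral_special)

text \<open>This and the following bounds are the scalar estimates applied to each partial
  derivative and summed over \<open>Basis\<close>, so that the constant enters linearly with the
  norm of the direction. The directions to come, \<open>dd Phi (Emat i a) _\<close>, are unbounded
  in the state.\<close>

lemma dd_lipschitz_cball: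
  fixes f :: "'a::euclidean_space \<Rightarrow> real"
  assumes f: "C2_fun f"
  obtains C where "C \<ge> 0" "\<And>x y h. norm x \<le> R \<Longrightarrow> norm y \<le> R \<Longrightarrow>
    \<bar>dd f h y - dd f h x\<bar> \<le> C * norm h * norm (y - x)"
proof -
  have d: "\<And>z. f differentiable (at z)" and f2: "\<And>h. C1_fun (dd f h)"
    using f by (auto simp: C2_fun_def C1_fun_def)
  have "\<exists>C\<ge>0. \<forall>x y. norm x \<le> R \<longrightarrow> norm y \<le> R \<longrightarrow> \<bar>dd f b y - dd f b x\<bar> \<le> C * norm (y - x)" for b
    using C1_fun_lipschitz_cball[OF f2] by metis
  then obtain C where C: "\<And>b. C b \<ge> 0"
    "\<And>b x y. norm x \<le> R \<Longrightarrow> norm y \<le> R \<Longrightarrow> \<bar>dd f b y - dd f b x\<bar> \<le> C b * norm (y - x)" by metis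
  show ?thesis
  proof (rule that[of "\<Sum>b\<in>Basis. C b"])
    show "0 \<le> sum C Basis" by (intro sum_nonneg C)
    fix x y h :: 'a assume xy: "norm x \<le> R" "norm y \<le> R"
    have "dd f h y - dd f h x = (\<Sum>b\<in>Basis. (h \<bullet> b) * (dd f b y - dd f b x))"
      using dd_Basis[OF d, of h] by (simp add: sum_subtractf right_diff_distrib)
    then have "\<bar>dd f h y - dd f h x\<bar> \<le> (\<Sum>b\<in>Basis. \<bar>h \<bullet> b\<bar> * \<bar>dd f b y - dd f b x\<bar>)"
      by (simp only:) (rule order_trans[OF sum_abs], simp add: abs_mult)
    also have "\<dots> \<le> (\<Sum>b\<in>Basis. norm h * (C b * norm (y - x)))"
      by (intro sum_mono mult_mono C xy) (auto simp: Basis_le_norm)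
    finally show "\<bar>dd f h y - dd f h x\<bar> \<le> sum C Basis * norm h * norm (y - x)"
      by (simp add: sum_distrib_left sum_distrib_right mult_ac)
  qed
qed

lemma dd2_Basis:
  fixes f :: "'a::euclidean_space \<Rightarrow> real"
  assumes f: "C2_fun f"
  shows "dd (dd f h) k x = (\<Sum>b\<in>Basis. (h \<bullet> b) * dd (dd f b) k x)"
proof -
  have d: "\<And>z. f differentiable (at z)" and f2: "\<And>h. C1_fun (dd f h)"
    using f by (auto simp: C2_fun_def C1_fun_def)
  have "dd f h = (\<lambda>z. \<Sum>b\<in>Basis. (h \<bullet> b) *\<^sub>R dd f b z)"
    using dd_Basis[OF d, of h] by auto
  then have "dd (dd f h) k x = dd (\<lambda>z. \<Sum>b\<in>Basis. (h \<bullet> b) *\<^sub>R dd f b z) k x" by simp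
  also have "\<dots> = (\<Sum>b\<in>Basis. dd (\<lambda>z. (h \<bullet> b) *\<^sub>R dd f b z) k x)"
    by (intro dd_sum C1_fun_scaleR C1_fun_const f2)
  also have "\<dots> = (\<Sum>b\<in>Basis. (h \<bullet> b) * dd (dd f b) k x)"
    by (intro sum.cong refl) (subst dd_scaleR[OF C1_fun_const f2], simp)
  finally show ?thesis .
qed

lemma dd2_bounded_cball:
  fixes f :: "'a::euclidean_space \<Rightarrow> real"
  assumes f: "C2_fun f"
  obtains C where "C \<ge> 0" "\<And>x h k. norm x \<le> R \<Longrightarrow> \<bar>dd (dd f h) k x\<bar> \<le> C * norm h * norm k"
proof -
  have f2: "\<And>h. C1_fun (dd f h)" using f by (auto simp: C2_fun_def)
  have "\<exists>C\<ge>0. \<forall>x k. norm x \<le> R \<longrightarrow> \<bar>dd (dd f b) k x\<bar> \<le> C * norm k" for b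
    using dd_bounded_cball[OF f2] by metis
  then obtain C where C: "\<And>b. C b \<ge> 0" "\<And>b x k. norm x \<le> R \<Longrightarrow> \<bar>dd (dd f b) k x\<bar> \<le> C b * norm k" by metis
  show ?thesis
  proof (rule that[of "\<Sum>b\<in>Basis. C b"])
    show "0 \<le> sum C Basis" by (intro sum_nonneg C)
    fix x h k :: 'a assume x: "norm x \<le> R"
    have "\<bar>dd (dd f h) k x\<bar> \<le> (\<Sum>b\<in>Basis. \<bar>h \<bullet> b\<bar> * \<bar>dd (dd f b) k x\<bar>)"
      unfolding dd2_Basis[OF f, of h] by (rule order_trans[OF sum_abs]) (simp add: abs_mult)
    also have "\<dots> \<le> (\<Sum>b\<in>Basis. norm h * (C b * norm k))"
      by (intro sum_mono mult_mono C x) (auto simp: Basis_le_norm)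
    finally show "\<bar>dd (dd f h) k x\<bar> \<le> sum C Basis * norm h * norm k"
      by (simp add: sum_distrib_left sum_distrib_right mult_ac)
  qed
qed

lemma dd_taylor_cball:
  fixes f :: "'a::euclidean_space \<Rightarrow> real"
  assumes f: "C2_fun f" and f': "\<And>h. C2_fun (dd f h)"
  obtains C where "C \<ge> 0" "\<And>x y h. norm x \<le> R \<Longrightarrow> norm y \<le> R \<Longrightarrow>
    \<bar>dd f h y - dd f h x - dd (dd f h) (y - x) x\<bar> \<le> C * norm h * (norm (y - x))\<^sup>2"
proof -
  have d: "\<And>z. f differentiable (at z)" using f by (auto simp: C2_fun_def C1_fun_def)
  have "\<exists>C\<ge>0. \<forall>x y. norm x \<le> R \<longrightarrow> norm y \<le> R \<longrightarrow>
      \<bar>dd f b y - dd f b x - dd (dd f b) (y - x) x\<bar> \<le> C * (norm (y - x))\<^sup>2" for b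
    using C2_fun_taylor_cball[OF f'] by metis
  then obtain C where C: "\<And>b. C b \<ge> 0" "\<And>b x y. norm x \<le> R \<Longrightarrow> norm y \<le> R \<Longrightarrow>
      \<bar>dd f b y - dd f b x - dd (dd f b) (y - x) x\<bar> \<le> C b * (norm (y - x))\<^sup>2" by metis
  show ?thesis
  proof (rule that[of "\<Sum>b\<in>Basis. C b"])
    show "0 \<le> sum C Basis" by (intro sum_nonneg C)
    fix x y h :: 'a assume xy: "norm x \<le> R" "norm y \<le> R"
    have "dd f h y - dd f h x - dd (dd f h) (y - x) x
        = (\<Sum>b\<in>Basis. (h \<bullet> b) * (dd f b y - dd f b x - dd (dd f b) (y - x) x))"
      using dd_Basis[OF d, of h] dd2_Basis[OF f, of h] by (simp add: sum_subtractf right_diff_distrib)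
    then have "\<bar>dd f h y - dd f h x - dd (dd f h) (y - x) x\<bar>
        \<le> (\<Sum>b\<in>Basis. \<bar>h \<bullet> b\<bar> * \<bar>dd f b y - dd f b x - dd (dd f b) (y - x) x\<bar>)"
      by (simp only:) (rule order_trans[OF sum_abs], simp add: abs_mult)
    also have "\<dots> \<le> (\<Sum>b\<in>Basis. norm h * (C b * (norm (y - x))\<^sup>2))"
      by (intro sum_mono mult_mono C xy) (auto simp: Basis_le_norm)
    finally show "\<bar>dd f h y - dd f h x - dd (dd f h) (y - x) x\<bar> \<le> sum C Basis * norm h * (norm (y - x))\<^sup>2"
      by (simp add: sum_distrib_left sum_distrib_right mult_ac)
  qed
qed

text \<open>The cofactor entries differ like squares: with the symmetric form,
  \<open>cof M - cof N\<close> is half of \<open>ccof (M + N) (M - N)\<close>.\<close>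

lemma dd_Phi_Emat_diff:
  "dd Phi (Emat i a) M - dd Phi (Emat i a) N
     = (0, ccof (M - N) (Emat i a), (1/2) * (ccof (M + N) (M - N) $ i $ a))"
  by (simp add: dd_Phi inner_Emat ccof.diff_left ccof.diff_right ccof.add_left cof_eq_ccof ccof_commute[of M N]
      field_simps)

lemma dd_Phi_Emat_bounds:
  obtains K where "K \<ge> 0"
    "\<And>i a M. norm (dd Phi (Emat i a) M) \<le> K * (1 + (norm M)\<^sup>2)"
    "\<And>i a M N. norm (dd Phi (Emat i a) M - dd Phi (Emat i a) N) \<le> K * (1 + norm M + norm N) * norm (M - N)"
    "\<And>M N. norm (ccof M N) \<le> K * norm M * norm N"
proof -
  obtain K where K: "K > 0" "\<And>M N. norm (ccof M N) \<le> norm M * norm N * K"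
    using ccof.pos_bounded by blast
  have el: "\<bar>M $ i $ a\<bar> \<le> norm M" for M :: mat3 and i a
    using Finite_Cartesian_Product.norm_nth_le order_trans by (metis real_norm_def)
  have sq: "x \<le> 1 + x\<^sup>2" for x :: real using zero_le_power2[of "x - 1/2"] by (simp add: power2_eq_square field_simps)
  show ?thesis
  proof (rule that[of "1 + 2 * K"])
    show "0 \<le> 1 + 2 * K" using K by simp
    show "norm (ccof M N) \<le> (1 + 2 * K) * norm M * norm N" for M N
      by (rule order_trans[OF K(2)]) (use K(1) in \<open>simp add: algebra_simps\<close>)
    fix i a M N
    have "norm (dd Phi (Emat i a) M) \<le> norm (Emat i a) + (norm (ccof M (Emat i a)) + \<bar>cof M $ i $ a\<bar>)"
      unfolding dd_Phi by (intro order_trans[OF norm_Pair_le] add_mono order_refl) (simp add: inner_Emat)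
    also have "\<dots> \<le> 1 + (norm M * K + (norm M)\<^sup>2 * K)"
      using K(2)[of M "Emat i a"] K(2)[of M M] el[of "cof M" i a] K(1)
      by (intro add_mono) (auto simp: cof_eq_ccof power2_eq_square)
    also have "\<dots> \<le> 1 + ((1 + (norm M)\<^sup>2) * K + (norm M)\<^sup>2 * K)"
      using K(1) sq by (intro add_mono mult_right_mono) auto
    also have "\<dots> \<le> (1 + 2 * K) * (1 + (norm M)\<^sup>2)"
      using K(1) by (simp add: algebra_simps)
    finally show "norm (dd Phi (Emat i a) M) \<le> (1 + 2 * K) * (1 + (norm M)\<^sup>2)" .
    have "norm (dd Phi (Emat i a) M - dd Phi (Emat i a) N)
      \<le> norm (0::mat3) + (norm (ccof (M - N) (Emat i a)) + \<bar>(1/2) * (ccof (M + N) (M - N) $ i $ a)\<bar>)"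
      unfolding dd_Phi_Emat_diff by (intro order_trans[OF norm_Pair_le] add_mono order_refl) simp
    also have "\<dots> \<le> 0 + (norm (M - N) * K + norm (M + N) * norm (M - N) * K)"
      using K(2)[of "M - N" "Emat i a"] K(2)[of "M + N" "M - N"] el[of "ccof (M + N) (M - N)" i a] K(1)
      by (intro add_mono) auto
    also have "\<dots> = K * (1 + norm (M + N)) * norm (M - N)" by (simp add: algebra_simps)
    also have "\<dots> \<le> (1 + 2 * K) * (1 + norm M + norm N) * norm (M - N)"
      using K(1) norm_triangle_ineq[of M N] by (intro mult_right_mono mult_mono) auto
    finally show "norm (dd Phi (Emat i a) M - dd Phi (Emat i a) N) \<le> (1 + 2 * K) * (1 + norm M + norm N) * norm (M - N)" .
  qed
qed

lemma sum_nth_nth: "(\<Sum>i\<in>UNIV. \<Sum>a\<in>UNIV. A $ i $ a *\<^sub>R Emat i a) = A"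
  by (simp add: vec_eq_iff Emat_def forall_3 sum_3 neq_3)

lemma bounded_linear_embed:
  "bounded_linear (\<lambda>A::mat3. (A, 0::mat3, 0::real))" "bounded_linear (\<lambda>A::mat3. (0::mat3, A, 0::real))"
  "bounded_linear (\<lambda>A::real. (0::mat3, 0::mat3, A))"
  by (auto intro!: bounded_linear_Pair bounded_linear_ident bounded_linear_zero)

lemma dd_split:
  assumes "G differentiable (at X)"
  shows "dd G (A1, A2, A3) X = dG_F G X \<bullet> A1 + dG_Z G X \<bullet> A2 + dG_w G X * A3"
proof -
  interpret l: linear "\<lambda>h. dd G h X" by (rule linear_dd[OF assms])
  have m: "dd G (f A) X = (\<chi> i a. dd G (f (Emat i a)) X) \<bullet> A" if f: "linear f" for f :: "mat3 \<Rightarrow> xi" and A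
  proof -
    interpret f: linear f by (rule f)
    have "dd G (f A) X = dd G (f (\<Sum>i\<in>UNIV. \<Sum>a\<in>UNIV. A $ i $ a *\<^sub>R Emat i a)) X" by (simp add: sum_nth_nth)
    also have "\<dots> = (\<Sum>i\<in>UNIV. \<Sum>a\<in>UNIV. A $ i $ a * dd G (f (Emat i a)) X)"
      by (simp add: f.sum f.scale l.sum l.scale)
    also have "\<dots> = (\<chi> i a. dd G (f (Emat i a)) X) \<bullet> A" by (simp add: inner_vec_def mult.commute)
    finally show ?thesis .
  qed
  have "(A1, A2, A3) = (A1, 0, 0) + (0, A2, 0) + A3 *\<^sub>R (0, 0, 1)" by simp
  then have "dd G (A1, A2, A3) X = dd G (A1, 0, 0) X + dd G (0, A2, 0) X + A3 * dd G (0, 0, 1) X"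
    by (simp only: l.add l.scale) simp
  then show ?thesis
    unfolding dG_F_def dG_Z_def dG_w_def
    using m[of "\<lambda>A. (A, 0, 0)" A1] m[of "\<lambda>A. (0, A, 0)" A2] bounded_linear_embed[THEN bounded_linear.linear] by simp
qed

section \<open>The stored energy\<close>

text \<open>The Bregman distance of \<open>G\<close> with base point \<open>X\<close>.\<close>

definition rel_energy :: "('a::real_normed_vector \<Rightarrow> real) \<Rightarrow> 'a \<Rightarrow> 'a \<Rightarrow> real" where
  "rel_energy G L X = G L - G X - dd G (L - X) X"

lemma square_norm_le_2: "(norm (x + y))\<^sup>2 \<le> 2 * (norm x)\<^sup>2 + 2 * (norm y)\<^sup>2"
proof -
  have "(norm (x + y))\<^sup>2 \<le> (norm x + norm y)\<^sup>2" by (simp add: norm_triangle_ineq power_mono)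
  also have "\<dots> \<le> 2 * (norm x)\<^sup>2 + 2 * (norm y)\<^sup>2"
    using zero_le_power2[of "norm x - norm y"] by (simp add: power2_eq_square algebra_simps)
  finally show ?thesis .
qed

locale energy =
  fixes G :: "xi \<Rightarrow> real" and p q r :: real
  assumes hyp_G: "hyp_G G p q r"
begin

lemma G_nonneg: "0 \<le> G X" and p4: "4 < p" and q2: "2 \<le> q" and r2: "2 \<le> r" and C3_G: "C3_fun G"
  using hyp_G unfolding hyp_G_def by blast+

lemma G_C2: "C2_fun G" and dG_C2: "C2_fun (dd G h)"
proof -
  have d: "\<And>z. G differentiable (at z)" "\<And>h z. dd G h differentiable (at z)"
      "\<And>h k z. dd (dd G h) k differentiable (at z)"
    and c: "\<And>h k l. continuous_on UNIV (dd (dd (dd G h) k) l)"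
    using C3_G unfolding C3_fun_def by blast+
  have cont: "continuous_on UNIV f" if "\<And>z. f differentiable (at z)" for f :: "xi \<Rightarrow> real"
    using that differentiable_imp_continuous_within continuous_at_imp_continuous_on by blast
  show "C2_fun G" "C2_fun (dd G h)"
    using d c cont unfolding C2_fun_def C1_fun_def by blast+
qed

lemma G_C1: "C1_fun G" and dG_C1: "C1_fun (dd G h)" and ddG_C1: "C1_fun (dd (dd G h) k)"
  and G_diff: "G differentiable (at X)" and dG_diff: "dd G h differentiable (at X)"
  using G_C2 dG_C2 unfolding C2_fun_def C1_fun_def by blast+

lemma rel_energy_lower:
  obtains c where "c > 0" "\<And>L X. c * (norm (L - X))\<^sup>2 \<le> rel_energy G L X"
proof -
  obtain g0 where g0: "g0 > 0" "\<And>X h. dd (dd G h) h X \<ge> g0 * (norm h)\<^sup>2"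
    using hyp_G unfolding hyp_G_def by blast
  show ?thesis
    by (rule that[of "g0 / 2"]) (use g0 strong_convexity_lower[OF G_C2 g0(2)] in \<open>auto simp: rel_energy_def\<close>)
qed

lemma weight_ge_1: "1 \<le> weight p q r X"
  by (auto simp: weight_def split: prod.splits)

lemma weight_le_G:
  obtains C where "C \<ge> 0" "\<And>X. weight p q r X \<le> C * (G X + 1)"
proof -
  obtain c1 c2 where c: "c1 > 0" "c2 \<ge> 0" "\<And>X. G X \<ge> c1 * weight p q r X - c2"
    using hyp_G unfolding hyp_G_def by blast
  show ?thesis
  \<comment> \<open>Nonnegativity of \<open>G\<close> turns \<open>G X + c2\<close> into a multiple
    of \<open>G X + 1\<close>, and \<open>c1\<close> is divided out.\<close>
  proof (rule that[of "(1 + c2) / c1"])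
    show "0 \<le> (1 + c2) / c1" using c by simp
    fix X
    have "c1 * weight p q r X \<le> G X + c2" using c(3)[of X] by simp
    also have "\<dots> \<le> (1 + c2) * (G X + 1)" using c G_nonneg[of X] by (simp add: algebra_simps)
    finally show "weight p q r X \<le> (1 + c2) / c1 * (G X + 1)"
      using c(1) by (simp add: field_simps)
  qed
qed

definition dG_size :: "xi \<Rightarrow> real" where
  "dG_size X = norm (dG_F G X) + norm (dG_Z G X) powr (p / (p - 1)) + \<bar>dG_w G X\<bar> powr (p / (p - 2))"

text \<open>Outside a ball the limit in (H4)' makes the ratio less than 1; inside it the derivatives
  are bounded by continuity, and the weight is at least 1 everywhere.\<close>

lemma dG_growth:
  obtains C where "C \<ge> 0" "\<And>X. dG_size X \<le> C * weight p q r X"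
proof -
  have "((\<lambda>X. dG_size X / weight p q r X) \<longlongrightarrow> 0) at_infinity"
    using hyp_G by (simp add: hyp_G_def dG_size_def)
  then have "eventually (\<lambda>X. dG_size X / weight p q r X < 1) at_infinity"
    by (rule order_tendstoD) simp
  then obtain R where R: "\<And>X. norm X \<ge> R \<Longrightarrow> dG_size X / weight p q r X < 1"
    by (auto simp: eventually_at_infinity)
  have 1: "continuous_on UNIV (\<lambda>X. norm (dG_F G X))" "continuous_on UNIV (\<lambda>X. norm (dG_Z G X))"
      "continuous_on UNIV (\<lambda>X. norm (dG_w G X))"
    unfolding dG_F_def dG_Z_def dG_w_def
    by (intro continuous_intros continuous_on_vec_lambda C1_fun_continuous_on dG_C1)+
  obtain C1 where C1: "C1 \<ge> 0" "\<And>X. norm X \<le> R \<Longrightarrow> \<bar>norm (dG_F G X)\<bar> \<le> C1"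
    using C1_fun_bounded_cball[OF 1(1)] by metis
  obtain C2 where C2: "C2 \<ge> 0" "\<And>X. norm X \<le> R \<Longrightarrow> \<bar>norm (dG_Z G X)\<bar> \<le> C2"
    using C1_fun_bounded_cball[OF 1(2)] by metis
  obtain C3 where C3: "C3 \<ge> 0" "\<And>X. norm X \<le> R \<Longrightarrow> \<bar>norm (dG_w G X)\<bar> \<le> C3"
    using C1_fun_bounded_cball[OF 1(3)] by metis
  define C where "C = 1 + C1 + C2 powr (p / (p - 1)) + C3 powr (p / (p - 2))"
  have Cpos: "C \<ge> 1" using C1 by (simp add: C_def)
  show ?thesis
  proof (rule that[of C])
    show "0 \<le> C" using Cpos by simp
    fix X
    show "dG_size X \<le> C * weight p q r X"
    proof (cases "norm X \<ge> R")
      case True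
      then have "dG_size X \<le> 1 * weight p q r X" using R[of X] weight_ge_1[of X] by (simp add: field_simps)
      also have "\<dots> \<le> C * weight p q r X" using Cpos weight_ge_1[of X] by (intro mult_right_mono) auto
      finally show ?thesis .
    next
      case False
      then have "dG_size X \<le> C1 + C2 powr (p / (p - 1)) + C3 powr (p / (p - 2))"
        unfolding dG_size_def using C1(2)[of X] C2(2)[of X] C3(2)[of X] p4
        by (intro add_mono powr_mono2) auto
      also have "\<dots> \<le> C * 1" by (simp add: C_def)
      also have "\<dots> \<le> C * weight p q r X" using Cpos weight_ge_1[of X] by (intro mult_left_mono) auto
      finally show ?thesis .
    qed
  qed
qed

text \<open>The flux as a function on all of R^19, off the graph of \<open>Phi\<close> as well,
  since the Young measure samples it there. At \<open>Phi M\<close> it is the Piola-Kirchhoff stress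
  S(M).\<close>

definition stress :: "3 \<Rightarrow> 3 \<Rightarrow> xi \<Rightarrow> real" where
  "stress i a L = dd G (dd Phi (Emat i a) (fst L)) L"

lemma flux_eq_stress: "flux G i a l = stress i a (snd l)"
  by (simp add: flux_def stress_def)

text \<open>Young's inequality with the exponents of (H4)': the Z-derivative meets an entry linear
  in \<open>F\<close>, for the pair p/(p-1) and p, and the w-derivative meets a cofactor of size
  |F|^2, for the pair p/(p-2) and p/2. Both products land on \<open>norm F powr p\<close>.\<close>

lemma stress_growth:
  obtains C where "C \<ge> 0" "\<And>i a X. \<bar>stress i a X\<bar> \<le> C * weight p q r X"
proof -
  obtain C where C: "C \<ge> 0" "\<And>X. dG_size X \<le> C * weight p q r X" using dG_growth by metis
  obtain K where K: "K \<ge> 0" "\<And>M N. norm (ccof M N) \<le> K * norm M * norm N"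
    using dd_Phi_Emat_bounds by metis
  have el: "\<bar>M $ i $ a\<bar> \<le> norm M" for M :: mat3 and i a
    using Finite_Cartesian_Product.norm_nth_le order_trans by (metis real_norm_def)
  show ?thesis
  proof (rule that[of "(C + K * (C + 1)) + K * (C + 1)"])
    show "0 \<le> C + K * (C + 1) + K * (C + 1)" using C K by simp
    fix i a and X :: xi
    obtain F Z w where X: "X = (F, Z, w)" by (cases X)
    define W where "W = weight p q r X"
    have W: "W \<ge> 1" "norm F powr p \<le> W" "dG_size X \<le> C * W"
      using weight_ge_1[of X] C(2)[of X] by (auto simp: W_def X weight_def)
    have pos: "norm (dG_F G X) \<ge> 0" "norm (dG_Z G X) powr (p / (p - 1)) \<ge> 0" "\<bar>dG_w G X\<bar> powr (p / (p - 2)) \<ge> 0" by auto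
    have s: "stress i a X = dG_F G X \<bullet> Emat i a + dG_Z G X \<bullet> ccof F (Emat i a) + dG_w G X * (cof F $ i $ a)"
      by (simp add: stress_def X dd_Phi dd_split[OF G_diff] inner_Emat)
    have 1: "\<bar>dG_F G X \<bullet> Emat i a\<bar> \<le> C * W"
      using Cauchy_Schwarz_ineq2[of "dG_F G X" "Emat i a"] W(3) pos unfolding dG_size_def norm_Emat by linarith
    have "norm (dG_Z G X) * norm F \<le> norm (dG_Z G X) powr (p / (p - 1)) / (p / (p - 1)) + norm F powr p / p"
      using p4 by (intro Youngs_inequality) (auto simp: field_simps)
    also have "\<dots> \<le> norm (dG_Z G X) powr (p / (p - 1)) / 1 + norm F powr p / 1"
      using p4 by (intro add_mono divide_left_mono) (auto simp: field_simps)
    also have "\<dots> \<le> (C + 1) * W" using W pos unfolding dG_size_def distrib_right by linarith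
    finally have y1: "norm (dG_Z G X) * norm F \<le> (C + 1) * W" .
    have "\<bar>dG_Z G X \<bullet> ccof F (Emat i a)\<bar> \<le> norm (dG_Z G X) * norm (ccof F (Emat i a))"
      by (rule Cauchy_Schwarz_ineq2)
    also have "\<dots> \<le> norm (dG_Z G X) * (K * norm F)"
      using K(2)[of F "Emat i a"] by (intro mult_left_mono) auto
    also have "\<dots> \<le> K * ((C + 1) * W)" using mult_left_mono[OF y1 K(1)] by (simp add: mult_ac)
    finally have 2: "\<bar>dG_Z G X \<bullet> ccof F (Emat i a)\<bar> \<le> K * ((C + 1) * W)" .
    have Fp: "(norm F * norm F) powr (p / 2) = norm F powr p"
      using powr_add[of "norm F" "p/2" "p/2"] by (simp add: powr_mult)
    have "\<bar>dG_w G X\<bar> * (norm F * norm F) \<le> \<bar>dG_w G X\<bar> powr (p / (p - 2)) / (p / (p - 2)) + (norm F * norm F) powr (p / 2) / (p / 2)"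
      using p4 by (intro Youngs_inequality) (auto simp: field_simps)
    also have "\<dots> \<le> \<bar>dG_w G X\<bar> powr (p / (p - 2)) / 1 + (norm F * norm F) powr (p / 2) / 1"
      using p4 by (intro add_mono divide_left_mono) (auto simp: field_simps)
    also have "\<dots> \<le> (C + 1) * W" using W pos unfolding Fp dG_size_def distrib_right by linarith
    finally have y2: "\<bar>dG_w G X\<bar> * (norm F * norm F) \<le> (C + 1) * W" .
    have "\<bar>dG_w G X * (cof F $ i $ a)\<bar> \<le> \<bar>dG_w G X\<bar> * (K * (norm F * norm F))"
      using el[of "cof F" i a] K(2)[of F F] unfolding abs_mult
      by (intro mult_left_mono) (auto simp: cof_eq_ccof)
    also have "\<dots> \<le> K * ((C + 1) * W)" using mult_left_mono[OF y2 K(1)] by (simp add: mult_ac)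
    finally have 3: "\<bar>dG_w G X * (cof F $ i $ a)\<bar> \<le> K * ((C + 1) * W)" .
    have "\<bar>stress i a X\<bar> \<le> C * W + K * ((C + 1) * W) + K * ((C + 1) * W)"
      unfolding s using 1 2 3 by linarith
    then show "\<bar>stress i a X\<bar> \<le> (C + K * (C + 1) + K * (C + 1)) * weight p q r X"
      by (simp add: W_def algebra_simps)
  qed
qed

lemma stress_le_G:
  obtains C where "C \<ge> 0" "\<And>i a X. \<bar>stress i a X\<bar> \<le> C * (G X + 1)"
proof -
  obtain C where C: "C \<ge> 0" "\<And>i a X. \<bar>stress i a X\<bar> \<le> C * weight p q r X" using stress_growth by metis
  obtain D where D: "D \<ge> 0" "\<And>X. weight p q r X \<le> D * (G X + 1)" using weight_le_G by metis
  show ?thesis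
  proof (rule that[of "C * D"])
    show "\<bar>stress i a X\<bar> \<le> C * D * (G X + 1)" for i a X
      using C(2)[of i a X] mult_left_mono[OF D(2)[of X] C(1)] by (simp add: mult.assoc)
  qed (use C D in auto)
qed

text \<open>At distance at least 1 the affine part of \<open>G\<close> at \<open>X\<close> is
  bounded by a multiple of the squared distance, and strong convexity bounds the latter by the
  Bregman distance.\<close>

lemma G_far:
  obtains C where "C \<ge> 0" "\<And>L X. norm X \<le> M \<Longrightarrow> norm (L - X) \<ge> 1 \<Longrightarrow> G L + 1 \<le> C * rel_energy G L X"
proof -
  obtain c where c: "c > 0" "\<And>L X. c * (norm (L - X))\<^sup>2 \<le> rel_energy G L X" using rel_energy_lower by metis
  obtain C0 where C0: "C0 \<ge> 0" "\<And>X. norm X \<le> M \<Longrightarrow> \<bar>G X\<bar> \<le> C0"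
    using C1_fun_bounded_cball[OF C1_fun_continuous_on[OF G_C1]] by metis
  obtain C1 where C1: "C1 \<ge> 0" "\<And>X h. norm X \<le> M \<Longrightarrow> \<bar>dd G h X\<bar> \<le> C1 * norm h"
    using dd_bounded_cball[OF G_C1] by metis
  show ?thesis
  proof (rule that[of "1 + (C0 + C1 + 1) / c"])
    show "0 \<le> 1 + (C0 + C1 + 1) / c" using C0 C1 c by simp
    fix L X :: xi assume X: "norm X \<le> M" and far: "norm (L - X) \<ge> 1"
    have f2: "1 \<le> (norm (L - X))\<^sup>2" "norm (L - X) \<le> (norm (L - X))\<^sup>2"
      using far by (auto intro: one_le_power self_le_power)
    have "G L + 1 = rel_energy G L X + G X + dd G (L - X) X + 1" by (simp add: rel_energy_def)
    also have "\<dots> \<le> rel_energy G L X + C0 * 1 + C1 * norm (L - X) + 1"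
      using C0(2)[OF X] C1(2)[OF X, of "L - X"] by (simp add: abs_le_iff)
    also have "\<dots> \<le> rel_energy G L X + C0 * (norm (L - X))\<^sup>2 + C1 * (norm (L - X))\<^sup>2 + (norm (L - X))\<^sup>2"
      by (intro add_mono mult_left_mono f2 C0 C1 order_refl)
    also have "\<dots> = rel_energy G L X + (C0 + C1 + 1) * (norm (L - X))\<^sup>2" by (simp add: algebra_simps)
    also have "(C0 + C1 + 1) * (norm (L - X))\<^sup>2 \<le> (C0 + C1 + 1) * (rel_energy G L X / c)"
      using c(2)[of L X] c(1) C0 C1 by (intro mult_left_mono) (auto simp: field_simps)
    finally show "G L + 1 \<le> (1 + (C0 + C1 + 1) / c) * rel_energy G L X"
      by (simp add: algebra_simps add_divide_distrib)
  qed
qed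

text \<open>Only the derivative of \<open>G\<close> is frozen at \<open>X\<close> in the first
  subtracted term, dPhi stays at \<open>fst L\<close>. What remains is the increment of dG applied
  to dPhi at \<open>L\<close>, whose linear part is the Hessian applied to dPhi at \<open>X\<close>.
  Near \<open>X\<close> the error is a product of two differences plus a Taylor remainder; far away
  each of the three terms is controlled by the Bregman distance on its own.\<close>

lemma stress_quadratic:
  obtains C where "C \<ge> 0" "\<And>i a L X. norm X \<le> M \<Longrightarrow>
    \<bar>stress i a L - dd G (dd Phi (Emat i a) (fst L)) X - dd (dd G (dd Phi (Emat i a) (fst X))) (L - X) X\<bar>
      \<le> C * rel_energy G L X"
proof -
  obtain c where c: "c > 0" "\<And>L X. c * (norm (L - X))\<^sup>2 \<le> rel_energy G L X" using rel_energy_lower by metis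
  obtain K where K: "K \<ge> 0"
    "\<And>i a M. norm (dd Phi (Emat i a) M) \<le> K * (1 + (norm M)\<^sup>2)"
    "\<And>i a M N. norm (dd Phi (Emat i a) M - dd Phi (Emat i a) N) \<le> K * (1 + norm M + norm N) * norm (M - N)"
    using dd_Phi_Emat_bounds by metis
  obtain A1 where A1: "A1 \<ge> 0" "\<And>x y h. norm x \<le> M + 1 \<Longrightarrow> norm y \<le> M + 1 \<Longrightarrow>
    \<bar>dd G h y - dd G h x\<bar> \<le> A1 * norm h * norm (y - x)"
    using dd_lipschitz_cball[OF G_C2] by metis
  obtain A2 where A2: "A2 \<ge> 0" "\<And>x y h. norm x \<le> M + 1 \<Longrightarrow> norm y \<le> M + 1 \<Longrightarrow>
    \<bar>dd G h y - dd G h x - dd (dd G h) (y - x) x\<bar> \<le> A2 * norm h * (norm (y - x))\<^sup>2"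
    using dd_taylor_cball[OF G_C2 dG_C2] by metis
  obtain A3 where A3: "A3 \<ge> 0" "\<And>x h k. norm x \<le> M \<Longrightarrow> \<bar>dd (dd G h) k x\<bar> \<le> A3 * norm h * norm k"
    using dd2_bounded_cball[OF G_C2] by metis
  obtain A4 where A4: "A4 \<ge> 0" "\<And>X h. norm X \<le> M \<Longrightarrow> \<bar>dd G h X\<bar> \<le> A4 * norm h"
    using dd_bounded_cball[OF G_C1] by metis
  obtain A5 where A5: "A5 \<ge> 0" "\<And>i a X. \<bar>stress i a X\<bar> \<le> A5 * (G X + 1)" using stress_le_G by metis
  obtain A6 where A6: "A6 \<ge> 0" "\<And>L X. norm X \<le> M \<Longrightarrow> norm (L - X) \<ge> 1 \<Longrightarrow> G L + 1 \<le> A6 * rel_energy G L X"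
    using G_far by metis
  define B where "B = K * (1 + M\<^sup>2)"
  define C1 where "C1 = A1 * (K * (3 + 2 * M)) + A2 * B"
  define C2 where "C2 = A4 * (K * (3 + 2 * M\<^sup>2)) + A3 * B"
  have B0: "B \<ge> 0" unfolding B_def using K by simp
  have C2: "C2 \<ge> 0" unfolding C2_def using B0 A4 K A3 by simp
  show ?thesis
  \<comment> \<open>The sign of \<open>M\<close> is unknown until some \<open>X\<close> in the ball
    is given, and \<open>C1\<close> contains the factor \<open>3 + 2 * M\<close>; hence the absolute
    value.\<close>
  proof (rule that[of "\<bar>C1\<bar> / c + (A5 * A6 + C2 / c)"])
    show "0 \<le> \<bar>C1\<bar> / c + (A5 * A6 + C2 / c)" using C2 c A5 A6 by simp
    fix i a and L X :: xi assume X: "norm X \<le> M"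
    have M0: "M \<ge> 0" using X norm_ge_zero order_trans by blast
    define Y where "Y = dd Phi (Emat i a) (fst L)"
    define Y0 where "Y0 = dd Phi (Emat i a) (fst X)"
    define d where "d = norm (L - X)"
    have fl: "norm (fst L - fst X) \<le> d" using norm_fst_le[of "fst (L - X)" "snd (L - X)"] unfolding d_def by (metis fst_diff prod.collapse)
    have fX: "norm (fst X) \<le> M" using X norm_fst_le[of "fst X" "snd X"] by simp
    have R: "d\<^sup>2 \<le> rel_energy G L X / c" using c(2)[of L X] c(1) by (simp add: d_def field_simps)
    have R0: "rel_energy G L X \<ge> 0" using c(2)[of L X] c(1) by (meson mult_nonneg_nonneg order_trans less_imp_le zero_le_power2)
    have Y0: "norm Y0 \<le> B"
      unfolding Y0_def B_def by (rule order_trans[OF K(2)]) (use K(1) fX in \<open>auto intro!: mult_left_mono power_mono\<close>)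
    have st: "stress i a L = dd G Y L" by (simp add: stress_def Y_def)
    show "\<bar>stress i a L - dd G (dd Phi (Emat i a) (fst L)) X - dd (dd G (dd Phi (Emat i a) (fst X))) (L - X) X\<bar>
      \<le> (\<bar>C1\<bar> / c + (A5 * A6 + C2 / c)) * rel_energy G L X"
    proof (cases "d \<le> 1")
      case True
      have L: "norm L \<le> M + 1" using norm_triangle_sub[of L X] X True by (simp add: d_def)
      have X': "norm X \<le> M + 1" using X by simp
      have fL: "norm (fst L) \<le> M + 1" using L norm_fst_le[of "fst L" "snd L"] by simp
      have YY: "norm (Y - Y0) \<le> K * (3 + 2 * M) * d"
        unfolding Y_def Y0_def using fL fX M0 K(1)
        by (intro order_trans[OF K(3)] mult_mono fl) (auto intro!: mult_left_mono)
      \<comment> \<open>Replacing \<open>Y\<close> by \<open>Y0\<close> in the increment costs a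
        Lipschitz increment of dG times \<open>Y - Y0\<close>, both of order
        \<open>d\<close>.\<close>
      have "dd G Y L - dd G Y X = dd G (Y - Y0) L - dd G (Y - Y0) X + (dd G Y0 L - dd G Y0 X)"
        using linear_diff[OF linear_dd[OF G_diff]] by simp
      then have "\<bar>stress i a L - dd G Y X - dd (dd G Y0) (L - X) X\<bar>
         \<le> \<bar>dd G (Y - Y0) L - dd G (Y - Y0) X\<bar> + \<bar>dd G Y0 L - dd G Y0 X - dd (dd G Y0) (L - X) X\<bar>"
        unfolding st by linarith
      also have "\<dots> \<le> A1 * norm (Y - Y0) * d + A2 * norm Y0 * d\<^sup>2"
        unfolding d_def by (intro add_mono A1(2)[OF X' L] A2(2)[OF X' L])
      also have "\<dots> \<le> A1 * (K * (3 + 2 * M) * d) * d + A2 * B * d\<^sup>2"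
        by (intro add_mono mult_right_mono mult_left_mono YY Y0 A1(1) A2(1)) (auto simp: d_def)
      also have "\<dots> = C1 * d\<^sup>2" by (simp add: C1_def power2_eq_square algebra_simps)
      also have "\<dots> \<le> \<bar>C1\<bar> * (rel_energy G L X / c)" using R by (intro mult_mono) auto
      also have "\<dots> \<le> (\<bar>C1\<bar> / c + (A5 * A6 + C2 / c)) * rel_energy G L X"
        using R0 A5(1) A6(1) C2 c(1) by (simp add: algebra_simps)
      finally show ?thesis unfolding Y_def Y0_def .
    next
      case False
      then have d1: "1 \<le> d" by simp
      have f2: "1 \<le> d\<^sup>2" "d \<le> d\<^sup>2"
        using d1 by (auto intro: one_le_power self_le_power)
      \<comment> \<open>The stress alone has more than quadratic growth in general; here it is
        bounded by \<open>G\<close> and then by the Bregman distance, which is where (H4)' is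
        felt.\<close>
      have "\<bar>stress i a L\<bar> \<le> A5 * (A6 * rel_energy G L X)"
        using A5(2)[of i a L] mult_left_mono[OF A6(2)[OF X, of L] A5(1)] d1 unfolding d_def by linarith
      moreover have "\<bar>dd G Y X\<bar> \<le> A4 * (K * (3 + 2 * M\<^sup>2)) * d\<^sup>2"
      proof -
        have "(norm (fst L))\<^sup>2 \<le> 2 * (norm (fst X))\<^sup>2 + 2 * (norm (fst L - fst X))\<^sup>2"
          using square_norm_le_2[of "fst X" "fst L - fst X"] by simp
        also have "\<dots> \<le> 2 * M\<^sup>2 + 2 * d\<^sup>2" using fX fl by (intro add_mono mult_left_mono power_mono) auto
        finally have "1 + (norm (fst L))\<^sup>2 \<le> 1 + 2 * M\<^sup>2 + 2 * d\<^sup>2" by simp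
        also have "\<dots> \<le> d\<^sup>2 + 2 * M\<^sup>2 * d\<^sup>2 + 2 * d\<^sup>2"
          using f2(1) by (intro add_mono) (auto simp: mult_le_cancel_left1)
        finally have "1 + (norm (fst L))\<^sup>2 \<le> (3 + 2 * M\<^sup>2) * d\<^sup>2" by (simp add: algebra_simps)
        then have "norm Y \<le> K * ((3 + 2 * M\<^sup>2) * d\<^sup>2)"
          unfolding Y_def using K(1) by (intro order_trans[OF K(2)] mult_left_mono)
        then show ?thesis
          using order_trans[OF A4(2)[OF X, of Y] mult_left_mono[OF _ A4(1)]] by (simp add: mult.assoc)
      qed
      moreover have "\<bar>dd (dd G Y0) (L - X) X\<bar> \<le> A3 * B * d\<^sup>2"
      proof -
        have "\<bar>dd (dd G Y0) (L - X) X\<bar> \<le> A3 * norm Y0 * d" using A3(2)[OF X] by (simp add: d_def)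
        also have "\<dots> \<le> A3 * B * d\<^sup>2" using A3(1) B0 Y0 f2 d1 by (intro mult_mono) auto
        finally show ?thesis .
      qed
      ultimately have "\<bar>stress i a L - dd G Y X - dd (dd G Y0) (L - X) X\<bar>
         \<le> A5 * (A6 * rel_energy G L X) + C2 * d\<^sup>2" by (simp add: C2_def algebra_simps)
      also have "\<dots> \<le> A5 * (A6 * rel_energy G L X) + C2 * (rel_energy G L X / c)"
        using R C2 by (intro add_mono mult_left_mono order_refl)
      also have "\<dots> \<le> (\<bar>C1\<bar> / c + (A5 * A6 + C2 / c)) * rel_energy G L X"
        using R0 c(1) by (simp add: algebra_simps)
      finally show ?thesis unfolding Y_def Y0_def .
    qed
  qed
qed

end

section \<open>Integration by parts on the torus\<close>

lemma C1_fun_differentiable: "C1_fun f \<Longrightarrow> f differentiable (at z)"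
  unfolding C1_fun_def by blast

text \<open>Restricting the measure, rather than the integrand, makes all integrals over the
  space-time cylinder integrals for a finite measure.\<close>

definition QM :: "real \<Rightarrow> pt measure" where "QM T = restrict_space lborel (QT T)"
definition QB :: "(real^3) measure" where "QB = restrict_space lborel Qbox"

lemma measurable_vec_nth [measurable]: "(\<lambda>x::real^'n. x $ i) \<in> borel_measurable borel"
  by (intro borel_measurable_continuous_onI continuous_intros)

lemma Qbox_sets [measurable]: "Qbox \<in> sets borel"
  unfolding Qbox_def forall_3 by measurable

lemma QT_sets [measurable]: "QT T \<in> sets borel"
proof -
  have "Qbox \<times> {0..<T} \<in> sets (borel \<Otimes>\<^sub>M borel)" by (intro pair_measureI) auto
  then show ?thesis unfolding QT_def borel_prod .
qed

lemma Qbox_bounded: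
  obtains R where "R \<ge> 0" "\<And>x. x \<in> Qbox \<Longrightarrow> norm x \<le> R"
proof (rule that[of "\<Sum>i\<in>(UNIV::3 set). 2 * pi"])
  fix x assume "x \<in> Qbox"
  then have "\<bar>x $ i\<bar> \<le> 2 * pi" for i unfolding Qbox_def using pi_gt_zero by (smt (verit) mem_Collect_eq)
  then show "norm x \<le> (\<Sum>i\<in>(UNIV::3 set). 2 * pi)"
    by (intro order_trans[OF norm_le_l1_cart] sum_mono)
qed simp

lemma QT_bounded:
  obtains R where "R \<ge> 0" "\<And>z. z \<in> QT T \<Longrightarrow> norm z \<le> R"
proof -
  obtain R where R: "R \<ge> 0" "\<And>x. x \<in> Qbox \<Longrightarrow> norm x \<le> R" using Qbox_bounded by metis
  show ?thesis
  proof (rule that[of "R + \<bar>T\<bar>"])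
    fix z assume "z \<in> QT T"
    then obtain x t where "z = (x, t)" "x \<in> Qbox" "0 \<le> t" "t < T" by (auto simp: QT_def)
    then show "norm z \<le> R + \<bar>T\<bar>" using R(2)[of x] norm_Pair_le[of x t] by auto
  qed (use R in simp)
qed

lemma emeasure_lborel_finite: "bounded S \<Longrightarrow> S \<in> sets borel \<Longrightarrow> emeasure lborel S < \<infinity>"
  for S :: "'a::euclidean_space set"
  using emeasure_bounded_finite by (metis infinity_ennreal_def)

lemma QM_finite: "finite_measure (QM T)"
proof
  obtain R where "\<And>z. z \<in> QT T \<Longrightarrow> norm z \<le> R" using QT_bounded by metis
  then have "bounded (QT T)" unfolding bounded_iff by blast
  then show "emeasure (QM T) (space (QM T)) \<noteq> \<infinity>"
    using emeasure_lborel_finite[OF _ QT_sets] by (simp add: QM_def space_restrict_space emeasure_restrict_space less_top)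
qed

lemma QB_finite: "finite_measure QB"
proof
  obtain R where "\<And>z. z \<in> Qbox \<Longrightarrow> norm z \<le> R" using Qbox_bounded by metis
  then have "bounded Qbox" by (auto simp: bounded_iff)
  then show "emeasure QB (space QB) \<noteq> \<infinity>"
    using emeasure_lborel_finite[OF _ Qbox_sets] by (simp add: QB_def space_restrict_space emeasure_restrict_space less_top)
qed

interpretation QM: finite_measure "QM T" for T by (rule QM_finite)
interpretation QB: finite_measure QB by (rule QB_finite)

lemma space_QM [simp]: "space (QM T) = QT T" by (simp add: QM_def space_restrict_space)
lemma space_QB [simp]: "space QB = Qbox" by (simp add: QB_def space_restrict_space)

lemma measurable_QM [measurable (raw)]: "f \<in> borel_measurable borel \<Longrightarrow> f \<in> borel_measurable (QM T)"
  unfolding QM_def by (rule measurable_restrict_space1) simp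

lemma measurable_QB [measurable (raw)]: "f \<in> borel_measurable borel \<Longrightarrow> f \<in> borel_measurable QB"
  unfolding QB_def by (rule measurable_restrict_space1) simp

lemma LINT_QM: "(LINT z:QT T|lborel. f z) = (\<integral>z. f z \<partial>QM T)"
  for f :: "pt \<Rightarrow> 'b::{banach, second_countable_topology}"
  by (simp add: QM_def set_lebesgue_integral_def integral_restrict_space)

lemma LINT_QB: "(LINT x:Qbox|lborel. f x) = (\<integral>x. f x \<partial>QB)"
  for f :: "real^3 \<Rightarrow> 'b::{banach, second_countable_topology}"
  by (simp add: QB_def set_lebesgue_integral_def integral_restrict_space)

lemma integrable_QM: "set_integrable lborel (QT T) f \<longleftrightarrow> integrable (QM T) f"
  for f :: "pt \<Rightarrow> 'b::{banach, second_countable_topology}"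
  by (simp add: QM_def set_integrable_def integrable_restrict_space)

lemma AE_QM: "(AE z in QM T. P z) \<longleftrightarrow> (AE z in lborel. z \<in> QT T \<longrightarrow> P z)"
  unfolding QM_def by (rule AE_restrict_space_iff) simp

lemma AE_QB: "(AE z in QB. P z) \<longleftrightarrow> (AE z in lborel. z \<in> Qbox \<longrightarrow> P z)"
  unfolding QB_def by (rule AE_restrict_space_iff) simp

lemma integrable_QM_bounded:
  fixes f :: "pt \<Rightarrow> 'b::{banach, second_countable_topology}"
  assumes "f \<in> borel_measurable borel" "\<And>z. z \<in> QT T \<Longrightarrow> norm (f z) \<le> C"
  shows "integrable (QM T) f"
  by (rule QM.integrable_const_bound[where B=C]) (auto intro!: AE_I2 assms measurable_QM)

lemma bounded_on_QT:
  fixes f :: "pt \<Rightarrow> real"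
  assumes "continuous_on UNIV f"
  obtains C where "C \<ge> 0" "\<And>z. z \<in> QT T \<Longrightarrow> \<bar>f z\<bar> \<le> C"
proof -
  obtain R where R: "R \<ge> 0" "\<And>z. z \<in> QT T \<Longrightarrow> norm z \<le> R" using QT_bounded by metis
  obtain C where "C \<ge> 0" "\<And>z. norm z \<le> R \<Longrightarrow> \<bar>f z\<bar> \<le> C"
    using C1_fun_bounded_cball[OF assms] by metis
  then show ?thesis using R that by blast
qed

lemma bounded_on_Qbox:
  fixes f :: "real^3 \<Rightarrow> real"
  assumes "continuous_on UNIV f"
  obtains C where "C \<ge> 0" "\<And>z. z \<in> Qbox \<Longrightarrow> \<bar>f z\<bar> \<le> C"
proof -
  obtain R where R: "R \<ge> 0" "\<And>z. z \<in> Qbox \<Longrightarrow> norm z \<le> R" using Qbox_bounded by metis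
  obtain C where "C \<ge> 0" "\<And>z. norm z \<le> R \<Longrightarrow> \<bar>f z\<bar> \<le> C"
    using C1_fun_bounded_cball[OF assms] by metis
  then show ?thesis using R that by blast
qed

lemma integrable_QM_mult:
  fixes f g :: "pt \<Rightarrow> real"
  assumes "integrable (QM T) g" "f \<in> borel_measurable borel" "\<And>z. z \<in> QT T \<Longrightarrow> \<bar>f z\<bar> \<le> C"
  shows "integrable (QM T) (\<lambda>z. f z * g z)"
proof (rule Bochner_Integration.integrable_bound[OF integrable_mult_right[OF integrable_norm[OF assms(1)], of C]])
  show "(\<lambda>z. f z * g z) \<in> borel_measurable (QM T)"
    using assms(1) measurable_QM[OF assms(2)] by (intro borel_measurable_times) auto
  show "AE z in QM T. norm (f z * g z) \<le> norm (C * norm (g z))"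
    by (intro AE_I2) (auto simp: abs_mult intro!: mult_right_mono intro: order_trans[OF assms(3)])
qed

lemma integrable_QM_mult_cont:
  fixes f g :: "pt \<Rightarrow> real"
  assumes "integrable (QM T) g" "continuous_on UNIV f"
  shows "integrable (QM T) (\<lambda>z. f z * g z)"
proof -
  obtain C where "\<And>z. z \<in> QT T \<Longrightarrow> \<bar>f z\<bar> \<le> C" using bounded_on_QT[OF assms(2)] by metis
  then show ?thesis using integrable_QM_mult[OF assms(1) borel_measurable_continuous_onI[OF assms(2)]] by blast
qed

lemma integrable_QM_cont:
  fixes f :: "pt \<Rightarrow> real"
  assumes "continuous_on UNIV f"
  shows "integrable (QM T) f"
  using integrable_QM_mult_cont[of T "\<lambda>_. 1", OF _ assms] by simp

lemma integrable_QB_mult_cont: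
  fixes f g :: "real^3 \<Rightarrow> real"
  assumes "integrable QB g" "continuous_on UNIV f"
  shows "integrable QB (\<lambda>z. f z * g z)"
proof -
  obtain C where C: "C \<ge> 0" "\<And>z. z \<in> Qbox \<Longrightarrow> \<bar>f z\<bar> \<le> C" using bounded_on_Qbox[OF assms(2)] by metis
  show ?thesis
  proof (rule Bochner_Integration.integrable_bound[OF integrable_mult_right[OF integrable_norm[OF assms(1)], of C]])
    show "(\<lambda>z. f z * g z) \<in> borel_measurable QB"
      using assms(1) measurable_QB[OF borel_measurable_continuous_onI[OF assms(2)]] by (intro borel_measurable_times) auto
    show "AE z in QB. norm (f z * g z) \<le> norm (C * norm (g z))"
      by (intro AE_I2) (auto simp: abs_mult intro!: mult_right_mono intro: order_trans[OF C(2)])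
  qed
qed

lemma integrable_QB_cont:
  fixes f :: "real^3 \<Rightarrow> real"
  assumes "continuous_on UNIV f"
  shows "integrable QB f"
  using integrable_QB_mult_cont[of "\<lambda>_. 1", OF _ assms] by simp

lemma lborel_integral_shift:
  fixes f :: "'a::euclidean_space \<Rightarrow> real"
  assumes [measurable]: "f \<in> borel_measurable borel"
  shows "(\<integral>x. f (x + c) \<partial>lborel) = (\<integral>x. f x \<partial>lborel)"
proof -
  have "(\<integral>x. f x \<partial>lborel) = (\<integral>x. f x \<partial>distr lborel borel ((+) c))" by (simp add: lborel_distr_plus)
  also have "\<dots> = (\<integral>x. f (c + x) \<partial>lborel)" by (rule integral_distr) auto
  finally show ?thesis by (simp add: add.commute)
qed

text \<open>The shifted cell is cut at the face it crosses: the slab \<open>A\<close> that has left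
  the original cell is moved back by one period, and together with \<open>B\<close> it fills the
  cell again.\<close>

lemma integral_QM_shift:
  fixes g :: "pt \<Rightarrow> real"
  assumes g: "continuous_on UNIV g" and per: "periodic g" and s: "0 \<le> s" "s \<le> 2 * pi"
  shows "(\<integral>z. g (z + s *\<^sub>R (axis a 1, 0)) \<partial>QM T) = (\<integral>z. g z \<partial>QM T)"
proof -
  define e :: pt where "e = (axis a 1, 0)"
  have [measurable]: "g \<in> borel_measurable borel" by (rule borel_measurable_continuous_onI[OF g])
  have "(\<lambda>z::pt. fst z $ a) \<in> borel_measurable borel"
    by (intro borel_measurable_continuous_onI continuous_intros)
  note [measurable] = this
  define A where "A = {z \<in> QT T. fst z $ a < s}"
  define B where "B = {z \<in> QT T. s \<le> fst z $ a}"
  have AB: "A = QT T \<inter> (\<lambda>z. fst z $ a) -` {..<s} \<inter> space borel" "B = QT T \<inter> (\<lambda>z. fst z $ a) -` {s..} \<inter> space borel"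
    by (auto simp: A_def B_def)
  have [measurable]: "A \<in> sets borel" "B \<in> sets borel" unfolding AB Int_assoc
    by (intro sets.Int QT_sets measurable_sets[where A=borel and M=borel]; measurable)+
  obtain C where C: "\<And>z. z \<in> QT T \<Longrightarrow> \<bar>g z\<bar> \<le> C" using bounded_on_QT[OF g] by metis
  have int: "integrable lborel (\<lambda>z. indicator S z * g z)" if "S \<subseteq> QT T" "S \<in> sets borel" for S
  proof -
    have "integrable (QM T) (\<lambda>z. indicator S z * g z)"
    proof (rule integrable_QM_bounded[where C=C])
      show "(\<lambda>z. indicator S z * g z) \<in> borel_measurable borel" using that by measurable
      show "norm (indicator S z * g z) \<le> C" if "z \<in> QT T" for z
        using C[OF that] abs_ge_zero[of "g z"] by (auto simp: indicator_def simp del: abs_ge_zero)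
    qed
    moreover have "(\<lambda>z. indicator (QT T) z *\<^sub>R (indicator S z * g z)) = (\<lambda>z. indicator S z * g z)"
      using that(1) by (auto simp: indicator_def fun_eq_iff)
    ultimately show ?thesis unfolding QM_def by (subst (asm) integrable_restrict_space) simp_all
  qed
  have perg: "g (z + (2 * pi) *\<^sub>R e) = g z" for z
    using per by (cases z) (simp add: periodic_def e_def)
  have ax: "axis a (1::real) $ i = (if i = a then 1 else 0)" for i :: 3 by (simp add: axis_def)
  \<comment> \<open>The cell translated by \<open>s\<close> is the disjoint union of
    \<open>B\<close> and of \<open>A\<close> translated by a full period.\<close>
  have ind: "indicator (QT T) (w - s *\<^sub>R e) = (indicator B w + indicator A (w - (2 * pi) *\<^sub>R e) :: real)" for w
  proof -
    obtain x t where w: "w = (x, t)" by (cases w)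
    have 1: "w - s *\<^sub>R e \<in> QT T \<longleftrightarrow> (\<forall>i. i \<noteq> a \<longrightarrow> 0 \<le> x $ i \<and> x $ i < 2 * pi) \<and> s \<le> x $ a \<and> x $ a < 2 * pi + s \<and> 0 \<le> t \<and> t < T"
      unfolding w e_def QT_def Qbox_def by (auto simp: ax)
    have 2: "w \<in> B \<longleftrightarrow> (\<forall>i. i \<noteq> a \<longrightarrow> 0 \<le> x $ i \<and> x $ i < 2 * pi) \<and> s \<le> x $ a \<and> x $ a < 2 * pi \<and> 0 \<le> t \<and> t < T"
      unfolding w B_def QT_def Qbox_def using s by (auto simp: ax) (metis order_trans)+
    have 3: "w - (2 * pi) *\<^sub>R e \<in> A \<longleftrightarrow> (\<forall>i. i \<noteq> a \<longrightarrow> 0 \<le> x $ i \<and> x $ i < 2 * pi) \<and> 2 * pi \<le> x $ a \<and> x $ a < 2 * pi + s \<and> 0 \<le> t \<and> t < T"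
      unfolding w e_def A_def QT_def Qbox_def using s by (auto simp: ax)
    show ?thesis
      using s unfolding indicator_def of_bool_def 1 2 3 by auto
  qed
  have "(\<integral>z. g (z + s *\<^sub>R e) \<partial>QM T) = (\<integral>z. indicator (QT T) z * g (z + s *\<^sub>R e) \<partial>lborel)"
    unfolding QM_def by (simp add: integral_restrict_space)
  also have "\<dots> = (\<integral>z. indicator (QT T) (z + s *\<^sub>R e - s *\<^sub>R e) * g (z + s *\<^sub>R e) \<partial>lborel)" by simp
  also have "\<dots> = (\<integral>w. indicator (QT T) (w - s *\<^sub>R e) * g w \<partial>lborel)"
    by (rule lborel_integral_shift) measurable
  also have "\<dots> = (\<integral>w. indicator B w * g w + indicator A (w - (2 * pi) *\<^sub>R e) * g (w - (2 * pi) *\<^sub>R e) \<partial>lborel)"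
    unfolding ind using perg[of "w - (2 * pi) *\<^sub>R e" for w] by (simp add: algebra_simps)
  also have "\<dots> = (\<integral>w. indicator B w * g w \<partial>lborel) + (\<integral>w. indicator A (w - (2 * pi) *\<^sub>R e) * g (w - (2 * pi) *\<^sub>R e) \<partial>lborel)"
  proof (rule Bochner_Integration.integral_add)
    show "integrable lborel (\<lambda>w. indicator B w * g w)" by (rule int) (auto simp: B_def)
    have "integrable (distr lborel borel ((+) (- (2 * pi) *\<^sub>R e))) (\<lambda>w. indicator A w * g w)"
      unfolding lborel_distr_plus by (rule int) (auto simp: A_def)
    then have "integrable lborel (\<lambda>w. indicator A (- (2 * pi) *\<^sub>R e + w) * g (- (2 * pi) *\<^sub>R e + w))"
      by (subst (asm) integrable_distr_eq) auto
    then show "integrable lborel (\<lambda>w. indicator A (w - (2 * pi) *\<^sub>R e) * g (w - (2 * pi) *\<^sub>R e))"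
      by (simp add: algebra_simps)
  qed
  also have "(\<integral>w. indicator A (w - (2 * pi) *\<^sub>R e) * g (w - (2 * pi) *\<^sub>R e) \<partial>lborel) = (\<integral>w. indicator A w * g w \<partial>lborel)"
    using lborel_integral_shift[of "\<lambda>w. indicator A w * g w" "- (2 * pi) *\<^sub>R e"] by simp
  also have "(\<integral>w. indicator B w * g w \<partial>lborel) + (\<integral>w. indicator A w * g w \<partial>lborel) = (\<integral>w. indicator B w * g w + indicator A w * g w \<partial>lborel)"
    by (rule Bochner_Integration.integral_add[symmetric]) (auto intro!: int simp: A_def B_def)
  also have "\<dots> = (\<integral>w. indicator (QT T) w * g w \<partial>lborel)"
    by (intro Bochner_Integration.integral_cong refl) (auto simp: A_def B_def indicator_def)
  also have "\<dots> = (\<integral>z. g z \<partial>QM T)" unfolding QM_def by (simp add: integral_restrict_space)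
  finally show ?thesis by (simp add: e_def)
qed

text \<open>The difference quotients have zero mean by shift invariance. They converge pointwise to
  the derivative and are dominated by a Lipschitz constant on a ball one unit larger than the cell,
  since the steps are at most 1.\<close>

lemma integral_d_x_eq_0:
  assumes f: "C1_fun f" and per: "periodic f"
  shows "(\<integral>z. d_x a f z \<partial>QM T) = 0"
proof -
  define e :: pt where "e = (axis a 1, 0)"
  have ne: "norm e = 1" by (simp add: e_def norm_Pair norm_axis_1)
  obtain R where R: "R \<ge> 0" "\<And>z. z \<in> QT T \<Longrightarrow> norm z \<le> R" using QT_bounded by metis
  obtain C where C: "C \<ge> 0" "\<And>x y. norm x \<le> R + 1 \<Longrightarrow> norm y \<le> R + 1 \<Longrightarrow> \<bar>f y - f x\<bar> \<le> C * norm (y - x)"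
    using C1_fun_lipschitz_cball[OF f] by metis
  define s where "s n = inverse (real (Suc n))" for n
  have s: "0 < s n" "s n \<le> 1" for n by (auto simp: s_def field_simps)
  have cont: "continuous_on UNIV f" by (rule C1_fun_continuous_on[OF f])
  have [measurable]: "f \<in> borel_measurable borel" by (rule borel_measurable_continuous_onI[OF cont])
  define D where "D n z = (f (z + s n *\<^sub>R e) - f z) / s n" for n z
  have contD: "continuous_on UNIV (\<lambda>z. f (z + c))" for c
    by (intro continuous_on_compose2[OF cont] continuous_intros) auto
  have "(\<lambda>n. \<integral>z. D n z \<partial>QM T) \<longlonglongrightarrow> (\<integral>z. d_x a f z \<partial>QM T)"
  proof (rule integral_dominated_convergence[where w = "\<lambda>_. C"])
    show "d_x a f \<in> borel_measurable (QM T)"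
      unfolding d_x_def by (intro measurable_QM borel_measurable_continuous_onI C1_fun_continuous_on_dd f)
    show "D n \<in> borel_measurable (QM T)" for n
      unfolding D_def[abs_def] by (intro measurable_QM) measurable
    show "AE z in QM T. (\<lambda>n. D n z) \<longlonglongrightarrow> d_x a f z"
    proof (intro AE_I2)
      fix z
      have "((\<lambda>s. f (z + s *\<^sub>R e)) has_real_derivative dd f e (z + 0 *\<^sub>R e)) (at 0)"
        by (rule has_real_derivative_line) (rule C1_fun_differentiable[OF f])
      then have "((\<lambda>h. (f (z + h *\<^sub>R e) - f z) / h) \<longlongrightarrow> d_x a f z) (at 0)"
        by (simp add: DERIV_def d_x_def flip: e_def)
      moreover have "filterlim s (at 0) sequentially"
        unfolding filterlim_at using LIMSEQ_inverse_real_of_nat by (auto simp: s_def[abs_def])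
      ultimately show "(\<lambda>n. D n z) \<longlonglongrightarrow> d_x a f z"
        unfolding D_def by (rule filterlim_compose)
    qed
    show "AE z in QM T. norm (D n z) \<le> C" for n
    proof (intro AE_I2)
      fix z assume "z \<in> space (QM T)"
      then have z: "norm z \<le> R" using R by simp
      have "norm (z + s n *\<^sub>R e) \<le> R + 1"
        using norm_triangle_ineq[of z "s n *\<^sub>R e"] z s[of n] ne by simp
      then have "\<bar>f (z + s n *\<^sub>R e) - f z\<bar> \<le> C * s n"
        using C(2)[of z "z + s n *\<^sub>R e"] z s[of n] ne by simp
      then show "norm (D n z) \<le> C" using s[of n] by (simp add: D_def field_simps)
    qed
  qed auto
  moreover have "(\<integral>z. D n z \<partial>QM T) = 0" for n
  proof -
    have "(\<integral>z. f (z + s n *\<^sub>R e) - f z \<partial>QM T) = 0"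
      using integral_QM_shift[OF cont per, of "s n" T a] s[of n] pi_ge_two
      by (subst Bochner_Integration.integral_diff) (auto intro!: integrable_QM_cont contD cont simp: e_def)
    then show ?thesis by (simp add: D_def)
  qed
  ultimately show ?thesis by (simp add: LIMSEQ_const_iff)
qed

text \<open>Fubini and the fundamental theorem of calculus on each time line; the upper boundary
  term drops because \<open>f\<close> vanishes from \<open>T'\<close> on.\<close>

lemma integral_d_t:
  assumes f: "C1_fun f" and T: "0 < T" and van: "T' < T" "\<And>x t. T' \<le> t \<Longrightarrow> f (x, t) = 0"
  shows "(\<integral>z. d_t f z \<partial>QM T) = - (\<integral>x. f (x, 0) \<partial>QB)"
proof -
  have cont: "continuous_on UNIV (d_t f)" unfolding d_t_def by (rule C1_fun_continuous_on_dd[OF f])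
  have fd: "\<And>z. f differentiable (at z)" using f by (rule C1_fun_differentiable)
  have int: "integrable (lborel \<Otimes>\<^sub>M lborel) (\<lambda>z. indicator (QT T) z * d_t f z)"
    using integrable_QM_cont[OF cont, of T] by (simp add: QM_def integrable_restrict_space lborel_prod)
  have inner: "(\<integral>t. indicator (QT T) (x, t) * d_t f (x, t) \<partial>lborel) = indicator Qbox x * - f (x, 0)" for x
  proof -
    have "(\<integral>t. d_t f (x, t) * indicator {0..T} t \<partial>lborel) = f (x, T) - f (x, 0)"
    proof (rule integral_FTC_Icc_real)
      show "0 \<le> T" using T by simp
      show "((\<lambda>t. f (x, t)) has_real_derivative d_t f (x, t)) (at t)" for t
        using has_real_derivative_line[of f "(x, 0)" t "(0, 1)", OF fd] by (simp add: d_t_def)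
      show "isCont (\<lambda>t. d_t f (x, t)) t" for t
        using continuous_on_compose2[OF cont, of UNIV "\<lambda>t. (x, t)"]
        by (auto intro!: continuous_intros simp: continuous_on_eq_continuous_at)
    qed
    moreover have "f (x, T) = 0" using van by simp
    moreover have "(\<integral>t. indicator (QT T) (x, t) * d_t f (x, t) \<partial>lborel) =
        (\<integral>t. indicator Qbox x * (d_t f (x, t) * indicator {0..T} t) \<partial>lborel)"
    proof (rule integral_cong_AE)
      have m: "(\<lambda>t. d_t f (x, t)) \<in> borel_measurable borel"
        by (intro borel_measurable_continuous_onI continuous_on_compose2[OF cont] continuous_intros) auto
      have "(\<lambda>t. (x, t)) \<in> borel_measurable borel"
        by (intro borel_measurable_continuous_onI continuous_intros)
      then show "(\<lambda>t. indicator (QT T) (x, t) * d_t f (x, t)) \<in> borel_measurable lborel"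
        using m by measurable
      show "(\<lambda>t. indicator Qbox x * (d_t f (x, t) * indicator {0..T} t)) \<in> borel_measurable lborel"
        using m by measurable
      \<comment> \<open>The cylinder is half open in time while the fundamental theorem is used on
        the closed interval; the difference is the single time \<open>T\<close>.\<close>
      have "AE t in lborel. t \<noteq> T" by (rule AE_lborel_singleton)
      then show "AE t in lborel. indicator (QT T) (x, t) * d_t f (x, t) = indicator Qbox x * (d_t f (x, t) * indicator {0..T} t)"
        by eventually_elim (auto simp: QT_def indicator_def)
    qed
    ultimately show ?thesis by simp
  qed
  have "(\<integral>z. d_t f z \<partial>QM T) = (\<integral>z. indicator (QT T) z * d_t f z \<partial>(lborel \<Otimes>\<^sub>M lborel))"
    by (simp add: QM_def integral_restrict_space lborel_prod)
  also have "\<dots> = (\<integral>x. \<integral>t. indicator (QT T) (x, t) * d_t f (x, t) \<partial>lborel \<partial>lborel)"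
    by (rule lborel_pair.integral_fst'[OF int, symmetric])
  also have "\<dots> = (\<integral>x. - f (x, 0) \<partial>QB)"
    unfolding inner by (simp add: QB_def integral_restrict_space)
  finally show ?thesis by simp
qed

section \<open>Mollification\<close>

text \<open>In every sign configuration of \<open>x\<close> and \<open>x + h\<close> the first order
  remainder is at most \<open>h\<^sup>2\<close>. The function is the C^1 building block of the
  mollifying kernel, of the steps in time and of the Gronwall cutoff.\<close>

lemma has_real_derivative_pos_square:
  "((\<lambda>s::real. (max 0 s)\<^sup>2) has_real_derivative 2 * max 0 x) (at x)"
proof -
  have est: "\<bar>(max 0 (x + h))\<^sup>2 - (max 0 x)\<^sup>2 - 2 * max 0 x * h\<bar> \<le> h\<^sup>2" for h
  proof (cases "x \<ge> 0"; cases "x + h \<ge> 0")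
    assume "x \<ge> 0" "x + h \<ge> 0"
    then show ?thesis by (simp add: power2_eq_square algebra_simps)
  next
    assume a: "x \<ge> 0" "\<not> x + h \<ge> 0"
    have "\<bar>- x\<^sup>2 - 2 * x * h\<bar> = \<bar>h\<^sup>2 - (x + h)\<^sup>2\<bar>" by (simp add: power2_eq_square algebra_simps)
    also have "\<dots> \<le> h\<^sup>2" using a abs_le_square_iff[of "x + h" h] by simp
    finally show ?thesis using a by (simp add: max_def)
  next
    assume a: "\<not> x \<ge> 0" "x + h \<ge> 0"
    then show ?thesis using abs_le_square_iff[of "x + h" h] by (simp add: max_def)
  next
    assume "\<not> x \<ge> 0" "\<not> x + h \<ge> 0"
    then show ?thesis by (simp add: max_def)
  qed
  have "((\<lambda>h. ((max 0 (x + h))\<^sup>2 - (max 0 x)\<^sup>2) / h - 2 * max 0 x) \<longlongrightarrow> 0) (at 0)"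
  proof (rule Lim_null_comparison)
    show "\<forall>\<^sub>F h in at 0. norm (((max 0 (x + h))\<^sup>2 - (max 0 x)\<^sup>2) / h - 2 * max 0 x) \<le> \<bar>h\<bar>"
      unfolding eventually_at_filter
    proof (intro always_eventually allI impI)
      fix h :: real assume h: "h \<noteq> 0"
      have "((max 0 (x + h))\<^sup>2 - (max 0 x)\<^sup>2) / h - 2 * max 0 x = ((max 0 (x + h))\<^sup>2 - (max 0 x)\<^sup>2 - 2 * max 0 x * h) / h"
        using h by (simp add: field_simps)
      then have "norm (((max 0 (x + h))\<^sup>2 - (max 0 x)\<^sup>2) / h - 2 * max 0 x)
          = \<bar>(max 0 (x + h))\<^sup>2 - (max 0 x)\<^sup>2 - 2 * max 0 x * h\<bar> / \<bar>h\<bar>" by (simp only: real_norm_def abs_divide)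
      also have "\<dots> \<le> h\<^sup>2 / \<bar>h\<bar>" by (intro divide_right_mono est) simp
      also have "\<dots> = \<bar>h\<bar>" by (simp add: power2_eq_square abs_if)
      finally show "norm (((max 0 (x + h))\<^sup>2 - (max 0 x)\<^sup>2) / h - 2 * max 0 x) \<le> \<bar>h\<bar>" .
    qed
    show "((\<lambda>h. \<bar>h\<bar>) \<longlongrightarrow> 0) (at (0::real))" by (rule tendsto_rabs_zero) (rule tendsto_ident_at)
  qed
  then show ?thesis unfolding DERIV_def by (simp add: LIM_zero_iff)
qed

section \<open>Convolution with a compactly supported kernel\<close>

lemma conv_integrable:
  fixes k g :: "'a::euclidean_space \<Rightarrow> real"
  assumes k: "continuous_on UNIV k" "\<And>w. norm w \<ge> 1 \<Longrightarrow> k w = 0" and g: "continuous_on UNIV g"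
  shows "integrable lborel (\<lambda>w. k w * g w)"
proof -
  have "integrable lborel (\<lambda>w. indicator (cball 0 1) w *\<^sub>R (k w * g w))"
    by (rule borel_integrable_compact)
       (auto intro!: continuous_intros intro: continuous_on_subset[OF k(1)] continuous_on_subset[OF g])
  moreover have "(\<lambda>w. indicator (cball 0 1) w *\<^sub>R (k w * g w)) = (\<lambda>w. k w * g w)"
    using k(2) by (auto simp: indicator_def fun_eq_iff)
  ultimately show ?thesis by simp
qed

text \<open>Moves the dependence on \<open>z\<close> from \<open>f\<close> to the kernel and
  confines the integral to a fixed box, the form in which it can be differentiated under the
  integral sign although \<open>f\<close> is merely Lipschitz.\<close>

lemma conv_shift:
  fixes k f :: "'a::euclidean_space \<Rightarrow> real"
  assumes k: "continuous_on UNIV k" "\<And>w. norm w \<ge> 1 \<Longrightarrow> k w = 0" and f: "continuous_on UNIV f"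
    and a: "cball z 1 \<subseteq> cbox (- a) a"
  shows "(\<integral>w. k w * f (z + w) \<partial>lborel) = integral (cbox (- a) a) (\<lambda>u. k (u - z) * f u)"
    and "(\<lambda>u. k (u - z) * f u) integrable_on cbox (- a) a"
proof -
  have c: "continuous_on UNIV (\<lambda>u. k (u - z) * f u)"
    by (intro continuous_intros continuous_on_compose2[OF k(1)] f) auto
  have "(\<integral>w. k w * f (z + w) \<partial>lborel) = (\<integral>w. k ((w + z) - z) * f (w + z) \<partial>lborel)"
    by (simp add: add.commute)
  also have "\<dots> = (\<integral>u. k (u - z) * f u \<partial>lborel)"
    by (rule lborel_integral_shift) (intro borel_measurable_continuous_onI c)
  also have "\<dots> = (LINT u:cbox (- a) a|lborel. k (u - z) * f u)"
  proof -
    have "k (u - z) * f u = indicator (cbox (- a) a) u *\<^sub>R (k (u - z) * f u)" for u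
    proof (cases "u \<in> cbox (- a) a")
      case False
      then have "u \<notin> cball z 1" using a by auto
      then have "k (u - z) = 0" by (intro k(2)) (auto simp: dist_norm norm_minus_commute)
      then show ?thesis by simp
    qed simp
    then have "(\<lambda>u. indicator (cbox (- a) a) u *\<^sub>R (k (u - z) * f u)) = (\<lambda>u. k (u - z) * f u)"
      by (rule ext[OF sym])
    then show ?thesis unfolding set_lebesgue_integral_def by simp
  qed
  also have "\<dots> = integral (cbox (- a) a) (\<lambda>u. k (u - z) * f u)"
    by (rule set_borel_integral_eq_integral(2)[unfolded set_integrable_def])
       (rule borel_integrable_compact[OF compact_cbox continuous_on_subset[OF c subset_UNIV]])
  finally show "(\<integral>w. k w * f (z + w) \<partial>lborel) = integral (cbox (- a) a) (\<lambda>u. k (u - z) * f u)" .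
  show "(\<lambda>u. k (u - z) * f u) integrable_on cbox (- a) a"
    by (rule integrable_continuous) (auto intro: continuous_on_subset[OF c])
qed

lemma conv_lipschitz:
  fixes k f :: "'a::euclidean_space \<Rightarrow> real"
  assumes k: "continuous_on UNIV k" "\<And>w. norm w \<ge> 1 \<Longrightarrow> k w = 0" and f: "L-lipschitz_on UNIV f"
  shows "\<bar>(\<integral>w. k w * f (x + w) \<partial>lborel) - (\<integral>w. k w * f (y + w) \<partial>lborel)\<bar>
    \<le> (\<integral>w. \<bar>k w\<bar> \<partial>lborel) * (L * norm (x - y))"
proof -
  have fc: "continuous_on UNIV f" by (rule lipschitz_on_continuous_on[OF f])
  have fs: "continuous_on UNIV (\<lambda>w. f (x + w))" for x
    by (intro continuous_on_compose2[OF fc] continuous_intros) auto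
  have ik: "integrable lborel (\<lambda>w. \<bar>k w\<bar>)"
    using conv_integrable[of "\<lambda>w. \<bar>k w\<bar>" "\<lambda>_. 1"] k by (auto intro!: continuous_intros)
  have "(\<integral>w. k w * f (x + w) \<partial>lborel) - (\<integral>w. k w * f (y + w) \<partial>lborel)
      = (\<integral>w. k w * f (x + w) - k w * f (y + w) \<partial>lborel)"
    by (rule Bochner_Integration.integral_diff[symmetric]) (intro conv_integrable k fs; assumption)+
  also have "\<bar>\<dots>\<bar> \<le> (\<integral>w. \<bar>k w * f (x + w) - k w * f (y + w)\<bar> \<partial>lborel)"
    using integral_norm_bound[of lborel] by (metis (no_types, lifting) Bochner_Integration.integral_cong real_norm_def)
  also have "\<dots> \<le> (\<integral>w. \<bar>k w\<bar> * (L * norm (x - y)) \<partial>lborel)"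
  proof (rule integral_mono)
    show "integrable lborel (\<lambda>w. \<bar>k w * f (x + w) - k w * f (y + w)\<bar>)"
      by (intro integrable_abs Bochner_Integration.integrable_diff conv_integrable k fs; assumption)
    show "integrable lborel (\<lambda>w. \<bar>k w\<bar> * (L * norm (x - y)))" using ik by simp
    show "\<bar>k w * f (x + w) - k w * f (y + w)\<bar> \<le> \<bar>k w\<bar> * (L * norm (x - y))" for w
    proof -
      have "\<bar>k w * f (x + w) - k w * f (y + w)\<bar> = \<bar>k w\<bar> * dist (f (x + w)) (f (y + w))"
        by (simp add: dist_real_def abs_mult flip: right_diff_distrib)
      also have "\<dots> \<le> \<bar>k w\<bar> * (L * norm (x - y))"
        using lipschitz_onD[OF f, of "x + w" "y + w"] by (intro mult_left_mono) (auto simp: dist_norm)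
      finally show ?thesis .
    qed
  qed
  finally show ?thesis by simp
qed

lemma C2_fun_const: "C2_fun (\<lambda>z. c)"
proof -
  have "dd (\<lambda>z::'a. c) h = (\<lambda>z. 0)" for h by auto
  then show ?thesis by (simp add: C2_fun_def)
qed

lemma C2_fun_mult: "C2_fun f \<Longrightarrow> C2_fun g \<Longrightarrow> C2_fun (\<lambda>z. f z * g z)"
proof -
  assume f: "C2_fun f" and g: "C2_fun g"
  have "dd (\<lambda>z. f z * g z) h = (\<lambda>z. f z * dd g h z + dd f h z * g z)" for h
    using f g by (auto simp: C2_fun_def dd_mult)
  then show ?thesis
    using f g by (auto simp: C2_fun_def intro!: C1_fun_add C1_fun_mult)
qed

lemma C2_fun_compose:
  fixes W :: "'a::euclidean_space \<Rightarrow> 'b::euclidean_space"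
  assumes f: "C2_fun f" and W: "C1_fun W" "\<And>h. C1_fun (dd W h)"
  shows "C2_fun (\<lambda>z. f (W z))"
proof -
  have f1: "C1_fun f" and f2: "\<And>h. C1_fun (dd f h)" using f by (auto simp: C2_fun_def)
  have "dd (\<lambda>z. f (W z)) h = (\<lambda>z. \<Sum>b\<in>Basis. (dd W h z \<bullet> b) *\<^sub>R dd f b (W z))" for h
  proof
    show "dd (\<lambda>z. f (W z)) h z = (\<Sum>b\<in>Basis. (dd W h z \<bullet> b) *\<^sub>R dd f b (W z))" for z
      unfolding dd_compose[OF f1 W(1)] by (rule dd_Basis[OF C1_fun_differentiable[OF f1]])
  qed
  moreover have "C1_fun (\<lambda>z. \<Sum>b\<in>Basis. (dd W h z \<bullet> b) *\<^sub>R dd f b (W z))" for h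
    by (intro C1_fun_sum C1_fun_scaleR C1_fun_inner_left W(2) C1_fun_compose[OF f2 W(1)])
  ultimately show ?thesis
    unfolding C2_fun_def using C1_fun_compose[OF f1 W(1)] by simp
qed

lemma C1_fun_pos_square: "C1_fun (\<lambda>s::real. (max 0 s)\<^sup>2)"
  by (rule C1_fun_real[OF has_real_derivative_pos_square]) (intro continuous_intros)

text \<open>All derivatives fall on the kernel; the minus sign comes from the argument
  \<open>u - z\<close>. The derivative is again a convolution, so continuity follows from the
  Lipschitz estimate and the lemma can be iterated.\<close>

lemma C1_fun_convolution:
  fixes k f :: "'a::euclidean_space \<Rightarrow> real"
  assumes k: "C1_fun k" "\<And>w. norm w \<ge> 1 \<Longrightarrow> k w = 0" "\<And>h w. norm w \<ge> 1 \<Longrightarrow> dd k h w = 0"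
    and f: "L-lipschitz_on UNIV f"
  shows "C1_fun (\<lambda>z. \<integral>w. k w * f (z + w) \<partial>lborel)"
    and "dd (\<lambda>z. \<integral>w. k w * f (z + w) \<partial>lborel) h = (\<lambda>z. \<integral>w. - dd k h w * f (z + w) \<partial>lborel)"
proof -
  have kc: "continuous_on UNIV k" by (rule C1_fun_continuous_on[OF k(1)])
  have dkc: "continuous_on S (dd k h)" for h S by (rule C1_fun_continuous_on_dd[OF k(1)])
  have dk: "continuous_on UNIV (\<lambda>w. - dd k h w)" "\<And>w. norm w \<ge> 1 \<Longrightarrow> - dd k h w = 0" for h
    using k(3) dkc by (auto intro: continuous_intros)
  have fc: "continuous_on UNIV f" by (rule lipschitz_on_continuous_on[OF f])
  have L0: "L \<ge> 0" using lipschitz_on_nonneg[OF f] .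
  have der: "((\<lambda>z. \<integral>w. k w * f (z + w) \<partial>lborel) has_derivative (\<lambda>h. \<integral>w. - dd k h w * f (z + w) \<partial>lborel)) (at z)" for z
  proof -
    obtain a where a: "cball z 2 \<subseteq> cbox (- a) a"
      using bounded_subset_cbox_symmetric[OF bounded_cball] by metis
    have a1: "cball x 1 \<subseteq> cbox (- a) a" if "x \<in> ball z 1" for x
    proof -
      have "cball x 1 \<subseteq> cball z 2"
      proof
        fix y assume "y \<in> cball x 1"
        then show "y \<in> cball z 2" using that dist_triangle[of z y x] by (simp add: dist_commute)
      qed
      then show ?thesis using a by blast
    qed
    \<comment> \<open>The rule for differentiating under the integral needs the derivative as a
      bounded linear map depending continuously on the parameters; it is assembled from the partial
      derivatives of \<open>k\<close>.\<close>
    define fx where "fx x u = (\<Sum>b\<in>Basis. (- dd k b (u - x) * f u) *\<^sub>R blinfun_inner_right b)" for x u :: 'a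
    have fx: "blinfun_apply (fx x u) h = - dd k h (u - x) * f u" for x u h
      using dd_Basis[OF C1_fun_differentiable[OF k(1)], where z="u - x" and h=h]
      by (simp add: fx_def blinfun.sum_left blinfun.minus_left blinfun.scaleR_left sum_negf sum_distrib_right sum_distrib_left inner_commute mult_ac)
    have cfx: "continuous_on (S \<times> S') (\<lambda>(x, t). fx x t)" for S S'
      unfolding fx_def split_beta
      by (intro continuous_intros continuous_on_compose2[OF fc] continuous_on_compose2[OF dkc[of UNIV]]) auto
    have "((\<lambda>x. integral (cbox (- a) a) (\<lambda>u. k (u - x) * f u)) has_derivative integral (cbox (- a) a) (fx z)) (at z within ball z 1)"
    proof (rule leibniz_rule)
      fix x u assume "x \<in> ball z 1"
      have q: "((\<lambda>x. u - x) has_derivative (\<lambda>h. - h)) (at x within ball z 1)"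
        by (auto intro!: derivative_eq_intros)
      have "((\<lambda>x. k (u - x)) has_derivative (\<lambda>h. dd k (- h) (u - x))) (at x within ball z 1)"
        by (rule has_derivative_compose[OF q C1_fun_has_derivative[OF k(1)]])
      then have "((\<lambda>x. k (u - x) * f u) has_derivative (\<lambda>h. dd k (- h) (u - x) * f u)) (at x within ball z 1)"
        by (rule has_derivative_mult_left)
      moreover have "(\<lambda>h. dd k (- h) (u - x) * f u) = blinfun_apply (fx x u)"
      proof
        show "dd k (- h) (u - x) * f u = blinfun_apply (fx x u) h" for h
          unfolding fx linear_neg[OF linear_dd[OF C1_fun_differentiable[OF k(1)]]] ..
      qed
      ultimately show "((\<lambda>x. k (u - x) * f u) has_derivative blinfun_apply (fx x u)) (at x within ball z 1)"
        by (simp only:)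
    next
      fix x assume "x \<in> ball z 1"
      then show "(\<lambda>u. k (u - x) * f u) integrable_on cbox (- a) a"
        using conv_shift(2)[OF kc k(2) fc a1] by blast
    qed (auto intro!: cfx)
    moreover have "at z within ball z 1 = at z" by (rule at_within_open) auto
    ultimately have 1: "((\<lambda>x. integral (cbox (- a) a) (\<lambda>u. k (u - x) * f u)) has_derivative integral (cbox (- a) a) (fx z)) (at z)"
      by (simp only:)
    have 2: "((\<lambda>x. \<integral>w. k w * f (x + w) \<partial>lborel) has_derivative integral (cbox (- a) a) (fx z)) (at z)"
    proof (rule has_derivative_transform_within_open[OF 1, of "ball z 1"])
      show "integral (cbox (- a) a) (\<lambda>u. k (u - x) * f u) = (\<integral>w. k w * f (x + w) \<partial>lborel)" if "x \<in> ball z 1" for x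
        using conv_shift(1)[OF kc k(2) fc a1[OF that]] by (rule sym)
    qed auto
    have "fx z integrable_on cbox (- a) a"
    proof (rule integrable_continuous)
      show "continuous_on (cbox (- a) a) (fx z)"
        unfolding fx_def
        by (intro continuous_intros continuous_on_subset[OF fc] continuous_on_compose2[OF dkc[of UNIV]]) auto
    qed
    then have "blinfun_apply (integral (cbox (- a) a) (fx z)) h = (\<integral>w. - dd k h w * f (z + w) \<partial>lborel)" for h
      using conv_shift(1)[OF dk fc a1[of z], of h] by (simp add: blinfun_apply_integral fx)
    then have "blinfun_apply (integral (cbox (- a) a) (fx z)) = (\<lambda>h. \<integral>w. - dd k h w * f (z + w) \<partial>lborel)"
      by (rule ext)
    then show ?thesis using 2 by (simp only:)
  qed
  show "C1_fun (\<lambda>z. \<integral>w. k w * f (z + w) \<partial>lborel)"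
  proof (rule C1_funI[OF der])
    fix h
    define I where "I = (\<integral>w. \<bar>- dd k h w\<bar> \<partial>lborel)"
    have I: "I \<ge> 0" unfolding I_def by (rule integral_nonneg_AE) simp
    have "(I * L)-lipschitz_on UNIV (\<lambda>z. \<integral>w. - dd k h w * f (z + w) \<partial>lborel)"
      using conv_lipschitz[OF dk f] I L0
      by (intro lipschitz_onI) (auto simp: dist_norm I_def mult.assoc)
    then show "continuous_on UNIV (\<lambda>z. \<integral>w. - dd k h w * f (z + w) \<partial>lborel)"
      by (rule lipschitz_on_continuous_on)
  qed
  show "dd (\<lambda>z. \<integral>w. k w * f (z + w) \<partial>lborel) h = (\<lambda>z. \<integral>w. - dd k h w * f (z + w) \<partial>lborel)"
    using dd_eqI[OF der] by auto
qed

text \<open>The result is an average of translates of \<open>f\<close> over a ball of radius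
  \<epsilon> with a nonnegative normalised weight. Hence it inherits the Lipschitz constant without
  loss, is within \<open>L * \<epsilon>\<close> of \<open>f\<close>, and keeps every period.\<close>

lemma mollify:
  fixes f :: "'a::euclidean_space \<Rightarrow> real"
  assumes f: "L-lipschitz_on UNIV f" and \<epsilon>: "0 < \<epsilon>" "\<epsilon> \<le> 1"
  obtains F where "C2_fun F" "\<And>z. \<bar>F z - f z\<bar> \<le> L * \<epsilon>" "\<And>x y. \<bar>F x - F y\<bar> \<le> L * norm (x - y)"
    "\<And>c z. (\<And>z. f (z + c) = f z) \<Longrightarrow> F (z + c) = F z"
proof -
  define m where "m = 1 / \<epsilon>"
  have m: "m \<ge> 1" using \<epsilon> by (simp add: m_def)
  have L0: "L \<ge> 0" using lipschitz_on_nonneg[OF f] .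
  define s where "s w = 1 - m\<^sup>2 * (w \<bullet> w)" for w :: 'a
  \<comment> \<open>This is the cube of the positive part of \<open>s\<close>, hence C^2 and
    supported in the ball of radius \<epsilon>. Writing it as \<open>s\<close> times a square makes
    both derivatives accessible from the derivative of \<open>(max 0 s)\<^sup>2\<close>.\<close>
  define K where "K w = s w * (max 0 (s w))\<^sup>2" for w
  define K' where "K' h w = (max 0 (s w))\<^sup>2 * (- 6 * m\<^sup>2 * (w \<bullet> h))" for h w
  have s1: "C1_fun s" and ds: "dd s h = (\<lambda>w. - 2 * m\<^sup>2 * (w \<bullet> h))" for h
  proof -
    have d: "(s has_derivative (\<lambda>h. - 2 * m\<^sup>2 * (w \<bullet> h))) (at w)" for w
      unfolding s_def by (auto intro!: derivative_eq_intros simp: inner_commute algebra_simps)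
    show "C1_fun s" by (rule C1_funI[OF d]) (intro continuous_intros)
    show "dd s h = (\<lambda>w. - 2 * m\<^sup>2 * (w \<bullet> h))" using dd_eqI[OF d] by auto
  qed
  have sp: "C1_fun (\<lambda>w. (max 0 (s w))\<^sup>2)" by (rule C1_fun_compose[OF C1_fun_pos_square s1])
  have K1: "C1_fun K" unfolding K_def by (intro C1_fun_mult s1 sp)
  have dK: "dd K h = K' h" for h
  proof
    fix w
    have "dd (\<lambda>w. (max 0 (s w))\<^sup>2) h w = 2 * max 0 (s w) * dd s h w"
      using dd_compose[OF C1_fun_pos_square s1] dd_real[OF has_real_derivative_pos_square] by simp
    then have "dd K h w = s w * (2 * max 0 (s w) * dd s h w) + dd s h w * (max 0 (s w))\<^sup>2"
      unfolding K_def using dd_mult[OF s1 sp] by simp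
    also have "\<dots> = 3 * (max 0 (s w))\<^sup>2 * dd s h w" by (simp add: max_def power2_eq_square)
    finally show "dd K h w = K' h w" by (simp add: K'_def ds)
  qed
  have K'1: "C1_fun (K' h)" for h
    unfolding K'_def
    by (intro C1_fun_mult sp C1_fun_const) (simp add: C1_fun_inner_left C1_fun_linear)
  have s0: "s w \<le> 0" if "norm w \<ge> \<epsilon>" for w
  proof -
    have "1 \<le> m * norm w" using that \<epsilon> by (simp add: m_def field_simps)
    then have "1 \<le> (m * norm w)\<^sup>2" by (rule one_le_power)
    then show ?thesis by (simp add: s_def dot_square_norm power_mult_distrib)
  qed
  have s0': "(max 0 (s w))\<^sup>2 = 0" if "norm w \<ge> \<epsilon>" for w using s0[OF that] by simp
  have K0': "K w = 0" if "norm w \<ge> \<epsilon>" for w using s0'[of w] that \<epsilon> by (simp add: K_def)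
  have K0: "K w = 0" if "norm w \<ge> 1" for w using K0'[of w] that \<epsilon> by simp
  have "K' h w = 0" if "norm w \<ge> \<epsilon>" for h w using s0'[OF that] by (simp add: K'_def)
  then have dK0: "dd K h w = 0" if "norm w \<ge> 1" for h w using that \<epsilon> by (simp add: dK)
  have ddK0: "dd (K' h) k w = 0" if "norm w \<ge> 1" for h k w
  proof -
    have 1: "dd (\<lambda>w. (max 0 (s w))\<^sup>2) k w = 2 * max 0 (s w) * dd s k w"
      using dd_compose[OF C1_fun_pos_square s1] dd_real[OF has_real_derivative_pos_square] by simp
    have 2: "C1_fun (\<lambda>w. - 6 * m\<^sup>2 * (w \<bullet> h))"
      by (intro C1_fun_mult C1_fun_const) (simp add: C1_fun_inner_left C1_fun_linear)
    show ?thesis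
      unfolding K'_def[abs_def] dd_mult[OF sp 2] 1 using s0[of w] that \<epsilon> by (simp add: max_def)
  qed
  have Kc: "continuous_on UNIV K" by (rule C1_fun_continuous_on[OF K1])
  have Kpos: "K w \<ge> 0" for w by (simp add: K_def max_def)
  have fc: "continuous_on UNIV f" by (rule lipschitz_on_continuous_on[OF f])
  have fs: "continuous_on UNIV (\<lambda>w. f (x + w))" for x
    by (intro continuous_on_compose2[OF fc] continuous_intros) auto
  have iK: "integrable lborel K" using conv_integrable[of K "\<lambda>_. 1"] Kc K0 by simp
  define c where "c = (\<integral>w. K w \<partial>lborel)"
  have "c \<ge> 0" unfolding c_def by (rule integral_nonneg_AE) (simp add: Kpos)
  \<comment> \<open>A continuous nonnegative kernel with zero integral would vanish almost
    everywhere, but \<open>K\<close> is positive on the open ball of radius \<epsilon>.\<close>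
  moreover have "c \<noteq> 0"
  proof
    assume "c = 0"
    then have "AE w in lborel. K w = 0"
      unfolding c_def using integral_nonneg_eq_0_iff_AE[OF iK] Kpos by simp
    then have "emeasure lborel {w. K w \<noteq> 0} = 0"
      by (subst (asm) AE_iff_measurable[of "{w. K w \<noteq> 0}"])
         (auto intro!: borel_open open_Collect_neq Kc continuous_intros)
    moreover have "ball 0 \<epsilon> \<subseteq> {w. K w \<noteq> 0}"
    proof
      fix w :: 'a assume "w \<in> ball 0 \<epsilon>"
      then have "m * norm w < 1" using \<epsilon> by (simp add: m_def field_simps)
      moreover have "0 \<le> m * norm w" using m by simp
      ultimately have "(m * norm w)\<^sup>2 < 1" by (simp add: power_less_one_iff abs_square_less_1)
      then have "s w > 0" by (simp add: s_def dot_square_norm power_mult_distrib)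
      then show "w \<in> {w. K w \<noteq> 0}" by (simp add: K_def max_def)
    qed
    ultimately have "emeasure lborel (ball (0::'a) \<epsilon>) = 0"
      by (metis emeasure_mono le_zero_eq sets_lborel borel_open open_Collect_neq[OF Kc continuous_on_const])
    then have "measure lebesgue (ball (0::'a) \<epsilon>) = 0" by (simp add: measure_def)
    then show False using content_ball_pos[OF \<epsilon>(1), of "0::'a"] by simp
  qed
  ultimately have c: "c > 0" by simp
  define F where "F z = (\<integral>w. K w * f (z + w) \<partial>lborel) / c" for z
  have lip: "\<bar>F x - F y\<bar> \<le> L * norm (x - y)" for x y
  proof -
    have "\<bar>c * F x - c * F y\<bar> \<le> c * (L * norm (x - y))"
      using conv_lipschitz[OF Kc K0 f, of x y] c Kpos by (simp add: F_def c_def)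
    then show ?thesis using c by (simp add: abs_mult flip: right_diff_distrib)
  qed
  have close: "\<bar>F z - f z\<bar> \<le> L * \<epsilon>" for z
  proof -
    have "c * (F z - f z) = (\<integral>w. K w * f (z + w) - K w * f z \<partial>lborel)"
      using c conv_integrable[OF Kc K0 fs, of z] iK by (simp add: F_def c_def right_diff_distrib)
    also have "\<bar>\<dots>\<bar> \<le> (\<integral>w. \<bar>K w * f (z + w) - K w * f z\<bar> \<partial>lborel)"
      using integral_norm_bound[of lborel] by (metis (no_types, lifting) Bochner_Integration.integral_cong real_norm_def)
    also have "\<dots> \<le> (\<integral>w. K w * (L * \<epsilon>) \<partial>lborel)"
    proof (rule integral_mono)
      show "integrable lborel (\<lambda>w. \<bar>K w * f (z + w) - K w * f z\<bar>)"
        by (intro integrable_abs Bochner_Integration.integrable_diff conv_integrable Kc K0 fs integrable_mult_left iK; assumption)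
      show "integrable lborel (\<lambda>w. K w * (L * \<epsilon>))" using iK by simp
      show "\<bar>K w * f (z + w) - K w * f z\<bar> \<le> K w * (L * \<epsilon>)" for w
      proof (cases "norm w \<ge> \<epsilon>")
        case False
        have "\<bar>K w * f (z + w) - K w * f z\<bar> = K w * dist (f (z + w)) (f z)"
          using Kpos[of w] by (simp add: dist_real_def abs_mult flip: right_diff_distrib)
        also have "dist (f (z + w)) (f z) \<le> L * norm w"
          using lipschitz_onD[OF f, of "z + w" z] by (simp add: dist_norm)
        also have "L * norm w \<le> L * \<epsilon>" using False L0 by (intro mult_left_mono) auto
        finally show ?thesis using Kpos[of w] by (simp add: mult_left_mono)
      qed (simp add: K0')
    qed
    also have "\<dots> = c * (L * \<epsilon>)" by (simp add: c_def)
    finally have "\<bar>c * (F z - f z)\<bar> \<le> c * (L * \<epsilon>)" .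
    then show ?thesis using c by (simp add: abs_mult)
  qed
  have per: "F (z + v) = F z" if "\<And>z. f (z + v) = f z" for v z
  proof -
    have "f (z + v + w) = f (z + w)" for w using that[of "z + w"] by (simp add: algebra_simps)
    then show ?thesis by (simp add: F_def)
  qed
  have "C1_fun (\<lambda>z. \<integral>w. K w * f (z + w) \<partial>lborel)" and
    d: "dd (\<lambda>z. \<integral>w. K w * f (z + w) \<partial>lborel) h = (\<lambda>z. - (\<integral>w. K' h w * f (z + w) \<partial>lborel))" for h
    using C1_fun_convolution(1)[OF K1 K0 dK0 f] C1_fun_convolution(2)[OF K1 K0 dK0 f, of h] by (auto simp: dK)
  moreover have "C1_fun (\<lambda>z. \<integral>w. K' h w * f (z + w) \<partial>lborel)" for h
    using C1_fun_convolution(1)[OF K'1 dK0[unfolded dK] ddK0 f] .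
  ultimately have "C2_fun (\<lambda>z. \<integral>w. K w * f (z + w) \<partial>lborel)"
    unfolding C2_fun_def by (auto simp: d intro: C1_fun_minus)
  moreover have "C2_fun (\<lambda>z. inverse c)" by (rule C2_fun_const)
  ultimately have "C2_fun F"
    unfolding F_def divide_inverse by (rule C2_fun_mult)
  then show ?thesis using that close lip per by blast
qed

section \<open>Weakly null sequences\<close>

text \<open>Weak-star convergence to 0 in L^\<infinity>(QT T), with a bound common to the whole
  sequence.\<close>

definition wnull :: "real \<Rightarrow> (nat \<Rightarrow> pt \<Rightarrow> real) \<Rightarrow> bool" where
  "wnull T R \<longleftrightarrow> (\<forall>n. R n \<in> borel_measurable borel) \<and> (\<exists>C. \<forall>n. \<forall>z\<in>QT T. \<bar>R n z\<bar> \<le> C)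
     \<and> (\<forall>g. integrable (QM T) g \<longrightarrow> (\<lambda>n. \<integral>z. R n z * g z \<partial>QM T) \<longlonglongrightarrow> 0)"

text \<open>The factor in time vanishes near 0 as well as near \<open>T\<close>, which removes the
  initial terms of the weak equations. The factor in space is C^2 so that its derivatives are
  admissible in test functions.\<close>

definition bump :: "real \<Rightarrow> (real^3 \<Rightarrow> real) \<Rightarrow> (real \<Rightarrow> real) \<Rightarrow> bool" where
  "bump T X b \<longleftrightarrow> C2_fun X \<and> periodic_x X \<and> C1_fun b
     \<and> (\<exists>t0>0. \<exists>T'<T. \<forall>t. t \<le> t0 \<or> T' \<le> t \<longrightarrow> b t = 0)"

text \<open>The common bound makes the pairings with \<open>g\<close> and with \<open>f k\<close>
  differ by at most a multiple of the L^1 distance, uniformly in \<open>n\<close>; so the set of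
  good test functions is closed in L^1.\<close>

lemma integral_QM_weak_limit:
  fixes R :: "nat \<Rightarrow> pt \<Rightarrow> real"
  assumes R: "\<And>n. R n \<in> borel_measurable borel" "\<And>n z. z \<in> QT T \<Longrightarrow> \<bar>R n z\<bar> \<le> C"
    and f: "\<And>k. integrable (QM T) (f k)" "integrable (QM T) g"
    and P: "\<And>k. (\<lambda>n. \<integral>z. R n z * f k z \<partial>QM T) \<longlonglongrightarrow> 0"
    and lim: "(\<lambda>k. \<integral>z. \<bar>f k z - g z\<bar> \<partial>QM T) \<longlonglongrightarrow> 0"
  shows "(\<lambda>n. \<integral>z. R n z * g z \<partial>QM T) \<longlonglongrightarrow> 0"
proof (rule LIMSEQ_I)
  fix r :: real assume r: "0 < r"
  define D where "D = \<bar>C\<bar> + 1"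
  have D: "D > 0" by (simp add: D_def)
  have RD: "\<bar>R n z\<bar> \<le> D" if "z \<in> QT T" for n z using R(2)[OF that, of n] by (simp add: D_def)
  have "r / (2 * D) > 0" using r D by simp
  then obtain k where k: "norm ((\<integral>z. \<bar>f k z - g z\<bar> \<partial>QM T) - 0) < r / (2 * D)"
    using LIMSEQ_D[OF lim] by blast
  obtain N where N: "\<And>n. n \<ge> N \<Longrightarrow> norm ((\<integral>z. R n z * f k z \<partial>QM T) - 0) < r / 2"
    using LIMSEQ_D[OF P[of k], of "r/2"] r by auto
  have "norm ((\<integral>z. R n z * g z \<partial>QM T) - 0) < r" if n: "n \<ge> N" for n
  proof -
    have i1: "integrable (QM T) (\<lambda>z. R n z * f k z)" "integrable (QM T) (\<lambda>z. R n z * g z)"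
      by (intro integrable_QM_mult[OF _ R(1) R(2)] f; assumption)+
    have i2: "integrable (QM T) (\<lambda>z. \<bar>f k z - g z\<bar>)"
      by (intro integrable_abs Bochner_Integration.integrable_diff f)
    have "(\<integral>z. R n z * f k z \<partial>QM T) - (\<integral>z. R n z * g z \<partial>QM T) = (\<integral>z. R n z * f k z - R n z * g z \<partial>QM T)"
      by (rule Bochner_Integration.integral_diff[symmetric]) (intro i1)+
    also have "\<bar>\<dots>\<bar> \<le> (\<integral>z. \<bar>R n z * f k z - R n z * g z\<bar> \<partial>QM T)"
      by (rule integral_abs_bound)
    also have "\<dots> \<le> (\<integral>z. D * \<bar>f k z - g z\<bar> \<partial>QM T)"
    proof (rule integral_mono)
      show "integrable (QM T) (\<lambda>z. \<bar>R n z * f k z - R n z * g z\<bar>)"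
        by (intro integrable_abs Bochner_Integration.integrable_diff i1)
      show "integrable (QM T) (\<lambda>z. D * \<bar>f k z - g z\<bar>)" using i2 by simp
      show "\<bar>R n z * f k z - R n z * g z\<bar> \<le> D * \<bar>f k z - g z\<bar>" if "z \<in> space (QM T)" for z
        using RD[of z n] that by (auto simp: abs_mult mult_right_mono simp flip: right_diff_distrib)
    qed
    also have "\<dots> < r / 2" using k D by (simp add: field_simps abs_less_iff)
    finally show ?thesis using N[OF n] unfolding real_norm_def diff_0_right by linarith
  qed
  then show "\<exists>no. \<forall>n\<ge>no. norm ((\<integral>z. R n z * g z \<partial>QM T) - 0) < r" by blast
qed

section \<open>Smooth approximations of indicators of boxes\<close>

lemma C2_fun_coordinate:
  fixes f :: "real \<Rightarrow> real"
  assumes f: "\<And>x. (f has_real_derivative f' x) (at x)" and f': "C1_fun f'"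
  shows "C2_fun (\<lambda>x::real^3. f (x $ i))"
proof -
  have f1: "C1_fun f" by (rule C1_fun_real[OF f C1_fun_continuous_on[OF f']])
  have n: "C1_fun (\<lambda>x::real^3. x $ i)" by (rule C1_fun_linear[OF bounded_linear_vec_nth])
  have "dd (\<lambda>x::real^3. f (x $ i)) h = (\<lambda>x. f' (x $ i) * (h $ i))" for h
    by (auto simp: dd_compose[OF f1 n] dd_linear[OF bounded_linear_vec_nth] dd_real[OF f])
  then show ?thesis
    unfolding C2_fun_def by (auto intro!: C1_fun_mult C1_fun_compose[OF f1 n] C1_fun_compose[OF f' n])
qed

text \<open>On \<open>[0, 2\<pi>]\<close> the cosine difference is positive exactly for \<open>0 < x < a\<close>, so that its
  multiples under \<open>arctan\<close> give smooth periodic approximations of the indicator of \<open>(0, a)\<close>.\<close>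

definition space_step :: "real \<Rightarrow> nat \<Rightarrow> real \<Rightarrow> real" where
  "space_step a k x = 1/2 + arctan (real k * (cos (x - max 0 (min a (2 * pi)) / 2) - cos (max 0 (min a (2 * pi)) / 2))) / pi"

lemma space_step_C2: "C2_fun (\<lambda>x::real^3. space_step a k (x $ i))"
proof -
  define d where "d = max 0 (min a (2 * pi)) / 2"
  define u where "u x = real k * (cos (x - d) - cos d)" for x
  define u' where "u' x = - (real k * sin (x - d))" for x
  have u: "(u has_real_derivative u' x) (at x)" "(u' has_real_derivative - (real k * cos (x - d))) (at x)" for x
    unfolding u_def u'_def by (auto intro!: derivative_eq_intros)
  have nz: "1 + (u x)\<^sup>2 \<noteq> 0" for x using zero_le_power2[of "u x"] by linarith
  define f' where "f' x = u' x / (1 + (u x)\<^sup>2) / pi" for x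
  have at: "((\<lambda>x. arctan (u x)) has_real_derivative inverse (1 + (u x)\<^sup>2) * u' x) (at x)" for x
    by (rule DERIV_chain2[OF DERIV_arctan u(1)])
  have "((\<lambda>x. 1/2 + arctan (u x) / pi) has_real_derivative f' x) (at x)" for x
    by (rule DERIV_cong[OF DERIV_add[OF DERIV_const DERIV_cdivide[OF at]]])
       (simp add: f'_def divide_inverse)
  then have "(space_step a k has_real_derivative f' x) (at x)" for x
    unfolding space_step_def[abs_def] d_def[symmetric] u_def[symmetric] .
  moreover have "C1_fun f'"
  proof (rule C1_fun_real)
    have "((\<lambda>x. 1 + (u x)\<^sup>2) has_real_derivative 2 * u x * u' x) (at x)" for x
      by (auto intro!: derivative_eq_intros u)
    then show "(f' has_real_derivative (- (real k * cos (x - d)) * (1 + (u x)\<^sup>2) - u' x * (2 * u x * u' x)) / ((1 + (u x)\<^sup>2) * (1 + (u x)\<^sup>2)) / pi) (at x)" for x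
      unfolding f'_def by (intro DERIV_cdivide DERIV_divide u nz)
    show "continuous_on UNIV (\<lambda>x. (- (real k * cos (x - d)) * (1 + (u x)\<^sup>2) - u' x * (2 * u x * u' x)) / ((1 + (u x)\<^sup>2) * (1 + (u x)\<^sup>2)) / pi)"
      by (intro continuous_intros) (use nz in \<open>auto simp: u_def u'_def intro!: continuous_intros\<close>)
  qed
  ultimately show ?thesis by (rule C2_fun_coordinate)
qed

lemma space_step_periodic: "space_step a k (x + 2 * pi) = space_step a k x"
  by (simp add: space_step_def add.commute[of x] add_diff_eq[symmetric] cos_add)

lemma arctan_multiples_limit:
  assumes "u > 0" shows "(\<lambda>k. arctan (real k * u)) \<longlonglongrightarrow> pi / 2"
proof -
  have "filterlim (\<lambda>k. real k * u) at_top sequentially"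
    by (rule filterlim_at_top_mult_tendsto_pos[OF tendsto_const assms filterlim_real_sequentially])
  then show ?thesis by (rule filterlim_compose[OF tendsto_arctan_at_top])
qed

lemma space_step_limit:
  assumes x: "0 < x" "x < 2 * pi" "x \<noteq> a"
  shows "(\<lambda>k. space_step a k x) \<longlonglongrightarrow> (if x \<le> a then 1 else 0)"
proof -
  \<comment> \<open>Clipping to one period lets the same formula serve thresholds below 0 and above
    \<open>2 * pi\<close>, where the limit is constantly 0 or 1 inside the cell.\<close>
  define c where "c = max 0 (min a (2 * pi))"
  have c: "0 \<le> c" "c \<le> 2 * pi" by (auto simp: c_def)
  define u where "u = cos (x - c / 2) - cos (c / 2)"
  \<comment> \<open>The sum-to-product formula isolates the sign: the first sine is positive inside
    the period, so \<open>u\<close> has the sign of \<open>c - x\<close>.\<close>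
  have u: "u = 2 * sin (x / 2) * sin ((c - x) / 2)"
  proof -
    have "(c / 2 - (x - c / 2)) / 2 = (c - x) / 2" by simp
    then show ?thesis unfolding u_def cos_diff_cos by simp
  qed
  have s: "sin (x / 2) > 0" using x by (intro sin_gt_zero) auto
  show ?thesis
  proof (cases "x \<le> a")
    case True
    then have "x < c" using x by (auto simp: c_def)
    then have "sin ((c - x) / 2) > 0" using c x by (intro sin_gt_zero) auto
    then have "u > 0" unfolding u using s by simp
    then have "(\<lambda>k. 1/2 + arctan (real k * u) / pi) \<longlonglongrightarrow> 1/2 + (pi / 2) / pi"
      by (intro tendsto_intros arctan_multiples_limit) auto
    then show ?thesis using True by (simp add: space_step_def u_def c_def)
  next
    case False
    then have "c < x" using x by (auto simp: c_def)
    then have "sin ((x - c) / 2) > 0" using c x by (intro sin_gt_zero) auto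
    moreover have "sin ((c - x) / 2) = - sin ((x - c) / 2)"
      by (metis minus_diff_eq minus_divide_left sin_minus)
    ultimately have "- u > 0" unfolding u using s by simp
    then have "(\<lambda>k. 1/2 - arctan (real k * (- u)) / pi) \<longlonglongrightarrow> 1/2 - (pi / 2) / pi"
      by (intro tendsto_intros arctan_multiples_limit) auto
    then have "(\<lambda>k. 1/2 + arctan (real k * u) / pi) \<longlonglongrightarrow> 0" by (simp add: arctan_minus)
    then show ?thesis using False by (simp add: space_step_def u_def c_def)
  qed
qed

lemma space_step_bounds: "\<bar>space_step a k x\<bar> \<le> 1"
  using arctan_bounded[of "real k * (cos (x - max 0 (min a (2 * pi)) / 2) - cos (max 0 (min a (2 * pi)) / 2))"]
  by (simp add: space_step_def field_simps abs_le_iff)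

text \<open>Approximates the indicator of (0, a). The two squares shrink the support by 1/(k+1) at
  each end, so that each function vanishes near 0 and near \<open>a\<close>, and the factor k+1 in
  the exponent drives the values inside to 1.\<close>

definition time_step :: "real \<Rightarrow> nat \<Rightarrow> real \<Rightarrow> real" where
  "time_step a k t = 1 - exp (- (real (Suc k) * ((max 0 (t - inverse (real (Suc k))))\<^sup>2 * (max 0 (a - inverse (real (Suc k)) - t))\<^sup>2)))"

lemma C1_fun_affine: "C1_fun (\<lambda>t::real. a * t + b)"
  by (rule C1_fun_real[where f' = "\<lambda>_. a"]) (auto intro!: derivative_eq_intros)

lemma time_step_C1: "C1_fun (time_step a k)"
proof -
  define e where "e = inverse (real (Suc k))"
  have 1: "C1_fun (\<lambda>t. (max 0 (t - e))\<^sup>2)"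
    using C1_fun_compose[OF C1_fun_pos_square C1_fun_affine[of 1 "- e"]] by simp
  have 2: "C1_fun (\<lambda>t. (max 0 (a - e - t))\<^sup>2)"
    using C1_fun_compose[OF C1_fun_pos_square C1_fun_affine[of "-1" "a - e"]] by simp
  have 3: "C1_fun (\<lambda>s::real. 1 - exp (- (K * s)))" for K :: real
  proof (rule C1_fun_real)
    show "((\<lambda>s::real. 1 - exp (- (K * s))) has_real_derivative K * exp (- (K * s))) (at s)" for s
      by (auto intro!: derivative_eq_intros)
  qed (intro continuous_intros)
  show ?thesis
    unfolding time_step_def[abs_def] e_def[symmetric] by (rule C1_fun_compose[OF 3 C1_fun_mult[OF 1 2]])
qed

lemma time_step_bounds: "\<bar>time_step a k t\<bar> \<le> 1"
  by (auto simp: time_step_def abs_le_iff intro!: order_trans[OF _ less_imp_le[OF exp_gt_zero]])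

lemma time_step_zero: "t \<le> inverse (real (Suc k)) \<or> a - inverse (real (Suc k)) \<le> t \<Longrightarrow> time_step a k t = 0"
  by (auto simp: time_step_def max_def)

lemma time_step_limit:
  assumes t: "0 < t" "t \<noteq> a"
  shows "(\<lambda>k. time_step a k t) \<longlonglongrightarrow> (if t \<le> a then 1 else 0)"
proof (cases "t \<le> a")
  case False
  then have "time_step a k t = 0" for k
  proof (intro time_step_zero disjI2)
    have "inverse (real (Suc k)) > 0" by simp
    then show "a - inverse (real (Suc k)) \<le> t" using False by linarith
  qed
  then show ?thesis using False by simp
next
  case True
  define m where "m k = (max 0 (t - inverse (real (Suc k))))\<^sup>2 * (max 0 (a - inverse (real (Suc k)) - t))\<^sup>2" for k
  have "m \<longlonglongrightarrow> (max 0 (t - 0))\<^sup>2 * (max 0 (a - 0 - t))\<^sup>2"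
    \<comment> \<open>The limit of \<open>m\<close> is positive for 0 < t < a, so the extra factor
      \<open>Suc k\<close> sends the exponent to minus infinity.\<close>
    unfolding m_def by (intro tendsto_intros LIMSEQ_inverse_real_of_nat)
  moreover have "(max 0 (t - 0))\<^sup>2 * (max 0 (a - 0 - t))\<^sup>2 > 0" using t True by simp
  moreover have "filterlim (\<lambda>k. real (Suc k)) at_top sequentially"
    using filterlim_real_sequentially filterlim_sequentially_Suc by (metis (mono_tags))
  ultimately have "filterlim (\<lambda>k. real (Suc k) * m k) at_top sequentially"
    using filterlim_at_top_mult_tendsto_pos by blast
  then have "(\<lambda>k. exp (- (real (Suc k) * m k))) \<longlonglongrightarrow> 0"
    by (intro filterlim_compose[OF exp_at_bot] filterlim_compose[OF filterlim_uminus_at_bot_at_top])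
  then have "(\<lambda>k. 1 - exp (- (real (Suc k) * m k))) \<longlonglongrightarrow> 1 - 0" by (intro tendsto_intros)
  then show ?thesis using True by (simp add: time_step_def m_def)
qed

text \<open>Taking the minimum with \<open>T\<close> keeps the support in time strictly below
  \<open>T\<close> for thresholds of any size.\<close>

lemma bump_step:
  "bump T (\<lambda>x. space_step a1 k (x $ 1) * space_step a2 k (x $ 2) * space_step a3 k (x $ 3)) (time_step (min a T) k)"
  unfolding bump_def
proof (intro conjI)
  show "C2_fun (\<lambda>x::real^3. space_step a1 k (x $ 1) * space_step a2 k (x $ 2) * space_step a3 k (x $ 3))"
    by (intro C2_fun_mult space_step_C2)
  have "space_step a k ((x + (2 * pi) *\<^sub>R axis i 1) $ j) = space_step a k (x $ j)" for a x and i j :: 3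
    by (simp add: axis_def space_step_periodic)
  then show "periodic_x (\<lambda>x::real^3. space_step a1 k (x $ 1) * space_step a2 k (x $ 2) * space_step a3 k (x $ 3))"
    unfolding periodic_x_def by simp
  show "C1_fun (time_step (min a T) k)" by (rule time_step_C1)
  have i: "inverse (real (Suc k)) > 0" by simp
  have "min a T - inverse (real (Suc k)) < T" using i by linarith
  then show "\<exists>t0>0. \<exists>T'<T. \<forall>t. t \<le> t0 \<or> T' \<le> t \<longrightarrow> time_step (min a T) k t = 0"
    using i time_step_zero by blast
qed

lemma AE_QM_coordinate: "AE z in QM T. fst z $ i \<noteq> c" "AE z in QM T. snd z \<noteq> c"
proof -
  have "AE z::pt in lborel. z \<bullet> (axis i 1, 0) \<noteq> c"
    by (rule AE_lborel_inner_neq) (auto simp: Basis_prod_def axis_in_Basis_iff)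
  then show "AE z in QM T. fst z $ i \<noteq> c" unfolding AE_QM
    by eventually_elim (auto simp: inner_prod_def inner_axis)
  have "AE z::pt in lborel. z \<bullet> (0, 1) \<noteq> c"
    by (rule AE_lborel_inner_neq) (auto simp: Basis_prod_def)
  then show "AE z in QM T. snd z \<noteq> c" unfolding AE_QM
    by eventually_elim (auto simp: inner_prod_def)
qed

text \<open>Bumps approximate indicators of lower orthants; these are closed under intersection and
  generate the Borel sets, so Dynkin's argument reaches all Borel indicators, and density of simple
  functions reaches L^1. Each passage is an L^1 limit, admissible because of the common bound
  \<open>C\<close>.\<close>

lemma wnullI:
  assumes R: "\<And>n. R n \<in> borel_measurable borel" "\<And>n z. z \<in> QT T \<Longrightarrow> \<bar>R n z\<bar> \<le> C"
    and bumps: "\<And>X b. bump T X b \<Longrightarrow> (\<lambda>n. \<integral>z. R n z * (X (fst z) * b (snd z)) \<partial>QM T) \<longlonglongrightarrow> 0"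
  shows "wnull T R"
proof -
  define P where "P g \<longleftrightarrow> (\<lambda>n. \<integral>z. R n z * g z \<partial>QM T) \<longlonglongrightarrow> 0" for g
  note lim = integral_QM_weak_limit[of R T C, OF R(1) R(2)]
  have iR: "integrable (QM T) (\<lambda>z. R n z * g z)" if "integrable (QM T) g" for n g
    by (intro integrable_QM_mult[OF that R(1) R(2)]; assumption)
  have ind: "integrable (QM T) (indicator A :: pt \<Rightarrow> real)" if "A \<in> sets borel" for A
    by (rule integrable_QM_bounded[where C=1]) (use that in \<open>auto simp: indicator_def\<close>)
  have bdd: "P g" if f: "\<And>k. P (f k)" "\<And>k. f k \<in> borel_measurable borel" "\<And>k z. \<bar>f k z\<bar> \<le> 1"
      and g: "g \<in> borel_measurable borel" "AE z in QM T. (\<lambda>k. f k z) \<longlonglongrightarrow> g z" "\<And>z. \<bar>g z\<bar> \<le> 1"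
    for f :: "nat \<Rightarrow> pt \<Rightarrow> real" and g
    unfolding P_def
  proof (rule lim)
    show "integrable (QM T) (f k)" for k by (rule integrable_QM_bounded[where C=1]) (use f in auto)
    show "integrable (QM T) g" by (rule integrable_QM_bounded[where C=1]) (use g in auto)
    show "(\<lambda>n. \<integral>z. R n z * f k z \<partial>QM T) \<longlonglongrightarrow> 0" for k using f(1) by (simp add: P_def)
    have "(\<lambda>k. \<integral>z. \<bar>f k z - g z\<bar> \<partial>QM T) \<longlonglongrightarrow> (\<integral>z. 0 \<partial>QM T)"
    proof (rule integral_dominated_convergence[where w = "\<lambda>_. 2"])
      show "(\<lambda>z. \<bar>f k z - g z\<bar>) \<in> borel_measurable (QM T)" for k
        using f(2)[of k] g(1) by (intro measurable_QM) measurable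
      show "AE z in QM T. (\<lambda>k. \<bar>f k z - g z\<bar>) \<longlonglongrightarrow> 0"
        using g(2) by eventually_elim (auto intro: tendsto_rabs_zero LIM_zero)
      show "AE z in QM T. norm \<bar>f k z - g z\<bar> \<le> 2" for k
      proof (intro AE_I2)
        show "norm \<bar>f k z - g z\<bar> \<le> 2" for z
          using f(3)[of k z] g(3)[of z] unfolding real_norm_def by linarith
      qed
    qed auto
    then show "(\<lambda>k. \<integral>z. \<bar>f k z - g z\<bar> \<partial>QM T) \<longlonglongrightarrow> 0" by simp
  qed
  have rect: "P (indicator {..c})" for c :: pt
  proof -
    obtain a \<tau> where c: "c = (a, \<tau>)" by (cases c)
    define f where "f k z = (space_step (a$1) k (fst z $ 1) * space_step (a$2) k (fst z $ 2) * space_step (a$3) k (fst z $ 3))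
      * time_step (min \<tau> T) k (snd z)" for k :: nat and z :: pt
    show ?thesis
    proof (rule bdd[of f])
      show "P (f k)" for k
        unfolding P_def f_def using bumps[OF bump_step[of T "a$1" k "a$2" "a$3" \<tau>]] by simp
      have "continuous_on UNIV (f k)" for k
      proof -
        have "continuous_on UNIV (\<lambda>x::real^3. space_step (a$i) k (x $ i))" for i
          using space_step_C2[of "a$i" k i] unfolding C2_fun_def by (intro C1_fun_continuous_on) blast
        then have "continuous_on UNIV (\<lambda>z::pt. space_step (a$i) k (fst z $ i))" for i
          by (rule continuous_on_compose2[where f=fst]) (auto intro: continuous_intros)
        moreover have "continuous_on UNIV (\<lambda>z::pt. time_step (min \<tau> T) k (snd z))"
          by (rule continuous_on_compose2[OF C1_fun_continuous_on[OF time_step_C1], where s=UNIV and f=snd and t=UNIV]) (auto intro: continuous_intros)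
        ultimately show ?thesis unfolding f_def by (intro continuous_intros)
      qed
      then show "f k \<in> borel_measurable borel" for k by (rule borel_measurable_continuous_onI)
      show "\<bar>f k z\<bar> \<le> 1" for k z
        unfolding f_def abs_mult using space_step_bounds time_step_bounds
        by (intro mult_le_one mult_nonneg_nonneg) auto
      show "indicator {..c} \<in> borel_measurable borel" by simp
      show "AE z in QM T. (\<lambda>k. f k z) \<longlonglongrightarrow> indicator {..c} z"
        \<comment> \<open>The pointwise limit of the steps fails only on finitely many hyperplanes,
          the faces through 0 and through the corner \<open>c\<close>.\<close>
        using AE_QM_coordinate(1)[of 1 0 T] AE_QM_coordinate(1)[of 2 0 T] AE_QM_coordinate(1)[of 3 0 T]
          AE_QM_coordinate(1)[of 1 "a$1" T] AE_QM_coordinate(1)[of 2 "a$2" T] AE_QM_coordinate(1)[of 3 "a$3" T]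
          AE_QM_coordinate(2)[of 0 T] AE_QM_coordinate(2)[of \<tau> T] AE_space
      proof eventually_elim
        case (elim z)
        obtain x t where z: "z = (x, t)" by (cases z)
        have q: "0 \<le> x $ i" "x $ i < 2 * pi" "0 \<le> t" "t < T" for i
          using elim(9) by (auto simp: z QT_def Qbox_def)
        have t: "0 < t" "t \<noteq> min \<tau> T" "t \<le> min \<tau> T \<longleftrightarrow> t \<le> \<tau>"
          using elim(7,8) q(3,4) by (auto simp: z min_def)
        have x: "0 < x $ 1" "0 < x $ 2" "0 < x $ 3" using elim(1-3) q(1)[of 1] q(1)[of 2] q(1)[of 3] by (auto simp: z)
        have "(\<lambda>k. f k z) \<longlonglongrightarrow> (if x $ 1 \<le> a $ 1 then 1 else 0) * (if x $ 2 \<le> a $ 2 then 1 else 0) *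
            (if x $ 3 \<le> a $ 3 then 1 else 0) * (if t \<le> min \<tau> T then 1 else 0)"
          unfolding f_def z fst_conv snd_conv
          by (intro tendsto_mult space_step_limit time_step_limit q t x) (use elim(4-6) in \<open>auto simp: z\<close>)
        moreover have "z \<in> {..c} \<longleftrightarrow> x $ 1 \<le> a $ 1 \<and> x $ 2 \<le> a $ 2 \<and> x $ 3 \<le> a $ 3 \<and> t \<le> \<tau>"
          by (simp add: z c less_eq_vec_def forall_3)
        ultimately show "(\<lambda>k. f k z) \<longlonglongrightarrow> indicator {..c} z" unfolding t(3) by (auto simp: indicator_def split: if_splits)
      qed
    qed (auto simp: indicator_def)
  qed
  have borel: "P (indicator A)" if "A \<in> sets borel" for A
  proof -
    have A: "A \<in> sigma_sets UNIV (range (\<lambda>a::pt. {..a}))"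
      using that by (subst (asm) borel_eq_atMost) simp
    have sets: "B \<in> sets borel" if "B \<in> sigma_sets UNIV (range (\<lambda>a::pt. {..a}))" for B
      using that by (subst borel_eq_atMost) simp
    \<comment> \<open>Complements are differences from the whole space, which is not an orthant; the
      bounded cylinder, however, lies below a single corner \<open>c\<close>.\<close>
    have UNIV: "P (indicator UNIV)"
    proof -
      obtain R0 where R0: "\<And>z. z \<in> QT T \<Longrightarrow> norm z \<le> R0" using QT_bounded by metis
      define c :: pt where "c = (\<Sum>b\<in>Basis. R0 *\<^sub>R b)"
      have "z \<le> c" if "z \<in> QT T" for z
        unfolding eucl_le[of z c]
      proof
        fix b :: pt assume "b \<in> Basis"
        then show "z \<bullet> b \<le> c \<bullet> b"
          using R0[OF that] Basis_le_norm[of b z] by (simp add: c_def inner_sum_left inner_Basis if_distrib cong: if_cong)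
      qed
      then have "(\<integral>z. R n z * indicator UNIV z \<partial>QM T) = (\<integral>z. R n z * indicator {..c} z \<partial>QM T)" for n
        by (intro Bochner_Integration.integral_cong refl) auto
      then show ?thesis using rect[of c] by (simp add: P_def)
    qed
    have sets_UNIV_borel: "(UNIV :: pt set) \<in> sets borel" by simp
    have "Int_stable (range (\<lambda>a::pt. {..a}))"
    proof (rule Int_stableI_image)
      show "\<exists>k\<in>UNIV. {..i} \<inter> {..j} = {..k}" for i j :: pt
        by (rule bexI[of _ "inf i j"]) auto
    qed
    moreover have "range (\<lambda>a::pt. {..a}) \<subseteq> Pow UNIV" by simp
    ultimately show ?thesis
      using A
    proof (induct rule: sigma_sets_induct_disjoint)
      case (basic A)
      then show ?case using rect by auto
    next
      case empty
      then show ?case by (simp add: P_def)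
    next
      case (compl A)
      have "(\<integral>z. R n z * indicator (UNIV - A) z \<partial>QM T) = (\<integral>z. R n z * indicator UNIV z \<partial>QM T) - (\<integral>z. R n z * indicator A z \<partial>QM T)" for n
        unfolding Bochner_Integration.integral_diff[OF iR[OF ind[OF sets_UNIV_borel]] iR[OF ind[OF sets[OF compl(1)]]], symmetric]
        by (intro Bochner_Integration.integral_cong refl) (auto simp: indicator_def)
      then show ?case using tendsto_diff[OF UNIV[unfolded P_def] compl(2)[unfolded P_def]] by (simp add: P_def)
    next
      case (union A)
      have m: "A i \<in> sets borel" for i using union(2) sets by blast
      show ?case
      proof (rule bdd[of "\<lambda>k. indicator (\<Union>i<k. A i)"])
        show "P (indicator (\<Union>i<k. A i))" for k
        proof -
          have "(\<integral>z. R n z * indicator (\<Union>i<k. A i) z \<partial>QM T) = (\<Sum>i<k. \<integral>z. R n z * indicator (A i) z \<partial>QM T)" for n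
          proof -
            have "indicator (\<Union>i<k. A i) z = (\<Sum>i<k. indicator (A i) z :: real)" for z
              by (rule indicator_UN_disjoint) (use union(1) in \<open>auto simp: disjoint_family_on_def\<close>)
            then have "R n z * indicator (\<Union>i<k. A i) z = (\<Sum>i<k. R n z * indicator (A i) z)" for z
              by (simp only: sum_distrib_left)
            then show ?thesis
              by (simp only: Bochner_Integration.integral_sum[OF iR[OF ind[OF m]]])
          qed
          then show ?thesis
            unfolding P_def using tendsto_sum[of "{..<k}" "\<lambda>i n. \<integral>z. R n z * indicator (A i) z \<partial>QM T" "\<lambda>_. 0"] union(3)
            by (simp add: P_def)
        qed
        show "AE z in QM T. (\<lambda>k. indicat_real (\<Union>i<k. A i) z) \<longlonglongrightarrow> indicator (\<Union> (range A)) z"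
          by (intro AE_I2 LIMSEQ_indicator_UN)
      qed (use m in \<open>auto simp: indicator_def\<close>)
    qed
  qed
  have "P g" if "integrable (QM T) g" for g
    using that
  proof induct
    case (base A c)
    have "A \<in> sets borel" using base(1) by (auto simp: QM_def sets_restrict_space)
    then have "(\<lambda>n. (\<integral>z. R n z * indicator A z \<partial>QM T) * c) \<longlonglongrightarrow> 0 * c"
      using borel[of A] unfolding P_def by (intro tendsto_mult_right)
    moreover have "(\<integral>z. R n z * (indicator A z *\<^sub>R c) \<partial>QM T) = (\<integral>z. R n z * indicator A z \<partial>QM T) * c" for n
      by (simp add: mult.assoc[symmetric] del: mult_cancel_right mult_cancel_right1)
    ultimately show ?case by (simp add: P_def)
  next
    case (add f g)
    have "(\<integral>z. R n z * (f z + g z) \<partial>QM T) = (\<integral>z. R n z * f z \<partial>QM T) + (\<integral>z. R n z * g z \<partial>QM T)" for n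
      by (simp add: distrib_left iR add)
    then show ?case using tendsto_add[OF add(2)[unfolded P_def] add(4)[unfolded P_def]] by (simp add: P_def)
  next
    case (lim f s)
    show ?case
      unfolding P_def
    proof (rule integral_QM_weak_limit[of R T C, OF R(1) R(2)])
      show "(\<lambda>n. \<integral>z. R n z * s i z \<partial>QM T) \<longlonglongrightarrow> 0" for i using lim(2) by (simp add: P_def)
      have "(\<lambda>k. \<integral>z. \<bar>s k z - f z\<bar> \<partial>QM T) \<longlonglongrightarrow> (\<integral>z. 0 \<partial>QM T)"
      \<comment> \<open>The approximating simple functions obey |s k| \<le> 2 |f|, whence the factor
        3.\<close>
      proof (rule integral_dominated_convergence[where w = "\<lambda>z. 3 * \<bar>f z\<bar>"])
        show "(\<lambda>z. \<bar>s k z - f z\<bar>) \<in> borel_measurable (QM T)" for k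
          using lim(1)[of k] lim(5) by (auto dest: borel_measurable_integrable)
        show "AE z in QM T. (\<lambda>k. \<bar>s k z - f z\<bar>) \<longlonglongrightarrow> 0"
          by (intro AE_I2 tendsto_rabs_zero LIM_zero lim(3))
        show "AE z in QM T. norm \<bar>s k z - f z\<bar> \<le> 3 * \<bar>f z\<bar>" for k
        proof (intro AE_I2)
          show "norm \<bar>s k z - f z\<bar> \<le> 3 * \<bar>f z\<bar>" if "z \<in> space (QM T)" for z
            using lim(4)[OF that, of k] unfolding real_norm_def by linarith
        qed
      qed (use lim(5) in auto)
      then show "(\<lambda>k. \<integral>z. \<bar>s k z - f z\<bar> \<partial>QM T) \<longlonglongrightarrow> 0" by simp
    qed (use lim(1,5) in auto)
  qed
  then show ?thesis using R unfolding wnull_def P_def by blast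
qed

section \<open>Algebra of weakly null sequences\<close>

lemma wnull_measurable: "wnull T R \<Longrightarrow> R n \<in> borel_measurable borel"
  by (simp add: wnull_def)

lemma wnull_bounded: "wnull T R \<Longrightarrow> \<exists>C. \<forall>n. \<forall>z\<in>QT T. \<bar>R n z\<bar> \<le> C"
  by (simp add: wnull_def)

lemma wnull_integrable:
  assumes "wnull T R" "integrable (QM T) g"
  shows "integrable (QM T) (\<lambda>z. R n z * g z)"
proof -
  obtain C where "\<And>n z. z \<in> QT T \<Longrightarrow> \<bar>R n z\<bar> \<le> C" using wnull_bounded[OF assms(1)] by metis
  then show ?thesis by (intro integrable_QM_mult[OF assms(2) wnull_measurable[OF assms(1)]])
qed

lemma wnullD: "wnull T R \<Longrightarrow> integrable (QM T) g \<Longrightarrow> (\<lambda>n. \<integral>z. R n z * g z \<partial>QM T) \<longlonglongrightarrow> 0"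
  unfolding wnull_def by blast

lemma wnull_zero: "wnull T (\<lambda>n z. 0)"
  unfolding wnull_def by auto

lemma wnull_add:
  assumes R: "wnull T R" and S: "wnull T S"
  shows "wnull T (\<lambda>n z. R n z + S n z)"
  unfolding wnull_def
proof (intro conjI allI impI)
  show "(\<lambda>z. R n z + S n z) \<in> borel_measurable borel" for n
    using R S by (intro borel_measurable_add wnull_measurable)
  obtain C D where C: "\<And>n z. z \<in> QT T \<Longrightarrow> \<bar>R n z\<bar> \<le> C" and D: "\<And>n z. z \<in> QT T \<Longrightarrow> \<bar>S n z\<bar> \<le> D"
    using wnull_bounded[OF R] wnull_bounded[OF S] by metis
  have "\<bar>R n z + S n z\<bar> \<le> C + D" if "z \<in> QT T" for n z
    using C[OF that, of n] D[OF that, of n] by linarith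
  then show "\<exists>C. \<forall>n. \<forall>z\<in>QT T. \<bar>R n z + S n z\<bar> \<le> C" by blast
  fix g :: "pt \<Rightarrow> real" assume g: "integrable (QM T) g"
  have "(\<integral>z. (R n z + S n z) * g z \<partial>QM T) = (\<integral>z. R n z * g z \<partial>QM T) + (\<integral>z. S n z * g z \<partial>QM T)" for n
    by (simp add: distrib_right wnull_integrable[OF R g] wnull_integrable[OF S g])
  then show "(\<lambda>n. \<integral>z. (R n z + S n z) * g z \<partial>QM T) \<longlonglongrightarrow> 0"
    using tendsto_add[OF wnullD[OF R g] wnullD[OF S g]] by simp
qed

lemma wnull_sum: "(\<And>i. i \<in> I \<Longrightarrow> wnull T (R i)) \<Longrightarrow> wnull T (\<lambda>n z. \<Sum>i\<in>I. R i n z)"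
  by (induction I rule: infinite_finite_induct) (auto intro: wnull_zero wnull_add)

text \<open>A weakly null sequence times a boundedly pointwise convergent one. Writing c n = c' + (c
  n - c'), the first part tests with the fixed integrable function c' g, the second tends to 0 by
  dominated convergence.\<close>

lemma wnull_mult:
  assumes R: "wnull T R" and c: "\<And>n. c n \<in> borel_measurable borel" "\<And>n z. z \<in> QT T \<Longrightarrow> \<bar>c n z\<bar> \<le> C"
    and lim: "\<And>z. z \<in> QT T \<Longrightarrow> (\<lambda>n. c n z) \<longlonglongrightarrow> c' z"
  shows "wnull T (\<lambda>n z. c n z * R n z)"
  unfolding wnull_def
proof (intro conjI allI impI)
  obtain D where D: "\<And>n z. z \<in> QT T \<Longrightarrow> \<bar>R n z\<bar> \<le> D" using wnull_bounded[OF R] by metis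
  have Rm: "R n \<in> borel_measurable borel" for n using R by (rule wnull_measurable)
  show "(\<lambda>z. c n z * R n z) \<in> borel_measurable borel" for n using c(1) Rm by measurable
  have CD: "\<bar>c n z * R n z\<bar> \<le> C * D" if "z \<in> QT T" for n z
    unfolding abs_mult using c(2)[OF that] D[OF that] by (intro mult_mono) (auto intro: order_trans[OF abs_ge_zero])
  then show "\<exists>C. \<forall>n. \<forall>z\<in>QT T. \<bar>c n z * R n z\<bar> \<le> C" by blast
  fix g :: "pt \<Rightarrow> real" assume g: "integrable (QM T) g"
  have c'm: "c' \<in> borel_measurable (QM T)"
    by (rule borel_measurable_LIMSEQ_metric[where f = c]) (use lim c(1) in \<open>auto intro: measurable_QM\<close>)
  have c'b: "\<bar>c' z\<bar> \<le> C" if "z \<in> QT T" for z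
    by (rule LIMSEQ_le_const2[OF tendsto_rabs[OF lim[OF that]]]) (use c(2)[OF that] in auto)
  have bnd: "integrable (QM T) (\<lambda>z. a z * g z)" if "a \<in> borel_measurable (QM T)" "\<And>z. z \<in> QT T \<Longrightarrow> \<bar>a z\<bar> \<le> K" for a :: "pt \<Rightarrow> real" and K
  proof (rule Bochner_Integration.integrable_bound[OF integrable_mult_right[OF integrable_norm[OF g], of K]])
    show "(\<lambda>z. a z * g z) \<in> borel_measurable (QM T)" using that(1) g by auto
    show "AE z in QM T. norm (a z * g z) \<le> norm (K * norm (g z))"
      by (intro AE_I2) (auto simp: abs_mult intro!: mult_right_mono intro: order_trans[OF that(2)])
  qed
  have ig': "integrable (QM T) (\<lambda>z. c' z * g z)" by (rule bnd[OF c'm c'b])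
  have icg: "integrable (QM T) (\<lambda>z. c n z * g z)" for n by (rule bnd[OF measurable_QM[OF c(1)] c(2)])
  have eq: "(\<integral>z. c n z * R n z * g z \<partial>QM T) = (\<integral>z. R n z * (c' z * g z) \<partial>QM T) + (\<integral>z. R n z * (c n z * g z - c' z * g z) \<partial>QM T)" for n
    unfolding Bochner_Integration.integral_add[OF wnull_integrable[OF R ig'] wnull_integrable[OF R Bochner_Integration.integrable_diff[OF icg ig']], symmetric]
    by (intro Bochner_Integration.integral_cong refl) (simp add: algebra_simps)
  have "(\<lambda>n. \<integral>z. R n z * (c n z * g z - c' z * g z) \<partial>QM T) \<longlonglongrightarrow> (\<integral>z. 0 \<partial>QM T)"
  proof (rule integral_dominated_convergence[where w = "\<lambda>z. D * (2 * C) * \<bar>g z\<bar>"])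
    show "(\<lambda>z. R n z * (c n z * g z - c' z * g z)) \<in> borel_measurable (QM T)" for n
      using measurable_QM[OF Rm[of n], of T] measurable_QM[OF c(1)[of n], of T] c'm g by auto
    show "AE z in QM T. norm (R n z * (c n z * g z - c' z * g z)) \<le> D * (2 * C) * \<bar>g z\<bar>" for n
    proof (intro AE_I2)
      fix z assume "z \<in> space (QM T)"
      then have z: "z \<in> QT T" by simp
      have "\<bar>c n z - c' z\<bar> \<le> 2 * C" using c(2)[OF z, of n] c'b[OF z] by linarith
      then have "\<bar>R n z\<bar> * (\<bar>c n z - c' z\<bar> * \<bar>g z\<bar>) \<le> D * (2 * C * \<bar>g z\<bar>)"
        using D[OF z, of n] by (intro mult_mono) (auto intro: order_trans[OF abs_ge_zero])
      then show "norm (R n z * (c n z * g z - c' z * g z)) \<le> D * (2 * C) * \<bar>g z\<bar>"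
        by (simp add: abs_mult mult.assoc flip: left_diff_distrib)
    qed
    show "AE z in QM T. (\<lambda>n. R n z * (c n z * g z - c' z * g z)) \<longlonglongrightarrow> 0"
    proof (intro AE_I2)
      fix z assume "z \<in> space (QM T)"
      then have z: "z \<in> QT T" by simp
      have "(\<lambda>n. c n z * g z - c' z * g z) \<longlonglongrightarrow> c' z * g z - c' z * g z"
        by (intro tendsto_intros lim z)
      then have "(\<lambda>n. D * \<bar>c n z * g z - c' z * g z\<bar>) \<longlonglongrightarrow> D * 0"
        by (intro tendsto_mult_left tendsto_rabs_zero) simp
      then have l: "(\<lambda>n. D * \<bar>c n z * g z - c' z * g z\<bar>) \<longlonglongrightarrow> 0" by simp
      show "(\<lambda>n. R n z * (c n z * g z - c' z * g z)) \<longlonglongrightarrow> 0"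
        by (rule Lim_null_comparison[OF always_eventually l]) (auto simp: abs_mult intro!: mult_right_mono D z)
    qed
  qed (use g in auto)
  then show "(\<lambda>n. \<integral>z. c n z * R n z * g z \<partial>QM T) \<longlonglongrightarrow> 0"
    unfolding eq using tendsto_add[OF wnullD[OF R ig']] by fastforce
qed

section \<open>Averages of the Young measure\<close>

lemma C1_fun_snd: "C1_fun \<theta> \<Longrightarrow> C1_fun (\<lambda>z::'a::euclidean_space \<times> 'b::euclidean_space. \<theta> (snd z))"
  by (rule C1_fun_compose[OF _ C1_fun_linear[OF bounded_linear_snd]])

lemma C1_fun_fst: "C1_fun X \<Longrightarrow> C1_fun (\<lambda>z::'a::euclidean_space \<times> 'b::euclidean_space. X (fst z))"
  by (rule C1_fun_compose[OF _ C1_fun_linear[OF bounded_linear_fst]])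

lemma dd_snd: "C1_fun \<theta> \<Longrightarrow> dd (\<lambda>z::'a::euclidean_space \<times> 'b::euclidean_space. \<theta> (snd z)) h z = dd \<theta> (snd h) (snd z)"
  using dd_compose[OF _ C1_fun_linear[OF bounded_linear_snd], of \<theta> h z] dd_linear[OF bounded_linear_snd, of h z] by simp

lemma dd_fst: "C1_fun \<theta> \<Longrightarrow> dd (\<lambda>z::'a::euclidean_space \<times> 'b::euclidean_space. \<theta> (fst z)) h z = dd \<theta> (fst h) (fst z)"
  using dd_compose[OF _ C1_fun_linear[OF bounded_linear_fst], of \<theta> h z] dd_linear[OF bounded_linear_fst, of h z] by simp

lemma dd_0_right: "f differentiable (at z) \<Longrightarrow> dd f 0 z = 0"
  by (rule linear_0[OF linear_dd])

lemma d_t_time_mult: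
  assumes "C1_fun \<theta>" "C1_fun f"
  shows "d_t (\<lambda>z. \<theta> (snd z) * f z) z = dd \<theta> 1 (snd z) * f z + \<theta> (snd z) * d_t f z"
  unfolding d_t_def by (subst dd_mult[OF C1_fun_snd[OF assms(1)] assms(2)]) (simp add: dd_snd[OF assms(1)])

lemma d_x_time_mult:
  assumes "C1_fun \<theta>" "C1_fun f"
  shows "d_x a (\<lambda>z. \<theta> (snd z) * f z) z = \<theta> (snd z) * d_x a f z"
  unfolding d_x_def
  by (subst dd_mult[OF C1_fun_snd[OF assms(1)] assms(2)])
     (simp add: dd_snd[OF assms(1)] dd_0_right[OF C1_fun_differentiable[OF assms(1)]])

lemma product_fn:
  fixes X :: "real^3 \<Rightarrow> real" and b :: "real \<Rightarrow> real"
  assumes X: "C1_fun X" and b: "C1_fun b"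
  shows "C1_fun (\<lambda>z::pt. X (fst z) * b (snd z))"
    "d_t (\<lambda>z::pt. X (fst z) * b (snd z)) = (\<lambda>z. X (fst z) * dd b 1 (snd z))"
    "d_x a (\<lambda>z::pt. X (fst z) * b (snd z)) = (\<lambda>z. dd X (axis a 1) (fst z) * b (snd z))"
proof -
  show "C1_fun (\<lambda>z::pt. X (fst z) * b (snd z))" by (intro C1_fun_mult C1_fun_fst C1_fun_snd X b)
  show "d_t (\<lambda>z::pt. X (fst z) * b (snd z)) = (\<lambda>z. X (fst z) * dd b 1 (snd z))"
    unfolding d_t_def dd_mult[OF C1_fun_fst[OF X] C1_fun_snd[OF b]] dd_fst[OF X] dd_snd[OF b]
    by (simp add: dd_mult[OF C1_fun_fst[OF X] C1_fun_snd[OF b]] dd_fst[OF X] dd_snd[OF b] dd_0_right[OF C1_fun_differentiable[OF X]] fun_eq_iff)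
  show "d_x a (\<lambda>z::pt. X (fst z) * b (snd z)) = (\<lambda>z. dd X (axis a 1) (fst z) * b (snd z))"
    unfolding d_x_def
    by (simp add: dd_mult[OF C1_fun_fst[OF X] C1_fun_snd[OF b]] dd_fst[OF X] dd_snd[OF b] dd_0_right[OF C1_fun_differentiable[OF b]] fun_eq_iff)
qed

lemma periodic_x_dd:
  fixes X :: "real^3 \<Rightarrow> real"
  assumes X: "C1_fun X" and per: "periodic_x X"
  shows "periodic_x (dd X h)"
  unfolding periodic_x_def
proof (intro allI)
  fix x and i :: 3
  define c :: "real^3" where "c = (2 * pi) *\<^sub>R axis i 1"
  have "((\<lambda>x. X (x + c)) has_derivative (\<lambda>h. dd X h (x + c))) (at x)"
    by (rule has_derivative_compose[of "\<lambda>x. x + c" "\<lambda>h. h", OF _ C1_fun_has_derivative[OF X], unfolded o_def])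
       (auto intro!: derivative_eq_intros)
  moreover have "(\<lambda>x. X (x + c)) = X" using per by (auto simp: periodic_x_def c_def)
  ultimately show "dd X h (x + (2 * pi) *\<^sub>R axis i 1) = dd X h x"
    using dd_eqI by (metis c_def)
qed

lemma product_test_fn:
  assumes "C1_fun X" "periodic_x X" "C1_fun b" "T' < T" "\<And>t. T' \<le> t \<Longrightarrow> b t = 0"
  shows "test_fn T (\<lambda>z. X (fst z) * b (snd z))"
  unfolding test_fn_def
proof (intro conjI)
  show "periodic (\<lambda>z. X (fst z) * b (snd z))" using assms(2) by (simp add: periodic_def periodic_x_def)
  show "\<exists>T'<T. \<forall>x t. T' \<le> t \<longrightarrow> X (fst (x, t)) * b (snd (x, t)) = 0" using assms(4,5) by auto
qed (rule product_fn(1)[OF assms(1,3)])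

lemma integrable_QM_scaleR_cont:
  fixes g :: "pt \<Rightarrow> 'b::{banach, second_countable_topology}"
  assumes "integrable (QM T) g" "continuous_on UNIV f"
  shows "integrable (QM T) (\<lambda>z. f z *\<^sub>R g z)"
proof -
  obtain C where C: "\<And>z. z \<in> QT T \<Longrightarrow> \<bar>f z\<bar> \<le> C" using bounded_on_QT[OF assms(2)] by metis
  show ?thesis
  proof (rule Bochner_Integration.integrable_bound[OF integrable_mult_right[OF integrable_norm[OF assms(1)], of C]])
    show "(\<lambda>z. f z *\<^sub>R g z) \<in> borel_measurable (QM T)"
      using assms(1) measurable_QM[OF borel_measurable_continuous_onI[OF assms(2)]] by (intro borel_measurable_scaleR) auto
    show "AE z in QM T. norm (f z *\<^sub>R g z) \<le> norm (C * norm (g z))"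
      by (intro AE_I2) (auto simp: abs_mult intro!: mult_right_mono intro: order_trans[OF C])
  qed
qed

lemma integrable_QB_scaleR_cont:
  fixes g :: "real^3 \<Rightarrow> 'b::{banach, second_countable_topology}"
  assumes "integrable QB g" "continuous_on UNIV f"
  shows "integrable QB (\<lambda>z. f z *\<^sub>R g z)"
proof -
  obtain C where C: "\<And>z. z \<in> Qbox \<Longrightarrow> \<bar>f z\<bar> \<le> C" using bounded_on_Qbox[OF assms(2)] by metis
  show ?thesis
  proof (rule Bochner_Integration.integrable_bound[OF integrable_mult_right[OF integrable_norm[OF assms(1)], of C]])
    show "(\<lambda>z. f z *\<^sub>R g z) \<in> borel_measurable QB"
      using assms(1) measurable_QB[OF borel_measurable_continuous_onI[OF assms(2)]] by (intro borel_measurable_scaleR) auto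
    show "AE z in QB. norm (f z *\<^sub>R g z) \<le> norm (C * norm (g z))"
      by (intro AE_I2) (auto simp: abs_mult intro!: mult_right_mono intro: order_trans[OF C])
  qed
qed

lemma continuous_on_initial: "continuous_on UNIV \<phi> \<Longrightarrow> continuous_on UNIV (\<lambda>x. \<phi> (x, 0::real))"
  for \<phi> :: "'a::topological_space \<times> real \<Rightarrow> 'b::topological_space"
  by (rule continuous_on_compose2[where f="\<lambda>x. (x, 0)"]) (auto intro: continuous_intros)

lemma weak_cons_law_inner:
  fixes U :: "pt \<Rightarrow> 'b::euclidean_space"
  assumes w: "weak_cons_law T U Flx U0" and t: "test_fn T \<phi>"
    and U: "integrable (QM T) U" and Flx: "\<And>a. integrable (QM T) (Flx a)" and U0: "integrable QB U0"
  shows "(\<integral>z. d_t \<phi> z * (U z \<bullet> b) - (\<Sum>a\<in>UNIV. d_x a \<phi> z * (Flx a z \<bullet> b)) \<partial>QM T) + (\<integral>x. \<phi> (x, 0) * (U0 x \<bullet> b) \<partial>QB) = 0"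
proof -
  have p: "C1_fun \<phi>" using t by (simp add: test_fn_def)
  have i1: "integrable (QM T) (\<lambda>z. d_t \<phi> z *\<^sub>R U z - (\<Sum>a\<in>UNIV. d_x a \<phi> z *\<^sub>R Flx a z))"
    unfolding d_t_def d_x_def
    by (intro Bochner_Integration.integrable_diff Bochner_Integration.integrable_sum integrable_QM_scaleR_cont U Flx C1_fun_continuous_on_dd p)
  have i2: "integrable QB (\<lambda>x. \<phi> (x, 0) *\<^sub>R U0 x)"
    by (intro integrable_QB_scaleR_cont U0 continuous_on_initial C1_fun_continuous_on p)
  have "((\<integral>z. d_t \<phi> z *\<^sub>R U z - (\<Sum>a\<in>UNIV. d_x a \<phi> z *\<^sub>R Flx a z) \<partial>QM T) + (\<integral>x. \<phi> (x, 0) *\<^sub>R U0 x \<partial>QB)) \<bullet> b = 0"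
    using w t unfolding weak_cons_law_def LINT_QM LINT_QB by simp
  then show ?thesis
    unfolding inner_add_left using integral_inner_left[of b, OF i1] integral_inner_left[of b, OF i2]
    by (simp add: inner_diff_left inner_sum_left)
qed

text \<open>Nonnegativity of the variance.\<close>

lemma (in prob_space) square_integral_le:
  fixes f :: "'a \<Rightarrow> real"
  assumes "integrable M f" "integrable M (\<lambda>x. (f x)\<^sup>2)"
  shows "(\<integral>x. f x \<partial>M)\<^sup>2 \<le> (\<integral>x. (f x)\<^sup>2 \<partial>M)"
proof -
  define m where "m = (\<integral>x. f x \<partial>M)"
  have "0 \<le> (\<integral>x. (f x - m)\<^sup>2 \<partial>M)" by (rule integral_nonneg_AE) simp
  also have "\<dots> = (\<integral>x. (f x)\<^sup>2 - 2 * m * f x + m\<^sup>2 \<partial>M)"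
    by (intro Bochner_Integration.integral_cong refl) (simp add: power2_eq_square algebra_simps)
  also have "\<dots> = (\<integral>x. (f x)\<^sup>2 \<partial>M) - 2 * m * m + m\<^sup>2"
    using assms by (simp add: m_def prob_space)
  finally show ?thesis by (simp add: m_def power2_eq_square)
qed

lemma (in prob_space) norm_integral_square_le:
  fixes f :: "'a \<Rightarrow> 'b::{banach, second_countable_topology}"
  assumes "integrable M f" "integrable M (\<lambda>x. (norm (f x))\<^sup>2)"
  shows "(norm (\<integral>x. f x \<partial>M))\<^sup>2 \<le> (\<integral>x. (norm (f x))\<^sup>2 \<partial>M)"
proof -
  have "(norm (\<integral>x. f x \<partial>M))\<^sup>2 \<le> (\<integral>x. norm (f x) \<partial>M)\<^sup>2"
    by (intro power_mono integral_norm_bound) simp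
  also have "\<dots> \<le> (\<integral>x. (norm (f x))\<^sup>2 \<partial>M)"
    by (rule square_integral_le) (use assms in auto)
  finally show ?thesis .
qed

locale weak_strong = energy G p q r for G p q r +
  fixes T :: real and v0 :: "real^3 \<Rightarrow> real^3" and F0 :: "real^3 \<Rightarrow> mat3"
    and y v :: "pt \<Rightarrow> real^3" and F :: "pt \<Rightarrow> mat3"
    and \<nu> :: "pt \<Rightarrow> ((real^3) \<times> xi) measure" and \<gamma> :: "pt measure"
    and vh :: "pt \<Rightarrow> real^3" and Fh :: "pt \<Rightarrow> mat3"
  assumes T_pos: "0 < T"
    and sol: "dmv_solution G p T v0 F0 y v F \<nu> \<gamma>"
    and hat: "lipschitz_solution G T vh Fh"
    and init: "AE x in lborel. x \<in> Qbox \<longrightarrow> v0 x = vh (x, 0) \<and> Phi (F0 x) = Phi (Fh (x, 0))"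
begin

lemma young: "young_generated G T \<nu>"
  using sol unfolding dmv_solution_def by blast

lemma nu_prob: "prob_space (\<nu> z)" and nu_sets: "sets (\<nu> z) = sets borel"
  and nu_emeasure: "B \<in> sets borel \<Longrightarrow> (\<lambda>z. emeasure (\<nu> z) B) \<in> borel_measurable borel"
  using young unfolding young_generated_def by blast+

lemma nu_measurable [measurable]: "\<nu> \<in> borel \<rightarrow>\<^sub>M subprob_algebra borel"
  by (rule measurable_subprob_algebra)
     (auto intro: prob_space_imp_subprob_space nu_prob nu_sets nu_emeasure simp: nu_sets)

lemma measurable_nu: "g \<in> borel_measurable borel \<Longrightarrow> g \<in> borel_measurable (\<nu> z)"
  using measurable_cong_sets[OF nu_sets refl] by blast

lemma avg_measurable:
  fixes g :: "(real^3) \<times> xi \<Rightarrow> 'b::{banach, second_countable_topology}"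
  assumes "g \<in> borel_measurable borel"
  shows "(\<lambda>z. \<integral>l. g l \<partial>\<nu> z) \<in> borel_measurable borel"
  by (rule measurable_compose[OF nu_measurable integral_measurable_subprob_algebra[OF assms]])

definition avg_eta :: "pt \<Rightarrow> real" where "avg_eta z = (\<integral>l. eta G l \<partial>\<nu> z)"

text \<open>Gathers the properties of \<nu> that hold almost everywhere, so that all later estimates
  are pointwise statements at good points.\<close>

definition good :: "pt \<Rightarrow> bool" where
  "good z \<longleftrightarrow> integrable (\<nu> z) (eta G) \<and> F z = (\<integral>l. fst (snd l) \<partial>\<nu> z) \<and> v z = (\<integral>l. fst l \<partial>\<nu> z)
      \<and> (\<integral>l. snd l \<partial>\<nu> z) = Phi (F z)"

lemma AE_good: "AE z in QM T. good z"
proof -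
  have "AE z in QM T. integrable (\<nu> z) (eta G)"
    using sol unfolding dmv_solution_def AE_QM by blast
  moreover have "AE z in QM T. F z = (\<integral>l. fst (snd l) \<partial>\<nu> z) \<and> v z = (\<integral>l. fst l \<partial>\<nu> z)
      \<and> (\<integral>l. snd l \<partial>\<nu> z) = Phi (F z)"
    using sol unfolding dmv_solution_def AE_QM by blast
  ultimately show ?thesis by eventually_elim (simp add: good_def)
qed

lemma v_measurable [measurable]: "v \<in> borel_measurable borel" and F_measurable [measurable]: "F \<in> borel_measurable borel"
  using sol unfolding dmv_solution_def Linf_Ls_def by blast+

lemma Phi_F_measurable [measurable]: "(\<lambda>z. Phi (F z)) \<in> borel_measurable borel"
  by (rule measurable_compose[OF F_measurable borel_measurable_continuous_onI[OF C1_fun_continuous_on[OF C1_fun_Phi]]])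

lemma avg_eta_integrable: "integrable (QM T) avg_eta"
  using sol unfolding dmv_solution_def integrable_QM avg_eta_def by blast

lemma eta_measurable [measurable]: "eta G \<in> borel_measurable borel"
  unfolding eta_def
  by (intro borel_measurable_continuous_onI continuous_intros continuous_on_compose2[OF C1_fun_continuous_on[OF G_C1, of UNIV]]) auto

lemma eta_nonneg: "0 \<le> eta G l"
  unfolding eta_def using G_nonneg by simp

text \<open>Strong convexity compared at the base point 0 yields quadratic growth of
  \<open>G\<close>; the linear term at 0 is absorbed by half of the quadratic one, which produces
  the constant \<open>A\<^sup>2 / (2 * c)\<close>.\<close>

lemma eta_coercive:
  obtains C where "C \<ge> 1" "\<And>l. (norm (fst l))\<^sup>2 + (norm (snd l))\<^sup>2 \<le> C * (eta G l + 1)"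
proof -
  obtain c where c: "c > 0" "\<And>L X. c * (norm (L - X))\<^sup>2 \<le> rel_energy G L X" using rel_energy_lower by metis
  obtain A where A: "A \<ge> 0" "\<And>h. \<bar>dd G h 0\<bar> \<le> A * norm h"
    using dd_bounded_cball[OF G_C1, of 0] by (metis norm_zero order_refl)
  have X: "(norm X)\<^sup>2 \<le> (2 / c) * (G X + A\<^sup>2 / (2 * c))" for X :: xi
  proof -
    have "c * (norm X)\<^sup>2 \<le> G X - G 0 - dd G X 0" using c(2)[of X 0] by (simp add: rel_energy_def)
    also have "\<dots> \<le> G X + A * norm X" using A(2)[of X] G_nonneg[of 0] by (simp add: abs_le_iff)
    also have "A * norm X \<le> c / 2 * (norm X)\<^sup>2 + A\<^sup>2 / (2 * c)"
    proof -
      have "0 \<le> (c * norm X - A)\<^sup>2 / (2 * c)" using c(1) by simp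
      then show ?thesis using c(1) by (simp add: power2_eq_square field_simps)
    qed
    finally have "c / 2 * (norm X)\<^sup>2 \<le> G X + A\<^sup>2 / (2 * c)" by simp
    then show ?thesis using c(1) by (simp add: field_simps)
  qed
  define C where "C = 2 + 2 / c + (2 / c) * (A\<^sup>2 / (2 * c))"
  show ?thesis
  proof (rule that[of C])
    show "C \<ge> 1" using c(1) by (simp add: C_def add_nonneg_nonneg)
    fix l :: "(real^3) \<times> xi"
    have "(norm (fst l))\<^sup>2 = 2 * ((norm (fst l))\<^sup>2 / 2)" by simp
    have a: "(2 / c) \<ge> 0" "(2 / c) * (A\<^sup>2 / (2 * c)) \<ge> 0" using c(1) by auto
    have g: "G (snd l) \<ge> 0" "(norm (fst l))\<^sup>2 / 2 \<ge> 0" using G_nonneg by auto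
    have "C * (eta G l + 1) = 2 * ((norm (fst l))\<^sup>2 / 2) + (2 / c) * (G (snd l) + A\<^sup>2 / (2 * c))
       + (2 / c) * ((norm (fst l))\<^sup>2 / 2) + (2 / c) * (A\<^sup>2 / (2 * c)) * ((norm (fst l))\<^sup>2 / 2 + G (snd l)) + 2 * G (snd l) + 2 + 2 / c"
      by (simp add: C_def eta_def algebra_simps)
    also have "\<dots> \<ge> 2 * ((norm (fst l))\<^sup>2 / 2) + (2 / c) * (G (snd l) + A\<^sup>2 / (2 * c))"
    proof -
      have "0 \<le> (2 / c) * ((norm (fst l))\<^sup>2 / 2)" using a g by (intro mult_nonneg_nonneg) auto
      moreover have "0 \<le> (2 / c) * (A\<^sup>2 / (2 * c)) * ((norm (fst l))\<^sup>2 / 2 + G (snd l))"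
        using a g by (intro mult_nonneg_nonneg add_nonneg_nonneg) auto
      ultimately show ?thesis using a g by linarith
    qed
    finally show "(norm (fst l))\<^sup>2 + (norm (snd l))\<^sup>2 \<le> C * (eta G l + 1)"
      using X[of "snd l"] by linarith
  qed
qed

lemma integrable_nu:
  fixes g :: "(real^3) \<times> xi \<Rightarrow> 'b::{banach, second_countable_topology}"
  assumes z: "good z" and g: "g \<in> borel_measurable borel" "\<And>l. norm (g l) \<le> C * (eta G l + 1)"
  shows "integrable (\<nu> z) g" and "norm (\<integral>l. g l \<partial>\<nu> z) \<le> C * (avg_eta z + 1)"
proof -
  interpret prob_space "\<nu> z" by (rule nu_prob)
  have i: "integrable (\<nu> z) (\<lambda>l. C * (eta G l + 1))" using z by (simp add: good_def)
  show ig: "integrable (\<nu> z) g"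
  proof (rule Bochner_Integration.integrable_bound[OF i measurable_nu[OF g(1)]])
    show "AE l in \<nu> z. norm (g l) \<le> norm (C * (eta G l + 1))"
      using order_trans[OF g(2) abs_ge_self] by (intro AE_I2) simp
  qed
  have "norm (\<integral>l. g l \<partial>\<nu> z) \<le> (\<integral>l. norm (g l) \<partial>\<nu> z)" by (rule integral_norm_bound)
  also have "\<dots> \<le> (\<integral>l. C * (eta G l + 1) \<partial>\<nu> z)"
    by (rule integral_mono[OF integrable_norm[OF ig] i g(2)])
  also have "\<dots> = C * (avg_eta z + 1)" using z by (simp add: avg_eta_def good_def prob_space)
  finally show "norm (\<integral>l. g l \<partial>\<nu> z) \<le> C * (avg_eta z + 1)" .
qed

lemma integrable_QM_avg_eta_bound:
  fixes f :: "pt \<Rightarrow> 'b::{banach, second_countable_topology}"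
  assumes f: "f \<in> borel_measurable borel" and b: "\<And>z. good z \<Longrightarrow> norm (f z) \<le> C * (avg_eta z + 1)"
  shows "integrable (QM T) f"
proof (rule Bochner_Integration.integrable_bound)
  show "integrable (QM T) (\<lambda>z. C * (avg_eta z + 1))" using avg_eta_integrable by simp
  show "f \<in> borel_measurable (QM T)" by (rule measurable_QM[OF f])
  show "AE z in QM T. norm (f z) \<le> norm (C * (avg_eta z + 1))"
    using AE_good by eventually_elim (use order_trans[OF b abs_ge_self] in simp)
qed

lemma norm_le_square: "x \<le> 1 + x\<^sup>2" for x :: real
  using zero_le_power2[of "x - 1/2"] by (simp add: power2_eq_square field_simps)

lemma eta_growth:
  obtains C where "C \<ge> 1" "\<And>l. (norm (fst l))\<^sup>2 \<le> C * (eta G l + 1)" "\<And>l. (norm (snd l))\<^sup>2 \<le> C * (eta G l + 1)"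
    "\<And>l. norm (fst l) \<le> C * (eta G l + 1)" "\<And>l. norm (snd l) \<le> C * (eta G l + 1)"
    "\<And>i a l. \<bar>flux G i a l\<bar> \<le> C * (eta G l + 1)"
proof -
  obtain C where C: "C \<ge> 1" "\<And>l. (norm (fst l))\<^sup>2 + (norm (snd l))\<^sup>2 \<le> C * (eta G l + 1)" using eta_coercive by metis
  obtain D where D: "D \<ge> 0" "\<And>i a X. \<bar>stress i a X\<bar> \<le> D * (G X + 1)" using stress_le_G by metis
  have e: "1 \<le> eta G l + 1" for l using eta_nonneg[of l] by simp
  have le: "x \<le> (1 + C + D) * (eta G l + 1)" if "x \<le> K * (eta G l + 1)" "K \<le> 1 + C + D" for x K l
    using that mult_right_mono[OF that(2), of "eta G l + 1"] e[of l] by linarith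
  show ?thesis
  proof (rule that[of "1 + C + D"])
    show "1 \<le> 1 + C + D" using C D by simp
    fix l :: "(real^3) \<times> xi" and i a
    have sq: "(norm (fst l))\<^sup>2 \<le> C * (eta G l + 1)" "(norm (snd l))\<^sup>2 \<le> C * (eta G l + 1)"
      using C(2)[of l] zero_le_power2[of "norm (snd l)"] zero_le_power2[of "norm (fst l)"] by linarith+
    show "(norm (fst l))\<^sup>2 \<le> (1 + C + D) * (eta G l + 1)" "(norm (snd l))\<^sup>2 \<le> (1 + C + D) * (eta G l + 1)"
      by (rule le[OF sq(1)], use D in simp, rule le[OF sq(2)], use D in simp)
    have "norm (fst l) \<le> (1 + C) * (eta G l + 1)" "norm (snd l) \<le> (1 + C) * (eta G l + 1)"
      using order_trans[OF norm_le_square add_mono[OF e[of l] sq(1)]] order_trans[OF norm_le_square add_mono[OF e[of l] sq(2)]]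
      unfolding distrib_right[of 1 C] by simp_all
    then show "norm (fst l) \<le> (1 + C + D) * (eta G l + 1)" "norm (snd l) \<le> (1 + C + D) * (eta G l + 1)"
      using D by (auto intro: le)
    have "\<bar>flux G i a l\<bar> \<le> D * (eta G l + 1)"
      unfolding flux_eq_stress by (rule order_trans[OF D(2)]) (use D in \<open>auto simp: eta_def intro!: mult_left_mono\<close>)
    then show "\<bar>flux G i a l\<bar> \<le> (1 + C + D) * (eta G l + 1)" using C by (auto intro: le)
  qed
qed

lemma flux_measurable: "flux G i a \<in> borel_measurable borel"
proof -
  have "flux G i a = (\<lambda>l. \<Sum>b\<in>Basis. (dd Phi (Emat i a) (fst (snd l)) \<bullet> b) * dd G b (snd l))"
    unfolding flux_def by (rule ext) (subst dd_Basis[OF G_diff], simp)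
  also have "\<dots> \<in> borel_measurable borel"
    by (intro borel_measurable_continuous_onI continuous_intros
        continuous_on_compose2[OF C1_fun_continuous_on[OF dG_C1, of UNIV]]
        continuous_on_compose2[OF C1_fun_continuous_on[OF C1_fun_dd_Phi, of UNIV]]) auto
  finally show ?thesis .
qed

lemma fst_snd_measurable: "(\<lambda>l::(real^3) \<times> xi. fst l) \<in> borel_measurable borel" "(\<lambda>l::(real^3) \<times> xi. snd l) \<in> borel_measurable borel"
  by (intro borel_measurable_continuous_onI continuous_intros)+

text \<open>\<open>v\<close> and \<open>Phi (F z)\<close> are barycentres of \<nu>, so Jensen's
  inequality transfers the quadratic bounds from the energy density to them; it is the weak form of
  their square integrability.\<close>

lemma avg_bounds:
  obtains C where "C \<ge> 1"
    "\<And>z. good z \<Longrightarrow> (norm (v z))\<^sup>2 \<le> C * (avg_eta z + 1)" "\<And>z. good z \<Longrightarrow> (norm (Phi (F z)))\<^sup>2 \<le> C * (avg_eta z + 1)"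
    "\<And>z. good z \<Longrightarrow> norm (v z) \<le> C * (avg_eta z + 1)" "\<And>z. good z \<Longrightarrow> norm (Phi (F z)) \<le> C * (avg_eta z + 1)"
    "\<And>i a z. good z \<Longrightarrow> \<bar>\<integral>l. flux G i a l \<partial>\<nu> z\<bar> \<le> C * (avg_eta z + 1)"
proof -
  obtain C where C: "C \<ge> 1" "\<And>l. (norm (fst l))\<^sup>2 \<le> C * (eta G l + 1)" "\<And>l. (norm (snd l))\<^sup>2 \<le> C * (eta G l + 1)"
    "\<And>l. norm (fst l) \<le> C * (eta G l + 1)" "\<And>l. norm (snd l) \<le> C * (eta G l + 1)"
    "\<And>i a l. \<bar>flux G i a l\<bar> \<le> C * (eta G l + 1)" using eta_growth by metis
  have sqm: "(\<lambda>l::(real^3) \<times> xi. (norm (fst l))\<^sup>2) \<in> borel_measurable borel" "(\<lambda>l::(real^3) \<times> xi. (norm (snd l))\<^sup>2) \<in> borel_measurable borel"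
    by (intro borel_measurable_continuous_onI continuous_intros)+
  show ?thesis
  proof (rule that[OF C(1)])
    fix z i a assume z: "good z"
    interpret prob_space "\<nu> z" by (rule nu_prob)
    have vP: "v z = (\<integral>l. fst l \<partial>\<nu> z)" "Phi (F z) = (\<integral>l. snd l \<partial>\<nu> z)" using z by (auto simp: good_def)
    show "norm (v z) \<le> C * (avg_eta z + 1)" unfolding vP by (rule integrable_nu(2)[OF z fst_snd_measurable(1) C(4)])
    show "norm (Phi (F z)) \<le> C * (avg_eta z + 1)" unfolding vP by (rule integrable_nu(2)[OF z fst_snd_measurable(2) C(5)])
    have "(norm (\<integral>l. fst l \<partial>\<nu> z))\<^sup>2 \<le> (\<integral>l. (norm (fst l))\<^sup>2 \<partial>\<nu> z)"
      by (intro norm_integral_square_le integrable_nu(1)[OF z fst_snd_measurable(1) C(4)] integrable_nu(1)[OF z sqm(1), of C]) (use C(2) in simp)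
    also have "\<dots> \<le> C * (avg_eta z + 1)" using integrable_nu(2)[OF z sqm(1), of C] C(2) by (simp add: abs_le_iff)
    finally show "(norm (v z))\<^sup>2 \<le> C * (avg_eta z + 1)" unfolding vP .
    have "(norm (\<integral>l. snd l \<partial>\<nu> z))\<^sup>2 \<le> (\<integral>l. (norm (snd l))\<^sup>2 \<partial>\<nu> z)"
      by (intro norm_integral_square_le integrable_nu(1)[OF z fst_snd_measurable(2) C(5)] integrable_nu(1)[OF z sqm(2), of C]) (use C(3) in simp)
    also have "\<dots> \<le> C * (avg_eta z + 1)" using integrable_nu(2)[OF z sqm(2), of C] C(3) by (simp add: abs_le_iff)
    finally show "(norm (Phi (F z)))\<^sup>2 \<le> C * (avg_eta z + 1)" unfolding vP .
    show "\<bar>\<integral>l. flux G i a l \<partial>\<nu> z\<bar> \<le> C * (avg_eta z + 1)"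
      using integrable_nu(2)[OF z flux_measurable, of i a C] C(6) by simp
  qed
qed

lemma v_integrable: "integrable (QM T) v" and Phi_F_integrable: "integrable (QM T) (\<lambda>z. Phi (F z))"
proof -
  obtain C where C: "\<And>z. good z \<Longrightarrow> norm (v z) \<le> C * (avg_eta z + 1)" "\<And>z. good z \<Longrightarrow> norm (Phi (F z)) \<le> C * (avg_eta z + 1)"
    using avg_bounds by metis
  show "integrable (QM T) v" by (rule integrable_QM_avg_eta_bound[OF v_measurable C(1)])
  show "integrable (QM T) (\<lambda>z. Phi (F z))" by (rule integrable_QM_avg_eta_bound[OF Phi_F_measurable C(2)])
qed

lemma F_integrable: "integrable (QM T) F"
proof (rule Bochner_Integration.integrable_bound[OF Phi_F_integrable measurable_QM[OF F_measurable]])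
  show "AE z in QM T. norm (F z) \<le> norm (Phi (F z))"
    using norm_fst_le by (intro AE_I2) (auto simp: Phi_def)
qed

definition avg_flux :: "3 \<Rightarrow> 3 \<Rightarrow> pt \<Rightarrow> real" where "avg_flux i a z = (\<integral>l. flux G i a l \<partial>\<nu> z)"

lemma avg_flux_integrable: "integrable (QM T) (avg_flux i a)"
proof -
  obtain C where C: "\<And>i a z. good z \<Longrightarrow> \<bar>\<integral>l. flux G i a l \<partial>\<nu> z\<bar> \<le> C * (avg_eta z + 1)" using avg_bounds by metis
  show ?thesis unfolding avg_flux_def[abs_def]
    by (rule integrable_QM_avg_eta_bound[OF avg_measurable[OF flux_measurable]]) (use C in auto)
qed

end

section \<open>Weak equations for the two solutions\<close>

text \<open>Normalised at the right end, so that the primitive is still a test function in time. It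
  need not vanish at 0, which brings initial data into play on purpose.\<close>

lemma continuous_antiderivative:
  fixes b :: "real \<Rightarrow> real"
  assumes b: "C1_fun b" and van: "\<And>t. T' \<le> t \<Longrightarrow> b t = 0"
  obtains B where "C1_fun B" "\<And>t. dd B 1 t = b t" "\<And>t. T' \<le> t \<Longrightarrow> B t = 0"
proof -
  have "isCont b x" for x
    using C1_fun_continuous_on[OF b, of UNIV] by (simp add: continuous_on_eq_continuous_at)
  then obtain H where "\<And>x. (H has_vector_derivative b x) (at x)"
    using einterval_antiderivative[of "-\<infinity>" "\<infinity>" b] by auto
  then have H: "(H has_real_derivative b x) (at x)" for x
    by (simp add: has_real_derivative_iff_has_vector_derivative)
  define B where "B t = H t - H T'" for t
  have B: "(B has_real_derivative b x) (at x)" for x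
    unfolding B_def using DERIV_diff[OF H DERIV_const] by simp
  show ?thesis
  proof (rule that[of B])
    show "C1_fun B" by (rule C1_fun_real[OF B C1_fun_continuous_on[OF b]])
    show "dd B 1 t = b t" for t using dd_real[OF B] by simp
    show "B t = 0" if t: "T' \<le> t" for t
    proof (cases "T' = t")
      case False
      then have "T' < t" using t by simp
      then obtain s where "T' < s" "H t - H T' = (t - T') * b s" using MVT2[of T' t H b] H by blast
      then show ?thesis using van[of s] by (simp add: B_def)
    qed (simp add: B_def)
  qed
qed

lemma periodic_dd:
  fixes f :: "pt \<Rightarrow> 'b::real_normed_vector"
  assumes f: "\<And>z. f differentiable (at z)" and per: "periodic f"
  shows "periodic (dd f h)"
  unfolding periodic_def
proof (intro allI)
  fix x t and i :: 3
  define c :: pt where "c = ((2 * pi) *\<^sub>R axis i 1, 0)"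
  have 1: "((\<lambda>z. z + c) has_derivative (\<lambda>h. h)) (at z)" for z by (auto intro!: derivative_eq_intros)
  have "((\<lambda>z. f (z + c)) has_derivative (\<lambda>h. dd f h (z + c))) (at z)" for z
    by (rule has_derivative_compose[OF 1 has_derivative_dd[OF f]])
  moreover have "(\<lambda>z. f (z + c)) = f" using per by (auto simp: periodic_def c_def)
  ultimately have "dd f h z = dd f h (z + c)" for z using dd_eqI by metis
  from this[of "(x, t)"] show "dd f h (x + (2 * pi) *\<^sub>R axis i 1, t) = dd f h (x, t)" by (simp add: c_def)
qed

lemma C2_fun_fst:
  assumes "C2_fun X" shows "C2_fun (\<lambda>z::'a::euclidean_space \<times> 'b::euclidean_space. X (fst z))"
proof (rule C2_fun_compose[OF assms])
  show "C1_fun (fst :: 'a \<times> 'b \<Rightarrow> 'a)" by (rule C1_fun_linear[OF bounded_linear_fst])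
  have "dd fst h = (\<lambda>z::'a \<times> 'b. fst h)" for h by (rule ext) (rule dd_linear[OF bounded_linear_fst])
  then show "C1_fun (dd (fst :: 'a \<times> 'b \<Rightarrow> 'a) h)" for h by simp
qed

lemma Phi_inner_slot: "Phi M \<bullet> (Emat k e, 0, 0) = M $ k $ e"
  by (simp add: Phi_def inner_Emat)

text \<open>Testing the geometric law with the slot \<open>(Emat k e, 0, 0)\<close> reduces it to
  the strain equation d_t F_{ke} = d_e v_k.\<close>

lemma sum_dd_Phi_inner_slot:
  fixes u :: "real^3"
  shows "(\<Sum>i\<in>UNIV. u $ i * (dd Phi (Emat i e') M \<bullet> (Emat k e, 0, 0))) = (if e' = e then u $ k else 0)"
proof -
  have "dd Phi (Emat i e') M \<bullet> (Emat k e, 0, 0) = (if i = k \<and> e' = e then 1 else 0)" for i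
    unfolding dd_Phi_Emat_inner by (simp add: ccof.zero_left) (auto simp: Emat_def)
  then have "(\<Sum>i\<in>UNIV. u $ i * (dd Phi (Emat i e') M \<bullet> (Emat k e, 0, 0)))
      = (\<Sum>i\<in>UNIV. if i = k then (if e' = e then u $ k else 0) else 0)"
    by (intro sum.cong) auto
  then show ?thesis by simp
qed

lemma sum_if_eq: "(\<Sum>e'\<in>(UNIV::3 set). g e' * (if e' = e then h else 0)) = g e * (h::real)"
  by (simp add: if_distrib cong: if_cong)

context weak_strong begin

text \<open>Freezing the Lipschitz solution outside \<open>[0, T]\<close> makes it globally Lipschitz, as needed for mollifying.\<close>

definition clamp :: "pt \<Rightarrow> pt" where "clamp z = (fst z, max 0 (min T (snd z)))"

definition Wc :: "pt \<Rightarrow> (real^3) \<times> mat3" where "Wc z = (vh (clamp z), Fh (clamp z))"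

lemma clamp_QT: "z \<in> QT T \<Longrightarrow> clamp z = z" and clamp_0: "clamp (x, 0) = (x, 0)"
  using T_pos by (auto simp: clamp_def QT_def)

lemma Wc_lipschitz: obtains L where "L-lipschitz_on UNIV Wc"
proof -
  obtain L1 L2 where L: "L1-lipschitz_on (UNIV \<times> {0..T}) vh" "L2-lipschitz_on (UNIV \<times> {0..T}) Fh"
    using hat unfolding lipschitz_solution_def by blast
  have c: "1-lipschitz_on UNIV clamp"
  proof (rule lipschitz_onI)
    fix z z' :: pt
    have "\<bar>max 0 (min T (snd z)) - max 0 (min T (snd z'))\<bar> \<le> \<bar>snd z - snd z'\<bar>" by (auto simp: max_def min_def)
    then have "(max 0 (min T (snd z)) - max 0 (min T (snd z')))\<^sup>2 \<le> (snd z - snd z')\<^sup>2"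
      by (simp add: abs_le_square_iff)
    then show "dist (clamp z) (clamp z') \<le> 1 * dist z z'"
      by (simp add: clamp_def dist_prod_def dist_real_def)
  qed simp
  have r: "clamp ` UNIV \<subseteq> UNIV \<times> {0..T}" using T_pos by (auto simp: clamp_def)
  have "(L1 * 1)-lipschitz_on UNIV (\<lambda>z. vh (clamp z))" "(L2 * 1)-lipschitz_on UNIV (\<lambda>z. Fh (clamp z))"
    by (intro lipschitz_on_compose2[OF c] lipschitz_on_subset[OF L(1) r] lipschitz_on_subset[OF L(2) r])+
  then have "(sqrt ((L1 * 1)\<^sup>2 + (L2 * 1)\<^sup>2))-lipschitz_on UNIV (\<lambda>z. (vh (clamp z), Fh (clamp z)))"
    by (rule lipschitz_on_Pair)
  then show ?thesis using that unfolding Wc_def by blast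
qed

lemma Wc_continuous: "continuous_on S Wc"
  using Wc_lipschitz lipschitz_on_continuous_on continuous_on_subset by (metis subset_UNIV)

lemma Wc_bounded: obtains M where "\<And>z. norm (Wc z) \<le> M"
proof -
  have "bounded (vh ` (UNIV \<times> {0..T}))" "bounded (Fh ` (UNIV \<times> {0..T}))"
    using hat unfolding lipschitz_solution_def by blast+
  then obtain M1 M2 where M: "\<And>y. y \<in> vh ` (UNIV \<times> {0..T}) \<Longrightarrow> norm y \<le> M1" "\<And>y. y \<in> Fh ` (UNIV \<times> {0..T}) \<Longrightarrow> norm y \<le> M2"
    unfolding bounded_iff by blast
  have r: "clamp z \<in> UNIV \<times> {0..T}" for z using T_pos by (auto simp: clamp_def)
  have "norm (Wc z) \<le> M1 + M2" for z
    unfolding Wc_def using M(1)[OF imageI[OF r[of z]]] M(2)[OF imageI[OF r[of z]]]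
    by (intro order_trans[OF norm_Pair_le] add_mono)
  then show ?thesis using that by blast
qed

lemma Wc_periodic: "periodic Wc"
proof -
  have "periodic vh" "periodic Fh" using hat unfolding lipschitz_solution_def by blast+
  then show ?thesis by (simp add: periodic_def Wc_def clamp_def)
qed

lemma vh_eq: "z \<in> QT T \<Longrightarrow> vh z = fst (Wc z)" "vh (x, 0) = fst (Wc (x, 0))"
  and Fh_eq: "z \<in> QT T \<Longrightarrow> Fh z = snd (Wc z)" "Fh (x, 0) = snd (Wc (x, 0))"
  by (simp_all add: Wc_def clamp_QT clamp_0)

text \<open>Each component of \<open>Wc\<close> is mollified at scale 1/(n+1). Closeness to
  \<open>Wc\<close> gives the limit and the bound, and the averaged Lipschitz constants make
  \<open>L\<close> independent of \<open>n\<close>.\<close>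

lemma approximations:
  obtains W L M where "\<And>n b. C2_fun (\<lambda>z. W n z \<bullet> b)" "\<And>n. periodic (W n)"
    "\<And>n x y. norm (W n x - W n y) \<le> L * norm (x - y)" "\<And>n z. norm (W n z) \<le> M"
    "\<And>z. (\<lambda>n. W n z) \<longlonglongrightarrow> Wc z"
proof -
  obtain L where L: "L-lipschitz_on UNIV Wc" using Wc_lipschitz by metis
  obtain M where M: "\<And>z. norm (Wc z) \<le> M" using Wc_bounded by metis
  have L0: "L \<ge> 0" using lipschitz_on_nonneg[OF L] .
  define e where "e n = inverse (real (Suc n))" for n
  have e: "0 < e n" "e n \<le> 1" for n by (auto simp: e_def field_simps)
  have Lb: "L-lipschitz_on UNIV (\<lambda>z. Wc z \<bullet> b)" if "b \<in> Basis" for b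
  proof (rule lipschitz_onI[OF _ L0])
    fix x y
    have "dist (Wc x \<bullet> b) (Wc y \<bullet> b) = \<bar>(Wc x - Wc y) \<bullet> b\<bar>" by (simp add: dist_real_def inner_diff_left)
    also have "\<dots> \<le> norm (Wc x - Wc y)" using that by (rule Basis_le_norm)
    finally show "dist (Wc x \<bullet> b) (Wc y \<bullet> b) \<le> L * dist x y"
      using lipschitz_onD[OF L, of x y] by (simp add: dist_norm)
  qed
  have "\<exists>f. C2_fun f \<and> (\<forall>z. \<bar>f z - Wc z \<bullet> b\<bar> \<le> L * e n) \<and> (\<forall>x y. \<bar>f x - f y\<bar> \<le> L * norm (x - y))
      \<and> (\<forall>c. (\<forall>z. Wc (z + c) \<bullet> b = Wc z \<bullet> b) \<longrightarrow> (\<forall>z. f (z + c) = f z))" if "b \<in> Basis" for b n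
    using mollify[OF Lb[OF that] e(1)[of n] e(2)[of n]] by metis
  then obtain f where f: "\<And>b n. b \<in> Basis \<Longrightarrow> C2_fun (f b n)"
    "\<And>b n z. b \<in> Basis \<Longrightarrow> \<bar>f b n z - Wc z \<bullet> b\<bar> \<le> L * e n"
    "\<And>b n x y. b \<in> Basis \<Longrightarrow> \<bar>f b n x - f b n y\<bar> \<le> L * norm (x - y)"
    "\<And>b n c z. b \<in> Basis \<Longrightarrow> (\<And>z. Wc (z + c) \<bullet> b = Wc z \<bullet> b) \<Longrightarrow> f b n (z + c) = f b n z"
    by metis
  define W where "W n z = (\<Sum>b\<in>Basis. f b n z *\<^sub>R b)" for n z
  have Wb: "W n z \<bullet> b = f b n z" if "b \<in> Basis" for n z b
    using that unfolding W_def by simp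
  \<comment> \<open>The number of components, the price for reassembling a vector from componentwise
    estimates.\<close>
  define D where "D = real (card (Basis :: ((real^3) \<times> mat3) set))"
  have D0: "D \<ge> 0" by (simp add: D_def)
  have nb: "norm u \<le> D * K" if "\<And>b. b \<in> Basis \<Longrightarrow> \<bar>u \<bullet> b\<bar> \<le> K" for u :: "(real^3) \<times> mat3" and K
    using order_trans[OF norm_le_l1 sum_bounded_above[of Basis "\<lambda>b. \<bar>u \<bullet> b\<bar>" K]] that by (simp add: D_def)
  have close: "norm (W n z - Wc z) \<le> D * (L * e n)" for n z
    by (rule nb) (use f(2) Wb in \<open>simp add: inner_diff_left\<close>)
  show ?thesis
  proof (rule that[of W "D * L" "D * L + M"])
    show "C2_fun (\<lambda>z. W n z \<bullet> b)" for n b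
    proof -
      have C2_sum: "C2_fun (\<lambda>z. \<Sum>i\<in>I. g i z)" if "finite I" "\<And>i. i \<in> I \<Longrightarrow> C2_fun (g i)"
        for I :: "((real^3) \<times> mat3) set" and g :: "(real^3) \<times> mat3 \<Rightarrow> pt \<Rightarrow> real"
      proof -
        have "dd (\<lambda>z. \<Sum>i\<in>I. g i z) h = (\<lambda>z. \<Sum>i\<in>I. dd (g i) h z)" for h
          by (rule ext, rule dd_sum) (use that(2) in \<open>auto simp: C2_fun_def\<close>)
        then show ?thesis using that(2) by (auto simp: C2_fun_def intro!: C1_fun_sum)
      qed
      have "(\<lambda>z. W n z \<bullet> b) = (\<lambda>z. \<Sum>i\<in>Basis. f i n z * (i \<bullet> b))"
        by (simp add: W_def inner_sum_left)
      moreover have "C2_fun (\<lambda>z. \<Sum>i\<in>Basis. f i n z * (i \<bullet> b))" by (intro C2_sum C2_fun_mult f C2_fun_const) auto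
      ultimately show ?thesis by simp
    qed
    show "periodic (W n)" for n
    proof -
      have "f b n (z + ((2 * pi) *\<^sub>R axis i 1, 0)) = f b n z" if "b \<in> Basis" for b z and i :: 3
        using Wc_periodic by (intro f(4)[OF that]) (auto simp: periodic_def)
      from this[of _ "(_, _)"] show ?thesis unfolding periodic_def W_def by simp
    qed
    show "norm (W n x - W n y) \<le> D * L * norm (x - y)" for n x y
      unfolding mult.assoc by (rule nb) (use f(3) Wb in \<open>simp add: inner_diff_left\<close>)
    show "norm (W n z) \<le> D * L + M" for n z
    proof -
      have "norm (W n z) \<le> norm (W n z - Wc z) + norm (Wc z)" using norm_triangle_sub[of "W n z" "Wc z"] by simp
      also have "\<dots> \<le> D * (L * 1) + M"
        by (intro add_mono M order_trans[OF close] mult_left_mono e D0 L0)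
      finally show ?thesis by simp
    qed
    show "(\<lambda>n. W n z) \<longlonglongrightarrow> Wc z" for z
    proof -
      have "(\<lambda>n. D * (L * e n)) \<longlonglongrightarrow> D * (L * 0)"
        unfolding e_def by (intro tendsto_intros LIMSEQ_inverse_real_of_nat)
      then have l: "(\<lambda>n. D * (L * e n)) \<longlonglongrightarrow> 0" by simp
      have "(\<lambda>n. W n z - Wc z) \<longlonglongrightarrow> 0"
        by (rule Lim_null_comparison[OF always_eventually l]) (use close in simp)
      then show ?thesis by (simp add: LIM_zero_iff)
    qed
  qed
qed

lemma init_QB: "AE x in QB. v0 x = fst (Wc (x, 0)) \<and> Phi (F0 x) = Phi (snd (Wc (x, 0)))"
  using init unfolding AE_QB vh_eq(2) Fh_eq(2) .

lemma continuous_on_Wc0: "continuous_on UNIV (\<lambda>x. fst (Wc (x, 0)) $ i)"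
  "continuous_on UNIV (\<lambda>x. Phi (snd (Wc (x, 0))) \<bullet> A)"
  by (intro continuous_intros continuous_on_initial Wc_continuous continuous_on_compose2[OF C1_fun_continuous_on[OF C1_fun_Phi, of UNIV]]; simp)+

lemma integrable_QB_contv:
  fixes f :: "real^3 \<Rightarrow> 'b::euclidean_space"
  assumes "continuous_on UNIV f"
  shows "integrable QB f"
proof -
  have "integrable QB (\<lambda>x. \<Sum>b\<in>Basis. (f x \<bullet> b) *\<^sub>R b)"
    by (intro Bochner_Integration.integrable_sum integrable_scaleR_left integrable_QB_cont continuous_intros assms)
  then show ?thesis by (simp add: euclidean_representation)
qed

lemma integrable_QM_contv:
  fixes f :: "pt \<Rightarrow> 'b::euclidean_space"
  assumes "continuous_on UNIV f"
  shows "integrable (QM T) f"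
proof -
  have "integrable (QM T) (\<lambda>x. \<Sum>b\<in>Basis. (f x \<bullet> b) *\<^sub>R b)"
    by (intro Bochner_Integration.integrable_sum integrable_scaleR_left integrable_QM_cont continuous_intros assms)
  then show ?thesis by (simp add: euclidean_representation)
qed

lemma v0_measurable: "v0 \<in> borel_measurable borel" and F0_measurable: "F0 \<in> borel_measurable borel"
  using sol unfolding dmv_solution_def by blast+

lemma Phi_F0_measurable: "(\<lambda>x. Phi (F0 x)) \<in> borel_measurable borel"
  by (rule measurable_compose[OF F0_measurable borel_measurable_continuous_onI[OF C1_fun_continuous_on[OF C1_fun_Phi]]])

lemma continuous_on_Wc0': "continuous_on UNIV (\<lambda>x. fst (Wc (x, 0)))"
  "continuous_on UNIV (\<lambda>x. Phi (snd (Wc (x, 0))))"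
  by (intro continuous_intros continuous_on_initial Wc_continuous continuous_on_compose2[OF C1_fun_continuous_on[OF C1_fun_Phi, of UNIV]]; simp)+

lemma v0_integrable: "integrable QB v0" and Phi_F0_integrable: "integrable QB (\<lambda>x. Phi (F0 x))"
proof -
  have "AE x in QB. v0 x = fst (Wc (x, 0))" using init_QB by eventually_elim simp
  from integrable_cong_AE[OF measurable_QB[OF v0_measurable] measurable_QB[OF borel_measurable_continuous_onI[OF continuous_on_Wc0'(1)]] this]
  show "integrable QB v0" using integrable_QB_contv[OF continuous_on_Wc0'(1)] by (rule iffD2)
  have "AE x in QB. Phi (F0 x) = Phi (snd (Wc (x, 0)))" using init_QB by eventually_elim simp
  from integrable_cong_AE[OF measurable_QB[OF Phi_F0_measurable] measurable_QB[OF borel_measurable_continuous_onI[OF continuous_on_Wc0'(2)]] this]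
  show "integrable QB (\<lambda>x. Phi (F0 x))" using integrable_QB_contv[OF continuous_on_Wc0'(2)] by (rule iffD2)
qed

text \<open>Here the agreement of the initial data enters: the boundary terms of both solutions are
  written with the same \<open>Wc (x, 0)\<close>.\<close>

lemma integral_init:
  fixes \<phi> :: "real^3 \<Rightarrow> real"
  assumes [measurable]: "\<phi> \<in> borel_measurable borel"
  shows "(\<integral>x. \<phi> x * (v0 x \<bullet> b) \<partial>QB) = (\<integral>x. \<phi> x * (fst (Wc (x, 0)) \<bullet> b) \<partial>QB)"
    and "(\<integral>x. \<phi> x * (Phi (F0 x) \<bullet> A) \<partial>QB) = (\<integral>x. \<phi> x * (Phi (snd (Wc (x, 0))) \<bullet> A) \<partial>QB)"
proof -
  have m: "(\<lambda>x. fst (Wc (x, 0))) \<in> borel_measurable borel" "(\<lambda>x. Phi (snd (Wc (x, 0)))) \<in> borel_measurable borel"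
    by (rule borel_measurable_continuous_onI, rule continuous_on_Wc0')+
  note [measurable] = m v0_measurable Phi_F0_measurable
  have e: "AE x in QB. v0 x = fst (Wc (x, 0))" "AE x in QB. Phi (F0 x) = Phi (snd (Wc (x, 0)))" using init_QB by auto
  show "(\<integral>x. \<phi> x * (v0 x \<bullet> b) \<partial>QB) = (\<integral>x. \<phi> x * (fst (Wc (x, 0)) \<bullet> b) \<partial>QB)"
    by (rule integral_cong_AE) (use e(1) in \<open>auto intro!: measurable_QB\<close>)
  show "(\<integral>x. \<phi> x * (Phi (F0 x) \<bullet> A) \<partial>QB) = (\<integral>x. \<phi> x * (Phi (snd (Wc (x, 0))) \<bullet> A) \<partial>QB)"
    by (rule integral_cong_AE) (use e(2) in \<open>auto intro!: measurable_QB\<close>)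
qed

lemma test_fn_measurable_0: "test_fn T \<phi> \<Longrightarrow> (\<lambda>x. \<phi> (x, 0)) \<in> borel_measurable borel"
  by (intro borel_measurable_continuous_onI continuous_on_initial C1_fun_continuous_on) (simp add: test_fn_def)

lemma integrable_vec:
  fixes f :: "'a \<Rightarrow> real^3"
  assumes "\<And>i. integrable M (\<lambda>z. f z $ i)" shows "integrable M f"
proof -
  have "integrable M (\<lambda>z. \<Sum>i\<in>UNIV. f z $ i *\<^sub>R axis i (1::real))"
    by (intro Bochner_Integration.integrable_sum integrable_scaleR_left assms)
  moreover have "(\<Sum>i\<in>UNIV. w $ i *\<^sub>R axis i (1::real)) = w" for w :: "real^3"
    by (simp add: vec_eq_iff forall_3 sum_3 axis_def neq_3)
  ultimately show ?thesis by simp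
qed

lemma momentum_law:
  assumes t: "test_fn T \<phi>"
  shows "(\<integral>z. d_t \<phi> z * (v z $ i) - (\<Sum>a\<in>UNIV. d_x a \<phi> z * avg_flux i a z) \<partial>QM T)
    + (\<integral>x. \<phi> (x, 0) * (fst (Wc (x, 0)) $ i) \<partial>QB) = 0"
proof -
  have w: "weak_cons_law T (\<lambda>z. \<integral>l. fst l \<partial>\<nu> z) (\<lambda>a z. \<chi> i. \<integral>l. flux G i a l \<partial>\<nu> z) v0"
    using sol unfolding dmv_solution_def by blast
  have m: "(\<lambda>z. \<integral>l. fst l \<partial>\<nu> z) \<in> borel_measurable borel" by (rule avg_measurable[OF fst_snd_measurable(1)])
  have e: "AE z in QM T. (\<integral>l. fst l \<partial>\<nu> z) = v z" using AE_good by eventually_elim (simp add: good_def)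
  have U: "integrable (QM T) (\<lambda>z. \<integral>l. fst l \<partial>\<nu> z)"
    using v_integrable integrable_cong_AE[OF measurable_QM[OF m] measurable_QM[OF v_measurable] e] by simp
  have Fx: "integrable (QM T) (\<lambda>z. \<chi> i. \<integral>l. flux G i a l \<partial>\<nu> z)" for a
    by (rule integrable_vec) (use avg_flux_integrable in \<open>simp add: avg_flux_def[abs_def]\<close>)
  have p: "C1_fun \<phi>" using t by (simp add: test_fn_def)
  have dm: "d_t \<phi> \<in> borel_measurable borel" "d_x a \<phi> \<in> borel_measurable borel" for a
    unfolding d_t_def d_x_def by (intro borel_measurable_continuous_onI C1_fun_continuous_on_dd p)+
  have "(\<integral>z. d_t \<phi> z * (v z $ i) - (\<Sum>a\<in>UNIV. d_x a \<phi> z * avg_flux i a z) \<partial>QM T)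
    = (\<integral>z. d_t \<phi> z * ((\<integral>l. fst l \<partial>\<nu> z) \<bullet> axis i 1) - (\<Sum>a\<in>UNIV. d_x a \<phi> z * ((\<chi> i. \<integral>l. flux G i a l \<partial>\<nu> z) \<bullet> axis i 1)) \<partial>QM T)"
  proof (rule integral_cong_AE)
    show "AE z in QM T. d_t \<phi> z * (v z $ i) - (\<Sum>a\<in>UNIV. d_x a \<phi> z * avg_flux i a z) =
       d_t \<phi> z * ((\<integral>l. fst l \<partial>\<nu> z) \<bullet> axis i 1) - (\<Sum>a\<in>UNIV. d_x a \<phi> z * ((\<chi> i. \<integral>l. flux G i a l \<partial>\<nu> z) \<bullet> axis i 1))"
      using e by eventually_elim (simp add: inner_axis avg_flux_def)
    show "(\<lambda>z. d_t \<phi> z * (v z $ i) - (\<Sum>a\<in>UNIV. d_x a \<phi> z * avg_flux i a z)) \<in> borel_measurable (QM T)"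
      using measurable_QM[OF dm(1)] measurable_QM[OF dm(2)] borel_measurable_integrable[OF avg_flux_integrable] measurable_QM[OF v_measurable]
        measurable_compose[OF measurable_QM[OF v_measurable] measurable_vec_nth]
      by (intro borel_measurable_diff borel_measurable_sum borel_measurable_times) auto
    show "(\<lambda>z. d_t \<phi> z * ((\<integral>l. fst l \<partial>\<nu> z) \<bullet> axis i 1) - (\<Sum>a\<in>UNIV. d_x a \<phi> z * ((\<chi> i. \<integral>l. flux G i a l \<partial>\<nu> z) \<bullet> axis i 1))) \<in> borel_measurable (QM T)"
      using measurable_QM[OF dm(1)] measurable_QM[OF dm(2)] borel_measurable_integrable[OF U] borel_measurable_integrable[OF Fx]
      by (intro borel_measurable_diff borel_measurable_sum borel_measurable_times borel_measurable_inner) auto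
  qed
  also have "\<dots> = - (\<integral>x. \<phi> (x, 0) * (v0 x \<bullet> axis i 1) \<partial>QB)"
    using weak_cons_law_inner[OF w t U Fx v0_integrable, of "axis i 1"] by simp
  finally show ?thesis
    using integral_init(1)[OF test_fn_measurable_0[OF t], of "axis i 1"] by (simp add: inner_axis)
qed

text \<open>The entries of dPhi(M) are entries of \<open>M\<close> and of \<open>cof M\<close>, thus
  already components of \<open>Phi M\<close>. So dPhi grows linearly in \<open>Phi M\<close>, and
  its product with \<open>v\<close> is integrable because both factors are square
  integrable.\<close>

lemma Phi_dd_bound:
  obtains C where "C \<ge> 1" "\<And>i a M. norm (dd Phi (Emat i a) M) \<le> C * (1 + norm (Phi M))"
proof -
  obtain K where K: "K \<ge> 0" "\<And>M N. norm (ccof M N) \<le> K * norm M * norm N" using dd_Phi_Emat_bounds by metis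
  have el: "\<bar>M $ i $ a\<bar> \<le> norm M" for M :: mat3 and i a
    using Finite_Cartesian_Product.norm_nth_le order_trans by (metis real_norm_def)
  show ?thesis
  proof (rule that[of "1 + K + 1"])
    show "1 \<le> 1 + K + 1" using K by simp
    fix i a M
    have n: "norm M \<le> norm (Phi M)" "norm (cof M) \<le> norm (Phi M)"
      using norm_fst_le[of M "(cof M, det M)"] order_trans[OF norm_fst_le[of "cof M" "det M"] norm_snd_le[of "(cof M, det M)" M]]
      by (auto simp: Phi_def)
    have "norm (dd Phi (Emat i a) M) \<le> norm (Emat i a) + (norm (ccof M (Emat i a)) + \<bar>cof M $ i $ a\<bar>)"
      unfolding dd_Phi by (intro order_trans[OF norm_Pair_le] add_mono order_refl) (simp add: inner_Emat)
    also have "\<dots> \<le> 1 + (K * norm (Phi M) + norm (Phi M))"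
      using K(2)[of M "Emat i a"] mult_left_mono[OF n(1) K(1)] order_trans[OF el n(2), of i a]
      by (intro add_mono) auto
    also have "\<dots> \<le> (1 + K + 1) * (1 + norm (Phi M))" using K(1) by (simp add: algebra_simps)
    finally show "norm (dd Phi (Emat i a) M) \<le> (1 + K + 1) * (1 + norm (Phi M))" .
  qed
qed

lemma dd_Phi_F_measurable: "(\<lambda>z. dd Phi (Emat i a) (F z)) \<in> borel_measurable borel"
  by (rule measurable_compose[OF F_measurable borel_measurable_continuous_onI[OF C1_fun_continuous_on[OF C1_fun_dd_Phi]]])

lemma v_nth_measurable: "(\<lambda>z. v z $ i) \<in> borel_measurable borel"
  by (rule measurable_compose[OF v_measurable measurable_vec_nth])

lemma v_dd_Phi_integrable: "integrable (QM T) (\<lambda>z. (v z $ i) *\<^sub>R dd Phi (Emat i a) (F z))"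
proof -
  obtain C where C: "C \<ge> 1"
    "\<And>z. good z \<Longrightarrow> (norm (v z))\<^sup>2 \<le> C * (avg_eta z + 1)" "\<And>z. good z \<Longrightarrow> (norm (Phi (F z)))\<^sup>2 \<le> C * (avg_eta z + 1)"
    "\<And>z. good z \<Longrightarrow> norm (v z) \<le> C * (avg_eta z + 1)" using avg_bounds by metis
  obtain D where D: "D \<ge> 1" "\<And>i a M. norm (dd Phi (Emat i a) M) \<le> D * (1 + norm (Phi M))" using Phi_dd_bound by metis
  show ?thesis
  proof (rule integrable_QM_avg_eta_bound)
    show "(\<lambda>z. (v z $ i) *\<^sub>R dd Phi (Emat i a) (F z)) \<in> borel_measurable borel"
      by (intro borel_measurable_scaleR v_nth_measurable dd_Phi_F_measurable)
    fix z assume z: "good z"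
    have "norm ((v z $ i) *\<^sub>R dd Phi (Emat i a) (F z)) \<le> norm (v z) * (D * (1 + norm (Phi (F z))))"
      using component_le_norm_cart[of "v z" i] D(2)[of i a "F z"] by (auto intro!: mult_mono)
    also have "\<dots> = D * (norm (v z) + norm (v z) * norm (Phi (F z)))" by (simp add: algebra_simps)
    also have "\<dots> \<le> D * (C * (avg_eta z + 1) + (C * (avg_eta z + 1) + C * (avg_eta z + 1)))"
    proof (intro mult_left_mono add_mono C z)
      have "2 * (norm (v z) * norm (Phi (F z))) \<le> (norm (v z))\<^sup>2 + (norm (Phi (F z)))\<^sup>2"
        using zero_le_power2[of "norm (v z) - norm (Phi (F z))"] by (simp add: power2_eq_square algebra_simps)
      moreover have "0 \<le> norm (v z) * norm (Phi (F z))" by simp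
      ultimately show "norm (v z) * norm (Phi (F z)) \<le> C * (avg_eta z + 1) + C * (avg_eta z + 1)"
        using C(2,3)[OF z] by linarith
    qed (use D in auto)
    finally show "norm ((v z $ i) *\<^sub>R dd Phi (Emat i a) (F z)) \<le> (3 * D * C) * (avg_eta z + 1)" by simp
  qed
qed

lemma geometric_law:
  assumes t: "test_fn T \<phi>"
  shows "(\<integral>z. d_t \<phi> z * (Phi (F z) \<bullet> A) - (\<Sum>a\<in>UNIV. d_x a \<phi> z * (\<Sum>i\<in>UNIV. v z $ i * (dd Phi (Emat i a) (F z) \<bullet> A))) \<partial>QM T)
    + (\<integral>x. \<phi> (x, 0) * (Phi (snd (Wc (x, 0))) \<bullet> A) \<partial>QB) = 0"
proof -
  have w: "weak_cons_law T (\<lambda>z. Phi (F z)) (\<lambda>a z. \<Sum>i\<in>UNIV. (v z $ i) *\<^sub>R dd Phi (Emat i a) (F z)) (\<lambda>x. Phi (F0 x))"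
    using sol unfolding dmv_solution_def by blast
  have i: "integrable (QM T) (\<lambda>z. \<Sum>i\<in>UNIV. (v z $ i) *\<^sub>R dd Phi (Emat i a) (F z))" for a
    by (intro Bochner_Integration.integrable_sum v_dd_Phi_integrable)
  show ?thesis
    using weak_cons_law_inner[OF w t Phi_F_integrable i Phi_F0_integrable, of A] integral_init(2)[OF test_fn_measurable_0[OF t], of A]
    by (simp add: inner_sum_left)
qed

lemma hat_momentum_law:
  assumes t: "test_fn T \<phi>"
  shows "(\<integral>z. d_t \<phi> z * (fst (Wc z) $ i) - (\<Sum>a\<in>UNIV. d_x a \<phi> z * stress i a (Phi (snd (Wc z)))) \<partial>QM T)
    + (\<integral>x. \<phi> (x, 0) * (fst (Wc (x, 0)) $ i) \<partial>QB) = 0"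
proof -
  have w: "weak_cons_law T vh (\<lambda>a z. \<chi> i. dd G (dd Phi (Emat i a) (Fh z)) (Phi (Fh z))) (\<lambda>x. vh (x, 0))"
    using hat unfolding lipschitz_solution_def by blast
  have "continuous_on UNIV (stress i a)" for i a
    unfolding stress_def
    by (subst dd_Basis[OF G_diff])
       (intro continuous_intros C1_fun_continuous_on dG_C1 continuous_on_compose2[OF C1_fun_continuous_on[OF C1_fun_dd_Phi, of UNIV]]; simp)
  moreover have "continuous_on UNIV (\<lambda>z. Phi (snd (Wc z)))"
    by (intro continuous_on_compose2[OF C1_fun_continuous_on[OF C1_fun_Phi, of UNIV]] continuous_intros Wc_continuous; simp)
  ultimately have c: "continuous_on UNIV (\<lambda>z. stress i a (Phi (snd (Wc z))))" for i a
    using continuous_on_compose2[OF _ _ subset_UNIV] by blast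
  have s: "dd G (dd Phi (Emat i a) M) (Phi M) = stress i a (Phi M)" for i a M by (simp add: stress_def Phi_def)
  have U: "integrable (QM T) vh"
    using integrable_QM_contv[of "\<lambda>z. fst (Wc z)"] Wc_continuous
    by (subst Bochner_Integration.integrable_cong[OF refl, where g="\<lambda>z. fst (Wc z)"]) (auto simp: vh_eq intro: continuous_intros)
  have "integrable (QM T) (\<lambda>z. stress i a (Phi (snd (Wc z))))" for i a
    by (rule integrable_QM_cont[OF c])
  then have Fx: "integrable (QM T) (\<lambda>z. \<chi> i. dd G (dd Phi (Emat i a) (Fh z)) (Phi (Fh z)))" for a
    by (intro integrable_vec, subst Bochner_Integration.integrable_cong[OF refl, where g="\<lambda>z. stress _ a (Phi (snd (Wc z)))"])
       (auto simp: Fh_eq s)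
  have U0: "integrable QB (\<lambda>x. vh (x, 0))"
    unfolding vh_eq by (rule integrable_QB_contv[OF continuous_on_Wc0'(1)])
  have "(\<integral>z. d_t \<phi> z * (fst (Wc z) $ i) - (\<Sum>a\<in>UNIV. d_x a \<phi> z * stress i a (Phi (snd (Wc z)))) \<partial>QM T)
    = (\<integral>z. d_t \<phi> z * (vh z \<bullet> axis i 1) - (\<Sum>a\<in>UNIV. d_x a \<phi> z * ((\<chi> i. dd G (dd Phi (Emat i a) (Fh z)) (Phi (Fh z))) \<bullet> axis i 1)) \<partial>QM T)"
    by (rule Bochner_Integration.integral_cong[OF refl]) (simp add: inner_axis s vh_eq Fh_eq)
  then show ?thesis
    using weak_cons_law_inner[OF w t U Fx U0, of "axis i 1"] by (simp add: inner_axis vh_eq)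
qed

lemma hat_geometric_law:
  assumes t: "test_fn T \<phi>"
  shows "(\<integral>z. d_t \<phi> z * (Phi (snd (Wc z)) \<bullet> A) - (\<Sum>a\<in>UNIV. d_x a \<phi> z * (\<Sum>i\<in>UNIV. fst (Wc z) $ i * (dd Phi (Emat i a) (snd (Wc z)) \<bullet> A))) \<partial>QM T)
    + (\<integral>x. \<phi> (x, 0) * (Phi (snd (Wc (x, 0))) \<bullet> A) \<partial>QB) = 0"
proof -
  have w: "weak_cons_law T (\<lambda>z. Phi (Fh z)) (\<lambda>a z. \<Sum>i\<in>UNIV. (vh z $ i) *\<^sub>R dd Phi (Emat i a) (Fh z)) (\<lambda>x. Phi (Fh (x, 0)))"
    using hat unfolding lipschitz_solution_def by blast
  have "continuous_on UNIV (\<lambda>z. Phi (snd (Wc z)))"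
    by (intro continuous_on_compose2[OF C1_fun_continuous_on[OF C1_fun_Phi, of UNIV]] continuous_intros Wc_continuous; simp)
  then have "integrable (QM T) (\<lambda>z. Phi (snd (Wc z)))" by (rule integrable_QM_contv)
  then have U: "integrable (QM T) (\<lambda>z. Phi (Fh z))"
    by (subst Bochner_Integration.integrable_cong[OF refl, where g="\<lambda>z. Phi (snd (Wc z))"]) (auto simp: Fh_eq)
  have "continuous_on UNIV (\<lambda>z. \<Sum>i\<in>UNIV. (fst (Wc z) $ i) *\<^sub>R dd Phi (Emat i a) (snd (Wc z)))" for a
    by (intro continuous_on_compose2[OF C1_fun_continuous_on[OF C1_fun_dd_Phi, of UNIV]] continuous_intros Wc_continuous; simp)
  then have "integrable (QM T) (\<lambda>z. \<Sum>i\<in>UNIV. (fst (Wc z) $ i) *\<^sub>R dd Phi (Emat i a) (snd (Wc z)))" for a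
    by (rule integrable_QM_contv)
  then have Fx: "integrable (QM T) (\<lambda>z. \<Sum>i\<in>UNIV. (vh z $ i) *\<^sub>R dd Phi (Emat i a) (Fh z))" for a
    by (subst Bochner_Integration.integrable_cong[OF refl, where g="\<lambda>z. \<Sum>i\<in>UNIV. (fst (Wc z) $ i) *\<^sub>R dd Phi (Emat i a) (snd (Wc z))"])
       (auto simp: Fh_eq vh_eq)
  have U0: "integrable QB (\<lambda>x. Phi (Fh (x, 0)))"
    unfolding Fh_eq by (rule integrable_QB_contv[OF continuous_on_Wc0'(2)])
  have "(\<integral>z. d_t \<phi> z * (Phi (snd (Wc z)) \<bullet> A) - (\<Sum>a\<in>UNIV. d_x a \<phi> z * (\<Sum>i\<in>UNIV. fst (Wc z) $ i * (dd Phi (Emat i a) (snd (Wc z)) \<bullet> A))) \<partial>QM T)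
    = (\<integral>z. d_t \<phi> z * (Phi (Fh z) \<bullet> A) - (\<Sum>a\<in>UNIV. d_x a \<phi> z * ((\<Sum>i\<in>UNIV. (vh z $ i) *\<^sub>R dd Phi (Emat i a) (Fh z)) \<bullet> A)) \<partial>QM T)"
    by (rule Bochner_Integration.integral_cong[OF refl]) (simp add: inner_sum_left vh_eq Fh_eq)
  then show ?thesis
    using weak_cons_law_inner[OF w t U Fx U0, of A] by (simp add: Fh_eq)
qed

text \<open>\<open>F\<close> is the weak gradient of \<open>y\<close>. Testing that relation in
  direction \<open>a\<close> with \<open>b\<close> times the derivative of \<open>f\<close> along
  \<open>c\<close>, and the other way round, gives equal left-hand sides by symmetry of the second
  derivatives. The potential relation is available only for test functions vanishing near time
  0.\<close>

lemma curl_F_interior: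
  assumes f: "C2_fun f" "periodic f" and b: "C1_fun b"
    and van: "0 < t0" "T' < T" "\<And>t. t \<le> t0 \<or> T' \<le> t \<Longrightarrow> b t = 0"
  shows "(\<integral>z. b (snd z) * (d_x a f z * F z $ k $ c - d_x c f z * F z $ k $ a) \<partial>QM T) = 0"
proof -
  have f1: "C1_fun f" and f2: "\<And>h. C1_fun (dd f h)" using f by (auto simp: C2_fun_def)
  define \<phi> where "\<phi> e z = b (snd z) * d_x e f z" for e z
  have t: "test_fn0 T (\<phi> e)" for e
    unfolding test_fn0_def test_fn_def
  proof (intro conjI)
    show "C1_fun (\<phi> e)" unfolding \<phi>_def d_x_def by (intro C1_fun_mult C1_fun_snd b f2)
    show "periodic (\<phi> e)"
      using periodic_dd[OF C1_fun_differentiable[OF f1] f(2)] by (simp add: \<phi>_def d_x_def periodic_def)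
    show "\<exists>T'<T. \<forall>x t. T' \<le> t \<longrightarrow> \<phi> e (x, t) = 0" "\<exists>t0>0. \<forall>x t. t \<le> t0 \<longrightarrow> \<phi> e (x, t) = 0"
      using van by (auto simp: \<phi>_def)
  qed
  have y: "(LINT z:QT T|lborel. d_x e \<phi>' z *\<^sub>R y z) = - (LINT z:QT T|lborel. \<phi>' z *\<^sub>R (\<chi> i. F z $ i $ e))"
    if "test_fn0 T \<phi>'" for \<phi>' e
    using sol that unfolding dmv_solution_def by blast
  have "d_x a (\<phi> c) z = d_x c (\<phi> a) z" for z
    unfolding \<phi>_def using d_x_time_mult[OF b f2[unfolded d_x_def[symmetric]]] dd_commute[OF f(1)]
    by (simp add: d_x_def d_x_time_mult[OF b f2, unfolded d_x_def])
  then have eq: "(\<integral>z. \<phi> c z *\<^sub>R (\<chi> i. F z $ i $ a) \<partial>QM T) = (\<integral>z. \<phi> a z *\<^sub>R (\<chi> i. F z $ i $ c) \<partial>QM T)"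
    using y[OF t[of c], of a] y[OF t[of a], of c] unfolding LINT_QM by simp
  have Fi: "integrable (QM T) (\<lambda>z. F z $ i $ e)" for i e
    using integrable_bounded_linear[OF bounded_linear_vec_nth integrable_bounded_linear[OF bounded_linear_vec_nth F_integrable]] .
  have Fe: "integrable (QM T) (\<lambda>z. \<chi> i. F z $ i $ e)" for e
    by (rule integrable_vec) (simp add: Fi)
  have cont: "continuous_on UNIV (\<phi> e)" for e using t[of e] by (auto simp: test_fn0_def test_fn_def intro: C1_fun_continuous_on)
  have i: "integrable (QM T) (\<lambda>z. \<phi> e z *\<^sub>R (\<chi> i. F z $ i $ e'))" for e e'
    by (rule integrable_QM_scaleR_cont[OF Fe cont])
  have c1: "(\<integral>z. \<phi> e z * F z $ k $ e' \<partial>QM T) = (\<integral>z. \<phi> e z *\<^sub>R (\<chi> i. F z $ i $ e') \<partial>QM T) $ k" for e e'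
    using integral_bounded_linear[OF bounded_linear_vec_nth i[of e e'], of k] by simp
  have i2: "integrable (QM T) (\<lambda>z. \<phi> e z * F z $ k $ e')" for e e'
    by (rule integrable_QM_mult_cont[OF Fi cont])
  have "(\<integral>z. b (snd z) * (d_x a f z * F z $ k $ c - d_x c f z * F z $ k $ a) \<partial>QM T)
    = (\<integral>z. \<phi> a z * F z $ k $ c - \<phi> c z * F z $ k $ a \<partial>QM T)"
    by (intro Bochner_Integration.integral_cong refl) (simp add: \<phi>_def algebra_simps)
  also have "\<dots> = 0"
    using eq by (simp add: Bochner_Integration.integral_diff[OF i2 i2] c1)
  finally show ?thesis .
qed

lemma F_nth_integrable: "integrable (QM T) (\<lambda>z. F z $ i $ e)"
  using integrable_bounded_linear[OF bounded_linear_vec_nth integrable_bounded_linear[OF bounded_linear_vec_nth F_integrable]] .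

text \<open>Multiplication by cutoffs that vanish near 0 and increase to 1 removes the restriction
  at the initial time; dominated convergence applies since the whole expression is
  integrable.\<close>

lemma curl_F:
  assumes f: "C2_fun f" "periodic f" and \<theta>: "C1_fun \<theta>" and van: "T' < T" "\<And>t. T' \<le> t \<Longrightarrow> \<theta> t = 0"
  shows "(\<integral>z. \<theta> (snd z) * (d_x a f z * F z $ k $ c - d_x c f z * F z $ k $ a) \<partial>QM T) = 0"
proof -
  have f1: "C1_fun f" using f by (auto simp: C2_fun_def)
  define R where "R z = \<theta> (snd z) * (d_x a f z * F z $ k $ c - d_x c f z * F z $ k $ a)" for z
  have c: "continuous_on UNIV (\<lambda>z. \<theta> (snd z) * d_x e f z)" for e
    unfolding d_x_def by (intro continuous_intros C1_fun_continuous_on_dd f1 C1_fun_continuous_on[OF C1_fun_snd[OF \<theta>]])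
  have "integrable (QM T) (\<lambda>z. \<theta> (snd z) * d_x a f z * F z $ k $ c - \<theta> (snd z) * d_x c f z * F z $ k $ a)"
    by (intro Bochner_Integration.integrable_diff integrable_QM_mult_cont F_nth_integrable c)
  then have R: "integrable (QM T) R" unfolding R_def by (simp add: algebra_simps)
  have mt: "(\<lambda>z::pt. time_step (T + 2) m (snd z)) \<in> borel_measurable borel" for m
    by (intro borel_measurable_continuous_onI C1_fun_continuous_on C1_fun_snd time_step_C1)
  \<comment> \<open>With the threshold \<open>T + 2\<close> beyond the time interval, the cutoffs
    tend to 1 at every time in (0, T).\<close>
  have "(\<lambda>m. \<integral>z. time_step (T + 2) m (snd z) * R z \<partial>QM T) \<longlonglongrightarrow> (\<integral>z. R z \<partial>QM T)"
  proof (rule integral_dominated_convergence[where w = "\<lambda>z. \<bar>R z\<bar>"])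
    show "(\<lambda>z. time_step (T + 2) m (snd z) * R z) \<in> borel_measurable (QM T)" for m
      using R measurable_QM[OF mt] by (intro borel_measurable_times) auto
    show "AE z in QM T. norm (time_step (T + 2) m (snd z) * R z) \<le> \<bar>R z\<bar>" for m
      by (intro AE_I2) (simp add: abs_mult time_step_bounds mult_left_le_one_le)
    show "AE z in QM T. (\<lambda>m. time_step (T + 2) m (snd z) * R z) \<longlonglongrightarrow> R z"
      using AE_QM_coordinate(2)[of 0 T] AE_space
    proof eventually_elim
      case (elim z)
      then have "0 < snd z" "snd z \<noteq> T + 2" "snd z \<le> T + 2" by (auto simp: QT_def)
      then have "(\<lambda>m. time_step (T + 2) m (snd z)) \<longlonglongrightarrow> 1" using time_step_limit[of "snd z" "T + 2"] by simp
      then show ?case using tendsto_mult_right[of _ 1 _ "R z"] by simp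
    qed
  qed (use R in auto)
  moreover have "(\<integral>z. time_step (T + 2) m (snd z) * R z \<partial>QM T) = 0" for m
  proof -
    have "(\<integral>z. (time_step (T + 2) m (snd z) * \<theta> (snd z)) * (d_x a f z * F z $ k $ c - d_x c f z * F z $ k $ a) \<partial>QM T) = 0"
    proof (rule curl_F_interior[OF f])
      show "C1_fun (\<lambda>t. time_step (T + 2) m t * \<theta> t)" by (intro C1_fun_mult time_step_C1 \<theta>)
      show "0 < inverse (real (Suc m))" by simp
      show "T' < T" by (rule van)
      show "time_step (T + 2) m t * \<theta> t = 0" if "t \<le> inverse (real (Suc m)) \<or> T' \<le> t" for t
        using that van(2) time_step_zero[of t m "T + 2"] by auto
    qed
    then show ?thesis by (simp add: R_def mult.assoc)
  qed
  ultimately have "(\<integral>z. R z \<partial>QM T) = 0" by (simp add: LIMSEQ_const_iff)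
  then show ?thesis by (simp add: R_def)
qed

text \<open>The strain equation conserves the curl, so the curl tested with \<open>b\<close> equals
  an expression in the initial strain alone. This expression is common to both solutions, and it is
  0 because it is so for the gradient \<open>F\<close>.\<close>

lemma curl_hat:
  assumes bump: "bump T X b"
  shows "(\<integral>z. b (snd z) * (dd X (axis a 1) (fst z) * snd (Wc z) $ k $ c - dd X (axis c 1) (fst z) * snd (Wc z) $ k $ a) \<partial>QM T) = 0"
proof -
  obtain t0 T' where X: "C2_fun X" "periodic_x X" and b: "C1_fun b" and van: "0 < t0" "T' < T" "\<And>t. t \<le> t0 \<or> T' \<le> t \<Longrightarrow> b t = 0"
    using bump unfolding bump_def by blast
  have X1: "C1_fun X" and X2: "\<And>h. C1_fun (dd X h)" using X by (auto simp: C2_fun_def)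
  \<comment> \<open>With the primitive \<open>B\<close> in the test function, the time derivative of
    the strain equation lands exactly on \<open>b\<close>.\<close>
  obtain B where B: "C1_fun B" "\<And>t. dd B 1 t = b t" "\<And>t. T' \<le> t \<Longrightarrow> B t = 0"
    using continuous_antiderivative[OF b, of T'] van(3) by metis
  define \<phi> where "\<phi> e z = dd X (axis e 1) (fst z) * B (snd z)" for e :: 3 and z :: pt
  have t: "test_fn T (\<phi> e)" for e
    unfolding \<phi>_def by (rule product_test_fn[OF X2 periodic_x_dd[OF X1 X(2)] B(1) van(2) B(3)])
  have dt: "d_t (\<phi> e) z = b (snd z) * dd X (axis e 1) (fst z)" for e z
    unfolding \<phi>_def by (simp add: product_fn(2)[OF X2 B(1)] B(2))
  have dx: "d_x e' (\<phi> e) z = dd (dd X (axis e 1)) (axis e' 1) (fst z) * B (snd z)" for e e' z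
    unfolding \<phi>_def by (simp add: product_fn(3)[OF X2 B(1)])
  define A where "A e = (Emat k e, 0::mat3, 0::real)" for e
  have law: "(\<integral>z. d_t (\<phi> e) z * (M z $ k $ e') - d_x e' (\<phi> e) z * u z $ k \<partial>QM T) + (\<integral>x. \<phi> e (x, 0) * (Phi (snd (Wc (x, 0))) \<bullet> A e') \<partial>QB) = 0"
    if "M = F \<and> u = v \<or> M = (\<lambda>z. snd (Wc z)) \<and> u = (\<lambda>z. fst (Wc z))" for e e' M u
    using geometric_law[OF t[of e], of "A e'"] hat_geometric_law[OF t[of e], of "A e'"] that
    unfolding A_def by (auto simp: Phi_inner_slot sum_dd_Phi_inner_slot sum_if_eq)
  \<comment> \<open>By symmetry of the second derivatives of \<open>X\<close> the velocity terms of
    the two tested equations cancel in the difference.\<close>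
  have comm: "d_x c (\<phi> a) z = d_x a (\<phi> c) z" for z
    unfolding dx dd_commute[OF X(1), of "axis a 1"] ..
  have cdt: "continuous_on UNIV (d_t (\<phi> e))" "continuous_on UNIV (d_x e' (\<phi> e))" for e e'
    using t[of e] unfolding d_t_def d_x_def test_fn_def by (auto intro: C1_fun_continuous_on_dd)
  define gap where "gap M = (\<integral>z. b (snd z) * (dd X (axis a 1) (fst z) * M z $ k $ c - dd X (axis c 1) (fst z) * M z $ k $ a) \<partial>QM T)" for M :: "pt \<Rightarrow> mat3"
  have gap: "gap M = (\<integral>x. \<phi> c (x, 0) * (Phi (snd (Wc (x, 0))) \<bullet> A a) \<partial>QB) - (\<integral>x. \<phi> a (x, 0) * (Phi (snd (Wc (x, 0))) \<bullet> A c) \<partial>QB)"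
    if M: "M = F \<and> u = v \<or> M = (\<lambda>z. snd (Wc z)) \<and> u = (\<lambda>z. fst (Wc z))" for M u
  proof -
    have "continuous_on UNIV (\<lambda>z. snd (Wc z) $ i $ j)" "continuous_on UNIV (\<lambda>z. fst (Wc z) $ i)" for i j
      by (intro continuous_intros Wc_continuous)+
    then have iM: "integrable (QM T) (\<lambda>z. M z $ i $ j)" "integrable (QM T) (\<lambda>z. u z $ i)" for i j
      using M F_nth_integrable integrable_bounded_linear[OF bounded_linear_vec_nth v_integrable] by (auto intro: integrable_QM_cont)
    have i: "integrable (QM T) (\<lambda>z. d_t (\<phi> e) z * (M z $ k $ e') - d_x e' (\<phi> e) z * u z $ k)" for e e'
      by (intro Bochner_Integration.integrable_diff integrable_QM_mult_cont iM cdt)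
    have "gap M = (\<integral>z. (d_t (\<phi> a) z * (M z $ k $ c) - d_x c (\<phi> a) z * u z $ k) - (d_t (\<phi> c) z * (M z $ k $ a) - d_x a (\<phi> c) z * u z $ k) \<partial>QM T)"
      unfolding gap_def comm dt by (intro Bochner_Integration.integral_cong refl) (simp add: algebra_simps)
    also have "\<dots> = (\<integral>z. d_t (\<phi> a) z * (M z $ k $ c) - d_x c (\<phi> a) z * u z $ k \<partial>QM T) - (\<integral>z. d_t (\<phi> c) z * (M z $ k $ a) - d_x a (\<phi> c) z * u z $ k \<partial>QM T)"
      by (rule Bochner_Integration.integral_diff[OF i i])
    finally show ?thesis using law[OF M, of a c] law[OF M, of c a] by simp
  qed
  have "gap F = 0"
  proof -
    have "d_x e (\<lambda>z. X (fst z)) z = dd X (axis e 1) (fst z)" for e and z :: pt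
      unfolding d_x_def by (simp add: dd_fst[OF X1])
    moreover have "periodic (\<lambda>z. X (fst z))" using X(2) by (simp add: periodic_def periodic_x_def)
    ultimately show ?thesis
      using curl_F_interior[OF C2_fun_fst[OF X(1)] _ b van, of a k c] by (simp add: gap_def)
  qed
  then show ?thesis using gap[of F v] gap[of "\<lambda>z. snd (Wc z)" "\<lambda>z. fst (Wc z)"] unfolding gap_def by simp
qed

end

section \<open>Residuals of the mollified equations\<close>

lemma dd_bound_of_lipschitz:
  fixes f :: "'a::euclidean_space \<Rightarrow> real"
  assumes f: "f differentiable (at z)" and L: "\<And>x y. \<bar>f x - f y\<bar> \<le> C * norm (x - y)"
  shows "\<bar>dd f h z\<bar> \<le> C * norm h"
proof -
  have "((\<lambda>s. f (z + s *\<^sub>R h)) has_real_derivative dd f h (z + 0 *\<^sub>R h)) (at 0)"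
    by (rule has_real_derivative_line) (use f in simp)
  then have "((\<lambda>s. (f (z + s *\<^sub>R h) - f z) / s) \<longlongrightarrow> dd f h z) (at 0)"
    by (simp add: DERIV_def)
  then have "((\<lambda>s. \<bar>(f (z + s *\<^sub>R h) - f z) / s\<bar>) \<longlongrightarrow> \<bar>dd f h z\<bar>) (at 0)" by (rule tendsto_rabs)
  then show ?thesis
  proof (rule tendsto_upperbound)
    show "\<forall>\<^sub>F s in at 0. \<bar>(f (z + s *\<^sub>R h) - f z) / s\<bar> \<le> C * norm h"
      unfolding eventually_at_filter
    proof (intro always_eventually allI impI)
      fix s :: real assume "s \<noteq> 0"
      then show "\<bar>(f (z + s *\<^sub>R h) - f z) / s\<bar> \<le> C * norm h"
        using L[of "z + s *\<^sub>R h" z] by (simp add: field_simps)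
    qed
  qed simp
qed

lemma C1_fun_nth: "C1_fun (\<lambda>w::(real^3) \<times> mat3. fst w $ i)" "C1_fun (\<lambda>w::(real^3) \<times> mat3. snd w $ i $ a)"
  and bounded_linear_nth: "bounded_linear (\<lambda>w::(real^3) \<times> mat3. fst w $ i)" "bounded_linear (\<lambda>w::(real^3) \<times> mat3. snd w $ i $ a)"
proof -
  show b: "bounded_linear (\<lambda>w::(real^3) \<times> mat3. fst w $ i)" "bounded_linear (\<lambda>w::(real^3) \<times> mat3. snd w $ i $ a)"
    by (rule bounded_linear_compose[OF bounded_linear_vec_nth bounded_linear_fst],
        rule bounded_linear_compose[OF bounded_linear_vec_nth bounded_linear_compose[OF bounded_linear_vec_nth bounded_linear_snd]])
  show "C1_fun (\<lambda>w::(real^3) \<times> mat3. fst w $ i)" "C1_fun (\<lambda>w::(real^3) \<times> mat3. snd w $ i $ a)"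
    by (intro C1_fun_linear b)+
qed

lemma integral_d_x_by_parts:
  assumes f: "C1_fun f" "periodic f" and \<psi>: "C1_fun \<psi>" "periodic \<psi>"
  shows "(\<integral>z. d_x a f z * \<psi> z \<partial>QM T) = - (\<integral>z. f z * d_x a \<psi> z \<partial>QM T)"
proof -
  note c = C1_fun_continuous_on[OF f(1)] C1_fun_continuous_on[OF \<psi>(1)] C1_fun_continuous_on_dd[OF f(1)] C1_fun_continuous_on_dd[OF \<psi>(1)]
  have "(\<integral>z. d_x a (\<lambda>z. f z * \<psi> z) z \<partial>QM T) = 0"
    by (rule integral_d_x_eq_0[OF C1_fun_mult[OF f(1) \<psi>(1)]]) (use f(2) \<psi>(2) in \<open>simp add: periodic_def\<close>)
  moreover have "d_x a (\<lambda>z. f z * \<psi> z) z = f z * d_x a \<psi> z + d_x a f z * \<psi> z" for z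
    unfolding d_x_def by (rule dd_mult[OF f(1) \<psi>(1)])
  moreover have "integrable (QM T) (\<lambda>z. f z * d_x a \<psi> z)" "integrable (QM T) (\<lambda>z. d_x a f z * \<psi> z)"
    unfolding d_x_def by (intro integrable_QM_cont continuous_intros c)+
  ultimately show ?thesis by simp
qed

lemma integral_d_t_by_parts:
  assumes T: "0 < T" and f: "C1_fun f" and \<psi>: "C1_fun \<psi>" and van: "T' < T" "\<And>x t. T' \<le> t \<Longrightarrow> \<psi> (x, t) = 0" "\<And>x. \<psi> (x, 0) = 0"
  shows "(\<integral>z. d_t f z * \<psi> z \<partial>QM T) = - (\<integral>z. f z * d_t \<psi> z \<partial>QM T)"
proof -
  note c = C1_fun_continuous_on[OF f(1)] C1_fun_continuous_on[OF \<psi>(1)] C1_fun_continuous_on_dd[OF f(1)] C1_fun_continuous_on_dd[OF \<psi>(1)]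
  have "(\<integral>z. d_t (\<lambda>z. f z * \<psi> z) z \<partial>QM T) = - (\<integral>x. f (x, 0) * \<psi> (x, 0) \<partial>QB)"
    by (rule integral_d_t[OF C1_fun_mult[OF f(1) \<psi>(1)] T van(1)]) (use van in simp)
  moreover have "d_t (\<lambda>z. f z * \<psi> z) z = f z * d_t \<psi> z + d_t f z * \<psi> z" for z
    unfolding d_t_def by (rule dd_mult[OF f(1) \<psi>(1)])
  moreover have "integrable (QM T) (\<lambda>z. f z * d_t \<psi> z)" "integrable (QM T) (\<lambda>z. d_t f z * \<psi> z)"
    unfolding d_t_def by (intro integrable_QM_cont continuous_intros c)+
  ultimately show ?thesis by (simp add: van(3))
qed

locale weak_strong_approx = weak_strong G p q r T v0 F0 y v F \<nu> \<gamma> vh Fh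
  for G p q r T v0 F0 y v F \<nu> \<gamma> vh Fh +
  fixes W :: "nat \<Rightarrow> pt \<Rightarrow> (real^3) \<times> mat3" and L M :: real
  assumes W_C2: "\<And>n b. C2_fun (\<lambda>z. W n z \<bullet> b)"
    and W_periodic: "\<And>n. periodic (W n)"
    and W_lipschitz: "\<And>n x y. norm (W n x - W n y) \<le> L * norm (x - y)"
    and W_bounded: "\<And>n z. norm (W n z) \<le> M"
    and W_limit: "\<And>z. (\<lambda>n. W n z) \<longlonglongrightarrow> Wc z"
begin

lemma W_C1: "C1_fun (W n)"
  by (rule C1_fun_componentwise) (use W_C2 in \<open>auto simp: C2_fun_def\<close>)

lemma dd_W_C1: "C1_fun (dd (W n) h)"
proof (rule C1_fun_componentwise)
  fix b :: "(real^3) \<times> mat3"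
  have eq: "(\<lambda>z. dd (W n) h z \<bullet> b) = dd (\<lambda>z. W n z \<bullet> b) h"
    using dd_inner_left[OF W_C1, of n b h] by auto
  show "C1_fun (\<lambda>z. dd (W n) h z \<bullet> b)" unfolding eq using W_C2[of n b] unfolding C2_fun_def by blast
qed

lemma field_C1: "C1_fun f \<Longrightarrow> C1_fun (\<lambda>z. f (W n z))"
  by (rule C1_fun_compose[OF _ W_C1])

lemma field_C2: "C2_fun f \<Longrightarrow> C2_fun (\<lambda>z. f (W n z))"
  by (rule C2_fun_compose[OF _ W_C1 dd_W_C1])

lemma field_periodic: "periodic (\<lambda>z. f (W n z))"
  using W_periodic[of n] by (simp add: periodic_def)

lemma Wc_M: "norm (Wc z) \<le> M"
  by (rule LIMSEQ_le_const2[OF tendsto_norm[OF W_limit]]) (use W_bounded in auto)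

lemma field_bounded:
  fixes f :: "(real^3) \<times> mat3 \<Rightarrow> real"
  assumes "continuous_on UNIV f"
  obtains C where "C \<ge> 0" "\<And>n z. \<bar>f (W n z)\<bar> \<le> C" "\<And>z. \<bar>f (Wc z)\<bar> \<le> C"
proof -
  obtain C where "C \<ge> 0" "\<And>w. norm w \<le> M \<Longrightarrow> \<bar>f w\<bar> \<le> C" using C1_fun_bounded_cball[OF assms] by metis
  then show ?thesis using that W_bounded Wc_M by blast
qed

lemma field_limit:
  assumes "continuous_on UNIV f" shows "(\<lambda>n. f (W n z)) \<longlonglongrightarrow> f (Wc z)"
proof -
  have "isCont f (Wc z)" using assms continuous_on_eq_continuous_at[OF open_UNIV] by blast
  then show ?thesis by (rule isCont_tendsto_compose[OF _ W_limit])
qed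

lemma L_nonneg: "0 \<le> L"
proof -
  obtain u :: pt where "norm u = 1" using vector_choose_size[OF zero_le_one] by blast
  then have "0 \<le> L * 1" using order_trans[OF norm_ge_zero W_lipschitz[of 0 u 0]] by simp
  then show ?thesis by simp
qed

lemma field_dd_bounded:
  fixes f :: "(real^3) \<times> mat3 \<Rightarrow> real"
  assumes f: "C1_fun f"
  obtains C where "C \<ge> 0" "\<And>n z h. \<bar>dd (\<lambda>z. f (W n z)) h z\<bar> \<le> C * norm h"
proof -
  obtain K where K: "K \<ge> 0" "\<And>x y. norm x \<le> M \<Longrightarrow> norm y \<le> M \<Longrightarrow> \<bar>f y - f x\<bar> \<le> K * norm (y - x)"
    using C1_fun_lipschitz_cball[OF f] by metis
  show ?thesis
  proof (rule that[of "K * L"])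
    show "0 \<le> K * L" using K L_nonneg by simp
    fix n z h
    have "\<bar>f (W n x) - f (W n y)\<bar> \<le> (K * L) * norm (x - y)" for x y
      using K(2)[OF W_bounded W_bounded, of n x n y] mult_left_mono[OF W_lipschitz K(1), of n x y] by simp
    then show "\<bar>dd (\<lambda>z. f (W n z)) h z\<bar> \<le> (K * L) * norm h"
      by (rule dd_bound_of_lipschitz[OF C1_fun_differentiable[OF field_C1[OF f]]])
  qed
qed

lemma norm_dd_W: "norm (dd (W n) h z) \<le> L * norm h"
proof (cases "dd (W n) h z = 0")
  case True
  then show ?thesis using L_nonneg by simp
next
  case False
  \<comment> \<open>Projection onto the direction of the derivative itself makes the scalar estimate
    sharp, so no dimensional constant appears.\<close>
  define u where "u = dd (W n) h z /\<^sub>R norm (dd (W n) h z)"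
  have u: "norm u = 1" "dd (W n) h z \<bullet> u = norm (dd (W n) h z)"
    using False by (auto simp: u_def dot_square_norm power2_eq_square)
  have "\<bar>W n x \<bullet> u - W n y \<bullet> u\<bar> \<le> L * norm (x - y)" for x y
    using Cauchy_Schwarz_ineq2[of "W n x - W n y" u] W_lipschitz[of n x y] u by (simp add: inner_diff_left)
  then have "\<bar>dd (\<lambda>z. W n z \<bullet> u) h z\<bar> \<le> L * norm h"
    by (rule dd_bound_of_lipschitz[OF C1_fun_differentiable[OF C1_fun_inner_left[OF W_C1]]])
  then show ?thesis unfolding dd_inner_left[OF W_C1] u by simp
qed

lemma norm_unit: "norm (axis a 1 :: real^3, 0::real) = 1" "norm (0 :: real^3, 1::real) = 1"
  by (simp_all add: norm_Pair norm_axis_1)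

lemma wnull_field_mult:
  assumes R: "wnull T R" and f: "continuous_on UNIV f"
  shows "wnull T (\<lambda>n z. f (W n z) * R n z)"
proof -
  obtain C where C: "\<And>n z. \<bar>f (W n z)\<bar> \<le> C" using field_bounded[OF f] by metis
  show ?thesis
  proof (rule wnull_mult[OF R])
    show "(\<lambda>z. f (W n z)) \<in> borel_measurable borel" for n
      by (intro borel_measurable_continuous_onI continuous_on_compose2[OF f] C1_fun_continuous_on W_C1) simp
    show "(\<lambda>n. f (W n z)) \<longlonglongrightarrow> f (Wc z)" for z by (rule field_limit[OF f])
  qed (rule C)
qed

text \<open>Against a bump, integration by parts removes all derivatives from the approximations;
  the integrand then converges boundedly to the weak equation of \<open>Wc\<close>, which is 0. The
  bound on the residuals themselves comes from the Lipschitz constant common to all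
  \<open>n\<close>.\<close>

lemma wnull_residual:
  assumes ft: "C1_fun ft" and fa: "\<And>a. C1_fun (fa a)"
    and weak: "\<And>X b. bump T X b \<Longrightarrow> (\<integral>z. d_t (\<lambda>z. X (fst z) * b (snd z)) z * ft (Wc z)
        - (\<Sum>a\<in>UNIV. d_x a (\<lambda>z. X (fst z) * b (snd z)) z * fa a (Wc z)) \<partial>QM T) = 0"
  shows "wnull T (\<lambda>n z. d_t (\<lambda>z. ft (W n z)) z - (\<Sum>a\<in>UNIV. d_x a (\<lambda>z. fa a (W n z)) z))"
proof -
  obtain Ct where Ct: "\<And>n z h. \<bar>dd (\<lambda>z. ft (W n z)) h z\<bar> \<le> Ct * norm h" using field_dd_bounded[OF ft] by metis
  have "\<exists>C. \<forall>n z h. \<bar>dd (\<lambda>z. fa a (W n z)) h z\<bar> \<le> C * norm h" for a using field_dd_bounded[OF fa] by metis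
  then obtain Ca where Ca: "\<And>a n z h. \<bar>dd (\<lambda>z. fa a (W n z)) h z\<bar> \<le> Ca a * norm h" by metis
  define R where "R n z = d_t (\<lambda>z. ft (W n z)) z - (\<Sum>a\<in>UNIV. d_x a (\<lambda>z. fa a (W n z)) z)" for n z
  have cR: "continuous_on UNIV (R n)" for n
    unfolding R_def d_t_def d_x_def by (intro continuous_intros C1_fun_continuous_on_dd field_C1 ft fa)
  have cf: "continuous_on UNIV ft" "continuous_on UNIV (fa a)" for a by (intro C1_fun_continuous_on ft fa)+
  have cW: "continuous_on UNIV (\<lambda>z. f (W n z))" if "continuous_on UNIV f" for f :: "(real^3) \<times> mat3 \<Rightarrow> real" and n
    by (intro continuous_on_compose2[OF that] C1_fun_continuous_on W_C1) simp
  have cWc: "continuous_on UNIV (\<lambda>z. f (Wc z))" if "continuous_on UNIV f" for f :: "(real^3) \<times> mat3 \<Rightarrow> real"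
    by (intro continuous_on_compose2[OF that] Wc_continuous) simp
  have "wnull T R"
  proof (rule wnullI)
    show "R n \<in> borel_measurable borel" for n by (rule borel_measurable_continuous_onI[OF cR])
    show "\<bar>R n z\<bar> \<le> Ct + (\<Sum>a\<in>UNIV. Ca a)" for n z
    proof -
      have "\<bar>\<Sum>a\<in>UNIV. d_x a (\<lambda>z. fa a (W n z)) z\<bar> \<le> (\<Sum>a\<in>UNIV. Ca a)"
        unfolding d_x_def using Ca[of _ n "(axis _ 1, 0)" z] by (intro order_trans[OF sum_abs] sum_mono) (simp add: norm_unit)
      moreover have "\<bar>d_t (\<lambda>z. ft (W n z)) z\<bar> \<le> Ct"
        using Ct[of n "(0, 1)" z] by (simp add: d_t_def norm_unit)
      ultimately show ?thesis unfolding R_def by linarith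
    qed
    fix X b assume bump: "bump T X b"
    obtain t0 T' where X: "C2_fun X" "periodic_x X" and b: "C1_fun b" and van: "0 < t0" "T' < T" "\<And>t. t \<le> t0 \<or> T' \<le> t \<Longrightarrow> b t = 0"
      using bump unfolding bump_def by blast
    have X1: "C1_fun X" using X by (simp add: C2_fun_def)
    define \<psi> where "\<psi> z = X (fst z) * b (snd z)" for z :: pt
    have \<psi>: "C1_fun \<psi>" "periodic \<psi>" "\<And>x t. T' \<le> t \<Longrightarrow> \<psi> (x, t) = 0" "\<And>x. \<psi> (x, 0) = 0"
      using product_fn(1)[OF X1 b] X(2) van by (auto simp: \<psi>_def[abs_def] periodic_def periodic_x_def)
    have c\<psi>: "continuous_on UNIV \<psi>" "continuous_on UNIV (d_t \<psi>)" "continuous_on UNIV (d_x a \<psi>)" for a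
      unfolding d_t_def d_x_def using \<psi>(1) C1_fun_continuous_on C1_fun_continuous_on_dd by blast+
    define S where "S u z = d_t \<psi> z * ft (u z) - (\<Sum>a\<in>UNIV. d_x a \<psi> z * fa a (u z))" for u :: "pt \<Rightarrow> (real^3) \<times> mat3" and z
    have cS: "continuous_on UNIV (S (W n))" "continuous_on UNIV (S Wc)" for n
      unfolding S_def by (intro continuous_intros c\<psi> cW cWc cf)+
    have eq: "(\<integral>z. R n z * \<psi> z \<partial>QM T) = - (\<integral>z. S (W n) z \<partial>QM T)" for n
    proof -
      have i: "integrable (QM T) (\<lambda>z. d_t (\<lambda>z. ft (W n z)) z * \<psi> z)" "integrable (QM T) (\<lambda>z. d_x a (\<lambda>z. fa a (W n z)) z * \<psi> z)"
        "integrable (QM T) (\<lambda>z. d_t \<psi> z * ft (W n z))" "integrable (QM T) (\<lambda>z. d_x a \<psi> z * fa a (W n z))" for a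
        by (intro integrable_QM_cont continuous_intros c\<psi> cW cf;
            simp add: d_t_def d_x_def C1_fun_continuous_on_dd field_C1 ft fa)+
      have "(\<integral>z. R n z * \<psi> z \<partial>QM T) = (\<integral>z. d_t (\<lambda>z. ft (W n z)) z * \<psi> z - (\<Sum>a\<in>UNIV. d_x a (\<lambda>z. fa a (W n z)) z * \<psi> z) \<partial>QM T)"
        by (simp add: R_def left_diff_distrib sum_distrib_right)
      also have "\<dots> = (\<integral>z. d_t (\<lambda>z. ft (W n z)) z * \<psi> z \<partial>QM T) - (\<Sum>a\<in>UNIV. \<integral>z. d_x a (\<lambda>z. fa a (W n z)) z * \<psi> z \<partial>QM T)"
        by (simp add: i)
      also have "\<dots> = - (\<integral>z. d_t \<psi> z * ft (W n z) \<partial>QM T) + (\<Sum>a\<in>UNIV. \<integral>z. d_x a \<psi> z * fa a (W n z) \<partial>QM T)"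
        using integral_d_t_by_parts[OF T_pos field_C1[OF ft] \<psi>(1) van(2) \<psi>(3,4), of n]
          integral_d_x_by_parts[OF field_C1[OF fa] field_periodic \<psi>(1,2), where T=T]
        by (simp add: sum_negf mult.commute)
      also have "\<dots> = - (\<integral>z. S (W n) z \<partial>QM T)" unfolding S_def by (simp add: i)
      finally show ?thesis .
    qed
    have bd: "\<exists>C. \<forall>n z. \<bar>f (W n z)\<bar> \<le> C" if "continuous_on UNIV f" for f :: "(real^3) \<times> mat3 \<Rightarrow> real"
      using field_bounded[OF that] by metis
    obtain Dt where Dt: "\<And>n z. \<bar>ft (W n z)\<bar> \<le> Dt" using bd[OF cf(1)] by blast
    have "\<forall>a. \<exists>C. \<forall>n z. \<bar>fa a (W n z)\<bar> \<le> C" using bd[OF cf(2)] by blast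
    then obtain Da where "\<And>a n z. \<bar>fa a (W n z)\<bar> \<le> Da a" by metis
    note D = Dt this
    have "(\<lambda>n. \<integral>z. S (W n) z \<partial>QM T) \<longlonglongrightarrow> (\<integral>z. S Wc z \<partial>QM T)"
    proof (rule integral_dominated_convergence[where w = "\<lambda>z. \<bar>d_t \<psi> z\<bar> * Dt + (\<Sum>a\<in>UNIV. \<bar>d_x a \<psi> z\<bar> * Da a)"])
      show "S Wc \<in> borel_measurable (QM T)" "S (W n) \<in> borel_measurable (QM T)" for n
        by (intro measurable_QM borel_measurable_continuous_onI cS)+
      show "integrable (QM T) (\<lambda>z. \<bar>d_t \<psi> z\<bar> * Dt + (\<Sum>a\<in>UNIV. \<bar>d_x a \<psi> z\<bar> * Da a))"
        by (intro integrable_QM_cont continuous_intros c\<psi>)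
      show "AE z in QM T. (\<lambda>n. S (W n) z) \<longlonglongrightarrow> S Wc z"
        unfolding S_def by (intro AE_I2 tendsto_intros field_limit cf)
      show "AE z in QM T. norm (S (W n) z) \<le> \<bar>d_t \<psi> z\<bar> * Dt + (\<Sum>a\<in>UNIV. \<bar>d_x a \<psi> z\<bar> * Da a)" for n
      proof (intro AE_I2)
        fix z
        have "\<bar>\<Sum>a\<in>UNIV. d_x a \<psi> z * fa a (W n z)\<bar> \<le> (\<Sum>a\<in>UNIV. \<bar>d_x a \<psi> z\<bar> * Da a)"
          by (intro order_trans[OF sum_abs] sum_mono) (simp add: abs_mult mult_left_mono D)
        moreover have "\<bar>d_t \<psi> z * ft (W n z)\<bar> \<le> \<bar>d_t \<psi> z\<bar> * Dt" by (simp add: abs_mult mult_left_mono D)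
        ultimately show "norm (S (W n) z) \<le> \<bar>d_t \<psi> z\<bar> * Dt + (\<Sum>a\<in>UNIV. \<bar>d_x a \<psi> z\<bar> * Da a)"
          unfolding S_def real_norm_def by linarith
      qed
    qed
    moreover have "(\<integral>z. S Wc z \<partial>QM T) = 0" using weak[OF bump] by (simp add: S_def \<psi>_def[abs_def])
    ultimately have "(\<lambda>n. - (\<integral>z. S (W n) z \<partial>QM T)) \<longlonglongrightarrow> 0" using tendsto_minus by fastforce
    then show "(\<lambda>n. \<integral>z. R n z * (X (fst z) * b (snd z)) \<partial>QM T) \<longlonglongrightarrow> 0"
      using eq by (simp add: \<psi>_def)
  qed
  then show ?thesis by (simp add: R_def[abs_def])
qed

lemma bump_test_fn:
  assumes "bump T X b"
  shows "test_fn T (\<lambda>z. X (fst z) * b (snd z))" "b 0 = 0"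
proof -
  obtain t0 T' where X: "C2_fun X" "periodic_x X" and b: "C1_fun b" and van: "0 < t0" "T' < T" "\<And>t. t \<le> t0 \<or> T' \<le> t \<Longrightarrow> b t = 0"
    using assms unfolding bump_def by blast
  show "test_fn T (\<lambda>z. X (fst z) * b (snd z))"
    by (rule product_test_fn[OF _ X(2) b van(2)]) (use X van in \<open>auto simp: C2_fun_def\<close>)
  show "b 0 = 0" using van by simp
qed

lemma stress_C1: "C1_fun (stress i a)"
proof -
  have "stress i a = (\<lambda>X. \<Sum>b\<in>Basis. (dd Phi (Emat i a) (fst X) \<bullet> b) *\<^sub>R dd G b X)"
    unfolding stress_def by (rule ext) (rule dd_Basis[OF G_diff])
  moreover have "C1_fun (\<lambda>X. \<Sum>b\<in>Basis. (dd Phi (Emat i a) (fst X) \<bullet> b) *\<^sub>R dd G b X)"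
    by (intro C1_fun_sum C1_fun_scaleR C1_fun_inner_left C1_fun_fst[OF C1_fun_dd_Phi] dG_C1)
  ultimately show ?thesis by simp
qed

lemma C1_fun_Phi_snd: "C1_fun (\<lambda>w::(real^3) \<times> mat3. Phi (snd w))"
  by (rule C1_fun_snd[OF C1_fun_Phi])

lemma wnull_momentum:
  "wnull T (\<lambda>n z. d_t (\<lambda>z. fst (W n z) $ i) z - (\<Sum>a\<in>UNIV. d_x a (\<lambda>z. stress i a (Phi (snd (W n z)))) z))"
proof (rule wnull_residual[where ft="\<lambda>w. fst w $ i" and fa="\<lambda>a w. stress i a (Phi (snd w))"])
  show "C1_fun (\<lambda>w::(real^3) \<times> mat3. stress i a (Phi (snd w)))" for a by (rule C1_fun_compose[OF stress_C1 C1_fun_Phi_snd])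
  show "(\<integral>z. d_t (\<lambda>z. X (fst z) * b (snd z)) z * fst (Wc z) $ i
        - (\<Sum>a\<in>UNIV. d_x a (\<lambda>z. X (fst z) * b (snd z)) z * stress i a (Phi (snd (Wc z)))) \<partial>QM T) = 0" if "bump T X b" for X b
    using hat_momentum_law[OF bump_test_fn(1)[OF that], of i] bump_test_fn(2)[OF that] by simp
qed (rule C1_fun_nth)

lemma wnull_strain:
  "wnull T (\<lambda>n z. d_t (\<lambda>z. snd (W n z) $ i $ a) z - d_x a (\<lambda>z. fst (W n z) $ i) z)"
proof -
  have "wnull T (\<lambda>n z. d_t (\<lambda>z. snd (W n z) $ i $ a) z - (\<Sum>c\<in>UNIV. d_x c (\<lambda>z. if c = a then fst (W n z) $ i else 0) z))"
  proof (rule wnull_residual[where ft="\<lambda>w. snd w $ i $ a" and fa="\<lambda>c w. if c = a then fst w $ i else 0"])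
    show "C1_fun (\<lambda>w::(real^3) \<times> mat3. if c = a then fst w $ i else 0)" for c by (cases "c = a") (auto intro: C1_fun_nth)
    show "(\<integral>z. d_t (\<lambda>z. X (fst z) * b (snd z)) z * snd (Wc z) $ i $ a
        - (\<Sum>c\<in>UNIV. d_x c (\<lambda>z. X (fst z) * b (snd z)) z * (if c = a then fst (Wc z) $ i else 0)) \<partial>QM T) = 0" if "bump T X b" for X b
      using hat_geometric_law[OF bump_test_fn(1)[OF that], of "(Emat i a, 0, 0)"] bump_test_fn(2)[OF that]
      by (simp add: Phi_inner_slot sum_dd_Phi_inner_slot)
  qed (rule C1_fun_nth)
  moreover have "(\<Sum>c\<in>UNIV. d_x c (\<lambda>z. if c = a then fst (W n z) $ i else 0) z) = d_x a (\<lambda>z. fst (W n z) $ i) z" for n z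
  proof -
    have "(\<Sum>c\<in>UNIV. d_x c (\<lambda>z. if c = a then fst (W n z) $ i else 0) z) = (\<Sum>c\<in>UNIV. if c = a then d_x c (\<lambda>z. fst (W n z) $ i) z else 0)"
      by (intro sum.cong) (auto simp: d_x_def)
    then show ?thesis by simp
  qed
  ultimately show ?thesis by simp
qed

text \<open>A curl component is a spatial divergence with two nonzero fluxes and no time part, so it
  is a residual in the sense of \<open>wnull_residual\<close>. The case a = c is separate because
  both fluxes would occupy the same slot.\<close>

lemma wnull_curl:
  "wnull T (\<lambda>n z. d_x a (\<lambda>z. snd (W n z) $ k $ c) z - d_x c (\<lambda>z. snd (W n z) $ k $ a) z)"
proof (cases "a = c")
  case True
  then show ?thesis by (simp add: wnull_zero)
next
  case False
  define fa where "fa e w = (if e = a then - snd w $ k $ c else if e = c then snd w $ k $ a else 0)" for e :: 3 and w :: "(real^3) \<times> mat3"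
  have "wnull T (\<lambda>n z. d_t (\<lambda>z. 0) z - (\<Sum>e\<in>UNIV. d_x e (\<lambda>z. fa e (W n z)) z))"
  proof (rule wnull_residual[where ft="\<lambda>w. 0"])
    show "C1_fun (fa e)" for e
      unfolding fa_def by (cases "e = a"; cases "e = c") (auto intro: C1_fun_nth C1_fun_minus)
    fix X b assume bump: "bump T X b"
    have X1: "C1_fun X" and b: "C1_fun b" using bump by (auto simp: bump_def C2_fun_def)
    have "(\<Sum>e\<in>UNIV. d_x e (\<lambda>z. X (fst z) * b (snd z)) z * fa e (Wc z))
        = (\<Sum>e\<in>UNIV. (if e = a then d_x e (\<lambda>z. X (fst z) * b (snd z)) z * - snd (Wc z) $ k $ c else 0)
            + (if e = c then d_x e (\<lambda>z. X (fst z) * b (snd z)) z * snd (Wc z) $ k $ a else 0))" for z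
      using False by (intro sum.cong) (auto simp: fa_def)
    then have "(\<Sum>e\<in>UNIV. d_x e (\<lambda>z. X (fst z) * b (snd z)) z * fa e (Wc z))
        = - (b (snd z) * (dd X (axis a 1) (fst z) * snd (Wc z) $ k $ c - dd X (axis c 1) (fst z) * snd (Wc z) $ k $ a))" for z
      by (simp add: sum.distrib product_fn(3)[OF X1 b] algebra_simps)
    then show "(\<integral>z. d_t (\<lambda>z. X (fst z) * b (snd z)) z * 0 - (\<Sum>e\<in>UNIV. d_x e (\<lambda>z. X (fst z) * b (snd z)) z * fa e (Wc z)) \<partial>QM T) = 0"
      using curl_hat[OF bump, of a k c] by simp
  qed simp
  moreover have "d_t (\<lambda>z. 0) z - (\<Sum>e\<in>UNIV. d_x e (\<lambda>z. fa e (W n z)) z) = d_x a (\<lambda>z. snd (W n z) $ k $ c) z - d_x c (\<lambda>z. snd (W n z) $ k $ a) z" for n z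
  proof -
    have "(\<Sum>e\<in>UNIV. d_x e (\<lambda>z. fa e (W n z)) z) = (\<Sum>e\<in>UNIV. (if e = a then - d_x e (\<lambda>z. snd (W n z) $ k $ c) z else 0) + (if e = c then d_x e (\<lambda>z. snd (W n z) $ k $ a) z else 0))"
      using False by (intro sum.cong) (auto simp: fa_def d_x_def dd_minus field_C1[OF C1_fun_nth(2)])
    then show ?thesis by (simp add: sum.distrib d_t_def)
  qed
  ultimately show ?thesis by simp
qed

end

section \<open>Decomposition of the entropy production\<close>

lemma dd_dd_Phi: "dd (\<lambda>M. dd Phi E M) N H = (0, ccof N E, ccof H N \<bullet> E)"
proof (rule dd_eqI)
  have b: "bounded_linear (\<lambda>M. ccof M E)" by (rule ccof.bounded_linear_left)
  have c: "(cof has_derivative (\<lambda>N. ccof H N)) (at H)"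
    using C1_fun_has_derivative[OF C1_fun_cof, of H] by (simp add: dd_cof)
  show "((\<lambda>M. dd Phi E M) has_derivative (\<lambda>N. (0, ccof N E, ccof H N \<bullet> E))) (at H)"
    unfolding dd_Phi
    by (intro has_derivative_Pair has_derivative_const bounded_linear_imp_has_derivative[OF b] has_derivative_inner_left c)
qed

context energy begin

definition D2 :: "xi \<Rightarrow> xi \<Rightarrow> xi \<Rightarrow> real" where "D2 X Y Z = dd (dd G Y) Z X"

lemma D2_commute: "D2 X Y Z = D2 X Z Y"
  unfolding D2_def by (rule dd_commute[OF G_C2])

lemma linear_D2: "linear (D2 X Y)" "linear (\<lambda>Y. D2 X Y Z)"
proof -
  show l: "linear (D2 X Y)" for Y unfolding D2_def[abs_def] by (rule linear_dd[OF dG_diff])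
  have "(\<lambda>Y. D2 X Y Z) = D2 X Z" by (rule ext) (rule D2_commute)
  then show "linear (\<lambda>Y. D2 X Y Z)" using l by simp
qed

lemma D2_Basis: "D2 X Y Z = (\<Sum>b\<in>Basis. (Y \<bullet> b) * D2 X b Z)"
  unfolding D2_def by (rule dd2_Basis[OF G_C2])

text \<open>Product rule: the Hessian term differentiates dG, the other two differentiate dPhi. With
  \<open>N\<close> the derivative of \<open>H\<close> in direction \<open>a\<close>, the latter sum
  over \<open>a\<close> to curls of \<open>H\<close>.\<close>

lemma dd_stress_Phi:
  "dd (\<lambda>M. stress i a (Phi M)) N H = D2 (Phi H) (dd Phi (Emat i a) H) (dd Phi N H)
     + ccof N (dG_Z G (Phi H)) $ i $ a + dG_w G (Phi H) * ccof N H $ i $ a"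
proof -
  have C: "C1_fun (\<lambda>M. dd Phi (Emat i a) M \<bullet> b)" "C1_fun (\<lambda>M. dd G b (Phi M))" for b
    by (intro C1_fun_inner_left C1_fun_dd_Phi C1_fun_compose[OF dG_C1 C1_fun_Phi])+
  have "(\<lambda>M. stress i a (Phi M)) = (\<lambda>M. \<Sum>b\<in>Basis. (dd Phi (Emat i a) M \<bullet> b) * dd G b (Phi M))"
  proof
    fix M
    have "stress i a (Phi M) = dd G (dd Phi (Emat i a) M) (Phi M)" by (simp add: stress_def Phi_def)
    then show "stress i a (Phi M) = (\<Sum>b\<in>Basis. (dd Phi (Emat i a) M \<bullet> b) * dd G b (Phi M))"
      using dd_Basis[OF G_diff, of "dd Phi (Emat i a) M" "Phi M"] by simp
  qed
  then have "dd (\<lambda>M. stress i a (Phi M)) N H = dd (\<lambda>M. \<Sum>b\<in>Basis. (dd Phi (Emat i a) M \<bullet> b) * dd G b (Phi M)) N H" by simp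
  also have "\<dots> = (\<Sum>b\<in>Basis. (dd Phi (Emat i a) H \<bullet> b) * D2 (Phi H) b (dd Phi N H)
      + (dd (\<lambda>M. dd Phi (Emat i a) M) N H \<bullet> b) * dd G b (Phi H))"
    by (subst dd_sum) (auto intro!: C1_fun_mult C sum.cong simp: dd_mult[OF C] dd_inner_left[OF C1_fun_dd_Phi]
        dd_compose[OF dG_C1 C1_fun_Phi] D2_def)
  also have "\<dots> = D2 (Phi H) (dd Phi (Emat i a) H) (dd Phi N H) + dd G (dd (\<lambda>M. dd Phi (Emat i a) M) N H) (Phi H)"
    unfolding sum.distrib D2_Basis[of _ "dd Phi (Emat i a) H", symmetric]
    using dd_Basis[OF G_diff, of "dd (\<lambda>M. dd Phi (Emat i a) M) N H" "Phi H"] by simp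
  also have "dd G (dd (\<lambda>M. dd Phi (Emat i a) M) N H) (Phi H)
      = ccof N (dG_Z G (Phi H)) $ i $ a + dG_w G (Phi H) * ccof N H $ i $ a"
    unfolding dd_dd_Phi dd_split[OF G_diff]
    using ccof_inner_commute[of N "Emat i a" "dG_Z G (Phi H)"] by (simp add: inner_Emat inner_commute ccof_commute[of H N])
  finally show ?thesis by simp
qed

lemma dd_Phi_sum: "dd Phi N H = (\<Sum>i\<in>UNIV. \<Sum>a\<in>UNIV. N $ i $ a *\<^sub>R dd Phi (Emat i a) H)"
proof -
  interpret l: linear "\<lambda>N. dd Phi N H" by (rule linear_dd[OF C1_fun_differentiable[OF C1_fun_Phi]])
  have "dd Phi N H = dd Phi (\<Sum>i\<in>UNIV. \<Sum>a\<in>UNIV. N $ i $ a *\<^sub>R Emat i a) H" by (simp add: sum_nth_nth)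
  then show ?thesis by (simp add: l.sum l.scale)
qed

lemma D2_dd_Phi_sum: "D2 X Y (dd Phi N H) = (\<Sum>i\<in>UNIV. \<Sum>a\<in>UNIV. N $ i $ a * D2 X (dd Phi (Emat i a) H) Y)"
proof -
  interpret l: linear "\<lambda>Z. D2 X Z Y" by (rule linear_D2)
  show ?thesis unfolding D2_commute[of X Y] dd_Phi_sum[of N] by (simp add: l.sum l.scale)
qed

text \<open>The matrix representing the Z-slot of the linear form
  \<open>\<lambda>Y. D2 X Y Z\<close>, that is, the derivative of the Z-gradient of \<open>G\<close>
  in direction \<open>Z\<close>.\<close>

definition grad_Z :: "xi \<Rightarrow> xi \<Rightarrow> mat3" where
  "grad_Z X Z = (\<chi> k l. D2 X (0, Emat k l, 0) Z)"

lemma D2_split: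
  "D2 X (A1, A2, A3) Z = D2 X (A1, 0, 0) Z + grad_Z X Z \<bullet> A2 + A3 * D2 X (0, 0, 1) Z"
proof -
  interpret l: linear "\<lambda>Y. D2 X Y Z" by (rule linear_D2)
  have e: "linear (\<lambda>A::mat3. (0::mat3, A, 0::real))" by (intro bounded_linear.linear bounded_linear_embed)
  interpret e: linear "\<lambda>A::mat3. (0::mat3, A, 0::real)" by (rule e)
  have "D2 X (0, A2, 0) Z = D2 X (0, \<Sum>i\<in>UNIV. \<Sum>a\<in>UNIV. A2 $ i $ a *\<^sub>R Emat i a, 0) Z" by (simp add: sum_nth_nth)
  also have "\<dots> = (\<Sum>i\<in>UNIV. \<Sum>a\<in>UNIV. A2 $ i $ a * D2 X (0, Emat i a, 0) Z)"
    by (simp add: e.sum e.scale l.sum l.scale del: scaleR_Pair)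
  also have "\<dots> = grad_Z X Z \<bullet> A2" by (simp add: grad_Z_def inner_vec_def mult.commute)
  finally have "D2 X (0, A2, 0) Z = grad_Z X Z \<bullet> A2" .
  moreover have "(A1, A2, A3) = (A1, 0, 0) + (0, A2, 0) + A3 *\<^sub>R (0, 0, 1)" by simp
  then have "D2 X (A1, A2, A3) Z = D2 X (A1, 0, 0) Z + D2 X (0, A2, 0) Z + A3 * D2 X (0, 0, 1) Z"
    by (simp only: l.add l.scale) simp
  ultimately show ?thesis by simp
qed

lemma D2_dd_Phi_Emat:
  "D2 X (dd Phi (Emat i a) F) Z = D2 X (Emat i a, 0, 0) Z + ccof (grad_Z X Z) F $ i $ a + D2 X (0, 0, 1) Z * cof F $ i $ a"
  unfolding dd_Phi D2_split[of X "Emat i a" "ccof F (Emat i a)"]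
  using ccof_inner_commute[of F "Emat i a" "grad_Z X Z"] by (simp add: inner_Emat inner_commute ccof_commute[of F])

lemma dd_G_dd_Phi_Emat:
  "dd G (dd Phi (Emat i a) F) X = dG_F G X $ i $ a + ccof (dG_Z G X) F $ i $ a + dG_w G X * cof F $ i $ a"
  unfolding dd_Phi dd_split[OF G_diff]
  using ccof_inner_commute[of F "Emat i a" "dG_Z G X"] by (simp add: inner_Emat inner_commute ccof_commute[of F])

text \<open>In the following two identities \<open>(Vt, Ht)\<close> and \<open>(Va a, Ha a)\<close> are the time and space derivatives
  of a smooth approximation \<open>(V, H)\<close> of the Lipschitz solution.\<close>

lemma entropy_production_split:
  fixes v V Vt :: "real^3" and Va :: "3 \<Rightarrow> real^3" and H Ht F :: mat3 and Ha :: "3 \<Rightarrow> mat3" and f :: "3 \<Rightarrow> 3 \<Rightarrow> real" and P :: xi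
  defines "X \<equiv> Phi H"
  defines "Q \<equiv> \<lambda>i a. D2 X (dd Phi (Emat i a) H) (P - X)"
  shows "(\<Sum>i\<in>UNIV. Vt $ i * v $ i) - (\<Sum>i\<in>UNIV. \<Sum>a\<in>UNIV. Va a $ i * f i a) + D2 X (P - X) (dd Phi Ht H)
     - (\<Sum>i\<in>UNIV. \<Sum>a\<in>UNIV. v $ i * D2 X (dd Phi (Emat i a) F) (dd Phi (Ha a) H)) - (\<Sum>i\<in>UNIV. V $ i * Vt $ i)
   = (\<Sum>i\<in>UNIV. (v $ i - V $ i) * ((Vt $ i - (\<Sum>a\<in>UNIV. dd (\<lambda>M. stress i a (Phi M)) (Ha a) H))
        + (\<Sum>a\<in>UNIV. ccof (Ha a) (dG_Z G X) $ i $ a) + dG_w G X * (\<Sum>a\<in>UNIV. ccof (Ha a) H $ i $ a)))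
     + (\<Sum>i\<in>UNIV. \<Sum>a\<in>UNIV. (Ht $ i $ a - Va a $ i) * Q i a)
     + (\<Sum>i\<in>UNIV. \<Sum>a\<in>UNIV. Va a $ i * (Q i a - f i a))
     - (\<Sum>i\<in>UNIV. \<Sum>a\<in>UNIV. (v $ i - V $ i) * D2 X (dd Phi (Emat i a) F - dd Phi (Emat i a) H) (dd Phi (Ha a) H))
     - (\<Sum>i\<in>UNIV. V $ i * (\<Sum>a\<in>UNIV. D2 X (dd Phi (Emat i a) F) (dd Phi (Ha a) H)))"
proof -
  have diff: "D2 X (dd Phi (Emat i a) F - dd Phi (Emat i a) H) (dd Phi (Ha a) H)
     = D2 X (dd Phi (Emat i a) F) (dd Phi (Ha a) H) - D2 X (dd Phi (Emat i a) H) (dd Phi (Ha a) H)" for i a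
    by (rule linear_diff[OF linear_D2(2)])
  show ?thesis
    unfolding diff D2_dd_Phi_sum[of X "P - X" Ht] dd_stress_Phi X_def[symmetric] Q_def
    by (simp add: sum.distrib sum_subtractf sum_distrib_left left_diff_distrib right_diff_distrib distrib_left distrib_right mult_ac)
qed

lemma null_lagrangian_split:
  fixes V :: "real^3" and Va :: "3 \<Rightarrow> real^3" and H F :: mat3 and Ha :: "3 \<Rightarrow> mat3"
  defines "X \<equiv> Phi H"
  defines "dX \<equiv> \<lambda>a. dd Phi (Ha a) H"
  defines "dw \<equiv> \<lambda>i a. Va a $ i * dG_w G X + V $ i * D2 X (0, 0, 1) (dX a)"
  shows "- (V $ i * (\<Sum>a\<in>UNIV. D2 X (dd Phi (Emat i a) F) (dX a)))
   = (\<Sum>a\<in>UNIV. Va a $ i * dd G (dd Phi (Emat i a) F) X) - (\<Sum>a\<in>UNIV. dw i a * cof (F - H) $ i $ a)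
     + V $ i * dG_w G X * ((\<Sum>a\<in>UNIV. ccof (Ha a) F $ i $ a) - (\<Sum>a\<in>UNIV. ccof (Ha a) H $ i $ a))
     - ((\<Sum>a\<in>UNIV. Va a $ i * dG_F G X $ i $ a + V $ i * D2 X (Emat i a, 0, 0) (dX a))
      + (\<Sum>a\<in>UNIV. ccof (Va a $ i *\<^sub>R dG_Z G X + V $ i *\<^sub>R grad_Z X (dX a)) F $ i $ a)
      + (\<Sum>a\<in>UNIV. ccof (dw i a *\<^sub>R H + (V $ i * dG_w G X) *\<^sub>R Ha a) F $ i $ a)
      - (\<Sum>a\<in>UNIV. dw i a * cof H $ i $ a + V $ i * dG_w G X * ccof (Ha a) H $ i $ a))"
proof -
  \<comment> \<open>Each V d_a(dG) is rewritten as d_a(V dG) minus d_a(V) dG. In the w-slot the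
    expansion about \<open>H\<close> moves \<open>H\<close> inside the derivative as well; this
    creates the terms with \<open>ccof (Ha a)\<close>, whose sums over \<open>a\<close> are curls of
    the smooth strain.\<close>
  have c: "cof F = cof (F - H) + ccof H F - cof H" by (simp add: cof_diff)
  have "- (V $ i * D2 X (dd Phi (Emat i a) F) (dX a)) = Va a $ i * dd G (dd Phi (Emat i a) F) X - dw i a * cof (F - H) $ i $ a
     + V $ i * dG_w G X * (ccof (Ha a) F $ i $ a - ccof (Ha a) H $ i $ a)
     - ((Va a $ i * dG_F G X $ i $ a + V $ i * D2 X (Emat i a, 0, 0) (dX a))
      + ccof (Va a $ i *\<^sub>R dG_Z G X + V $ i *\<^sub>R grad_Z X (dX a)) F $ i $ a
      + ccof (dw i a *\<^sub>R H + (V $ i * dG_w G X) *\<^sub>R Ha a) F $ i $ a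
      - (dw i a * cof H $ i $ a + V $ i * dG_w G X * ccof (Ha a) H $ i $ a))" for a
  proof -
    have cF: "cof F $ i $ a = cof (F - H) $ i $ a + ccof H F $ i $ a - cof H $ i $ a"
      using arg_cong[OF c, of "\<lambda>M. M $ i $ a"] by simp
    show ?thesis
      unfolding D2_dd_Phi_Emat dd_G_dd_Phi_Emat cF dw_def ccof.add_left ccof.scaleR_left
      by (simp add: algebra_simps)
  qed
  then show ?thesis
    by (simp only: sum_distrib_left flip: sum.distrib sum_subtractf sum_negf)
qed

end

lemma C2_fun_linear: "bounded_linear f \<Longrightarrow> C2_fun f"
proof -
  assume f: "bounded_linear f"
  have "dd f h = (\<lambda>z. f h)" for h by (rule ext) (rule dd_linear[OF f])
  then show ?thesis using C1_fun_linear[OF f] by (simp add: C2_fun_def)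
qed

context weak_strong_approx begin

definition vanish :: "(nat \<Rightarrow> pt \<Rightarrow> real) \<Rightarrow> bool" where
  "vanish R \<longleftrightarrow> (\<forall>n. integrable (QM T) (R n)) \<and> (\<lambda>n. \<integral>z. R n z \<partial>QM T) \<longlonglongrightarrow> 0"

lemma vanish_0: "vanish (\<lambda>n z. 0)" by (simp add: vanish_def)

lemma vanish_add: "vanish R \<Longrightarrow> vanish S \<Longrightarrow> vanish (\<lambda>n z. R n z + S n z)"
  unfolding vanish_def using tendsto_add[of _ 0 sequentially _ 0] by auto

lemma vanish_diff: "vanish R \<Longrightarrow> vanish S \<Longrightarrow> vanish (\<lambda>n z. R n z - S n z)"
  unfolding vanish_def using tendsto_diff[of _ 0 sequentially _ 0] by auto

lemma vanish_sum: "(\<And>i. i \<in> I \<Longrightarrow> vanish (R i)) \<Longrightarrow> vanish (\<lambda>n z. \<Sum>i\<in>I. R i n z)"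
  by (induction I rule: infinite_finite_induct) (auto intro: vanish_0 vanish_add)

lemma vanish_wnull: "wnull T R \<Longrightarrow> integrable (QM T) g \<Longrightarrow> vanish (\<lambda>n z. R n z * g z)"
  unfolding vanish_def using wnullD wnull_integrable by blast

lemma wnull_diff:
  assumes "wnull T R" "wnull T S" shows "wnull T (\<lambda>n z. R n z - S n z)"
  using wnull_add[OF assms(1) wnull_field_mult[OF assms(2), of "\<lambda>_. -1"]] by simp

definition Vn :: "nat \<Rightarrow> pt \<Rightarrow> real^3" where "Vn n z = fst (W n z)"
definition Hn :: "nat \<Rightarrow> pt \<Rightarrow> mat3" where "Hn n z = snd (W n z)"
definition Xn :: "nat \<Rightarrow> pt \<Rightarrow> xi" where "Xn n z = Phi (Hn n z)"
definition Vt :: "nat \<Rightarrow> pt \<Rightarrow> real^3" where "Vt n z = fst (dd (W n) (0, 1) z)"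
definition Ht :: "nat \<Rightarrow> pt \<Rightarrow> mat3" where "Ht n z = snd (dd (W n) (0, 1) z)"
definition Va :: "nat \<Rightarrow> pt \<Rightarrow> 3 \<Rightarrow> real^3" where "Va n z a = fst (dd (W n) (axis a 1, 0) z)"
definition Ha :: "nat \<Rightarrow> pt \<Rightarrow> 3 \<Rightarrow> mat3" where "Ha n z a = snd (dd (W n) (axis a 1, 0) z)"
definition dX :: "nat \<Rightarrow> pt \<Rightarrow> 3 \<Rightarrow> xi" where "dX n z a = dd Phi (Ha n z a) (Hn n z)"

lemma Hn_C1: "C1_fun (Hn n)" and dd_Hn: "dd (Hn n) h z = snd (dd (W n) h z)"
  using C1_fun_compose[OF C1_fun_linear[OF bounded_linear_snd] W_C1, of n]
    dd_compose[OF C1_fun_linear[OF bounded_linear_snd] W_C1, of n h z] dd_linear[OF bounded_linear_snd]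
  by (simp_all add: Hn_def[abs_def])

lemma d_V: "d_t (\<lambda>z. fst (W n z) $ i) z = Vt n z $ i" "d_x a (\<lambda>z. fst (W n z) $ i) z = Va n z a $ i"
  using dd_compose[OF C1_fun_nth(1) W_C1] dd_linear[OF bounded_linear_nth(1)]
  by (simp_all add: d_t_def d_x_def Vt_def Va_def)

lemma d_H: "d_t (\<lambda>z. snd (W n z) $ i $ c) z = Ht n z $ i $ c" "d_x a (\<lambda>z. snd (W n z) $ i $ c) z = Ha n z a $ i $ c"
  using dd_compose[OF C1_fun_nth(2) W_C1] dd_linear[OF bounded_linear_nth(2)]
  by (simp_all add: d_t_def d_x_def Ht_def Ha_def)

lemma d_fH:
  fixes f :: "mat3 \<Rightarrow> real"
  assumes "C1_fun f"
  shows "d_t (\<lambda>z. f (Hn n z)) z = dd f (Ht n z) (Hn n z)" "d_x a (\<lambda>z. f (Hn n z)) z = dd f (Ha n z a) (Hn n z)"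
  by (simp_all add: d_t_def d_x_def dd_compose[OF assms Hn_C1] dd_Hn Ht_def Ha_def)

lemma dd_dG_Phi: "dd (\<lambda>M. dd G A (Phi M)) N H = D2 (Phi H) A (dd Phi N H)"
  using dd_compose[OF dG_C1 C1_fun_Phi] by (simp add: D2_def)

lemma d_dG: "d_t (\<lambda>z. dd G A (Xn n z)) z = D2 (Xn n z) A (dd Phi (Ht n z) (Hn n z))"
    "d_x a (\<lambda>z. dd G A (Xn n z)) z = D2 (Xn n z) A (dX n z a)"
  using d_fH[OF C1_fun_compose[OF dG_C1 C1_fun_Phi]] by (simp_all add: Xn_def dX_def dd_dG_Phi)

lemma dG_field: "C1_fun (\<lambda>w::(real^3) \<times> mat3. dd G A (Phi (snd w)))" "C2_fun (\<lambda>w::(real^3) \<times> mat3. dd G A (Phi (snd w)))"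
proof -
  have "dd (\<lambda>w::(real^3) \<times> mat3. Phi (snd w)) h = (\<lambda>w. dd Phi (snd h) (snd w))" for h
    by (rule ext) (rule dd_snd[OF C1_fun_Phi])
  then show "C2_fun (\<lambda>w::(real^3) \<times> mat3. dd G A (Phi (snd w)))"
    by (intro C2_fun_compose[OF dG_C2] C1_fun_Phi_snd) (simp add: C1_fun_snd[OF C1_fun_dd_Phi])
  then show "C1_fun (\<lambda>w::(real^3) \<times> mat3. dd G A (Phi (snd w)))" by (simp add: C2_fun_def)
qed

lemma V_field: "C2_fun (\<lambda>w::(real^3) \<times> mat3. fst w $ i)" and H_field: "C2_fun (\<lambda>w::(real^3) \<times> mat3. snd w $ i $ a)"
  by (intro C2_fun_linear bounded_linear_nth)+

text \<open>The two \<open>ccof\<close> sums cancel the part of the divergence of the stress in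
  which dPhi is differentiated, see \<open>dd_stress_Phi\<close>; what remains is \<open>Vt\<close>
  minus the Hessian terms. Being built from curls, the added sums are weakly null
  themselves.\<close>

definition momentum_residual :: "3 \<Rightarrow> nat \<Rightarrow> pt \<Rightarrow> real" where
  "momentum_residual i n z = (Vt n z $ i - (\<Sum>a\<in>UNIV. dd (\<lambda>M. stress i a (Phi M)) (Ha n z a) (Hn n z)))
        + (\<Sum>a\<in>UNIV. ccof (Ha n z a) (dG_Z G (Xn n z)) $ i $ a) + dG_w G (Xn n z) * (\<Sum>a\<in>UNIV. ccof (Ha n z a) (Hn n z) $ i $ a)"

definition curl :: "3 \<Rightarrow> 3 \<Rightarrow> nat \<Rightarrow> pt \<Rightarrow> real" where
  "curl k c n z = Ha n z (c+1) $ k $ (c+2) - Ha n z (c+2) $ k $ (c+1)"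

lemma wnull_curl': "wnull T (curl k c)"
  using wnull_curl[of "c+1" k "c+2"] by (simp add: d_H curl_def[abs_def])

lemma sum_ccof_Ha: "(\<Sum>a\<in>UNIV. ccof (Ha n z a) N $ i $ a)
    = (\<Sum>c\<in>UNIV. N $ (i+2) $ c * curl (i+1) c n z - N $ (i+1) $ c * curl (i+2) c n z)"
  unfolding sum_ccof_curl curl_def ..

lemma wnull_ccof_Ha:
  assumes "\<And>k l. continuous_on UNIV (\<lambda>w. m w $ k $ l)"
  shows "wnull T (\<lambda>n z. \<Sum>a\<in>UNIV. ccof (Ha n z a) (m (W n z)) $ i $ a)"
  unfolding sum_ccof_Ha by (intro wnull_sum wnull_diff wnull_field_mult[OF wnull_curl'] assms)

lemma wnull_momentum_residual: "wnull T (momentum_residual i)"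
proof -
  have "wnull T (\<lambda>n z. Vt n z $ i - (\<Sum>a\<in>UNIV. dd (\<lambda>M. stress i a (Phi M)) (Ha n z a) (Hn n z)))"
    using wnull_momentum[of i] d_fH(2)[OF C1_fun_compose[OF stress_C1 C1_fun_Phi]] by (simp add: d_V Hn_def)
  moreover have "wnull T (\<lambda>n z. \<Sum>a\<in>UNIV. ccof (Ha n z a) (dG_Z G (Phi (snd (W n z)))) $ i $ a)"
    by (rule wnull_ccof_Ha) (simp add: dG_Z_def C1_fun_continuous_on[OF dG_field(1)])
  moreover have "wnull T (\<lambda>n z. dG_w G (Phi (snd (W n z))) * (\<Sum>a\<in>UNIV. ccof (Ha n z a) (snd (W n z)) $ i $ a))"
    by (intro wnull_field_mult[of _ "\<lambda>w. dG_w G (Phi (snd w))"] wnull_ccof_Ha)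
       (auto simp: dG_w_def intro: C1_fun_continuous_on dG_field C1_fun_nth)
  ultimately show ?thesis
    unfolding momentum_residual_def[abs_def] Xn_def Hn_def by (intro wnull_add)
qed

text \<open>The linearised stress at the approximate state in the direction of the averaged state,
  the quantity that the averaged flux is compared with.\<close>

definition Q :: "3 \<Rightarrow> 3 \<Rightarrow> nat \<Rightarrow> pt \<Rightarrow> real" where
  "Q i a n z = D2 (Xn n z) (dd Phi (Emat i a) (Hn n z)) (Phi (F z) - Xn n z)"

text \<open>The three parts of the entropy production: one that vanishes in the limit since it is linear in the
  residuals, one that is quadratic in the distance to the approximation, and one made of null Lagrangians.\<close>

definition residual_part :: "nat \<Rightarrow> pt \<Rightarrow> real" where
  "residual_part n z = (\<Sum>i\<in>UNIV. (v z $ i - Vn n z $ i) * momentum_residual i n z)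
     + (\<Sum>i\<in>UNIV. \<Sum>a\<in>UNIV. (Ht n z $ i $ a - Va n z a $ i) * Q i a n z)
     + (\<Sum>i\<in>UNIV. Vn n z $ i * dG_w G (Xn n z) * ((\<Sum>a\<in>UNIV. ccof (Ha n z a) (F z) $ i $ a) - (\<Sum>a\<in>UNIV. ccof (Ha n z a) (Hn n z) $ i $ a)))"

text \<open>The derivative in direction \<open>a\<close> of V_i times the w-derivative of
  \<open>G\<close> at the approximate state, compare \<open>d_x_V_dG\<close>.\<close>

definition dw :: "nat \<Rightarrow> pt \<Rightarrow> 3 \<Rightarrow> 3 \<Rightarrow> real" where
  "dw n z i a = Va n z a $ i * dG_w G (Xn n z) + Vn n z $ i * D2 (Xn n z) (0, 0, 1) (dX n z a)"

definition quadratic_part :: "nat \<Rightarrow> pt \<Rightarrow> real" where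
  "quadratic_part n z = (\<Sum>i\<in>UNIV. \<Sum>a\<in>UNIV. Va n z a $ i * (Q i a n z - avg_flux i a z + dd G (dd Phi (Emat i a) (F z)) (Xn n z)))
     - (\<Sum>i\<in>UNIV. \<Sum>a\<in>UNIV. (v z $ i - Vn n z $ i) * D2 (Xn n z) (dd Phi (Emat i a) (F z) - dd Phi (Emat i a) (Hn n z)) (dX n z a))
     - (\<Sum>i\<in>UNIV. \<Sum>a\<in>UNIV. dw n z i a * cof (F z - Hn n z) $ i $ a)"

definition null_part :: "nat \<Rightarrow> pt \<Rightarrow> real" where
  "null_part n z = (\<Sum>i\<in>UNIV. (\<Sum>a\<in>UNIV. Va n z a $ i * dG_F G (Xn n z) $ i $ a + Vn n z $ i * D2 (Xn n z) (Emat i a, 0, 0) (dX n z a))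
      + (\<Sum>a\<in>UNIV. ccof (Va n z a $ i *\<^sub>R dG_Z G (Xn n z) + Vn n z $ i *\<^sub>R grad_Z (Xn n z) (dX n z a)) (F z) $ i $ a)
      + (\<Sum>a\<in>UNIV. ccof (dw n z i a *\<^sub>R Hn n z + (Vn n z $ i * dG_w G (Xn n z)) *\<^sub>R Ha n z a) (F z) $ i $ a)
      - (\<Sum>a\<in>UNIV. dw n z i a * cof (Hn n z) $ i $ a + Vn n z $ i * dG_w G (Xn n z) * ccof (Ha n z a) (Hn n z) $ i $ a))"

text \<open>Collects the terms in which derivatives fall on the multipliers when both averaged laws
  are tested, minus the time derivative of the part of the relative energy that involves only the
  approximate state.\<close>

definition entropy_production :: "nat \<Rightarrow> pt \<Rightarrow> real" where
  "entropy_production n z = (\<Sum>i\<in>UNIV. Vt n z $ i * v z $ i) - (\<Sum>i\<in>UNIV. \<Sum>a\<in>UNIV. Va n z a $ i * avg_flux i a z)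
     + D2 (Xn n z) (Phi (F z) - Xn n z) (dd Phi (Ht n z) (Hn n z))
     - (\<Sum>i\<in>UNIV. \<Sum>a\<in>UNIV. v z $ i * D2 (Xn n z) (dd Phi (Emat i a) (F z)) (dX n z a)) - (\<Sum>i\<in>UNIV. Vn n z $ i * Vt n z $ i)"

text \<open>\<open>entropy_production_split\<close> leaves one sum linear in V_i, which
  \<open>null_lagrangian_split\<close> decomposes further; its term with
  \<open>dd G (dd Phi (Emat i a) F)\<close> completes the difference between averaged flux and
  linearised stress in \<open>quadratic_part\<close>.\<close>

lemma entropy_production_eq: "entropy_production n z = residual_part n z + quadratic_part n z - null_part n z"
proof -
  have e: "entropy_production n z = (\<Sum>i\<in>UNIV. (v z $ i - Vn n z $ i) * momentum_residual i n z)
     + (\<Sum>i\<in>UNIV. \<Sum>a\<in>UNIV. (Ht n z $ i $ a - Va n z a $ i) * Q i a n z)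
     + (\<Sum>i\<in>UNIV. \<Sum>a\<in>UNIV. Va n z a $ i * (Q i a n z - avg_flux i a z))
     - (\<Sum>i\<in>UNIV. \<Sum>a\<in>UNIV. (v z $ i - Vn n z $ i) * D2 (Xn n z) (dd Phi (Emat i a) (F z) - dd Phi (Emat i a) (Hn n z)) (dX n z a))
     + (\<Sum>i\<in>UNIV. - (Vn n z $ i * (\<Sum>a\<in>UNIV. D2 (Xn n z) (dd Phi (Emat i a) (F z)) (dX n z a))))"
    unfolding entropy_production_def momentum_residual_def Q_def dX_def Xn_def entropy_production_split sum_negf by simp
  show ?thesis
    unfolding e null_lagrangian_split[of "Vn n z" _ "Hn n z" "F z" "Ha n z" "Va n z", folded Xn_def dX_def dw_def]
      residual_part_def quadratic_part_def null_part_def dw_def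
    by (simp add: sum.distrib sum_subtractf distrib_left)
qed

lemma theta_integrable:
  fixes \<theta> :: "real \<Rightarrow> real" and g :: "pt \<Rightarrow> real"
  assumes \<theta>: "C1_fun \<theta>" and g: "integrable (QM T) g"
  shows "integrable (QM T) (\<lambda>z. \<theta> (snd z) * g z)"
  by (rule integrable_QM_mult_cont[OF g C1_fun_continuous_on[OF C1_fun_snd[OF \<theta>]]])

lemma v_nth_integrable: "integrable (QM T) (\<lambda>z. v z $ i)"
  using integrable_bounded_linear[OF bounded_linear_vec_nth v_integrable] .

lemma Phi_F_inner_integrable: "integrable (QM T) (\<lambda>z. Phi (F z) \<bullet> A)"
  using integrable_bounded_linear[OF bounded_linear_inner_left Phi_F_integrable] .

text \<open>Every summand factors as a bounded convergent field, a weakly null residual, and a fixed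
  integrable function of the measure-valued solution.\<close>

lemma vanish_residual_part:
  assumes \<theta>: "C1_fun \<theta>"
  shows "vanish (\<lambda>n z. \<theta> (snd z) * residual_part n z)"
proof -
  define q where "q i a A w = D2 (Phi (snd w)) (dd Phi (Emat i a) (snd w)) A" for i a A and w :: "(real^3) \<times> mat3"
  have qs: "q i a A = (\<lambda>w. \<Sum>b\<in>Basis. (dd Phi (Emat i a) (snd w) \<bullet> b) * dd (dd G b) A (Phi (snd w)))" for i a A
    unfolding q_def by (rule ext) (subst D2_Basis, simp add: D2_def)
  have q: "continuous_on UNIV (q i a A)" for i a A
    unfolding qs
    by (intro continuous_intros C1_fun_continuous_on C1_fun_snd[OF C1_fun_dd_Phi] C1_fun_compose[OF ddG_C1 C1_fun_Phi_snd])
  \<comment> \<open>The factor \<open>Phi (F z) - Xn n z\<close> mixes both kinds: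
    \<open>Phi (F z) \<bullet> A\<close> is the fixed integrable function, while the components of
    \<open>Xn\<close> are fields of the approximation and join the convergent factor.\<close>
  have Qq: "Q i a n z = (\<Sum>A\<in>Basis. q i a A (W n z) * (Phi (F z) \<bullet> A) - q i a A (W n z) * (Phi (snd (W n z)) \<bullet> A))" for i a n z
    unfolding Q_def D2_commute[of "Xn n z" "dd Phi (Emat i a) (Hn n z)"] D2_Basis[of _ "Phi (F z) - Xn n z"]
    by (intro sum.cong refl) (simp add: q_def D2_commute Xn_def Hn_def inner_diff_left algebra_simps)
  have cont: "continuous_on UNIV (\<lambda>w::(real^3) \<times> mat3. fst w $ i)" "continuous_on UNIV (\<lambda>w::(real^3) \<times> mat3. Phi (snd w) \<bullet> A)"
    "continuous_on UNIV (\<lambda>w::(real^3) \<times> mat3. fst w $ i * dG_w G (Phi (snd w)))" for i A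
    unfolding dG_w_def
    by (intro continuous_intros C1_fun_continuous_on dG_field C1_fun_nth C1_fun_Phi_snd)+
  define Z2 where "Z2 i a n z = Ht n z $ i $ a - Va n z a $ i" for i a n z
  have Z2: "wnull T (Z2 i a)" for i a using wnull_strain[of i a] by (simp add: d_H d_V Z2_def[abs_def])
  have KH: "wnull T (\<lambda>n z. \<Sum>a\<in>UNIV. ccof (Ha n z a) (snd (W n z)) $ i $ a)" for i
    by (rule wnull_ccof_Ha) (intro C1_fun_continuous_on C1_fun_nth)
  have \<theta>i: "integrable (QM T) (\<lambda>z. \<theta> (snd z))"
    by (intro integrable_QM_cont C1_fun_continuous_on C1_fun_snd \<theta>)
  have "vanish (\<lambda>n z. (\<Sum>i\<in>UNIV. momentum_residual i n z * (\<theta> (snd z) * v z $ i) - (fst (W n z) $ i * momentum_residual i n z) * \<theta> (snd z))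
     + (\<Sum>i\<in>UNIV. \<Sum>a\<in>UNIV. \<Sum>A\<in>Basis. (q i a A (W n z) * Z2 i a n z) * (\<theta> (snd z) * (Phi (F z) \<bullet> A))
          - ((Phi (snd (W n z)) \<bullet> A) * (q i a A (W n z) * Z2 i a n z)) * \<theta> (snd z))
     + (\<Sum>i\<in>UNIV. (\<Sum>c\<in>UNIV. ((fst (W n z) $ i * dG_w G (Phi (snd (W n z)))) * curl (i+1) c n z) * (\<theta> (snd z) * F z $ (i+2) $ c)
                   - ((fst (W n z) $ i * dG_w G (Phi (snd (W n z)))) * curl (i+2) c n z) * (\<theta> (snd z) * F z $ (i+1) $ c))
         - ((fst (W n z) $ i * dG_w G (Phi (snd (W n z)))) * (\<Sum>a\<in>UNIV. ccof (Ha n z a) (snd (W n z)) $ i $ a)) * \<theta> (snd z)))"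
    by (intro vanish_add vanish_sum vanish_diff vanish_wnull wnull_momentum_residual theta_integrable[OF \<theta>] v_nth_integrable \<theta>i
        Phi_F_inner_integrable F_nth_integrable wnull_curl' Z2 KH
        wnull_field_mult[OF wnull_momentum_residual cont(1)] wnull_field_mult[OF Z2 q] wnull_field_mult[OF wnull_field_mult[OF Z2 q] cont(2)]
        wnull_field_mult[OF wnull_curl' cont(3)] wnull_field_mult[OF KH cont(3)])
  moreover have "\<theta> (snd z) * residual_part n z = (\<Sum>i\<in>UNIV. momentum_residual i n z * (\<theta> (snd z) * v z $ i) - (fst (W n z) $ i * momentum_residual i n z) * \<theta> (snd z))
     + (\<Sum>i\<in>UNIV. \<Sum>a\<in>UNIV. \<Sum>A\<in>Basis. (q i a A (W n z) * Z2 i a n z) * (\<theta> (snd z) * (Phi (F z) \<bullet> A))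
          - ((Phi (snd (W n z)) \<bullet> A) * (q i a A (W n z) * Z2 i a n z)) * \<theta> (snd z))
     + (\<Sum>i\<in>UNIV. (\<Sum>c\<in>UNIV. ((fst (W n z) $ i * dG_w G (Phi (snd (W n z)))) * curl (i+1) c n z) * (\<theta> (snd z) * F z $ (i+2) $ c)
                   - ((fst (W n z) $ i * dG_w G (Phi (snd (W n z)))) * curl (i+2) c n z) * (\<theta> (snd z) * F z $ (i+1) $ c))
         - ((fst (W n z) $ i * dG_w G (Phi (snd (W n z)))) * (\<Sum>a\<in>UNIV. ccof (Ha n z a) (snd (W n z)) $ i $ a)) * \<theta> (snd z))" for n z
    unfolding residual_part_def sum_ccof_Ha[of n z "F z"] Z2_def[symmetric] Qq distrib_left sum_distrib_left
    by (intro arg_cong2[where f="(+)"] sum.cong refl)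
       (simp_all add: Vn_def Hn_def Xn_def algebra_simps sum_distrib_left sum_subtractf)
  ultimately show ?thesis by simp
qed

section \<open>Null Lagrangians integrate to zero\<close>

lemma null_scalar:
  assumes f: "C1_fun f" and \<theta>: "C1_fun \<theta>"
  shows "integrable (QM T) (\<lambda>z. \<theta> (snd z) * d_x a (\<lambda>z. f (W n z)) z)" "(\<integral>z. \<theta> (snd z) * d_x a (\<lambda>z. f (W n z)) z \<partial>QM T) = 0"
proof -
  show "integrable (QM T) (\<lambda>z. \<theta> (snd z) * d_x a (\<lambda>z. f (W n z)) z)"
    unfolding d_x_def by (intro theta_integrable[OF \<theta>] integrable_QM_cont C1_fun_continuous_on_dd field_C1 f)
  have "(\<integral>z. d_x a (\<lambda>z. \<theta> (snd z) * f (W n z)) z \<partial>QM T) = 0"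
    by (rule integral_d_x_eq_0[OF C1_fun_mult[OF C1_fun_snd[OF \<theta>] field_C1[OF f]]])
       (use field_periodic[of f n] in \<open>simp add: periodic_def\<close>)
  then show "(\<integral>z. \<theta> (snd z) * d_x a (\<lambda>z. f (W n z)) z \<partial>QM T) = 0"
    by (simp add: d_x_time_mult[OF \<theta> field_C1[OF f]])
qed

text \<open>The grouping of \<open>sum_ccof_curl'\<close> pairs derivatives of each smooth entry
  \<open>f k l\<close> with a curl component of a row of \<open>F\<close>; the weak curl identity
  applies to each pair because \<open>F\<close> enters linearly.\<close>

lemma null_curl:
  assumes f: "\<And>k l. C2_fun (f k l)" and \<theta>: "C1_fun \<theta>" "T' < T" "\<And>t. T' \<le> t \<Longrightarrow> \<theta> t = 0"
    and D: "\<And>a z k l. D a z $ k $ l = d_x a (\<lambda>z. f k l (W n z)) z"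
  shows "integrable (QM T) (\<lambda>z. \<theta> (snd z) * (\<Sum>a\<in>UNIV. ccof (D a z) (F z) $ i $ a))" (is ?i)
    and "(\<integral>z. \<theta> (snd z) * (\<Sum>a\<in>UNIV. ccof (D a z) (F z) $ i $ a) \<partial>QM T) = 0" (is ?e)
proof -
  define J where "J k l m c d z = \<theta> (snd z) * (d_x c (\<lambda>z. f k l (W n z)) z * F z $ m $ d - d_x d (\<lambda>z. f k l (W n z)) z * F z $ m $ c)" for k l m c d z
  have f1: "C1_fun (f k l)" for k l using f[of k l] by (simp add: C2_fun_def)
  have i: "integrable (QM T) (J k l m c d)" for k l m c d
    unfolding J_def d_x_def
    by (intro theta_integrable[OF \<theta>(1)] Bochner_Integration.integrable_diff integrable_QM_mult_cont F_nth_integrable C1_fun_continuous_on_dd field_C1 f1)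
  have e: "(\<integral>z. J k l m c d z \<partial>QM T) = 0" for k l m c d
    unfolding J_def by (rule curl_F[OF field_C2[OF f] field_periodic \<theta>])
  have eq: "\<theta> (snd z) * (\<Sum>a\<in>UNIV. ccof (D a z) (F z) $ i $ a)
      = (\<Sum>c\<in>UNIV. J (i+1) c (i+2) (c+2) (c+1) z - J (i+2) c (i+1) (c+2) (c+1) z)" for z
    unfolding sum_ccof_curl' D J_def sum_distrib_left by (intro sum.cong refl) (simp add: algebra_simps)
  show ?i ?e unfolding eq using i e by simp_all
qed

lemma C1_field_mult_dG: "C1_fun (\<lambda>w::(real^3) \<times> mat3. fst w $ i * dd G A (Phi (snd w)))"
  "C2_fun (\<lambda>w::(real^3) \<times> mat3. fst w $ i * dd G A (Phi (snd w)))"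
  by (intro C1_fun_mult C1_fun_nth dG_field C2_fun_mult V_field)+

lemma d_x_V_dG: "d_x a (\<lambda>z. fst (W n z) $ i * dd G A (Phi (snd (W n z)))) z
    = Va n z a $ i * dd G A (Xn n z) + Vn n z $ i * D2 (Xn n z) A (dX n z a)"
proof -
  have "d_x a (\<lambda>z. fst (W n z) $ i * dd G A (Phi (snd (W n z)))) z
    = fst (W n z) $ i * d_x a (\<lambda>z. dd G A (Phi (snd (W n z)))) z + d_x a (\<lambda>z. fst (W n z) $ i) z * dd G A (Phi (snd (W n z)))"
    unfolding d_x_def by (rule dd_mult[OF field_C1[OF C1_fun_nth(1)] field_C1[OF dG_field(1)]])
  then show ?thesis using d_dG(2)[of a A n z] by (simp add: d_V Xn_def Hn_def Vn_def)
qed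

text \<open>The four groups of \<open>null_part\<close> are recognised as exact derivatives. Those
  free of \<open>F\<close> vanish by periodicity, those linear in \<open>F\<close> by
  \<open>null_curl\<close>.\<close>

lemma integral_null_part:
  assumes \<theta>: "C1_fun \<theta>" "T' < T" "\<And>t. T' \<le> t \<Longrightarrow> \<theta> t = 0"
  shows "integrable (QM T) (\<lambda>z. \<theta> (snd z) * null_part n z)" "(\<integral>z. \<theta> (snd z) * null_part n z \<partial>QM T) = 0"
proof -
  \<comment> \<open>\<open>P1\<close>, \<open>D2'\<close>, \<open>D3\<close> and \<open>P4\<close>
    are the spatial derivatives of V_i times the F-gradient of \<open>G\<close>, the Z-gradient, the
    w-derivative times H, and the w-derivative times cof H.\<close>
  define P1 where "P1 i a z = d_x a (\<lambda>z. fst (W n z) $ i * dd G (Emat i a, 0, 0) (Phi (snd (W n z)))) z" for i a z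
  define D2' where "D2' i a z = (\<chi> k l. d_x a (\<lambda>z. fst (W n z) $ i * dd G (0, Emat k l, 0) (Phi (snd (W n z)))) z)" for i a z
  define D3 where "D3 i a z = (\<chi> k l. d_x a (\<lambda>z. fst (W n z) $ i * dd G (0, 0, 1) (Phi (snd (W n z))) * snd (W n z) $ k $ l) z)" for i a z
  define P4 where "P4 i a z = d_x a (\<lambda>z. fst (W n z) $ i * dd G (0, 0, 1) (Phi (snd (W n z))) * cof (snd (W n z)) $ i $ a) z" for i a z
  have cofC: "C1_fun (\<lambda>M. cof M $ i $ a)" for i a
    using C1_fun_compose[OF C1_fun_linear[OF bounded_linear_compose[OF bounded_linear_vec_nth bounded_linear_vec_nth]] C1_fun_cof] .
  have dcof: "dd (\<lambda>M. cof M $ i $ a) N H = ccof H N $ i $ a" for i a N H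
    using dd_compose[OF C1_fun_linear[OF bounded_linear_compose[OF bounded_linear_vec_nth bounded_linear_vec_nth]] C1_fun_cof, of i a N H]
      dd_linear[OF bounded_linear_compose[OF bounded_linear_vec_nth bounded_linear_vec_nth]] by (simp add: dd_cof)
  have 3: "D3 i a z = dw n z i a *\<^sub>R Hn n z + (Vn n z $ i * dG_w G (Xn n z)) *\<^sub>R Ha n z a" for i a z
  proof -
    have "d_x a (\<lambda>z. fst (W n z) $ i * dd G (0, 0, 1) (Phi (snd (W n z))) * snd (W n z) $ k $ l) z
      = fst (W n z) $ i * dd G (0, 0, 1) (Phi (snd (W n z))) * d_x a (\<lambda>z. snd (W n z) $ k $ l) z
      + d_x a (\<lambda>z. fst (W n z) $ i * dd G (0, 0, 1) (Phi (snd (W n z)))) z * snd (W n z) $ k $ l" for k l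
      unfolding d_x_def by (rule dd_mult[OF field_C1[OF C1_field_mult_dG(1)] field_C1[OF C1_fun_nth(2)]])
    then show ?thesis
      by (simp add: vec_eq_iff D3_def d_x_V_dG d_H dw_def dG_w_def Xn_def Hn_def Vn_def algebra_simps)
  qed
  have 4: "P4 i a z = dw n z i a * cof (Hn n z) $ i $ a + Vn n z $ i * dG_w G (Xn n z) * ccof (Ha n z a) (Hn n z) $ i $ a" for i a z
  proof -
    have "P4 i a z = fst (W n z) $ i * dd G (0, 0, 1) (Phi (snd (W n z))) * d_x a (\<lambda>z. cof (snd (W n z)) $ i $ a) z
      + d_x a (\<lambda>z. fst (W n z) $ i * dd G (0, 0, 1) (Phi (snd (W n z)))) z * cof (snd (W n z)) $ i $ a"
      unfolding d_x_def P4_def by (rule dd_mult[OF field_C1[OF C1_field_mult_dG(1)] field_C1[OF C1_fun_snd[OF cofC]]])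
    then show ?thesis
      using d_fH(2)[OF cofC]
      by (simp add: d_x_V_dG dcof dw_def dG_w_def Xn_def Hn_def Vn_def ccof_commute[of "snd (W n z)"])
  qed
  have 1: "P1 i a z = Va n z a $ i * dG_F G (Xn n z) $ i $ a + Vn n z $ i * D2 (Xn n z) (Emat i a, 0, 0) (dX n z a)" for i a z
    by (simp add: P1_def d_x_V_dG dG_F_def)
  have 2: "D2' i a z = Va n z a $ i *\<^sub>R dG_Z G (Xn n z) + Vn n z $ i *\<^sub>R grad_Z (Xn n z) (dX n z a)" for i a z
    by (simp add: D2'_def d_x_V_dG dG_Z_def grad_Z_def vec_eq_iff)
  have eq: "\<theta> (snd z) * null_part n z = (\<Sum>i\<in>UNIV. (\<Sum>a\<in>UNIV. \<theta> (snd z) * P1 i a z) + \<theta> (snd z) * (\<Sum>a\<in>UNIV. ccof (D2' i a z) (F z) $ i $ a)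
      + \<theta> (snd z) * (\<Sum>a\<in>UNIV. ccof (D3 i a z) (F z) $ i $ a) - (\<Sum>a\<in>UNIV. \<theta> (snd z) * P4 i a z))" for z
    unfolding null_part_def 1[symmetric] 2[symmetric] 3[symmetric] 4[symmetric]
    by (simp add: sum_distrib_left distrib_left right_diff_distrib)
  have s1: "integrable (QM T) (\<lambda>z. \<theta> (snd z) * P1 i a z)" "(\<integral>z. \<theta> (snd z) * P1 i a z \<partial>QM T) = 0" for i a
    unfolding P1_def using null_scalar[OF C1_field_mult_dG(1) \<theta>(1)] by auto
  have s4: "integrable (QM T) (\<lambda>z. \<theta> (snd z) * P4 i a z)" "(\<integral>z. \<theta> (snd z) * P4 i a z \<partial>QM T) = 0" for i a
    unfolding P4_def using null_scalar[OF C1_fun_mult[OF C1_field_mult_dG(1) C1_fun_snd[OF cofC]] \<theta>(1)] by auto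
  have s2: "integrable (QM T) (\<lambda>z. \<theta> (snd z) * (\<Sum>a\<in>UNIV. ccof (D2' i a z) (F z) $ i $ a))"
      "(\<integral>z. \<theta> (snd z) * (\<Sum>a\<in>UNIV. ccof (D2' i a z) (F z) $ i $ a) \<partial>QM T) = 0" for i
    by (rule null_curl[where f="\<lambda>k l w. fst w $ i * dd G (0, Emat k l, 0) (Phi (snd w))", OF C1_field_mult_dG(2) \<theta>]; simp add: D2'_def)+
  have s3: "integrable (QM T) (\<lambda>z. \<theta> (snd z) * (\<Sum>a\<in>UNIV. ccof (D3 i a z) (F z) $ i $ a))"
      "(\<integral>z. \<theta> (snd z) * (\<Sum>a\<in>UNIV. ccof (D3 i a z) (F z) $ i $ a) \<partial>QM T) = 0" for i
    by (rule null_curl[where f="\<lambda>k l w. fst w $ i * dd G (0, 0, 1) (Phi (snd w)) * snd w $ k $ l", OF C2_fun_mult[OF C1_field_mult_dG(2) H_field] \<theta>]; simp add: D3_def)+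
  show "integrable (QM T) (\<lambda>z. \<theta> (snd z) * null_part n z)" "(\<integral>z. \<theta> (snd z) * null_part n z \<partial>QM T) = 0"
    unfolding eq using s1 s2 s3 s4 by simp_all
qed

end

section \<open>The averaged relative energy\<close>

lemma sum_sum_abs_le:
  fixes f :: "3 \<Rightarrow> 3 \<Rightarrow> real"
  assumes "\<And>i a. \<bar>f i a\<bar> \<le> C"
  shows "\<bar>\<Sum>i\<in>UNIV. \<Sum>a\<in>UNIV. f i a\<bar> \<le> 9 * C"
proof -
  have "\<bar>\<Sum>i\<in>UNIV. \<Sum>a\<in>UNIV. f i a\<bar> \<le> (\<Sum>i\<in>(UNIV::3 set). \<Sum>a\<in>(UNIV::3 set). C)"
    by (intro order_trans[OF sum_abs] sum_mono assms)
  then show ?thesis by simp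
qed

lemma bounded_linear_dd: "f differentiable (at z) \<Longrightarrow> bounded_linear (\<lambda>h. dd f h z)"
  by (rule has_derivative_bounded_linear[OF has_derivative_dd])

context weak_strong begin

definition rel_eta :: "(real^3) \<times> xi \<Rightarrow> (real^3) \<times> mat3 \<Rightarrow> real" where
  "rel_eta l w = (norm (fst l - fst w))\<^sup>2 / 2 + rel_energy G (snd l) (Phi (snd w))"

text \<open>The part of the relative energy independent of \<open>l\<close>: half of |V|^2 plus the
  Legendre transform of \<open>G\<close> at the slope dG(Phi H).\<close>

definition legendre :: "(real^3) \<times> mat3 \<Rightarrow> real" where
  "legendre w = (fst w \<bullet> fst w) / 2 - G (Phi (snd w)) + dd G (Phi (snd w)) (Phi (snd w))"

text \<open>Given in closed form through the averages rather than as an integral over \<nu>: in this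
  form it is affine in quantities with known integrability and evolution, and at good points it is
  the average of \<open>rel_eta\<close>.\<close>

definition avg_rel_eta :: "(real^3) \<times> mat3 \<Rightarrow> pt \<Rightarrow> real" where
  "avg_rel_eta w z = avg_eta z - v z \<bullet> fst w + legendre w - dd G (Phi (F z)) (Phi (snd w))"

lemma rel_eta_eq: "rel_eta l w = eta G l - fst l \<bullet> fst w + legendre w - dd G (snd l) (Phi (snd w))"
  unfolding rel_eta_def eta_def rel_energy_def legendre_def
  using linear_diff[OF linear_dd[OF G_diff], of "snd l" "Phi (snd w)" "Phi (snd w)"]
  by (simp add: power2_norm_eq_inner inner_diff_left inner_diff_right inner_commute algebra_simps diff_divide_distrib add_divide_distrib)

lemma good_integrable:
  assumes "good z"
  shows "integrable (\<nu> z) (eta G)" "integrable (\<nu> z) fst" "integrable (\<nu> z) snd" "integrable (\<nu> z) (flux G i a)"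
proof -
  obtain C where C:
    "\<And>l. norm (fst l) \<le> C * (eta G l + 1)" "\<And>l. norm (snd l) \<le> C * (eta G l + 1)"
    "\<And>i a l. \<bar>flux G i a l\<bar> \<le> C * (eta G l + 1)" using eta_growth by metis
  show "integrable (\<nu> z) (eta G)" using assms by (simp add: good_def)
  show "integrable (\<nu> z) fst" "integrable (\<nu> z) snd"
    using integrable_nu(1)[OF assms fst_snd_measurable(1) C(1)] integrable_nu(1)[OF assms fst_snd_measurable(2) C(2)] by auto
  show "integrable (\<nu> z) (flux G i a)"
    by (rule integrable_nu(1)[OF assms flux_measurable, where C=C]) (use C(3) in simp)
qed

lemma goodD:
  assumes "good z"
  shows "(\<integral>l. fst l \<partial>\<nu> z) = v z" "(\<integral>l. snd l \<partial>\<nu> z) = Phi (F z)" "(\<integral>l. fst (snd l) \<partial>\<nu> z) = F z"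
  using assms by (auto simp: good_def)

lemma rel_eta_integral:
  assumes z: "good z"
  shows "integrable (\<nu> z) (\<lambda>l. rel_eta l w)" "(\<integral>l. rel_eta l w \<partial>\<nu> z) = avg_rel_eta w z"
proof -
  interpret prob_space "\<nu> z" by (rule nu_prob)
  note i = good_integrable[OF z]
  have i1: "integrable (\<nu> z) (\<lambda>l. fst l \<bullet> fst w)" using i(2) by simp
  have i2: "integrable (\<nu> z) (\<lambda>l. dd G (snd l) (Phi (snd w)))"
    by (rule integrable_bounded_linear[OF bounded_linear_dd[OF G_diff] i(3)])
  show "integrable (\<nu> z) (\<lambda>l. rel_eta l w)"
    unfolding rel_eta_eq using i(1) i1 i2 by simp
  have "(\<integral>l. fst l \<bullet> fst w \<partial>\<nu> z) = v z \<bullet> fst w" using integral_inner_left[of "fst w" "\<nu> z" fst] i(2) goodD(1)[OF z] by simp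
  moreover have "(\<integral>l. dd G (snd l) (Phi (snd w)) \<partial>\<nu> z) = dd G (Phi (F z)) (Phi (snd w))"
    using integral_bounded_linear[OF bounded_linear_dd[OF G_diff] i(3)] goodD(2)[OF z] by simp
  ultimately show "(\<integral>l. rel_eta l w \<partial>\<nu> z) = avg_rel_eta w z"
    unfolding rel_eta_eq avg_rel_eta_def using i(1) i1 i2 by (simp add: avg_eta_def prob_space)
qed

lemma rel_eta_lower:
  obtains c where "c > 0" "\<And>l w. c * ((norm (fst l - fst w))\<^sup>2 + (norm (snd l - Phi (snd w)))\<^sup>2) \<le> rel_eta l w"
proof -
  obtain c where c: "c > 0" "\<And>L X. c * (norm (L - X))\<^sup>2 \<le> rel_energy G L X" using rel_energy_lower by metis
  show ?thesis
  proof (rule that[of "min c (1/2)"])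
    show "min c (1/2) > 0" using c by simp
    fix l :: "(real^3) \<times> xi" and w :: "(real^3) \<times> mat3"
    have "min c (1/2) * (norm (fst l - fst w))\<^sup>2 \<le> 1/2 * (norm (fst l - fst w))\<^sup>2"
      "min c (1/2) * (norm (snd l - Phi (snd w)))\<^sup>2 \<le> c * (norm (snd l - Phi (snd w)))\<^sup>2"
      by (intro mult_right_mono; simp)+
    then show "min c (1/2) * ((norm (fst l - fst w))\<^sup>2 + (norm (snd l - Phi (snd w)))\<^sup>2) \<le> rel_eta l w"
      using c(2)[of "snd l" "Phi (snd w)"] unfolding rel_eta_def distrib_left by linarith
  qed
qed

text \<open>Strong convexity under the integral, and Jensen's inequality to pass from second moments
  to the distance of the barycentres. One constant serves all points and all base states, so later
  errors can be compared uniformly in \<open>n\<close>.\<close>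

lemma avg_rel_eta_lower:
  "\<exists>C\<ge>0. \<forall>z w. good z \<longrightarrow> (norm (v z - fst w))\<^sup>2 \<le> C * avg_rel_eta w z
    \<and> (norm (Phi (F z) - Phi (snd w)))\<^sup>2 \<le> C * avg_rel_eta w z
    \<and> integrable (\<nu> z) (\<lambda>l. (norm (snd l - Phi (snd w)))\<^sup>2)
    \<and> (\<integral>l. (norm (snd l - Phi (snd w)))\<^sup>2 \<partial>\<nu> z) \<le> C * avg_rel_eta w z
    \<and> (\<integral>l. rel_energy G (snd l) (Phi (snd w)) \<partial>\<nu> z) \<le> avg_rel_eta w z
    \<and> integrable (\<nu> z) (\<lambda>l. rel_energy G (snd l) (Phi (snd w)))
    \<and> 0 \<le> avg_rel_eta w z"
proof -
  obtain c where c: "c > 0" "\<And>l w. c * ((norm (fst l - fst w))\<^sup>2 + (norm (snd l - Phi (snd w)))\<^sup>2) \<le> rel_eta l w"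
    using rel_eta_lower by metis
  obtain c' where c': "c' > 0" "\<And>L X. c' * (norm (L - X))\<^sup>2 \<le> rel_energy G L X" using rel_energy_lower by metis
  have bd: "(norm (fst l - fst w))\<^sup>2 \<le> inverse c * rel_eta l w" "(norm (snd l - Phi (snd w)))\<^sup>2 \<le> inverse c * rel_eta l w"
     for l :: "(real^3) \<times> xi" and w :: "(real^3) \<times> mat3"
  proof -
    have "0 \<le> c * (norm (fst l - fst w))\<^sup>2" "0 \<le> c * (norm (snd l - Phi (snd w)))\<^sup>2" using c(1) by auto
    then have "c * (norm (fst l - fst w))\<^sup>2 \<le> rel_eta l w" "c * (norm (snd l - Phi (snd w)))\<^sup>2 \<le> rel_eta l w"
      using c(2)[of l w] unfolding distrib_left by linarith+
    then show "(norm (fst l - fst w))\<^sup>2 \<le> inverse c * rel_eta l w" "(norm (snd l - Phi (snd w)))\<^sup>2 \<le> inverse c * rel_eta l w"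
      using c(1) by (auto simp: field_simps)
  qed
  have pos: "0 \<le> rel_eta l w" for l w using c(2)[of l w] c(1) by (smt (verit) mult_nonneg_nonneg zero_le_power2)
  have cont: "continuous_on UNIV (\<lambda>l::(real^3) \<times> xi. (norm (fst l - x))\<^sup>2)" "continuous_on UNIV (\<lambda>l::(real^3) \<times> xi. (norm (snd l - X))\<^sup>2)" for x X
    by (intro continuous_intros)+
  have J: "integrable (\<nu> z) f \<and> (\<integral>l. f l \<partial>\<nu> z) \<le> inverse c * avg_rel_eta w z"
    if z: "good z" and f: "continuous_on UNIV f" "\<And>l. 0 \<le> f l" "\<And>l. f l \<le> inverse c * rel_eta l w" for f :: "(real^3) \<times> xi \<Rightarrow> real" and z w
  proof
    have m: "f \<in> borel_measurable (\<nu> z)" by (rule measurable_nu[OF borel_measurable_continuous_onI[OF f(1)]])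
    have ir: "integrable (\<nu> z) (\<lambda>l. inverse c * rel_eta l w)" using rel_eta_integral(1)[OF z] by simp
    show i: "integrable (\<nu> z) f"
    proof (rule Bochner_Integration.integrable_bound[OF ir m])
      show "AE l in \<nu> z. norm (f l) \<le> norm (inverse c * rel_eta l w)"
        using order_trans[OF f(3) abs_ge_self] f(2) by (intro AE_I2) simp
    qed
    have "(\<integral>l. f l \<partial>\<nu> z) \<le> (\<integral>l. inverse c * rel_eta l w \<partial>\<nu> z)" by (rule integral_mono[OF i ir f(3)])
    then show "(\<integral>l. f l \<partial>\<nu> z) \<le> inverse c * avg_rel_eta w z" using rel_eta_integral[OF z] by simp
  qed
  show ?thesis
  proof (rule exI[of _ "inverse c"], intro conjI allI impI)
    show "0 \<le> inverse c" using c by simp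
    fix z w assume z: "good z"
    interpret prob_space "\<nu> z" by (rule nu_prob)
    note j1 = J[OF z cont(1) zero_le_power2 bd(1)[of _ w]] and j2 = J[OF z cont(2) zero_le_power2 bd(2)[of _ w]]
    have i1: "integrable (\<nu> z) (\<lambda>l. fst l - fst w)" "integrable (\<nu> z) (\<lambda>l. snd l - Phi (snd w))"
      using good_integrable[OF z] by auto
    have e: "(\<integral>l. fst l - fst w \<partial>\<nu> z) = v z - fst w" "(\<integral>l. snd l - Phi (snd w) \<partial>\<nu> z) = Phi (F z) - Phi (snd w)"
      using good_integrable[OF z] goodD[OF z] by (simp_all add: prob_space)
    show "(norm (v z - fst w))\<^sup>2 \<le> inverse c * avg_rel_eta w z"
      using order_trans[OF norm_integral_square_le[OF i1(1)]] j1 unfolding e(1)[symmetric] by blast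
    show "(norm (Phi (F z) - Phi (snd w)))\<^sup>2 \<le> inverse c * avg_rel_eta w z"
      using order_trans[OF norm_integral_square_le[OF i1(2)]] j2 unfolding e(2)[symmetric] by blast
    show "integrable (\<nu> z) (\<lambda>l. (norm (snd l - Phi (snd w)))\<^sup>2)"
      "(\<integral>l. (norm (snd l - Phi (snd w)))\<^sup>2 \<partial>\<nu> z) \<le> inverse c * avg_rel_eta w z" using j2 by auto
    have i3: "integrable (\<nu> z) (\<lambda>l. (norm (fst l - fst w))\<^sup>2)" using j1 by auto
    have re: "rel_energy G (snd l) (Phi (snd w)) = rel_eta l w - (norm (fst l - fst w))\<^sup>2 / 2" for l by (simp add: rel_eta_def)
    show i4: "integrable (\<nu> z) (\<lambda>l. rel_energy G (snd l) (Phi (snd w)))"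
      unfolding re using i3 rel_eta_integral(1)[OF z] by simp
    have "(\<integral>l. rel_energy G (snd l) (Phi (snd w)) \<partial>\<nu> z) \<le> (\<integral>l. rel_eta l w \<partial>\<nu> z)"
      by (rule integral_mono[OF i4 rel_eta_integral(1)[OF z]]) (simp add: rel_eta_def)
    then show "(\<integral>l. rel_energy G (snd l) (Phi (snd w)) \<partial>\<nu> z) \<le> avg_rel_eta w z" using rel_eta_integral(2)[OF z] by simp
    show "0 \<le> avg_rel_eta w z" unfolding rel_eta_integral(2)[OF z, symmetric] by (rule integral_nonneg_AE) (simp add: pos)
  qed
qed

lemma norm_fst_snd_diff_le: "norm (fst (snd l) - H) \<le> norm (snd l - Phi H)" for l :: "(real^3) \<times> xi"
proof -
  have "fst (snd l) - H = fst (snd l - Phi H)" by (simp add: Phi_def)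
  then show ?thesis by (metis norm_fst_le prod.collapse)
qed

text \<open>The cofactor is not affine, but its defect under averaging is quadratic in \<open>\<lambda>\<^sub>F - H\<close>.\<close>

lemma averaged_stress_defect:
  assumes z: "good z"
  shows "integrable (\<nu> z) (\<lambda>l. cof (fst (snd l) - H) $ i $ a)"
    "integrable (\<nu> z) (\<lambda>l. dd G (dd Phi (Emat i a) (fst (snd l))) X)"
    "dd G (dd Phi (Emat i a) (F z)) X - (\<integral>l. dd G (dd Phi (Emat i a) (fst (snd l))) X \<partial>\<nu> z)
      = dG_w G X * (cof (F z - H) $ i $ a - (\<integral>l. cof (fst (snd l) - H) $ i $ a \<partial>\<nu> z))"
proof -
  interpret prob_space "\<nu> z" by (rule nu_prob)
  have C: "integrable (\<nu> z) (\<lambda>l. (norm (snd l - Phi (snd w)))\<^sup>2)" for w :: "(real^3) \<times> mat3"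
    using avg_rel_eta_lower z by blast
  obtain K where K: "K \<ge> 0" "\<And>M N. norm (ccof M N) \<le> K * norm M * norm N" using dd_Phi_Emat_bounds by metis
  have el: "\<bar>M $ i $ a\<bar> \<le> norm M" for M :: mat3
    using Finite_Cartesian_Product.norm_nth_le order_trans by (metis real_norm_def)
  have cb: "\<bar>cof (fst (snd l) - H) $ i $ a\<bar> \<le> K * (norm (snd l - Phi H))\<^sup>2" for l :: "(real^3) \<times> xi"
  proof -
    have "norm (fst (snd l) - H) \<le> norm (snd l - Phi H)" by (rule norm_fst_snd_diff_le)
    then have "norm (fst (snd l) - H) * norm (fst (snd l) - H) \<le> (norm (snd l - Phi H))\<^sup>2"
      unfolding power2_eq_square by (intro mult_mono) auto
    then have "K * (norm (fst (snd l) - H) * norm (fst (snd l) - H)) \<le> K * (norm (snd l - Phi H))\<^sup>2"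
      using K(1) by (rule mult_left_mono)
    moreover have "\<bar>cof (fst (snd l) - H) $ i $ a\<bar> \<le> K * (norm (fst (snd l) - H) * norm (fst (snd l) - H))"
      using el[of "ccof (fst (snd l) - H) (fst (snd l) - H)"] K(2)[of "fst (snd l) - H" "fst (snd l) - H"] by (simp add: cof_eq_ccof)
    ultimately show ?thesis by linarith
  qed
  have cm: "continuous_on UNIV (\<lambda>l::(real^3) \<times> xi. cof (fst (snd l) - H) $ i $ a)"
    by (intro continuous_intros continuous_on_compose2[OF C1_fun_continuous_on[OF C1_fun_cof, of UNIV]]) auto
  show ic: "integrable (\<nu> z) (\<lambda>l. cof (fst (snd l) - H) $ i $ a)"
  proof (rule Bochner_Integration.integrable_bound)
    show "integrable (\<nu> z) (\<lambda>l. K * (norm (snd l - Phi (snd (0::real^3, H))))\<^sup>2)"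
      using C[of "(0, H)"] by simp
    show "(\<lambda>l. cof (fst (snd l) - H) $ i $ a) \<in> borel_measurable (\<nu> z)"
      by (rule measurable_nu[OF borel_measurable_continuous_onI[OF cm]])
    show "AE l in \<nu> z. norm (cof (fst (snd l) - H) $ i $ a) \<le> norm (K * (norm (snd l - Phi (snd (0::real^3, H))))\<^sup>2)"
      using cb K(1) by (intro AE_I2) (simp add: abs_mult)
  qed
  \<comment> \<open>Expanding the cofactor about \<open>H\<close> splits the integrand into a
    constant, a linear part and the minor of \<open>N - H\<close>. The first two commute with
    averaging, so the defect comes from the minor only.\<close>
  define lin where "lin N = ccof (dG_Z G X) N $ i $ a + dG_w G X * ccof H N $ i $ a" for N
  have blin: "bounded_linear lin"
    unfolding lin_def
    by (intro bounded_linear_add bounded_linear_const_mult bounded_linear_compose[OF bounded_linear_vec_nth]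
        bounded_linear_compose[OF bounded_linear_vec_nth[where i=a]] ccof.bounded_linear_right)
  define c0 where "c0 = dG_F G X $ i $ a - dG_w G X * cof H $ i $ a"
  have eq: "dd G (dd Phi (Emat i a) N) X = c0 + lin N + dG_w G X * cof (N - H) $ i $ a" for N
  proof -
    have "cof N = cof (N - H) + ccof H N - cof H" by (simp add: cof_diff)
    from arg_cong[OF this, of "\<lambda>M. M $ i $ a"] have c: "cof N $ i $ a = cof (N - H) $ i $ a + ccof H N $ i $ a - cof H $ i $ a" by simp
    show ?thesis unfolding dd_G_dd_Phi_Emat c lin_def c0_def by (simp add: algebra_simps)
  qed
  have iF: "integrable (\<nu> z) (\<lambda>l. fst (snd l))"
    by (rule integrable_bounded_linear[OF bounded_linear_fst good_integrable(3)[OF z]])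
  have il: "integrable (\<nu> z) (\<lambda>l. lin (fst (snd l)))" by (rule integrable_bounded_linear[OF blin iF])
  show "integrable (\<nu> z) (\<lambda>l. dd G (dd Phi (Emat i a) (fst (snd l))) X)"
    unfolding eq using ic il by simp
  have "(\<integral>l. lin (fst (snd l)) \<partial>\<nu> z) = lin (F z)"
    using integral_bounded_linear[OF blin iF] goodD(3)[OF z] by simp
  then show "dd G (dd Phi (Emat i a) (F z)) X - (\<integral>l. dd G (dd Phi (Emat i a) (fst (snd l))) X \<partial>\<nu> z)
      = dG_w G X * (cof (F z - H) $ i $ a - (\<integral>l. cof (fst (snd l) - H) $ i $ a \<partial>\<nu> z))"
    unfolding eq using ic il by (simp add: prob_space right_diff_distrib)
qed

text \<open>Distances are measured in \<open>Phi\<close> and not in the strain: the increment of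
  dPhi contains the increment of the cofactor, itself a component of \<open>Phi N - Phi H\<close>.
  This gives bounds global in \<open>N\<close> without growth factors.\<close>

lemma cof_component_le:
  "\<exists>K\<ge>0. (\<forall>N H i a. \<bar>cof (N - H) $ i $ a\<bar> \<le> K * (norm (Phi N - Phi H))\<^sup>2)
    \<and> (\<forall>(l::(real^3) \<times> xi) H i a. \<bar>cof (fst (snd l) - H) $ i $ a\<bar> \<le> K * (norm (snd l - Phi H))\<^sup>2)
    \<and> (\<forall>i a N H. norm (dd Phi (Emat i a) N - dd Phi (Emat i a) H) \<le> K * norm (Phi N - Phi H))"
proof -
  obtain K where K: "K \<ge> 0" "\<And>M N. norm (ccof M N) \<le> K * norm M * norm N" using dd_Phi_Emat_bounds by metis
  have el: "\<bar>M $ i $ a\<bar> \<le> norm M" for M :: mat3 and i a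
    using Finite_Cartesian_Product.norm_nth_le order_trans by (metis real_norm_def)
  have b: "\<bar>cof M $ i $ a\<bar> \<le> (K + 1) * x\<^sup>2" if "norm M \<le> x" for M i a x
  proof -
    have "\<bar>cof M $ i $ a\<bar> \<le> K * (norm M * norm M)"
      using el[of "ccof M M" i a] K(2)[of M M] by (simp add: cof_eq_ccof)
    also have "\<dots> \<le> (K + 1) * x\<^sup>2" unfolding power2_eq_square using that K(1) order_trans[OF norm_ge_zero that] by (intro mult_mono) auto
    finally show ?thesis .
  qed
  have n1: "norm (N - H) \<le> norm (Phi N - Phi H)" for N H
    using norm_fst_le[of "N - H" "(cof N - cof H, det N - det H)"] by (simp add: Phi_def)
  have n2: "norm (cof N - cof H) \<le> norm (Phi N - Phi H)" for N H
    using order_trans[OF norm_fst_le[of "cof N - cof H" "det N - det H"] norm_snd_le[of "(cof N - cof H, det N - det H)" "N - H"]] by (simp add: Phi_def)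
  note n3 = norm_fst_snd_diff_le
  show ?thesis
  proof (rule exI[of _ "K + 1"], intro conjI allI)
    show "\<bar>cof (fst (snd l) - H) $ i $ a\<bar> \<le> (K + 1) * (norm (snd l - Phi H))\<^sup>2" for l :: "(real^3) \<times> xi" and H i a
      by (rule b[OF n3])
    show "\<bar>cof (N - H) $ i $ a\<bar> \<le> (K + 1) * (norm (Phi N - Phi H))\<^sup>2" for N H i a
      by (rule b[OF n1])
    show "norm (dd Phi (Emat i a) N - dd Phi (Emat i a) H) \<le> (K + 1) * norm (Phi N - Phi H)" for i a N H
    proof -
      have "dd Phi (Emat i a) N - dd Phi (Emat i a) H = (0, ccof (N - H) (Emat i a), (cof N - cof H) $ i $ a)"
        by (simp add: dd_Phi inner_Emat ccof.diff_left)
      then have "norm (dd Phi (Emat i a) N - dd Phi (Emat i a) H) \<le> norm (0::mat3) + (norm (ccof (N - H) (Emat i a)) + norm ((cof N - cof H) $ i $ a))"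
        using order_trans[OF norm_Pair_le add_left_mono[OF norm_Pair_le]] by metis
      also have "\<dots> \<le> 0 + (K * norm (Phi N - Phi H) + norm (Phi N - Phi H))"
        using K(2)[of "N - H" "Emat i a"] mult_left_mono[OF n1 K(1), of N H] order_trans[OF el n2, of N H i a]
        by (intro add_mono) auto
      finally show ?thesis by (simp add: algebra_simps)
    qed
  qed (use K(1) in simp)
qed

end

context weak_strong_approx begin

lemma Va_Ha_bounded: "\<bar>Va n z a $ i\<bar> \<le> L"
proof -
  have "\<bar>Va n z a $ i\<bar> \<le> norm (Va n z a)" by (rule component_le_norm_cart)
  also have "\<dots> \<le> norm (dd (W n) (axis a 1, 0) z)" unfolding Va_def by (metis norm_fst_le prod.collapse)
  also have "\<dots> \<le> L" using norm_dd_W[of n "(axis a 1, 0)" z] by (simp add: norm_unit)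
  finally show ?thesis .
qed

lemma dX_bounded: obtains C where "C \<ge> 0" "\<And>n z a. norm (dX n z a) \<le> C"
proof -
  have "\<exists>C\<ge>0. \<forall>n z a. \<bar>dX n z a \<bullet> b\<bar> \<le> C" for b
  proof -
    have c: "C1_fun (\<lambda>M. Phi M \<bullet> b)" by (intro C1_fun_inner_left C1_fun_Phi)
    obtain C where C: "C \<ge> 0" "\<And>n z h. \<bar>dd (\<lambda>z. Phi (snd (W n z)) \<bullet> b) h z\<bar> \<le> C * norm h"
      using field_dd_bounded[OF C1_fun_snd[OF c]] by metis
    have "dX n z a \<bullet> b = d_x a (\<lambda>z. Phi (snd (W n z)) \<bullet> b) z" for n z a
      using d_fH(2)[OF c, of a n z] by (simp add: Hn_def dd_inner_left[OF C1_fun_Phi] dX_def)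
    then show ?thesis using C(1) C(2)[of _ "(axis _ 1, 0)"] by (auto simp: d_x_def norm_unit intro!: exI[of _ C])
  qed
  then obtain C where C: "\<And>b. C b \<ge> 0" "\<And>b n z a. \<bar>dX n z a \<bullet> b\<bar> \<le> C b" by metis
  show ?thesis
    by (rule that[of "\<Sum>b\<in>Basis. C b"]) (auto intro!: sum_nonneg C order_trans[OF norm_le_l1] sum_mono)
qed

lemma Xn_bounded: obtains C where "C \<ge> 0" "\<And>n z. norm (Xn n z) \<le> C"
proof -
  have "continuous_on UNIV (\<lambda>w::(real^3) \<times> mat3. norm (Phi (snd w)))"
    by (intro continuous_intros C1_fun_continuous_on C1_fun_Phi_snd)
  then obtain C where "C \<ge> 0" "\<And>n z. \<bar>norm (Phi (snd (W n z)))\<bar> \<le> C" using field_bounded by metis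
  then show ?thesis using that by (simp add: Xn_def Hn_def)
qed

text \<open>Of the three groups, the first is the defect of the averaged flux, the second a product
  of the velocity and strain distances, the third a quadratic minor. Each is at most a multiple of
  the averaged relative energy, with coefficients bounded through \<open>L\<close> and
  \<open>M\<close>, uniformly in \<open>n\<close>.\<close>

lemma quadratic_part_bound:
  obtains C where "C \<ge> 0" "\<And>n z. good z \<Longrightarrow> \<bar>quadratic_part n z\<bar> \<le> C * avg_rel_eta (W n z) z"
proof -
  obtain Ch where Ch0: "Ch \<ge> 0" and Chz: "\<forall>z w. good z \<longrightarrow> (norm (v z - fst w))\<^sup>2 \<le> Ch * avg_rel_eta w z
    \<and> (norm (Phi (F z) - Phi (snd w)))\<^sup>2 \<le> Ch * avg_rel_eta w z
    \<and> integrable (\<nu> z) (\<lambda>l. (norm (snd l - Phi (snd w)))\<^sup>2)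
    \<and> (\<integral>l. (norm (snd l - Phi (snd w)))\<^sup>2 \<partial>\<nu> z) \<le> Ch * avg_rel_eta w z
    \<and> (\<integral>l. rel_energy G (snd l) (Phi (snd w)) \<partial>\<nu> z) \<le> avg_rel_eta w z
    \<and> integrable (\<nu> z) (\<lambda>l. rel_energy G (snd l) (Phi (snd w)))
    \<and> 0 \<le> avg_rel_eta w z"
    using avg_rel_eta_lower by blast
  note Chc = Chz[THEN spec, THEN spec, THEN mp]
  note Ch2 = Chc[THEN conjunct2] note Ch3 = Ch2[THEN conjunct2] note Ch4 = Ch3[THEN conjunct2]
  note Ch5 = Ch4[THEN conjunct2] note Ch6 = Ch5[THEN conjunct2] note Ch7 = Ch6[THEN conjunct2]
  note Ch = Ch0 Chc[THEN conjunct1] Ch2[THEN conjunct1] Ch3[THEN conjunct1] Ch4[THEN conjunct1] Ch5[THEN conjunct1] Ch6[THEN conjunct1] Ch7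
  obtain K where K0: "K \<ge> 0 \<and> (\<forall>N H i a. \<bar>cof (N - H) $ i $ a\<bar> \<le> K * (norm (Phi N - Phi H))\<^sup>2)
    \<and> (\<forall>(l::(real^3) \<times> xi) H i a. \<bar>cof (fst (snd l) - H) $ i $ a\<bar> \<le> K * (norm (snd l - Phi H))\<^sup>2)
    \<and> (\<forall>i a N H. norm (dd Phi (Emat i a) N - dd Phi (Emat i a) H) \<le> K * norm (Phi N - Phi H))"
    using cof_component_le by blast
  note K0b = K0[THEN conjunct2] note K0c = K0b[THEN conjunct2]
  note K = K0[THEN conjunct1] K0b[THEN conjunct1, THEN spec, THEN spec, THEN spec, THEN spec]
    K0c[THEN conjunct1, THEN spec, THEN spec, THEN spec, THEN spec] K0c[THEN conjunct2, THEN spec, THEN spec, THEN spec, THEN spec]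
  obtain MX where MX: "MX \<ge> 0" "\<And>n z. norm (Xn n z) \<le> MX" using Xn_bounded by metis
  obtain Cx where Cx: "Cx \<ge> 0" "\<And>n z a. norm (dX n z a) \<le> Cx" using dX_bounded by metis
  obtain A where A: "A \<ge> 0" "\<And>x h k. norm x \<le> MX \<Longrightarrow> \<bar>dd (dd G h) k x\<bar> \<le> A * norm h * norm k"
    using dd2_bounded_cball[OF G_C2] by metis
  obtain Cs where Cs: "Cs \<ge> 0" "\<And>i a Y X. norm X \<le> MX \<Longrightarrow>
    \<bar>stress i a Y - dd G (dd Phi (Emat i a) (fst Y)) X - dd (dd G (dd Phi (Emat i a) (fst X))) (Y - X) X\<bar>
      \<le> Cs * rel_energy G Y X" using stress_quadratic by metis
  obtain Cw where Cw: "Cw \<ge> 0" "\<And>n z. \<bar>dG_w G (Phi (snd (W n z)))\<bar> \<le> Cw"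
  proof (rule field_bounded[OF C1_fun_continuous_on[OF dG_field(1)[of "(0, 0, 1)"]]])
    fix C assume "C \<ge> 0" "\<And>n z. \<bar>dd G (0, 0, 1) (Phi (snd (W n z)))\<bar> \<le> C"
    then show thesis unfolding dG_w_def[symmetric] by (rule that)
  qed
  have "\<exists>C\<ge>0. \<forall>n z a. \<bar>dw n z i a\<bar> \<le> C" for i
  proof -
    obtain C where C: "C \<ge> 0" "\<And>n z h. \<bar>dd (\<lambda>z. fst (W n z) $ i * dd G (0, 0, 1) (Phi (snd (W n z)))) h z\<bar> \<le> C * norm h"
      proof (rule field_dd_bounded[OF C1_field_mult_dG(1)[of i "(0, 0, 1)"]])
      fix C assume "C \<ge> 0" "\<And>n z h. \<bar>dd (\<lambda>z. fst (W n z) $ i * dd G (0, 0, 1) (Phi (snd (W n z)))) h z\<bar> \<le> C * norm h"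
      then show thesis by (rule that)
    qed
    have "dw n z i a = d_x a (\<lambda>z. fst (W n z) $ i * dd G (0, 0, 1) (Phi (snd (W n z)))) z" for n z a
      by (simp add: d_x_V_dG dw_def dG_w_def)
    then show ?thesis using C(1) C(2)[of _ "(axis _ 1, 0)"] by (auto simp: d_x_def norm_unit intro!: exI[of _ C])
  qed
  then obtain Cd0 where Cd0: "\<And>i. Cd0 i \<ge> 0" "\<And>i n z a. \<bar>dw n z i a\<bar> \<le> Cd0 i" by metis
  define Cd where "Cd = (\<Sum>i\<in>UNIV. Cd0 i)"
  have Cd: "Cd \<ge> 0" "\<bar>dw n z i a\<bar> \<le> Cd" for n z i a
    using order_trans[OF Cd0(2)[of n z i a] member_le_sum[of i UNIV Cd0]] Cd0(1) unfolding Cd_def by (auto intro: sum_nonneg)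
  \<comment> \<open>The factor 2 in \<open>D1\<close> counts the two minors, that of
    \<open>F\<close> and the averaged one; the factors 9 below count the index pairs (i, a).\<close>
  define D1 where "D1 = L * (Cs + Cw * (2 * K * Ch))"
  define D2c where "D2c = A * K * Cx * Ch"
  define D3 where "D3 = Cd * K * Ch"
  show ?thesis
  proof (rule that[of "9 * D1 + 9 * D2c + 9 * D3"])
    show "0 \<le> 9 * D1 + 9 * D2c + 9 * D3"
      unfolding D1_def D2c_def D3_def using L_nonneg Cs Cw K Ch(1) A Cx Cd by (intro add_nonneg_nonneg mult_nonneg_nonneg) auto
    fix n z assume z: "good z"
    interpret prob_space "\<nu> z" by (rule nu_prob)
    define h where "h = avg_rel_eta (W n z) z"
    define X where "X = Xn n z"
    have Xe: "Phi (snd (W n z)) = X" "Phi (Hn n z) = X" "snd (W n z) = Hn n z" by (auto simp: X_def Xn_def Hn_def)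
    have fX: "fst X = Hn n z" by (simp add: X_def Xn_def Phi_def)
    have h0: "0 \<le> h" unfolding h_def by (rule Ch(8)[OF z])
    have hv: "(norm (v z - Vn n z))\<^sup>2 \<le> Ch * h" using Ch(2)[OF z, of "W n z"] by (simp add: h_def Vn_def)
    have hP: "(norm (Phi (F z) - X))\<^sup>2 \<le> Ch * h" using Ch(3)[OF z, of "W n z"] by (simp add: h_def Xe)
    have t1: "\<bar>Va n z a $ i * (Q i a n z - avg_flux i a z + dd G (dd Phi (Emat i a) (F z)) (Xn n z))\<bar> \<le> D1 * h" for i a
    proof -
      let ?Y = "dd Phi (Emat i a) (Hn n z)"
      \<comment> \<open>The integrand of \<open>stress_quadratic\<close>, with dPhi left at the
        integration variable. Its average differs from the bracket to be estimated, up to sign, by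
        the cofactor defect alone.\<close>
      define k where "k l = flux G i a l - dd G (dd Phi (Emat i a) (fst (snd l))) X - D2 X ?Y (snd l - X)" for l :: "(real^3) \<times> xi"
      have bl: "bounded_linear (D2 X ?Y)" unfolding D2_def[abs_def] by (rule bounded_linear_dd[OF dG_diff])
      have iS: "integrable (\<nu> z) (\<lambda>l. snd l - X)" using good_integrable(3)[OF z] by simp
      have iQ: "integrable (\<nu> z) (\<lambda>l. D2 X ?Y (snd l - X))" by (rule integrable_bounded_linear[OF bl iS])
      have Qi: "(\<integral>l. D2 X ?Y (snd l - X) \<partial>\<nu> z) = Q i a n z"
        using integral_bounded_linear[OF bl iS] good_integrable(3)[OF z] goodD(2)[OF z] by (simp add: Q_def X_def prob_space)
      note ig = averaged_stress_defect(2)[OF z, of i a X]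
      have ik: "integrable (\<nu> z) k" unfolding k_def using good_integrable(4)[OF z] ig iQ by simp
      have "(\<integral>l. k l \<partial>\<nu> z) = avg_flux i a z - (\<integral>l. dd G (dd Phi (Emat i a) (fst (snd l))) X \<partial>\<nu> z) - Q i a n z"
        unfolding k_def using good_integrable(4)[OF z] ig iQ by (simp add: avg_flux_def Qi)
      then have e: "Q i a n z - avg_flux i a z + dd G (dd Phi (Emat i a) (F z)) X
          = - (\<integral>l. k l \<partial>\<nu> z) + dG_w G X * (cof (F z - Hn n z) $ i $ a - (\<integral>l. cof (fst (snd l) - Hn n z) $ i $ a \<partial>\<nu> z))"
        using averaged_stress_defect(3)[OF z, of i a X "Hn n z"] by simp
      have "\<bar>\<integral>l. k l \<partial>\<nu> z\<bar> \<le> (\<integral>l. \<bar>k l\<bar> \<partial>\<nu> z)" by (rule integral_abs_bound)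
      also have "\<dots> \<le> (\<integral>l. Cs * rel_energy G (snd l) X \<partial>\<nu> z)"
      proof (rule integral_mono)
        show "integrable (\<nu> z) (\<lambda>l. \<bar>k l\<bar>)" using ik by simp
        show "integrable (\<nu> z) (\<lambda>l. Cs * rel_energy G (snd l) X)" using Ch(7)[OF z, of "W n z"] by (simp add: Xe)
        show "\<bar>k l\<bar> \<le> Cs * rel_energy G (snd l) X" for l
          using Cs(2)[of X i a "snd l"] MX(2)[of n z] unfolding k_def flux_eq_stress D2_def fX by (simp add: X_def)
      qed
      also have "\<dots> \<le> Cs * h"
        using mult_left_mono[OF Ch(6)[OF z, of "W n z"] Cs(1)] by (simp add: Xe h_def)
      finally have k1: "\<bar>\<integral>l. k l \<partial>\<nu> z\<bar> \<le> Cs * h" .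
      have "\<bar>\<integral>l. cof (fst (snd l) - Hn n z) $ i $ a \<partial>\<nu> z\<bar> \<le> (\<integral>l. \<bar>cof (fst (snd l) - Hn n z) $ i $ a\<bar> \<partial>\<nu> z)"
        by (rule integral_abs_bound)
      also have "\<dots> \<le> (\<integral>l. K * (norm (snd l - X))\<^sup>2 \<partial>\<nu> z)"
      proof (rule integral_mono)
        show "integrable (\<nu> z) (\<lambda>l. \<bar>cof (fst (snd l) - Hn n z) $ i $ a\<bar>)" using averaged_stress_defect(1)[OF z] by simp
        show "integrable (\<nu> z) (\<lambda>l. K * (norm (snd l - X))\<^sup>2)" using Ch(4)[OF z, of "W n z"] by (simp add: Xe)
        show "\<bar>cof (fst (snd l) - Hn n z) $ i $ a\<bar> \<le> K * (norm (snd l - X))\<^sup>2" for l :: "(real^3) \<times> xi" using K(3)[of l "Hn n z" i a] by (simp add: Xe)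
      qed
      also have "\<dots> \<le> K * (Ch * h)" using mult_left_mono[OF Ch(5)[OF z, of "W n z"] K(1)] by (simp add: Xe h_def)
      finally have k2: "\<bar>\<integral>l. cof (fst (snd l) - Hn n z) $ i $ a \<partial>\<nu> z\<bar> \<le> K * (Ch * h)" .
      have k3: "\<bar>cof (F z - Hn n z) $ i $ a\<bar> \<le> K * (Ch * h)"
        using order_trans[OF K(2)[of "F z" "Hn n z" i a] mult_left_mono[OF _ K(1)]] hP by (simp add: Xe)
      have "\<bar>cof (F z - Hn n z) $ i $ a - (\<integral>l. cof (fst (snd l) - Hn n z) $ i $ a \<partial>\<nu> z)\<bar> \<le> 2 * K * Ch * h" using k2 k3 by simp
      then have "\<bar>dG_w G X * (cof (F z - Hn n z) $ i $ a - (\<integral>l. cof (fst (snd l) - Hn n z) $ i $ a \<partial>\<nu> z))\<bar> \<le> Cw * (2 * K * Ch * h)"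
        unfolding abs_mult using Cw(2)[of n z] Cw(1) by (intro mult_mono) (auto simp: Xe)
      then have "\<bar>Q i a n z - avg_flux i a z + dd G (dd Phi (Emat i a) (F z)) X\<bar> \<le> Cs * h + Cw * (2 * K * Ch * h)"
        unfolding e using k1 by linarith
      then have "\<bar>Va n z a $ i\<bar> * \<bar>Q i a n z - avg_flux i a z + dd G (dd Phi (Emat i a) (F z)) X\<bar> \<le> L * (Cs * h + Cw * (2 * K * Ch * h))"
        using Va_Ha_bounded[of n z a i] L_nonneg by (intro mult_mono) auto
      then show ?thesis unfolding abs_mult D1_def X_def by (simp add: algebra_simps)
    qed
    have t2: "\<bar>(v z $ i - Vn n z $ i) * D2 (Xn n z) (dd Phi (Emat i a) (F z) - dd Phi (Emat i a) (Hn n z)) (dX n z a)\<bar> \<le> D2c * h" for i a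
    proof -
      have v1: "\<bar>v z $ i - Vn n z $ i\<bar> \<le> norm (v z - Vn n z)" using component_le_norm_cart[of "v z - Vn n z" i] by simp
      have "\<bar>D2 X (dd Phi (Emat i a) (F z) - dd Phi (Emat i a) (Hn n z)) (dX n z a)\<bar>
          \<le> A * norm (dd Phi (Emat i a) (F z) - dd Phi (Emat i a) (Hn n z)) * norm (dX n z a)"
        unfolding D2_def X_def by (rule A(2)[OF MX(2)])
      also have "\<dots> \<le> A * (K * norm (Phi (F z) - X)) * Cx"
        using K(4)[of i a "F z" "Hn n z"] A(1) Cx K(1) by (intro mult_mono mult_left_mono) (auto simp: Xe)
      finally have "\<bar>v z $ i - Vn n z $ i\<bar> * \<bar>D2 X (dd Phi (Emat i a) (F z) - dd Phi (Emat i a) (Hn n z)) (dX n z a)\<bar>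
          \<le> norm (v z - Vn n z) * (A * (K * norm (Phi (F z) - X)) * Cx)"
        using v1 by (intro mult_mono) auto
      also have "\<dots> = A * K * Cx * (norm (v z - Vn n z) * norm (Phi (F z) - X))" by (simp add: mult_ac)
      also have "\<dots> \<le> A * K * Cx * (Ch * h)"
      proof (intro mult_left_mono)
        \<comment> \<open>The two first order distances are combined by 2ab \<le> a^2 + b^2, each
          square being at most \<open>Ch * h\<close>.\<close>
        have "2 * (norm (v z - Vn n z) * norm (Phi (F z) - X)) \<le> (norm (v z - Vn n z))\<^sup>2 + (norm (Phi (F z) - X))\<^sup>2"
          using zero_le_power2[of "norm (v z - Vn n z) - norm (Phi (F z) - X)"] by (simp add: power2_eq_square algebra_simps)
        then show "norm (v z - Vn n z) * norm (Phi (F z) - X) \<le> Ch * h" using hv hP by linarith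
      qed (use A Cx K in auto)
      finally show ?thesis unfolding abs_mult D2c_def X_def by (simp add: mult_ac)
    qed
    have t3: "\<bar>dw n z i a * cof (F z - Hn n z) $ i $ a\<bar> \<le> D3 * h" for i a
    proof -
      have "\<bar>cof (F z - Hn n z) $ i $ a\<bar> \<le> K * (Ch * h)"
        using order_trans[OF K(2)[of "F z" "Hn n z" i a] mult_left_mono[OF _ K(1)]] hP by (simp add: Xe)
      then have "\<bar>dw n z i a\<bar> * \<bar>cof (F z - Hn n z) $ i $ a\<bar> \<le> Cd * (K * (Ch * h))"
        using Cd by (intro mult_mono) auto
      then show ?thesis unfolding abs_mult D3_def by (simp add: mult_ac)
    qed
    have "\<bar>quadratic_part n z\<bar> \<le> 9 * (D1 * h) + 9 * (D2c * h) + 9 * (D3 * h)"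
      unfolding quadratic_part_def by (intro order_trans[OF abs_triangle_ineq4] add_mono sum_sum_abs_le t1 t2 t3)
    then show "\<bar>quadratic_part n z\<bar> \<le> (9 * D1 + 9 * D2c + 9 * D3) * avg_rel_eta (W n z) z" by (simp add: h_def algebra_simps)
  qed
qed

end

section \<open>The relative energy inequality\<close>

lemma deriv_eq_dd: "C1_fun \<theta> \<Longrightarrow> deriv \<theta> t = dd \<theta> 1 t" for \<theta> :: "real \<Rightarrow> real"
  by (rule DERIV_imp_deriv[OF C1_fun_has_real_derivative])

context weak_strong begin

lemma rel_eta_init: "AE x in QB. eta G (v0 x, Phi (F0 x)) = eta G (fst (Wc (x, 0)), Phi (snd (Wc (x, 0))))"
  using init_QB by eventually_elim simp

lemma energy_law:
  assumes \<theta>: "C1_fun \<theta>" "\<And>t. 0 \<le> t \<Longrightarrow> t < T \<Longrightarrow> 0 \<le> \<theta> t" "T' < T" "\<And>t. T' \<le> t \<Longrightarrow> \<theta> t = 0"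
  shows "0 \<le> (\<integral>z. dd \<theta> 1 (snd z) * avg_eta z \<partial>QM T) + (\<integral>z. deriv \<theta> (snd z) \<partial>\<gamma>)
    + (\<integral>x. \<theta> 0 * eta G (fst (Wc (x, 0)), Phi (snd (Wc (x, 0)))) \<partial>QB)"
proof -
  have "0 \<le> (LINT z:QT T|lborel. deriv \<theta> (snd z) * (\<integral>l. eta G l \<partial>\<nu> z)) + (\<integral>z. deriv \<theta> (snd z) \<partial>\<gamma>)
    + (LINT x:Qbox|lborel. \<theta> 0 * eta G (v0 x, Phi (F0 x)))"
  proof -
    have "C1_fun \<theta> \<and> (\<forall>t\<in>{0..<T}. 0 \<le> \<theta> t) \<and> (\<exists>T'<T. \<forall>t. T' \<le> t \<longrightarrow> \<theta> t = 0)" using \<theta> by auto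
    with sol show ?thesis unfolding dmv_solution_def by blast
  qed
  moreover have "(LINT x:Qbox|lborel. \<theta> 0 * eta G (v0 x, Phi (F0 x))) = (\<integral>x. \<theta> 0 * eta G (fst (Wc (x, 0)), Phi (snd (Wc (x, 0)))) \<partial>QB)"
  proof -
    have "(\<lambda>x. \<theta> 0 * eta G (v0 x, Phi (F0 x))) \<in> borel_measurable borel"
      "(\<lambda>x. \<theta> 0 * eta G (fst (Wc (x, 0)), Phi (snd (Wc (x, 0))))) \<in> borel_measurable borel"
      by (intro borel_measurable_times measurable_compose[OF _ eta_measurable] borel_measurable_Pair
          v0_measurable Phi_F0_measurable borel_measurable_continuous_onI[OF continuous_on_Wc0'(1)]
          borel_measurable_continuous_onI[OF continuous_on_Wc0'(2)] borel_measurable_const)+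
    from integral_cong_AE[OF measurable_QB[OF this(1)] measurable_QB[OF this(2)]] show ?thesis
      unfolding LINT_QB using rel_eta_init by (simp add: eventually_mono)
  qed
  ultimately show ?thesis unfolding LINT_QM avg_eta_def[symmetric] deriv_eq_dd[OF \<theta>(1)] by linarith
qed

definition legendre_strain :: "mat3 \<Rightarrow> real" where
  "legendre_strain M = (\<Sum>b\<in>Basis. (Phi M \<bullet> b) * dd G b (Phi M)) - G (Phi M)"

lemma legendre_eq: "legendre w = (\<Sum>i\<in>UNIV. 1/2 * (fst w $ i * fst w $ i)) + legendre_strain (snd w)"
  using dd_Basis[OF G_diff, of "Phi (snd w)" "Phi (snd w)"]
  by (simp add: legendre_def legendre_strain_def inner_vec_def sum_divide_distrib)

text \<open>As for any Legendre transform, the derivative of \<open>G\<close> itself cancels against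
  the derivative of the first factor, and only the Hessian applied to the state remains.\<close>

lemma C1_fun_legendre_strain: "C1_fun legendre_strain"
  and dd_legendre_strain: "dd legendre_strain N M = D2 (Phi M) (Phi M) (dd Phi N M)"
proof -
  have c: "C1_fun (\<lambda>M. Phi M \<bullet> b)" "C1_fun (\<lambda>M. dd G b (Phi M))" "C1_fun (\<lambda>M. G (Phi M))" for b
    by (intro C1_fun_inner_left C1_fun_Phi C1_fun_compose[OF dG_C1] C1_fun_compose[OF G_C1])+
  have s: "C1_fun (\<lambda>M. \<Sum>b\<in>Basis. (Phi M \<bullet> b) * dd G b (Phi M))" by (intro C1_fun_sum C1_fun_mult c)
  show "C1_fun legendre_strain" unfolding legendre_strain_def[abs_def] by (rule C1_fun_diff[OF s c(3)])
  have "dd legendre_strain N M = (\<Sum>b\<in>Basis. dd (\<lambda>M. (Phi M \<bullet> b) * dd G b (Phi M)) N M) - dd (\<lambda>M. G (Phi M)) N M"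
    unfolding legendre_strain_def[abs_def] dd_diff[OF s c(3)] by (simp only: dd_sum[OF C1_fun_mult[OF c(1,2)]])
  also have "\<dots> = (\<Sum>b\<in>Basis. (Phi M \<bullet> b) * D2 (Phi M) b (dd Phi N M) + (dd Phi N M \<bullet> b) * dd G b (Phi M)) - dd G (dd Phi N M) (Phi M)"
    by (simp only: dd_mult[OF c(1,2)] dd_inner_left[OF C1_fun_Phi] dd_compose[OF dG_C1 C1_fun_Phi] dd_compose[OF G_C1 C1_fun_Phi] D2_def)
  also have "\<dots> = D2 (Phi M) (Phi M) (dd Phi N M)"
    unfolding sum.distrib D2_Basis[of _ "Phi M", symmetric]
    using dd_Basis[OF G_diff, of "dd Phi N M" "Phi M"] by simp
  finally show "dd legendre_strain N M = D2 (Phi M) (Phi M) (dd Phi N M)" .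
qed

lemma C1_fun_legendre: "C1_fun legendre"
  unfolding legendre_eq[abs_def]
  by (intro C1_fun_add C1_fun_sum C1_fun_mult C1_fun_const C1_fun_nth C1_fun_snd[OF C1_fun_legendre_strain])

end

section \<open>Testing the equations with the mollified multipliers\<close>

context weak_strong_approx begin

lemma d_t_legendre: "d_t (\<lambda>z. legendre (W n z)) z
    = (\<Sum>i\<in>UNIV. Vn n z $ i * Vt n z $ i) + D2 (Xn n z) (Xn n z) (dd Phi (Ht n z) (Hn n z))"
proof -
  have V: "C1_fun (\<lambda>z. fst (W n z) $ i)" for i by (rule field_C1[OF C1_fun_nth(1)])
  have c: "C1_fun (\<lambda>z. fst (W n z) $ i * fst (W n z) $ i)" for i by (intro C1_fun_mult V)
  have c': "C1_fun (\<lambda>z. 1/2 * (fst (W n z) $ i * fst (W n z) $ i))" for i by (intro C1_fun_mult C1_fun_const c)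
  have H: "C1_fun (\<lambda>z. legendre_strain (snd (W n z)))" by (rule field_C1[OF C1_fun_snd[OF C1_fun_legendre_strain]])
  have 1: "dd (\<lambda>z. 1/2 * (fst (W n z) $ i * fst (W n z) $ i)) (0, 1) z = Vn n z $ i * Vt n z $ i" for i
    unfolding dd_mult[OF C1_fun_const c] dd_mult[OF V V] using d_V(1)[of n i z]
    by (simp add: d_t_def Vn_def)
  have 2: "dd (\<lambda>z. legendre_strain (snd (W n z))) (0, 1) z = D2 (Xn n z) (Xn n z) (dd Phi (Ht n z) (Hn n z))"
    using d_fH(1)[OF C1_fun_legendre_strain, of n z] unfolding d_t_def Hn_def dd_legendre_strain Xn_def .
  show ?thesis
    unfolding d_t_def legendre_eq dd_add[OF C1_fun_sum[OF c'] H] dd_sum[OF c'] 1 2 ..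
qed

lemma time_field_test_fn:
  assumes f: "C1_fun f" and \<theta>: "C1_fun \<theta>" "T' < T" "\<And>t. T' \<le> t \<Longrightarrow> \<theta> t = 0"
  shows "test_fn T (\<lambda>z. \<theta> (snd z) * f (W n z))"
  unfolding test_fn_def
proof (intro conjI)
  show "C1_fun (\<lambda>z. \<theta> (snd z) * f (W n z))" by (intro C1_fun_mult C1_fun_snd \<theta> field_C1 f)
  show "periodic (\<lambda>z. \<theta> (snd z) * f (W n z))" using field_periodic[of f n] by (simp add: periodic_def)
  show "\<exists>T'<T. \<forall>x t. T' \<le> t \<longrightarrow> \<theta> (snd (x, t)) * f (W n (x, t)) = 0" using \<theta> by auto
qed

text \<open>The data of the two solutions agree, but the mollified state differs from them at time
  0; this is the resulting relative energy of the initial data.\<close>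

definition initial_gap :: "nat \<Rightarrow> real^3 \<Rightarrow> real" where
  "initial_gap n x = rel_eta (fst (Wc (x, 0)), Phi (snd (Wc (x, 0)))) (W n (x, 0))"

lemma continuous_field: "continuous_on UNIV f \<Longrightarrow> continuous_on UNIV (\<lambda>z. f (W n z))"
  by (rule continuous_on_compose2[OF _ C1_fun_continuous_on[OF W_C1]]) auto

lemma continuous_field_0: "continuous_on UNIV f \<Longrightarrow> continuous_on UNIV (\<lambda>x. f (W n (x, 0)))"
  by (rule continuous_on_initial[OF continuous_field])

lemma avg_rel_eta_field: "avg_rel_eta w z = avg_eta z - (\<Sum>i\<in>UNIV. fst w $ i * v z $ i) - (\<Sum>A\<in>Basis. dd G A (Phi (snd w)) * (Phi (F z) \<bullet> A)) + legendre w * 1"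
  using dd_Basis[OF G_diff, of "Phi (F z)" "Phi (snd w)"]
  by (simp add: avg_rel_eta_def inner_vec_def mult.commute)

text \<open>Energy inequality, minus the momentum law tested with \<theta> V, minus the geometric
  law tested with \<theta> dG(X), plus integration by parts in time for \<theta> times
  \<open>legendre\<close>. The terms with the derivative of \<theta> assemble to the relative
  energy, those with \<theta> to the entropy production, the values at time 0 to
  \<open>initial_gap\<close>.\<close>

lemma relative_energy_law:
  assumes \<theta>: "C1_fun \<theta>" "\<And>t. 0 \<le> t \<Longrightarrow> t < T \<Longrightarrow> 0 \<le> \<theta> t" "T' < T" "\<And>t. T' \<le> t \<Longrightarrow> \<theta> t = 0"
  shows "integrable (QM T) (\<lambda>z. dd \<theta> 1 (snd z) * avg_rel_eta (W n z) z - \<theta> (snd z) * entropy_production n z)"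
    and "0 \<le> (\<integral>z. dd \<theta> 1 (snd z) * avg_rel_eta (W n z) z - \<theta> (snd z) * entropy_production n z \<partial>QM T) + (\<integral>z. deriv \<theta> (snd z) \<partial>\<gamma>)
      + (\<integral>x. \<theta> 0 * initial_gap n x \<partial>QB)"
proof -
  \<comment> \<open>\<open>ia\<close>, \<open>ib\<close>, \<open>ic\<close> and \<open>ie\<close>
    are the space-time integrands of these four ingredients; \<open>ja\<close>, \<open>jb\<close>,
    \<open>jc\<close> and \<open>je\<close> below are their initial terms.\<close>
  define ia where "ia i z = d_t (\<lambda>z. \<theta> (snd z) * fst (W n z) $ i) z * v z $ i
      - (\<Sum>a\<in>UNIV. d_x a (\<lambda>z. \<theta> (snd z) * fst (W n z) $ i) z * avg_flux i a z)" for i z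
  define ib where "ib A z = d_t (\<lambda>z. \<theta> (snd z) * dd G A (Phi (snd (W n z)))) z * (Phi (F z) \<bullet> A)
      - (\<Sum>a\<in>UNIV. d_x a (\<lambda>z. \<theta> (snd z) * dd G A (Phi (snd (W n z)))) z * (\<Sum>i\<in>UNIV. v z $ i * (dd Phi (Emat i a) (F z) \<bullet> A)))" for A z
  define ic where "ic z = d_t (\<lambda>z. \<theta> (snd z) * legendre (W n z)) z" for z
  define ie where "ie z = dd \<theta> 1 (snd z) * avg_eta z" for z :: pt
  note tf = time_field_test_fn[OF _ \<theta>(1,3,4)]
  have ta: "test_fn T (\<lambda>z. \<theta> (snd z) * fst (W n z) $ i)" for i by (rule tf[OF C1_fun_nth(1)])
  have tb: "test_fn T (\<lambda>z. \<theta> (snd z) * dd G A (Phi (snd (W n z))))" for A by (rule tf[OF dG_field(1)])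
  have tc: "test_fn T (\<lambda>z. \<theta> (snd z) * legendre (W n z))" by (rule tf[OF C1_fun_legendre])
  have cont: "continuous_on UNIV (d_t \<phi>)" "continuous_on UNIV (d_x a \<phi>)" if "test_fn T \<phi>" for \<phi> a
    using that unfolding test_fn_def d_t_def d_x_def by (auto intro: C1_fun_continuous_on_dd)
  have dPi: "integrable (QM T) (\<lambda>z. v z $ i * (dd Phi (Emat i a) (F z) \<bullet> A))" for i a A
    using integrable_bounded_linear[OF bounded_linear_inner_left[of A] v_dd_Phi_integrable[of i a]] by simp
  have Ia: "integrable (QM T) (ia i)" for i
    unfolding ia_def[abs_def]
    by (intro Bochner_Integration.integrable_diff Bochner_Integration.integrable_sum integrable_QM_mult_cont cont ta
        v_nth_integrable avg_flux_integrable)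
  have Ib: "integrable (QM T) (ib A)" for A
    unfolding ib_def[abs_def]
    by (intro Bochner_Integration.integrable_diff Bochner_Integration.integrable_sum integrable_QM_mult_cont cont tb
        Phi_F_inner_integrable dPi)
  have Ic: "integrable (QM T) ic" unfolding ic_def[abs_def] by (intro integrable_QM_cont cont tc)
  have d\<theta>: "continuous_on UNIV (\<lambda>z::pt. dd \<theta> 1 (snd z))"
    by (rule continuous_on_compose2[OF C1_fun_continuous_on_dd[OF \<theta>(1), of UNIV]]) (auto intro: continuous_intros)
  have Ie: "integrable (QM T) ie" unfolding ie_def[abs_def] by (rule integrable_QM_mult_cont[OF avg_eta_integrable d\<theta>])
  have pa: "(\<Sum>i\<in>UNIV. ia i z) = dd \<theta> 1 (snd z) * (v z \<bullet> Vn n z) + \<theta> (snd z) * ((\<Sum>i\<in>UNIV. Vt n z $ i * v z $ i) - (\<Sum>i\<in>UNIV. \<Sum>a\<in>UNIV. Va n z a $ i * avg_flux i a z))" for z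
    unfolding ia_def d_t_time_mult[OF \<theta>(1) field_C1[OF C1_fun_nth(1)]] d_x_time_mult[OF \<theta>(1) field_C1[OF C1_fun_nth(1)]] d_V
    by (simp add: inner_vec_def sum_distrib_left sum.distrib sum_subtractf algebra_simps Vn_def)
  have pb: "(\<Sum>A\<in>Basis. ib A z) = dd \<theta> 1 (snd z) * dd G (Phi (F z)) (Xn n z) + \<theta> (snd z) * (D2 (Xn n z) (Phi (F z)) (dd Phi (Ht n z) (Hn n z))
      - (\<Sum>i\<in>UNIV. \<Sum>a\<in>UNIV. v z $ i * D2 (Xn n z) (dd Phi (Emat i a) (F z)) (dX n z a)))" for z
  proof -
    define K where "K A = (\<Sum>i\<in>UNIV. \<Sum>a\<in>UNIV. v z $ i * ((dd Phi (Emat i a) (F z) \<bullet> A) * D2 (Xn n z) A (dX n z a)))" for A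
    have b: "ib A z = dd \<theta> 1 (snd z) * ((Phi (F z) \<bullet> A) * dd G A (Xn n z)) + \<theta> (snd z) * ((Phi (F z) \<bullet> A) * D2 (Xn n z) A (dd Phi (Ht n z) (Hn n z)))
      - \<theta> (snd z) * K A" for A
    proof -
      have "(\<Sum>a\<in>UNIV. \<theta> (snd z) * D2 (Xn n z) A (dX n z a) * (\<Sum>i\<in>UNIV. v z $ i * (dd Phi (Emat i a) (F z) \<bullet> A)))
        = \<theta> (snd z) * (\<Sum>a\<in>UNIV. \<Sum>i\<in>UNIV. v z $ i * ((dd Phi (Emat i a) (F z) \<bullet> A) * D2 (Xn n z) A (dX n z a)))"
        by (simp add: sum_distrib_left mult_ac)
      also have "(\<Sum>a\<in>UNIV. \<Sum>i\<in>UNIV. v z $ i * ((dd Phi (Emat i a) (F z) \<bullet> A) * D2 (Xn n z) A (dX n z a)))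
        = (\<Sum>i\<in>UNIV. \<Sum>a\<in>UNIV. v z $ i * ((dd Phi (Emat i a) (F z) \<bullet> A) * D2 (Xn n z) A (dX n z a)))" by (rule sum.swap)
      finally show ?thesis
        unfolding ib_def d_t_time_mult[OF \<theta>(1) field_C1[OF dG_field(1)]] d_x_time_mult[OF \<theta>(1) field_C1[OF dG_field(1)]]
        using d_dG(1)[where A=A and n=n and z=z] d_dG(2)[where A=A and n=n and z=z] by (simp add: K_def Xn_def Hn_def algebra_simps)
    qed
    have s: "(\<Sum>A\<in>Basis. K A)
      = (\<Sum>i\<in>UNIV. \<Sum>a\<in>UNIV. v z $ i * D2 (Xn n z) (dd Phi (Emat i a) (F z)) (dX n z a))"
    proof -
      have "(\<Sum>A\<in>Basis. \<Sum>i\<in>UNIV. \<Sum>a\<in>UNIV. v z $ i * ((dd Phi (Emat i a) (F z) \<bullet> A) * D2 (Xn n z) A (dX n z a)))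
        = (\<Sum>i\<in>UNIV. \<Sum>A\<in>Basis. \<Sum>a\<in>UNIV. v z $ i * ((dd Phi (Emat i a) (F z) \<bullet> A) * D2 (Xn n z) A (dX n z a)))" by (rule sum.swap)
      also have "\<dots> = (\<Sum>i\<in>UNIV. \<Sum>a\<in>UNIV. \<Sum>A\<in>Basis. v z $ i * ((dd Phi (Emat i a) (F z) \<bullet> A) * D2 (Xn n z) A (dX n z a)))"
        by (intro sum.cong refl) (rule sum.swap)
      finally show ?thesis unfolding K_def sum_distrib_left[symmetric] D2_Basis[of _ "dd Phi _ (F z)", symmetric] .
    qed
    have g: "(\<Sum>A\<in>Basis. (Phi (F z) \<bullet> A) * dd G A (Xn n z)) = dd G (Phi (F z)) (Xn n z)"
      using dd_Basis[OF G_diff, of "Phi (F z)" "Xn n z"] by simp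
    show ?thesis
      unfolding b sum_subtractf sum.distrib sum_distrib_left[symmetric] s g D2_Basis[of _ "Phi (F z)", symmetric]
      by (simp add: right_diff_distrib)
  qed
  have pc: "ic z = dd \<theta> 1 (snd z) * legendre (W n z) + \<theta> (snd z) * ((\<Sum>i\<in>UNIV. Vn n z $ i * Vt n z $ i) + D2 (Xn n z) (Xn n z) (dd Phi (Ht n z) (Hn n z)))" for z
    unfolding ic_def d_t_time_mult[OF \<theta>(1) field_C1[OF C1_fun_legendre]] d_t_legendre ..
  have eq: "dd \<theta> 1 (snd z) * avg_rel_eta (W n z) z - \<theta> (snd z) * entropy_production n z = ie z - (\<Sum>i\<in>UNIV. ia i z) - (\<Sum>A\<in>Basis. ib A z) + ic z" for z
    unfolding pa pb pc ie_def avg_rel_eta_def entropy_production_def linear_diff[OF linear_D2(2)]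
    by (simp add: Vn_def Xn_def Hn_def algebra_simps)
  show "integrable (QM T) (\<lambda>z. dd \<theta> 1 (snd z) * avg_rel_eta (W n z) z - \<theta> (snd z) * entropy_production n z)"
    unfolding eq using Ia Ib Ic Ie by simp
  define ja where "ja i = (\<integral>x. \<theta> 0 * fst (W n (x, 0)) $ i * (fst (Wc (x, 0)) $ i) \<partial>QB)" for i
  define jb where "jb A = (\<integral>x. \<theta> 0 * dd G A (Phi (snd (W n (x, 0)))) * (Phi (snd (Wc (x, 0))) \<bullet> A) \<partial>QB)" for A
  define jc where "jc = (\<integral>x. \<theta> 0 * legendre (W n (x, 0)) \<partial>QB)"
  define je where "je = (\<integral>x. \<theta> 0 * eta G (fst (Wc (x, 0)), Phi (snd (Wc (x, 0)))) \<partial>QB)"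
  have La: "(\<integral>z. ia i z \<partial>QM T) + ja i = 0" for i using momentum_law[OF ta, of i i] by (simp add: ia_def ja_def)
  have Lb: "(\<integral>z. ib A z \<partial>QM T) + jb A = 0" for A using geometric_law[OF tb, of A A] by (simp add: ib_def jb_def)
  have Lc: "(\<integral>z. ic z \<partial>QM T) + jc = 0"
    using integral_d_t[OF _ T_pos \<theta>(3), of "\<lambda>z. \<theta> (snd z) * legendre (W n z)"] tc \<theta>(4)
    by (simp add: ic_def[abs_def] jc_def test_fn_def)
  have Le: "0 \<le> (\<integral>z. ie z \<partial>QM T) + (\<integral>z. deriv \<theta> (snd z) \<partial>\<gamma>) + je"
    using energy_law[OF \<theta>] by (simp add: ie_def je_def)
  have j: "(\<integral>x. \<theta> 0 * initial_gap n x \<partial>QB) = je - (\<Sum>i\<in>UNIV. ja i) - (\<Sum>A\<in>Basis. jb A) + jc"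
  proof -
    have c: "integrable QB (\<lambda>x. \<theta> 0 * fst (W n (x, 0)) $ i * (fst (Wc (x, 0)) $ i))"
      "integrable QB (\<lambda>x. \<theta> 0 * dd G A (Phi (snd (W n (x, 0)))) * (Phi (snd (Wc (x, 0))) \<bullet> A))"
      "integrable QB (\<lambda>x. \<theta> 0 * legendre (W n (x, 0)))" for i A
      by (intro integrable_QB_cont continuous_intros continuous_field_0 continuous_on_Wc0
          C1_fun_continuous_on[OF C1_fun_legendre] C1_fun_continuous_on[OF dG_field(1)] C1_fun_continuous_on[OF C1_fun_nth(1)])+
    have "continuous_on UNIV (eta G)"
      unfolding eta_def by (intro continuous_intros continuous_on_compose2[OF C1_fun_continuous_on[OF G_C1, of UNIV]]) auto
    from continuous_on_compose2[OF this continuous_on_Pair[OF continuous_on_Wc0'] subset_UNIV]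
    have ce: "integrable QB (\<lambda>x. \<theta> 0 * eta G (fst (Wc (x, 0)), Phi (snd (Wc (x, 0)))))"
      by (rule integrable_QB_cont[OF continuous_on_mult[OF continuous_on_const]])
    have "\<theta> 0 * initial_gap n x = \<theta> 0 * eta G (fst (Wc (x, 0)), Phi (snd (Wc (x, 0))))
       - (\<Sum>i\<in>UNIV. \<theta> 0 * fst (W n (x, 0)) $ i * (fst (Wc (x, 0)) $ i))
       - (\<Sum>A\<in>Basis. \<theta> 0 * dd G A (Phi (snd (W n (x, 0)))) * (Phi (snd (Wc (x, 0))) \<bullet> A)) + \<theta> 0 * legendre (W n (x, 0))" for x
      using dd_Basis[OF G_diff, of "Phi (snd (Wc (x, 0)))" "Phi (snd (W n (x, 0)))"]
      by (simp add: initial_gap_def rel_eta_eq inner_vec_def sum_distrib_left algebra_simps)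
    then show ?thesis unfolding ja_def jb_def jc_def je_def using c ce by simp
  qed
  have "(\<integral>z. dd \<theta> 1 (snd z) * avg_rel_eta (W n z) z - \<theta> (snd z) * entropy_production n z \<partial>QM T)
     = (\<integral>z. ie z \<partial>QM T) - (\<Sum>i\<in>UNIV. \<integral>z. ia i z \<partial>QM T) - (\<Sum>A\<in>Basis. \<integral>z. ib A z \<partial>QM T) + (\<integral>z. ic z \<partial>QM T)"
    unfolding eq using Ia Ib Ic Ie by simp
  moreover have "(\<Sum>i\<in>UNIV. \<integral>z. ia i z \<partial>QM T) = - (\<Sum>i\<in>UNIV. ja i)" "(\<Sum>A\<in>Basis. \<integral>z. ib A z \<partial>QM T) = - (\<Sum>A\<in>Basis. jb A)"
    unfolding sum_negf[symmetric] using La Lb by (auto intro!: sum.cong simp: eq_neg_iff_add_eq_0)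
  ultimately show "0 \<le> (\<integral>z. dd \<theta> 1 (snd z) * avg_rel_eta (W n z) z - \<theta> (snd z) * entropy_production n z \<partial>QM T) + (\<integral>z. deriv \<theta> (snd z) \<partial>\<gamma>)
      + (\<integral>x. \<theta> 0 * initial_gap n x \<partial>QB)"
    unfolding j using Lc Le by linarith
qed

end

section \<open>Passage to the limit in the mollification\<close>

context weak_strong_approx begin

lemma field_integral_limit:
  fixes f :: "(real^3) \<times> mat3 \<Rightarrow> real"
  assumes f: "continuous_on UNIV f" and g: "integrable (QM T) g"
  shows "integrable (QM T) (\<lambda>z. f (W n z) * g z)" "integrable (QM T) (\<lambda>z. f (Wc z) * g z)"
    "(\<lambda>n. \<integral>z. f (W n z) * g z \<partial>QM T) \<longlonglongrightarrow> (\<integral>z. f (Wc z) * g z \<partial>QM T)"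
proof -
  have c: "continuous_on UNIV (\<lambda>z. f (Wc z))" by (rule continuous_on_compose2[OF f Wc_continuous]) auto
  have i: "integrable (QM T) (\<lambda>z. f (W n z) * g z)" "integrable (QM T) (\<lambda>z. f (Wc z) * g z)" for n
    by (rule integrable_QM_mult_cont[OF g continuous_field[OF f]], rule integrable_QM_mult_cont[OF g c])
  show "integrable (QM T) (\<lambda>z. f (W n z) * g z)" "integrable (QM T) (\<lambda>z. f (Wc z) * g z)" by (rule i)+
  obtain C where C: "\<forall>n z. \<bar>f (W n z)\<bar> \<le> C"
  proof (rule field_bounded[OF f])
    fix C assume "\<And>n z. \<bar>f (W n z)\<bar> \<le> C" then show thesis by (intro that) blast
  qed
  show "(\<lambda>n. \<integral>z. f (W n z) * g z \<partial>QM T) \<longlonglongrightarrow> (\<integral>z. f (Wc z) * g z \<partial>QM T)"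
  proof (rule integral_dominated_convergence[where w = "\<lambda>z. C * \<bar>g z\<bar>"])
    show "AE z in QM T. (\<lambda>n. f (W n z) * g z) \<longlonglongrightarrow> f (Wc z) * g z"
      by (intro AE_I2 tendsto_mult_right field_limit f)
    show "AE z in QM T. norm (f (W n z) * g z) \<le> C * \<bar>g z\<bar>" for n
      by (intro AE_I2) (simp add: abs_mult mult_right_mono C)
  qed (use i g in auto)
qed

text \<open>The relative energy is a finite sum of continuous functions of the approximate state
  times fixed integrable functions, so each summand converges by domination.\<close>

lemma avg_rel_eta_limit:
  fixes \<psi> :: "pt \<Rightarrow> real"
  assumes \<psi>: "continuous_on UNIV \<psi>"
  shows "integrable (QM T) (\<lambda>z. \<psi> z * avg_rel_eta (W n z) z)" "integrable (QM T) (\<lambda>z. \<psi> z * avg_rel_eta (Wc z) z)"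
    "(\<lambda>n. \<integral>z. \<psi> z * avg_rel_eta (W n z) z \<partial>QM T) \<longlonglongrightarrow> (\<integral>z. \<psi> z * avg_rel_eta (Wc z) z \<partial>QM T)"
proof -
  define fV fG where "fV i w = fst w $ i" and "fG A w = dd G A (Phi (snd w))" for i A and w :: "(real^3) \<times> mat3"
  have c: "continuous_on UNIV (fV i)" "continuous_on UNIV (fG A)" "continuous_on UNIV legendre" for i A
    unfolding fV_def fG_def
    by (rule C1_fun_continuous_on[OF C1_fun_nth(1)], rule C1_fun_continuous_on[OF dG_field(1)], rule C1_fun_continuous_on[OF C1_fun_legendre])
  have g: "integrable (QM T) (\<lambda>z. \<psi> z * avg_eta z)" "integrable (QM T) (\<lambda>z. \<psi> z * v z $ i)"
    "integrable (QM T) (\<lambda>z. \<psi> z * (Phi (F z) \<bullet> A))" "integrable (QM T) \<psi>" for i A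
    by (intro integrable_QM_mult_cont[OF _ \<psi>] avg_eta_integrable v_nth_integrable Phi_F_inner_integrable integrable_QM_cont[OF \<psi>])+
  have eq: "\<psi> z * avg_rel_eta w z = \<psi> z * avg_eta z - (\<Sum>i\<in>UNIV. fV i w * (\<psi> z * v z $ i))
      - (\<Sum>A\<in>Basis. fG A w * (\<psi> z * (Phi (F z) \<bullet> A))) + legendre w * \<psi> z" for w z
    unfolding avg_rel_eta_field fV_def fG_def by (simp add: sum_distrib_left algebra_simps)
  note l1 = field_integral_limit[OF c(1) g(2)] and l2 = field_integral_limit[OF c(2) g(3)]
    and l3 = field_integral_limit[OF c(3) g(4)]
  have i: "integrable (QM T) (\<lambda>z. \<psi> z * avg_rel_eta (w z) z)"
    "(\<integral>z. \<psi> z * avg_rel_eta (w z) z \<partial>QM T) = (\<integral>z. \<psi> z * avg_eta z \<partial>QM T) - (\<Sum>i\<in>UNIV. \<integral>z. fV i (w z) * (\<psi> z * v z $ i) \<partial>QM T)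
      - (\<Sum>A\<in>Basis. \<integral>z. fG A (w z) * (\<psi> z * (Phi (F z) \<bullet> A)) \<partial>QM T) + (\<integral>z. legendre (w z) * \<psi> z \<partial>QM T)"
    if "w = Wc \<or> (\<exists>n. w = W n)" for w
  proof -
    have "integrable (QM T) (\<lambda>z. fV i (w z) * (\<psi> z * v z $ i))"
      "integrable (QM T) (\<lambda>z. fG A (w z) * (\<psi> z * (Phi (F z) \<bullet> A)))"
      "integrable (QM T) (\<lambda>z. legendre (w z) * \<psi> z)" for i A
      using that l1(1,2) l2(1,2) l3(1,2) by blast+
    then show "integrable (QM T) (\<lambda>z. \<psi> z * avg_rel_eta (w z) z)"
     "(\<integral>z. \<psi> z * avg_rel_eta (w z) z \<partial>QM T) = (\<integral>z. \<psi> z * avg_eta z \<partial>QM T) - (\<Sum>i\<in>UNIV. \<integral>z. fV i (w z) * (\<psi> z * v z $ i) \<partial>QM T)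
      - (\<Sum>A\<in>Basis. \<integral>z. fG A (w z) * (\<psi> z * (Phi (F z) \<bullet> A)) \<partial>QM T) + (\<integral>z. legendre (w z) * \<psi> z \<partial>QM T)"
      unfolding eq using g(1) by simp_all
  qed
  have in': "integrable (QM T) (\<lambda>z. \<psi> z * avg_rel_eta (W n z) z)" for n by (rule i(1)) blast
  show "integrable (QM T) (\<lambda>z. \<psi> z * avg_rel_eta (W n z) z)" by (rule in')
  show "integrable (QM T) (\<lambda>z. \<psi> z * avg_rel_eta (Wc z) z)" by (rule i(1)) blast
  have e1: "(\<integral>z. \<psi> z * avg_rel_eta (W n z) z \<partial>QM T) = (\<integral>z. \<psi> z * avg_eta z \<partial>QM T) - (\<Sum>i\<in>UNIV. \<integral>z. fV i (W n z) * (\<psi> z * v z $ i) \<partial>QM T)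
      - (\<Sum>A\<in>Basis. \<integral>z. fG A (W n z) * (\<psi> z * (Phi (F z) \<bullet> A)) \<partial>QM T) + (\<integral>z. legendre (W n z) * \<psi> z \<partial>QM T)" for n
    by (rule i(2)) blast
  have e2: "(\<integral>z. \<psi> z * avg_rel_eta (Wc z) z \<partial>QM T) = (\<integral>z. \<psi> z * avg_eta z \<partial>QM T) - (\<Sum>i\<in>UNIV. \<integral>z. fV i (Wc z) * (\<psi> z * v z $ i) \<partial>QM T)
      - (\<Sum>A\<in>Basis. \<integral>z. fG A (Wc z) * (\<psi> z * (Phi (F z) \<bullet> A)) \<partial>QM T) + (\<integral>z. legendre (Wc z) * \<psi> z \<partial>QM T)"
    by (rule i(2)) blast
  show "(\<lambda>n. \<integral>z. \<psi> z * avg_rel_eta (W n z) z \<partial>QM T) \<longlonglongrightarrow> (\<integral>z. \<psi> z * avg_rel_eta (Wc z) z \<partial>QM T)"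
    unfolding e1 e2 by (intro tendsto_intros l1(3) l2(3) l3(3))
qed

text \<open>The gap is a jointly continuous function of the exact and the mollified state that
  vanishes on the diagonal; both states stay in a fixed ball, so dominated convergence
  applies.\<close>

lemma initial_gap_limit: "(\<lambda>n. \<integral>x. c * initial_gap n x \<partial>QB) \<longlonglongrightarrow> 0"
proof -
  define f where "f u w = rel_eta (fst u, Phi (snd u)) w" for u w :: "(real^3) \<times> mat3"
  have f0: "f w w = 0" for w
    unfolding f_def rel_eta_def rel_energy_def using dd_0_right[OF G_diff] by simp
  have "f u w = eta G (fst u, Phi (snd u)) - fst u \<bullet> fst w + legendre w - (\<Sum>A\<in>Basis. (Phi (snd u) \<bullet> A) * dd G A (Phi (snd w)))" for u w
    using dd_Basis[OF G_diff, of "Phi (snd u)" "Phi (snd w)"] by (simp add: f_def rel_eta_eq)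
  moreover have "continuous_on UNIV (\<lambda>(u, w). eta G (fst u, Phi (snd u)) - fst u \<bullet> fst w + legendre w - (\<Sum>A\<in>Basis. (Phi (snd u) \<bullet> A) * dd G A (Phi (snd w))))"
    unfolding eta_def split_beta
    by (intro continuous_intros continuous_on_compose2[OF C1_fun_continuous_on[OF C1_fun_legendre, of UNIV]]
      continuous_on_compose2[OF C1_fun_continuous_on[OF C1_fun_Phi, of UNIV]]
      continuous_on_compose2[OF C1_fun_continuous_on[OF dG_C1, of UNIV]]
      continuous_on_compose2[OF C1_fun_continuous_on[OF G_C1, of UNIV]]; simp)
  ultimately have c: "continuous_on UNIV (\<lambda>(u, w). f u w)" by simp
  obtain C where C: "\<forall>z. norm z \<le> 2 * M \<longrightarrow> \<bar>case z of (u, w) \<Rightarrow> f u w\<bar> \<le> C"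
  proof (rule C1_fun_bounded_cball[OF c, of "2 * M"])
    fix C assume "\<And>z. norm z \<le> 2 * M \<Longrightarrow> \<bar>case z of (u, w) \<Rightarrow> f u w\<bar> \<le> C" then show thesis by (intro that) blast
  qed
  have b: "\<bar>f (Wc z) (W n z)\<bar> \<le> C" for n z
  proof -
    have "norm (Wc z, W n z) \<le> 2 * M" using norm_Pair_le[of "Wc z" "W n z"] W_bounded[of n z] Wc_M[of z] by simp
    with C[THEN spec, of "(Wc z, W n z)"] show ?thesis by simp
  qed
  have lim: "(\<lambda>n. f (Wc z) (W n z)) \<longlonglongrightarrow> 0" for z
  proof -
    have "continuous_on UNIV (f (Wc z))"
      using continuous_on_compose2[OF c continuous_on_Pair[OF continuous_on_const continuous_on_id] subset_UNIV] by simp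
    from field_limit[OF this, of z] show ?thesis by (simp add: f0)
  qed
  have g: "initial_gap n x = f (Wc (x, 0)) (W n (x, 0))" for n x by (simp add: initial_gap_def f_def)
  have m: "(\<lambda>x. initial_gap n x) \<in> borel_measurable borel" for n
  proof -
    have "continuous_on UNIV (\<lambda>z. f (Wc z) (W n z))"
      using continuous_on_compose2[OF c continuous_on_Pair[OF Wc_continuous C1_fun_continuous_on[OF W_C1[of n]]] subset_UNIV] by simp
    then show ?thesis unfolding g by (intro borel_measurable_continuous_onI continuous_on_initial)
  qed
  interpret QB: finite_measure QB by (rule QB_finite)
  have "(\<lambda>n. \<integral>x. c * initial_gap n x \<partial>QB) \<longlonglongrightarrow> (\<integral>x. 0 \<partial>QB)"
  proof (rule integral_dominated_convergence[where w = "\<lambda>x. \<bar>c\<bar> * C"])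
    show "AE x in QB. (\<lambda>n. c * initial_gap n x) \<longlonglongrightarrow> 0"
      unfolding g by (intro AE_I2 tendsto_mult_right_zero lim)
    show "AE x in QB. norm (c * initial_gap n x) \<le> \<bar>c\<bar> * C" for n
      unfolding g by (intro AE_I2) (simp add: abs_mult mult_left_mono b)
    show "(\<lambda>x. c * initial_gap n x) \<in> borel_measurable QB" for n
      by (intro borel_measurable_times measurable_QB m) simp
  qed simp_all
  then show ?thesis by simp
qed

text \<open>In the limit the residual part and the initial gap disappear, the null part is 0 for
  every \<open>n\<close>, and the quadratic part is replaced by its bound. The constant
  \<open>C\<close> is chosen before \<theta>, as the later choice of \<theta> depends on it.\<close>

lemma relative_energy_inequality:
  "\<exists>C. \<forall>\<theta>. C1_fun \<theta> \<and> (\<forall>t. 0 \<le> t \<and> t < T \<longrightarrow> 0 \<le> \<theta> t) \<and> (\<exists>T'<T. \<forall>t. T' \<le> t \<longrightarrow> \<theta> t = 0) \<longrightarrow>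
     0 \<le> (\<integral>z. (dd \<theta> 1 (snd z) + C * \<theta> (snd z)) * avg_rel_eta (Wc z) z \<partial>QM T) + (\<integral>z. deriv \<theta> (snd z) \<partial>\<gamma>)"
proof -
  obtain C where "C \<ge> 0" and C: "\<forall>n z. good z \<longrightarrow> \<bar>quadratic_part n z\<bar> \<le> C * avg_rel_eta (W n z) z"
  proof (rule quadratic_part_bound)
    fix C assume "C \<ge> 0" "\<And>n z. good z \<Longrightarrow> \<bar>quadratic_part n z\<bar> \<le> C * avg_rel_eta (W n z) z" then show thesis by (intro that) blast+
  qed
  show ?thesis
  proof (rule exI[of _ C], intro allI impI)
    fix \<theta> :: "real \<Rightarrow> real"
    assume "C1_fun \<theta> \<and> (\<forall>t. 0 \<le> t \<and> t < T \<longrightarrow> 0 \<le> \<theta> t) \<and> (\<exists>T'<T. \<forall>t. T' \<le> t \<longrightarrow> \<theta> t = 0)"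
    then obtain T' where \<theta>: "C1_fun \<theta>" "\<And>t. 0 \<le> t \<Longrightarrow> t < T \<Longrightarrow> 0 \<le> \<theta> t" "T' < T" "\<And>t. T' \<le> t \<Longrightarrow> \<theta> t = 0" by blast
    define \<psi> where "\<psi> z = dd \<theta> 1 (snd z) + C * \<theta> (snd z)" for z :: pt
    have \<psi>: "continuous_on UNIV \<psi>"
      unfolding \<psi>_def
      by (intro continuous_intros continuous_on_compose2[OF C1_fun_continuous_on_dd[OF \<theta>(1), of UNIV]]
         C1_fun_continuous_on[OF C1_fun_snd[OF \<theta>(1)]]) auto
    define g where "g = (\<integral>z. deriv \<theta> (snd z) \<partial>\<gamma>)"
    have R: "integrable (QM T) (\<lambda>z. \<theta> (snd z) * residual_part n z)" "(\<lambda>n. \<integral>z. \<theta> (snd z) * residual_part n z \<partial>QM T) \<longlonglongrightarrow> 0" for n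
      using vanish_residual_part[OF \<theta>(1)] by (auto simp: vanish_def)
    have N: "integrable (QM T) (\<lambda>z. \<theta> (snd z) * null_part n z)" "(\<integral>z. \<theta> (snd z) * null_part n z \<partial>QM T) = 0" for n
      by (rule integral_null_part[OF \<theta>(1,3,4)]; assumption)+
    have ineq: "0 \<le> (\<integral>z. \<psi> z * avg_rel_eta (W n z) z \<partial>QM T) - (\<integral>z. \<theta> (snd z) * residual_part n z \<partial>QM T) + g + (\<integral>x. \<theta> 0 * initial_gap n x \<partial>QB)" for n
    proof -
      have "(\<integral>z. dd \<theta> 1 (snd z) * avg_rel_eta (W n z) z - \<theta> (snd z) * entropy_production n z \<partial>QM T)
        \<le> (\<integral>z. \<psi> z * avg_rel_eta (W n z) z - \<theta> (snd z) * residual_part n z + \<theta> (snd z) * null_part n z \<partial>QM T)"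
      proof (rule integral_mono_AE)
        show "AE z in QM T. dd \<theta> 1 (snd z) * avg_rel_eta (W n z) z - \<theta> (snd z) * entropy_production n z
            \<le> \<psi> z * avg_rel_eta (W n z) z - \<theta> (snd z) * residual_part n z + \<theta> (snd z) * null_part n z"
          using AE_good AE_space
        proof eventually_elim
          case (elim z)
          then have "0 \<le> \<theta> (snd z)" by (intro \<theta>(2)) (auto simp: QT_def)
          \<comment> \<open>Entropy production enters with a minus sign and a nonnegative factor
            \<theta>, so only this side of the quadratic bound is needed; it holds at good points,
            that is almost everywhere.\<close>
          moreover have "- quadratic_part n z \<le> C * avg_rel_eta (W n z) z" using C elim(1) abs_ge_minus_self order_trans by blast
          ultimately have "\<theta> (snd z) * (- quadratic_part n z) \<le> \<theta> (snd z) * (C * avg_rel_eta (W n z) z)" by (rule mult_left_mono[rotated])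
          then show ?case unfolding entropy_production_eq \<psi>_def by (simp add: algebra_simps)
        qed
        show "integrable (QM T) (\<lambda>z. \<psi> z * avg_rel_eta (W n z) z - \<theta> (snd z) * residual_part n z + \<theta> (snd z) * null_part n z)"
          using avg_rel_eta_limit(1)[OF \<psi>] R(1) N(1) by simp
      qed (rule relative_energy_law(1)[OF \<theta>])
      also have "\<dots> = (\<integral>z. \<psi> z * avg_rel_eta (W n z) z \<partial>QM T) - (\<integral>z. \<theta> (snd z) * residual_part n z \<partial>QM T)"
        using avg_rel_eta_limit(1)[OF \<psi>] R(1) N by simp
      finally show ?thesis using relative_energy_law(2)[OF \<theta>, of n] unfolding g_def by linarith
    qed
    have "(\<lambda>n. (\<integral>z. \<psi> z * avg_rel_eta (W n z) z \<partial>QM T) - (\<integral>z. \<theta> (snd z) * residual_part n z \<partial>QM T) + g + (\<integral>x. \<theta> 0 * initial_gap n x \<partial>QB))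
      \<longlonglongrightarrow> (\<integral>z. \<psi> z * avg_rel_eta (Wc z) z \<partial>QM T) - 0 + g + 0"
      by (intro tendsto_add tendsto_diff tendsto_const avg_rel_eta_limit(3)[OF \<psi>] R(2) initial_gap_limit)
    then have "0 \<le> (\<integral>z. \<psi> z * avg_rel_eta (Wc z) z \<partial>QM T) - 0 + g + 0"
      by (rule LIMSEQ_le_const) (use ineq in auto)
    then show "0 \<le> (\<integral>z. (dd \<theta> 1 (snd z) + C * \<theta> (snd z)) * avg_rel_eta (Wc z) z \<partial>QM T) + (\<integral>z. deriv \<theta> (snd z) \<partial>\<gamma>)"
      unfolding \<psi>_def g_def by simp
  qed
qed

end

section \<open>Gronwall argument and conclusion\<close>

text \<open>A probability measure concentrated almost everywhere at one point takes the values 0 and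
  1 like the Dirac mass; points are Borel in a Hausdorff space.\<close>

lemma return_eqI:
  fixes M :: "'a::t2_space measure"
  assumes M: "prob_space M" "sets M = sets borel" and a: "AE l in M. l = a"
  shows "M = return borel a"
proof (rule measure_eqI)
  interpret prob_space M by (rule M)
  show "sets M = sets (return borel a)" using M by simp
  fix A assume A: "A \<in> sets M"
  show "emeasure M A = emeasure (return borel a) A"
  proof (cases "a \<in> A")
    case True
    then have "AE l in M. l \<in> A" using a by auto
    then show ?thesis using True A M(2) by (simp add: emeasure_eq_1_AE)
  next
    case False
    then have "AE l in M. l \<notin> A" using a by auto
    then have "emeasure M A = 0" using A by (subst (asm) AE_iff_measurable[OF A]) (auto dest: sets.sets_into_space)
    then show ?thesis using False A M(2) by simp
  qed
qed

text \<open>The exponential is an integrating factor: the derivative plus C \<theta> is minus a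
  function that is positive before \<open>T'\<close> and zero afterwards. Gronwall's inequality is
  thus built into the test function.\<close>

lemma cutoff:
  fixes T' C :: real
  defines "\<theta> \<equiv> \<lambda>t. (max 0 (T' - t))\<^sup>2 * exp (- C * t)"
  shows "C1_fun \<theta>" "dd \<theta> 1 t = - (2 * max 0 (T' - t) * exp (- C * t)) - C * \<theta> t"
    "0 \<le> \<theta> t" "T' \<le> t \<Longrightarrow> \<theta> t = 0"
proof -
  have d: "(\<theta> has_real_derivative - (2 * max 0 (T' - t) * exp (- C * t)) - C * \<theta> t) (at t)" for t
  proof -
    have 1: "((\<lambda>t. T' - t) has_real_derivative -1) (at t)" by (auto intro!: derivative_eq_intros)
    have 2: "((\<lambda>t. exp (- C * t)) has_real_derivative exp (- C * t) * - C) (at t)" by (auto intro!: derivative_eq_intros)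
    show ?thesis
      unfolding \<theta>_def
      by (rule DERIV_cong[OF DERIV_mult[OF DERIV_chain2[OF has_real_derivative_pos_square 1] 2]]) (simp add: algebra_simps)
  qed
  have c: "continuous_on UNIV \<theta>" unfolding \<theta>_def by (intro continuous_intros)
  show "C1_fun \<theta>" by (rule C1_fun_real[OF d]) (intro continuous_intros c)
  show "dd \<theta> 1 t = - (2 * max 0 (T' - t) * exp (- C * t)) - C * \<theta> t" using dd_real[OF d, of 1 t] by simp
  show "0 \<le> \<theta> t" "T' \<le> t \<Longrightarrow> \<theta> t = 0" by (simp_all add: \<theta>_def)
qed

context weak_strong_approx begin

lemma avg_rel_eta_nonneg: "good z \<Longrightarrow> 0 \<le> avg_rel_eta w z"
  using avg_rel_eta_lower by blast

lemma gamma_AE_QT: "AE z in \<gamma>. z \<in> QT T"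
proof (rule AE_I)
  show "{z \<in> space \<gamma>. z \<notin> QT T} \<subseteq> UNIV - QT T" by auto
  show "emeasure \<gamma> (UNIV - QT T) = 0" "UNIV - QT T \<in> sets \<gamma>"
    using sol unfolding dmv_solution_def by simp_all
qed

text \<open>With this test function the inequality says that the sum of two nonnegative integrals,
  one over the relative energy and one over \<gamma>, is at most 0. Both weights are positive before
  \<open>T'\<close>.\<close>

lemma concentration_eq_0_before:
  assumes T': "T' < T"
  shows "AE z in QM T. snd z < T' \<longrightarrow> avg_rel_eta (Wc z) z = 0" and "AE z in \<gamma>. \<not> snd z < T'"
proof -
  obtain C0 where C0: "\<forall>\<theta>. C1_fun \<theta> \<and> (\<forall>t. 0 \<le> t \<and> t < T \<longrightarrow> 0 \<le> \<theta> t) \<and> (\<exists>T'<T. \<forall>t. T' \<le> t \<longrightarrow> \<theta> t = 0) \<longrightarrow>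
     0 \<le> (\<integral>z. (dd \<theta> 1 (snd z) + C0 * \<theta> (snd z)) * avg_rel_eta (Wc z) z \<partial>QM T) + (\<integral>z. deriv \<theta> (snd z) \<partial>\<gamma>)"
    using relative_energy_inequality by blast
  \<comment> \<open>The constant is raised to be nonnegative because the integral over \<gamma> has
    no compensating C \<theta>: there the sign of the derivative of \<theta> itself matters, and it
    is minus the sum of \<kappa> and C \<theta>.\<close>
  define C where "C = max 0 C0"
  define \<theta> where "\<theta> t = (max 0 (T' - t))\<^sup>2 * exp (- C * t)" for t
  define \<kappa> where "\<kappa> t = 2 * max 0 (T' - t) * exp (- C * t)" for t
  have \<theta>: "C1_fun \<theta>" "dd \<theta> 1 t = - \<kappa> t - C * \<theta> t" "0 \<le> \<theta> t" "T' \<le> t \<Longrightarrow> \<theta> t = 0" for t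
    using cutoff[where T'=T' and C=C] unfolding \<theta>_def[abs_def] \<kappa>_def by blast+
  have \<kappa>: "0 \<le> \<kappa> t" "t < T' \<Longrightarrow> 0 < \<kappa> t" "T' \<le> t \<Longrightarrow> \<kappa> t = 0" for t by (auto simp: \<kappa>_def)
  have C: "C0 \<le> C" "0 \<le> C" by (auto simp: C_def)
  have "C1_fun \<theta> \<and> (\<forall>t. 0 \<le> t \<and> t < T \<longrightarrow> 0 \<le> \<theta> t) \<and> (\<exists>T'<T. \<forall>t. T' \<le> t \<longrightarrow> \<theta> t = 0)" using \<theta> T' by blast
  with C0 have 0: "0 \<le> (\<integral>z. (dd \<theta> 1 (snd z) + C0 * \<theta> (snd z)) * avg_rel_eta (Wc z) z \<partial>QM T) + (\<integral>z. deriv \<theta> (snd z) \<partial>\<gamma>)" by blast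
  have c\<kappa>: "continuous_on UNIV (\<lambda>z::pt. \<kappa> (snd z))" and c\<theta>: "continuous_on UNIV (\<lambda>z::pt. \<theta> (snd z))"
    unfolding \<kappa>_def \<theta>_def by (intro continuous_intros)+
  have c\<psi>: "continuous_on UNIV (\<lambda>z::pt. dd \<theta> 1 (snd z) + C0 * \<theta> (snd z))"
    unfolding \<theta>(2) by (intro continuous_intros c\<kappa> c\<theta>)
  have ik: "integrable (QM T) (\<lambda>z. \<kappa> (snd z) * avg_rel_eta (Wc z) z)" by (rule avg_rel_eta_limit(2)[OF c\<kappa>])
  have "(\<integral>z. (dd \<theta> 1 (snd z) + C0 * \<theta> (snd z)) * avg_rel_eta (Wc z) z \<partial>QM T) \<le> (\<integral>z. - (\<kappa> (snd z) * avg_rel_eta (Wc z) z) \<partial>QM T)"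
  proof (rule integral_mono_AE)
    show "AE z in QM T. (dd \<theta> 1 (snd z) + C0 * \<theta> (snd z)) * avg_rel_eta (Wc z) z \<le> - (\<kappa> (snd z) * avg_rel_eta (Wc z) z)"
      using AE_good
    proof eventually_elim
      case (elim z)
      have "C0 * \<theta> (snd z) \<le> C * \<theta> (snd z)" by (rule mult_right_mono[OF C(1) \<theta>(3)])
      then have "dd \<theta> 1 (snd z) + C0 * \<theta> (snd z) \<le> - \<kappa> (snd z)" unfolding \<theta>(2) by linarith
      from mult_right_mono[OF this avg_rel_eta_nonneg[OF elim, of "Wc z"]] show ?case by simp
    qed
  qed (use avg_rel_eta_limit(2)[OF c\<psi>] ik in auto)
  with 0 have le: "0 \<le> - (\<integral>z. \<kappa> (snd z) * avg_rel_eta (Wc z) z \<partial>QM T) + (\<integral>z. deriv \<theta> (snd z) \<partial>\<gamma>)" by simp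
  have pos: "AE z in QM T. 0 \<le> \<kappa> (snd z) * avg_rel_eta (Wc z) z"
    using AE_good by eventually_elim (intro mult_nonneg_nonneg \<kappa>(1) avg_rel_eta_nonneg)
  have nonneg: "0 \<le> (\<integral>z. \<kappa> (snd z) * avg_rel_eta (Wc z) z \<partial>QM T)" by (rule integral_nonneg_AE[OF pos])
  define d where "d z = - deriv \<theta> (snd z)" for z :: pt
  have d: "d z = \<kappa> (snd z) + C * \<theta> (snd z)" for z unfolding d_def deriv_eq_dd[OF \<theta>(1)] \<theta>(2) by simp
  have d0: "0 \<le> d z" for z unfolding d using \<kappa>(1) \<theta>(3) C(2) by simp
  have dn: "(\<integral>z. deriv \<theta> (snd z) \<partial>\<gamma>) = - (\<integral>z. d z \<partial>\<gamma>)" unfolding d_def by simp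
  have dnn: "0 \<le> (\<integral>z. d z \<partial>\<gamma>)" by (rule integral_nonneg_AE) (simp add: d0)
  have zk: "(\<integral>z. \<kappa> (snd z) * avg_rel_eta (Wc z) z \<partial>QM T) = 0" and zd: "(\<integral>z. d z \<partial>\<gamma>) = 0"
    using le nonneg dnn unfolding dn by linarith+
  have "AE z in QM T. \<kappa> (snd z) * avg_rel_eta (Wc z) z = 0"
    using zk integral_nonneg_eq_0_iff_AE[OF ik pos] by blast
  then show "AE z in QM T. snd z < T' \<longrightarrow> avg_rel_eta (Wc z) z = 0"
  proof eventually_elim
    case (elim z)
    show ?case
    proof
      assume "snd z < T'"
      then have "\<kappa> (snd z) \<noteq> 0" using \<kappa>(2)[of "snd z"] by simp
      with elim show "avg_rel_eta (Wc z) z = 0" by simp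
    qed
  qed
  have dc: "continuous_on UNIV d" unfolding d[abs_def] by (intro continuous_intros c\<kappa> c\<theta>)
  have sg: "sets \<gamma> = sets borel" and fin: "emeasure \<gamma> (Qbox \<times> {0..T'}) < \<infinity>"
    using sol T' unfolding dmv_solution_def by blast+
  have mS: "Qbox \<times> {0..T'} \<in> sets \<gamma>" unfolding sg borel_prod[symmetric] by (intro pair_measureI Qbox_sets) auto
  have md: "d \<in> borel_measurable \<gamma>"
    using borel_measurable_continuous_onI[OF dc] measurable_cong_sets[OF sg refl] by blast
  obtain K where K: "\<forall>z\<in>QT T. \<bar>d z\<bar> \<le> K"
  proof (rule bounded_on_QT[OF dc, of T])
    fix K assume "\<And>z. z \<in> QT T \<Longrightarrow> \<bar>d z\<bar> \<le> K" then show thesis by (intro that) blast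
  qed
  \<comment> \<open>A zero Bochner integral gives no information without integrability. On the
    cylinder \<open>d\<close> is bounded and vanishes after \<open>T'\<close>, and \<gamma> is
    finite up to \<open>T'\<close>.\<close>
  have id: "integrable \<gamma> d"
  proof (rule Bochner_Integration.integrable_bound[where f = "\<lambda>z. indicator (Qbox \<times> {0..T'}) z * K"])
    show "integrable \<gamma> (\<lambda>z. indicator (Qbox \<times> {0..T'}) z * K)"
      using mS fin by (intro integrable_mult_left) (simp add: integrable_indicator_iff sets_eq_imp_space_eq[OF sg])
    show "AE z in \<gamma>. norm (d z) \<le> norm (indicator (Qbox \<times> {0..T'}) z * K)"
      using gamma_AE_QT
    proof eventually_elim
      case (elim z)
      show ?case
      proof (cases "snd z \<le> T'")
        case True
        with elim have "z \<in> Qbox \<times> {0..T'}" unfolding QT_def mem_Times_iff by simp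
        then show ?thesis using order_trans[OF K[THEN bspec, OF elim] abs_ge_self] by simp
      next
        case False
        then have "d z = 0" unfolding d using \<kappa>(3) \<theta>(4) by simp
        then show ?thesis by simp
      qed
    qed
  qed (rule md)
  have "AE z in \<gamma>. d z = 0"
    using zd integral_nonneg_eq_0_iff_AE[OF id] d0 by simp
  then show "AE z in \<gamma>. \<not> snd z < T'"
  proof eventually_elim
    case (elim z)
    show ?case
    proof
      assume "snd z < T'"
      then have "0 < \<kappa> (snd z)" by (rule \<kappa>(2))
      moreover have "0 \<le> C * \<theta> (snd z)" using C(2) \<theta>(3) by simp
      ultimately show False using elim unfolding d by linarith
    qed
  qed
qed

text \<open>Exhausts the half-open time interval by countably many \<open>T'\<close>, so that the
  countable union of exceptional null sets stays null.\<close>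

lemma less_minus_inverse_Suc: "\<exists>k. t < T - inverse (real (Suc k))" if "t < T"
proof -
  obtain k where "inverse (real (Suc k)) < T - t" using reals_Archimedean[of "T - t"] \<open>t < T\<close> by auto
  then show ?thesis by (intro exI[of _ k]) simp
qed

lemma gamma_null: "A \<in> sets \<gamma> \<Longrightarrow> emeasure \<gamma> A = 0"
proof -
  assume A: "A \<in> sets \<gamma>"
  have "AE z in \<gamma>. \<forall>k. \<not> snd z < T - inverse (real (Suc k))"
    unfolding AE_all_countable by (intro allI concentration_eq_0_before(2)) simp
  then have "AE z in \<gamma>. z \<notin> A"
    using gamma_AE_QT
  proof eventually_elim
    case (elim z)
    then have "snd z < T" unfolding QT_def mem_Times_iff by simp
    with elim(1) less_minus_inverse_Suc show ?case by blast
  qed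
  then show ?thesis using A by (subst (asm) AE_iff_measurable[OF A]) (auto dest: sets.sets_into_space)
qed

lemma avg_rel_eta_eq_0: "AE z in QM T. avg_rel_eta (Wc z) z = 0"
proof -
  have "AE z in QM T. \<forall>k. snd z < T - inverse (real (Suc k)) \<longrightarrow> avg_rel_eta (Wc z) z = 0"
    unfolding AE_all_countable by (intro allI concentration_eq_0_before(1)) simp
  then show ?thesis
    using AE_space
  proof eventually_elim
    case (elim z)
    then have "snd z < T" unfolding space_QM QT_def mem_Times_iff by simp
    with elim(1) less_minus_inverse_Suc show ?case by blast
  qed
qed

text \<open>The integrand \<open>rel_eta\<close> is nonnegative with zero mean, so it vanishes
  \<nu>-almost everywhere; strong convexity leaves only the point at which it is based.\<close>

lemma nu_Dirac:
  assumes z: "good z" and 0: "avg_rel_eta w z = 0"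
  shows "\<nu> z = return borel (fst w, Phi (snd w))"
proof (rule return_eqI[OF nu_prob nu_sets])
  obtain c where c: "c > 0" "\<forall>l w. c * ((norm (fst l - fst w))\<^sup>2 + (norm (snd l - Phi (snd w)))\<^sup>2) \<le> rel_eta l w"
  proof (rule rel_eta_lower)
    fix c assume "c > 0" "\<And>l w. c * ((norm (fst l - fst w))\<^sup>2 + (norm (snd l - Phi (snd w)))\<^sup>2) \<le> rel_eta l w"
    then show thesis by (intro that) blast+
  qed
  have pos: "0 \<le> rel_eta l w" for l
    using c(2)[THEN spec, THEN spec, of l w] c(1)
    by (rule_tac order_trans[OF mult_nonneg_nonneg]) auto
  have "AE l in \<nu> z. rel_eta l w = 0"
    using integral_nonneg_eq_0_iff_AE[OF rel_eta_integral(1)[OF z]] pos rel_eta_integral(2)[OF z] 0 by simp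
  then show "AE l in \<nu> z. l = (fst w, Phi (snd w))"
  proof eventually_elim
    case (elim l)
    have "c * ((norm (fst l - fst w))\<^sup>2 + (norm (snd l - Phi (snd w)))\<^sup>2) \<le> 0"
      using c(2)[THEN spec, THEN spec, of l w] elim by simp
    then have "(norm (fst l - fst w))\<^sup>2 + (norm (snd l - Phi (snd w)))\<^sup>2 \<le> 0"
      using c(1) by (simp only: mult_le_0_iff) linarith
    then have "(norm (fst l - fst w))\<^sup>2 = 0" "(norm (snd l - Phi (snd w)))\<^sup>2 = 0"
      using zero_le_power2[of "norm (fst l - fst w)"] zero_le_power2[of "norm (snd l - Phi (snd w))"] by linarith+
    then show ?case by (simp add: prod_eq_iff)
  qed
qed

lemma weak_strong_uniqueness:
  "AE z in lborel. z \<in> QT T \<longrightarrow> v z = vh z \<and> (\<integral>l. snd l \<partial>\<nu> z) = Phi (Fh z) \<and> \<nu> z = return borel (vh z, Phi (Fh z))"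
  unfolding AE_QM[symmetric] using avg_rel_eta_eq_0 AE_good AE_space
proof eventually_elim
  case (elim z)
  then have w: "vh z = fst (Wc z)" "Fh z = snd (Wc z)" using vh_eq(1) Fh_eq(1) by simp_all
  have n: "\<nu> z = return borel (vh z, Phi (Fh z))" unfolding w by (rule nu_Dirac[OF elim(2,1)])
  have "(\<integral>l. fst l \<partial>\<nu> z) = vh z" "(\<integral>l. snd l \<partial>\<nu> z) = Phi (Fh z)"
    unfolding n using fst_snd_measurable by (subst integral_return; simp)+
  then show ?case using goodD(1)[OF elim(2)] n by simp
qed

end

theorem theorem3p3:
  fixes G :: "xi \<Rightarrow> real" and p q r T :: real
    and v0 :: "real^3 \<Rightarrow> real^3" and F0 :: "real^3 \<Rightarrow> mat3"
    and y v :: "pt \<Rightarrow> real^3" and F :: "pt \<Rightarrow> mat3"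
    and \<nu> :: "pt \<Rightarrow> ((real^3) \<times> xi) measure" and \<gamma> :: "pt measure"
    and vh :: "pt \<Rightarrow> real^3" and Fh :: "pt \<Rightarrow> mat3"
  assumes "hyp_G G p q r"
    and "T > 0"
    and "dmv_solution G p T v0 F0 y v F \<nu> \<gamma>"
    and "lipschitz_solution G T vh Fh"
    and "AE x in lborel. x \<in> Qbox \<longrightarrow> v0 x = vh (x, 0) \<and> Phi (F0 x) = Phi (Fh (x, 0))"
  shows "(\<forall>A \<in> sets \<gamma>. emeasure \<gamma> A = 0)
    \<and> (AE z in lborel. z \<in> QT T \<longrightarrow>
          v z = vh z \<and> (\<integral>l. snd l \<partial>\<nu> z) = Phi (Fh z)
        \<and> \<nu> z = return borel (vh z, Phi (Fh z)))"
proof -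
  \<comment> \<open>The approximations are obtained inside the first locale and then fixed for the
    second, where all statements along the sequence are made.\<close>
  interpret weak_strong G p q r T v0 F0 y v F \<nu> \<gamma> vh Fh
    by unfold_locales (fact assms)+
  obtain W L M where W: "\<And>n b. C2_fun (\<lambda>z. W n z \<bullet> b)" "\<And>n. periodic (W n)"
    "\<And>n x y. norm (W n x - W n y) \<le> L * norm (x - y)" "\<And>n z. norm (W n z) \<le> M"
    "\<And>z. (\<lambda>n. W n z) \<longlonglongrightarrow> Wc z"
  proof (rule approximations)
    fix W L M assume "\<And>n b. C2_fun (\<lambda>z. W n z \<bullet> b)" "\<And>n. periodic (W n)"
      "\<And>n x y. norm (W n x - W n y) \<le> L * norm (x - y)" "\<And>n z. norm (W n z) \<le> M"
      "\<And>z. (\<lambda>n. W n z) \<longlonglongrightarrow> Wc z"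
    then show thesis by (rule that)
  qed
  interpret weak_strong_approx G p q r T v0 F0 y v F \<nu> \<gamma> vh Fh W L M
    by unfold_locales (fact W)+
  show ?thesis using gamma_null weak_strong_uniqueness by blast
qed

end
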